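(* Let $M$ be a regular complex surface and let $D=\bigcup_{j\in J}P_j\subset M$ be a finite union of compact regular Riemann surfaces with normal crossings. Let $\Gamma$ be the weighted graph associated to $D$. Let $\tilde{\mathcal{F}}$ be a holomorphic foliation with reduced singularities defined on a neighborhood of $D$ in $M$ and such that $D$ is invariant by $\tilde{\mathcal{F}}$. Suppose that $\Gamma$ is a tree with negative definite intersection matrix. Then there exists a singular point $q\in P_{j_0}$ of $\tilde{\mathcal{F}}$, for some $j_0\in J$, outside the set of corners, such that $$\mathrm{Re}\,\mathrm{CS}(P_{j_0},q)<0.$$
   Context: A corner of $D$ is a point of an intersection $P_i\cap P_j\neq\emptyset$ with $i\neq j$. The weighted graph $\Gamma$ associated to $D$ has vertices $\{P_j\}_{j\in J}$, the weight of $P_j$ is the self-intersection number $P_j\cdot P_j$, and there is one edge between $P_i$ and $P_j$ ($i\ne j$) for each point of $P_i\cap P_j$. Its intersection matrix $(\alpha_{ij})$ is given by $\alpha_{jj}=P_j\cdot P_j$ and $\alpha_{ij}=\mathrm{card}(P_i\cap P_j)$ for $i\neq j$. Weighted graphs are assumed connected. A singularity of a foliation given locally by a holomorphic vector field is reduced if the linear part of the vector field there has eigenvalues $\lambda_1,\lambda_2$ with $\lambda_1\neq 0$ and $\lambda_2/\lambda_1$ not a positive rational number. $\mathrm{CS}(P,q)$ is the Camacho-Sad index at $q$ of the foliation relative to the smooth invariant curve $P$: if in local coordinates centered at $q$ one has $P=\{y=0\}$ and the foliation is generated by $A(x,y)\frac{\partial}{\partial x}+yB(x,y)\frac{\partial}{\partial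 y}$, then $\mathrm{CS}(P,q)=\mathrm{Res}_{x=0}\frac{B(x,0)}{A(x,0)}\,dx$. *)

theory Defs
  imports "HOL-Complex_Analysis.Complex_Analysis"
begin

section \<open>Holomorphic functions and maps of two complex variables\<close>

type_synonym cplane = "complex \<times> complex"

text \<open>Complex differentiability at every point: the Frechet derivative exists and is complex
  linear. The definition is meant for open sets.\<close>

definition holomorphic2_on :: "(cplane \<Rightarrow> complex) \<Rightarrow> cplane set \<Rightarrow> bool" where
  "holomorphic2_on f S \<longleftrightarrow>
     (\<forall>z\<in>S. \<exists>a b. (f has_derivative (\<lambda>(h, k). a * h + b * k)) (at z))"

definition holomorphic2_map_on :: "(cplane \<Rightarrow> cplane) \<Rightarrow> cplane set \<Rightarrow> bool" where
  "holomorphic2_map_on f S \<longleftrightarrow>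
     holomorphic2_on (\<lambda>z. fst (f z)) S \<and> holomorphic2_on (\<lambda>z. snd (f z)) S"

definition cscale :: "complex \<Rightarrow> cplane \<Rightarrow> cplane" where
  "cscale g v = (g * fst v, g * snd v)"

section \<open>Complex surfaces\<close>

text \<open>A chart is a pair of its domain and its coordinate map; the values of the
  coordinate map outside the domain are irrelevant.\<close>

type_synonym 'a chart = "'a set \<times> ('a \<Rightarrow> cplane)"

definition chart_on :: "'a topology \<Rightarrow> 'a chart \<Rightarrow> bool" where
  "chart_on X c \<longleftrightarrow>
     openin X (fst c) \<and> open (snd c ` fst c) \<and>
     homeomorphic_map (subtopology X (fst c)) (top_of_set (snd c ` fst c)) (snd c)"

text \<open>The change of coordinates from \<open>c\<close> to \<open>d\<close>; it is meaningful on
  \<^term>\<open>snd c ` (fst c \<inter> fst d)\<close>.\<close>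

definition transition :: "'a chart \<Rightarrow> 'a chart \<Rightarrow> cplane \<Rightarrow> cplane" where
  "transition c d = snd d \<circ> inv_into (fst c) (snd c)"

definition compatible_charts :: "'a chart \<Rightarrow> 'a chart \<Rightarrow> bool" where
  "compatible_charts c d \<longleftrightarrow>
     holomorphic2_map_on (transition c d) (snd c ` (fst c \<inter> fst d)) \<and>
     holomorphic2_map_on (transition d c) (snd d ` (fst c \<inter> fst d))"

definition complex_surface :: "'a topology \<Rightarrow> 'a chart set \<Rightarrow> bool" where
  "complex_surface X \<A> \<longleftrightarrow>
     Hausdorff_space X \<and>
     (\<exists>\<B>. countable \<B> \<and> (\<forall>V\<in>\<B>. openin X V) \<and>
          (\<forall>U x. openin X U \<and> x \<in> U \<longrightarrow> (\<exists>V\<in>\<B>. x \<in> V \<and> V \<subseteq> U))) \<and>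
     (\<forall>c\<in>\<A>. chart_on X c) \<and>
     (\<Union>c\<in>\<A>. fst c) = topspace X \<and>
     (\<forall>c\<in>\<A>. \<forall>d\<in>\<A>. compatible_charts c d)"

text \<open>Local holomorphic coordinates are the elements of the maximal atlas.\<close>

definition coordinates :: "'a topology \<Rightarrow> 'a chart set \<Rightarrow> 'a chart \<Rightarrow> bool" where
  "coordinates X \<A> c \<longleftrightarrow> chart_on X c \<and> (\<forall>d\<in>\<A>. compatible_charts c d)"

definition centered_at :: "'a chart \<Rightarrow> 'a \<Rightarrow> bool" where
  "centered_at c q \<longleftrightarrow> q \<in> fst c \<and> snd c q = (0, 0)"

section \<open>Curves in a surface\<close>

text \<open>Coordinates \<open>(x, y)\<close> in which \<open>P\<close> is given by \<open>y = 0\<close>.\<close>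

definition adapted_chart :: "'a topology \<Rightarrow> 'a chart set \<Rightarrow> 'a set \<Rightarrow> 'a chart \<Rightarrow> bool" where
  "adapted_chart X \<A> P c \<longleftrightarrow>
     coordinates X \<A> c \<and> (\<forall>q\<in>fst c. q \<in> P \<longleftrightarrow> snd (snd c q) = 0)"

definition compact_regular_curve :: "'a topology \<Rightarrow> 'a chart set \<Rightarrow> 'a set \<Rightarrow> bool" where
  "compact_regular_curve X \<A> P \<longleftrightarrow>
     P \<noteq> {} \<and> compactin X P \<and> connectedin X P \<and>
     (\<forall>q\<in>P. \<exists>c. adapted_chart X \<A> P c \<and> centered_at c q)"

definition normal_crossings ::
  "'a topology \<Rightarrow> 'a chart set \<Rightarrow> 'j set \<Rightarrow> ('j \<Rightarrow> 'a set) \<Rightarrow> bool" where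
  "normal_crossings X \<A> J P \<longleftrightarrow>
     (\<forall>i\<in>J. \<forall>j\<in>J. i \<noteq> j \<longrightarrow> (\<forall>p \<in> P i \<inter> P j.
        (\<exists>c. coordinates X \<A> c \<and> centered_at c p \<and>
             (\<forall>q\<in>fst c. q \<in> P i \<longleftrightarrow> fst (snd c q) = 0) \<and>
             (\<forall>q\<in>fst c. q \<in> P j \<longleftrightarrow> snd (snd c q) = 0)) \<and>
        (\<forall>k\<in>J - {i, j}. p \<notin> P k)))"

definition corners :: "'j set \<Rightarrow> ('j \<Rightarrow> 'a set) \<Rightarrow> 'a set" where
  "corners J P = {p. \<exists>i\<in>J. \<exists>j\<in>J. i \<noteq> j \<and> p \<in> P i \<inter> P j}"

section \<open>Self-intersection numbers\<close>

text \<open>The self-intersection number of a compact curve \<open>P\<close> is the degree of its normal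
  bundle \<open>TM|P / TP\<close>, that is, the number of zeros, counted with multiplicity, of a
  continuous section with finitely many zeros.

  In adapted coordinates \<open>(x, y)\<close> the normal bundle is trivialized by the class of
  \<open>\<partial>/\<partial>y\<close>, so a section is a family of functions, one for each adapted chart, and its
  component in the chart \<open>d\<close> is the one in \<open>c\<close> times the derivative of
  \<open>y\<^sub>d\<close> with respect to \<open>y\<^sub>c\<close>.\<close>

definition normal_section ::
  "'a topology \<Rightarrow> 'a chart set \<Rightarrow> 'a set \<Rightarrow> ('a chart \<Rightarrow> 'a \<Rightarrow> complex) \<Rightarrow> bool" where
  "normal_section X \<A> P s \<longleftrightarrow>
     (\<forall>c. adapted_chart X \<A> P c \<longrightarrow>
        continuous_map (subtopology X (P \<inter> fst c)) euclidean (s c)) \<and>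
     (\<forall>c d. adapted_chart X \<A> P c \<and> adapted_chart X \<A> P d \<longrightarrow>
        (\<forall>q \<in> P \<inter> fst c \<inter> fst d.
           s d q = snd (frechet_derivative (transition c d) (at (snd c q)) (0, 1)) * s c q))"

definition section_zeros ::
  "'a topology \<Rightarrow> 'a chart set \<Rightarrow> 'a set \<Rightarrow> ('a chart \<Rightarrow> 'a \<Rightarrow> complex) \<Rightarrow> 'a set" where
  "section_zeros X \<A> P s =
     {q\<in>P. \<exists>c. adapted_chart X \<A> P c \<and> q \<in> fst c \<and> s c q = 0}"

text \<open>The multiplicity of an isolated zero is the winding number about \<open>0\<close> of the
  section along a small positively oriented circle in \<open>P\<close> around that zero.\<close>

definition has_zero_index ::
  "'a topology \<Rightarrow> 'a chart set \<Rightarrow> 'a set \<Rightarrow> ('a chart \<Rightarrow> 'a \<Rightarrow> complex) \<Rightarrow> 'a \<Rightarrow> int \<Rightarrow> bool" where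
  "has_zero_index X \<A> P s q m \<longleftrightarrow>
     (\<exists>c. adapted_chart X \<A> P c \<and> centered_at c q \<and>
        (\<forall>\<^sub>F r in at_right 0.
           winding_number (\<lambda>t. s c (inv_into (fst c) (snd c) (circlepath 0 r t, 0))) 0
             = of_int m))"

definition self_intersection :: "'a topology \<Rightarrow> 'a chart set \<Rightarrow> 'a set \<Rightarrow> int" where
  "self_intersection X \<A> P =
     (THE n. \<exists>s m. normal_section X \<A> P s \<and> finite (section_zeros X \<A> P s) \<and>
        (\<forall>q\<in>section_zeros X \<A> P s. has_zero_index X \<A> P s q (m q)) \<and>
        n = (\<Sum>q\<in>section_zeros X \<A> P s. m q))"

section \<open>Weighted graphs\<close>

text \<open>Undirected graphs in which multiple edges are allowed; \<open>ends e\<close> is the set of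
  end points of the edge \<open>e\<close>.\<close>

record ('v, 'e) weighted_graph =
  vertices :: "'v set"
  weight :: "'v \<Rightarrow> int"
  edges :: "'e set"
  ends :: "'e \<Rightarrow> 'v set"

text \<open>A walk starting at a given vertex is a list of pairs consisting of the next edge and the
  vertex to which it leads.\<close>

fun is_walk :: "('v, 'e) weighted_graph \<Rightarrow> 'v \<Rightarrow> ('e \<times> 'v) list \<Rightarrow> 'v \<Rightarrow> bool" where
  "is_walk G u [] v \<longleftrightarrow> u \<in> vertices G \<and> u = v"
| "is_walk G u ((e, w) # es) v \<longleftrightarrow>
     u \<in> vertices G \<and> e \<in> edges G \<and> ends G e = {u, w} \<and> is_walk G w es v"

definition graph_connected :: "('v, 'e) weighted_graph \<Rightarrow> bool" where
  "graph_connected G \<longleftrightarrow>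
     vertices G \<noteq> {} \<and> (\<forall>u\<in>vertices G. \<forall>v\<in>vertices G. \<exists>es. is_walk G u es v)"

text \<open>Two different edges with the same end points form a cycle.\<close>

definition is_cycle :: "('v, 'e) weighted_graph \<Rightarrow> 'v \<Rightarrow> ('e \<times> 'v) list \<Rightarrow> bool" where
  "is_cycle G u es \<longleftrightarrow>
     es \<noteq> [] \<and> is_walk G u es u \<and> distinct (map fst es) \<and> distinct (map snd es)"

definition is_tree :: "('v, 'e) weighted_graph \<Rightarrow> bool" where
  "is_tree G \<longleftrightarrow> graph_connected G \<and> (\<nexists>u es. is_cycle G u es)"

text \<open>An edge is a point of the intersection of two different components, together with the pair
  of components.\<close>

definition dual_graph ::
  "'a topology \<Rightarrow> 'a chart set \<Rightarrow> 'j set \<Rightarrow> ('j \<Rightarrow> 'a set) \<Rightarrow> ('j, 'j set \<times> 'a) weighted_graph"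
  where
  "dual_graph X \<A> J P =
     \<lparr> vertices = J,
       weight = (\<lambda>j. self_intersection X \<A> (P j)),
       edges = {({i, j}, p) | i j p. i \<in> J \<and> j \<in> J \<and> i \<noteq> j \<and> p \<in> P i \<inter> P j},
       ends = fst \<rparr>"

definition intersection_matrix :: "('j, 'e) weighted_graph \<Rightarrow> 'j \<Rightarrow> 'j \<Rightarrow> int" where
  "intersection_matrix G i j =
     (if i = j then weight G j else int (card {e\<in>edges G. ends G e = {i, j}}))"

definition negative_definite_on :: "'j set \<Rightarrow> ('j \<Rightarrow> 'j \<Rightarrow> int) \<Rightarrow> bool" where
  "negative_definite_on J \<alpha> \<longleftrightarrow>
     (\<forall>x :: 'j \<Rightarrow> real. (\<exists>j\<in>J. x j \<noteq> 0) \<longrightarrow>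
        (\<Sum>i\<in>J. \<Sum>j\<in>J. of_int (\<alpha> i j) * x i * x j) < 0)"

section \<open>Holomorphic foliations\<close>

text \<open>A vector field on the domain of a chart is given by its components in that chart, as a
  function of the coordinates. Two vector fields, in the charts \<open>c\<close> and \<open>d\<close>, generate the
  same foliation if they differ by a holomorphic factor without zeros where both are defined.\<close>

type_synonym 'a local_field = "'a chart \<times> (cplane \<Rightarrow> cplane)"

definition same_foliation :: "'a local_field \<Rightarrow> 'a local_field \<Rightarrow> bool" where
  "same_foliation = (\<lambda>(c, V) (d, W).
     \<exists>g. holomorphic2_on g (snd c ` (fst c \<inter> fst d)) \<and>
         (\<forall>z \<in> snd c ` (fst c \<inter> fst d).
            g z \<noteq> 0 \<and>
            frechet_derivative (transition c d) (at z) (V z) = cscale (g z) (W (transition c d z))))"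

text \<open>A foliation with isolated singularities on the open set \<open>N\<close>, given by local
  generators whose domains cover \<open>N\<close>.\<close>

definition holomorphic_foliation ::
  "'a topology \<Rightarrow> 'a chart set \<Rightarrow> 'a set \<Rightarrow> 'a local_field set \<Rightarrow> bool" where
  "holomorphic_foliation X \<A> N \<F> \<longleftrightarrow>
     openin X N \<and>
     (\<Union>(c, V)\<in>\<F>. fst c) = N \<and>
     (\<forall>(c, V)\<in>\<F>. coordinates X \<A> c \<and> holomorphic2_map_on V (snd c ` fst c) \<and>
        (\<forall>z \<in> snd c ` fst c. \<not> z islimpt {w \<in> snd c ` fst c. V w = 0})) \<and>
     (\<forall>v\<in>\<F>. \<forall>w\<in>\<F>. same_foliation v w)"

text \<open>Arbitrary local generators of the foliation, not only the chosen ones.\<close>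

definition local_generator ::
  "'a topology \<Rightarrow> 'a chart set \<Rightarrow> 'a set \<Rightarrow> 'a local_field set \<Rightarrow> 'a local_field \<Rightarrow> bool" where
  "local_generator X \<A> N \<F> = (\<lambda>(c, V).
     coordinates X \<A> c \<and> fst c \<subseteq> N \<and> holomorphic2_map_on V (snd c ` fst c) \<and>
     (\<forall>w\<in>\<F>. same_foliation (c, V) w))"

definition singular_point :: "'a local_field set \<Rightarrow> 'a \<Rightarrow> bool" where
  "singular_point \<F> q \<longleftrightarrow> (\<exists>(c, V)\<in>\<F>. q \<in> fst c \<and> V (snd c q) = 0)"

text \<open>\<open>\<mu>\<^sub>1\<close> and \<open>\<mu>\<^sub>2\<close> are the eigenvalues, with multiplicity, of a complex linear
  map \<open>L\<close>.\<close>

definition eigenvalue_pair :: "(cplane \<Rightarrow> cplane) \<Rightarrow> complex \<Rightarrow> complex \<Rightarrow> bool" where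
  "eigenvalue_pair L \<mu>\<^sub>1 \<mu>\<^sub>2 \<longleftrightarrow>
     (\<forall>t. det (mat t - (vector [vector [fst (L (1, 0)), fst (L (0, 1))],
                                vector [snd (L (1, 0)), snd (L (0, 1))]] :: complex^2^2))
          = (t - \<mu>\<^sub>1) * (t - \<mu>\<^sub>2))"

definition reduced_linear_part :: "(cplane \<Rightarrow> cplane) \<Rightarrow> bool" where
  "reduced_linear_part L \<longleftrightarrow>
     (\<exists>\<mu>\<^sub>1 \<mu>\<^sub>2. eigenvalue_pair L \<mu>\<^sub>1 \<mu>\<^sub>2 \<and> \<mu>\<^sub>1 \<noteq> 0 \<and>
        \<not> (\<exists>r::rat. r > 0 \<and> \<mu>\<^sub>2 / \<mu>\<^sub>1 = of_rat r))"

definition reduced_singularities :: "'a local_field set \<Rightarrow> bool" where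
  "reduced_singularities \<F> \<longleftrightarrow>
     (\<forall>(c, V)\<in>\<F>. \<forall>z \<in> snd c ` fst c.
        V z = 0 \<longrightarrow> reduced_linear_part (frechet_derivative V (at z)))"

text \<open>\<open>P\<close> is invariant if the generators are tangent to \<open>P\<close> along \<open>P\<close>: after the change to
  coordinates in which \<open>P\<close> is \<open>y = 0\<close>, their second component vanishes there.\<close>

definition invariant_curve ::
  "'a topology \<Rightarrow> 'a chart set \<Rightarrow> 'a local_field set \<Rightarrow> 'a set \<Rightarrow> bool" where
  "invariant_curve X \<A> \<F> P \<longleftrightarrow>
     (\<forall>(c, V)\<in>\<F>. \<forall>d. adapted_chart X \<A> P d \<longrightarrow>
        (\<forall>q \<in> P \<inter> fst c \<inter> fst d.
           snd (frechet_derivative (transition c d) (at (snd c q)) (V (snd c q))) = 0))"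

definition camacho_sad ::
  "'a topology \<Rightarrow> 'a chart set \<Rightarrow> 'a set \<Rightarrow> 'a local_field set \<Rightarrow> 'a set \<Rightarrow> 'a \<Rightarrow> complex" where
  "camacho_sad X \<A> N \<F> P q =
     (THE \<kappa>. \<exists>c A B. adapted_chart X \<A> P c \<and> centered_at c q \<and>
        holomorphic2_on A (snd c ` fst c) \<and> holomorphic2_on B (snd c ` fst c) \<and>
        local_generator X \<A> N \<F> (c, \<lambda>(x, y). (A (x, y), y * B (x, y))) \<and>
        \<kappa> = residue (\<lambda>x. B (x, 0) / A (x, 0)) 0)"

end

theory Submission
  imports Defs
begin

text \<open>Let \<open>P\<close> be a compact invariant curve. In adapted coordinates the foliation is generated by
  \<open>A \<partial>\<^sub>x + y B \<partial>\<^sub>y\<close>, and \<open>\<omega> = (B/A) dx\<close> is a meromorphic connection form on the normal bundle of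
  \<open>P\<close> whose residues are the Camacho--Sad indices. For a continuous section \<open>s\<close> with finitely many
  zeros, \<open>ds/s - \<omega>\<close> is a global 1-form on \<open>P\<close>, so the sum of its residues vanishes: the
  self-intersection number of \<open>P\<close> is the sum of the Camacho--Sad indices along \<open>P\<close>. At a corner the
  two indices are either inverse to each other or one of them is zero.

  If no singular point outside the corners had an index with negative real part, the corner indices
  on each curve would have real parts summing to at most its weight. Since for every edge there is a
  real \<open>t\<close> with \<open>Re a\<^sub>1 + Re a\<^sub>2 t\<^sup>2 + 2 t \<ge> 0\<close> (where \<open>a\<^sub>1\<close>, \<open>a\<^sub>2\<close> are the two indices), and the
  graph is a tree, these \<open>t\<close> can be realised as ratios of the entries of one non-zero vector, on
  which the intersection form is then non-negative.\<close>

section \<open>Integration in the plane and Stokes' formula\<close>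

text \<open>The self-intersection number is defined through arbitrary continuous sections, so
  \<open>ds/s\<close> is not a differential form; only the ratio of the local expressions of a
  section in two charts is holomorphic. The residue theorem is therefore proved with a partition of
  unity and Stokes' formula in the plane, every derivative being moved onto the partition functions.
  As the number is given by a definite description, two facts are needed: a section with finitely
  many zeros exists, which is a topological construction disc by disc, and all such sections give
  the same count. The second fact is a consequence of the index formula, since the count always
  equals the sum of the Camacho-Sad indices. At a corner the linear part of the field is diagonal,
  and reducedness guarantees that it is not zero: this is the source of the alternative for the two
  indices. The tree hypothesis enters because the ratio on each edge is chosen without regard to the
  other edges; around a cycle the chosen ratios would have to multiply to 1.\<close>

definition dz :: "(complex \<Rightarrow> complex) \<Rightarrow> complex \<Rightarrow> complex" where
  "dz f z = (frechet_derivative f (at z) 1 - \<i> * frechet_derivative f (at z) \<i>) / 2"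

definition dzbar :: "(complex \<Rightarrow> complex) \<Rightarrow> complex \<Rightarrow> complex" where
  "dzbar f z = (frechet_derivative f (at z) 1 + \<i> * frechet_derivative f (at z) \<i>) / 2"

text \<open>The conditions are pointwise, with derivatives taken over full neighbourhoods. Hence
  \<open>C1\<close> and \<open>C2\<close> pass to unions of arbitrary sets, and it is enough to
  check \<open>C1 f {z}\<close> for each \<open>z\<close>.\<close>

definition C1 :: "(complex \<Rightarrow> complex) \<Rightarrow> complex set \<Rightarrow> bool" where
  "C1 f S \<longleftrightarrow> (\<forall>z\<in>S. f differentiable (at z) \<and> isCont (dz f) z \<and> isCont (dzbar f) z)"

text \<open>Equality of the mixed derivatives is carried along by the closure lemmas; it makes the
  second-order terms of \<open>dz (h * dzbar f) - dzbar (h * dz f)\<close> cancel in the residue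
  theorem.\<close>

definition C2 :: "(complex \<Rightarrow> complex) \<Rightarrow> complex set \<Rightarrow> bool" where
  "C2 f S \<longleftrightarrow> C1 f S \<and> C1 (dz f) S \<and> C1 (dzbar f) S \<and> (\<forall>z\<in>S. dzbar (dz f) z = dz (dzbar f) z)"

text \<open>Every real-linear map of the plane is a combination of \<open>h\<close> and
  \<open>cnj h\<close>; its values at 1 and \<open>\<i>\<close> determine the two
  coefficients.\<close>

lemma wirtinger_has_derivative:
  assumes "f differentiable (at z)"
  shows "(f has_derivative (\<lambda>h. dz f z * h + dzbar f z * cnj h)) (at z)"
proof -
  let ?D = "frechet_derivative f (at z)"
  have D: "(f has_derivative ?D) (at z)" using assms frechet_derivative_works by blast
  then have lin: "linear ?D" using has_derivative_linear by blast
  have "?D h = dz f z * h + dzbar f z * cnj h" for h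
  proof -
    have "h = Re h *\<^sub>R 1 + Im h *\<^sub>R \<i>" by (simp add: complex_eq_iff)
    then have "?D h = ?D (Re h *\<^sub>R 1 + Im h *\<^sub>R \<i>)" by (rule arg_cong)
    also have "\<dots> = Re h *\<^sub>R ?D 1 + Im h *\<^sub>R ?D \<i>"
      by (simp add: linear_add[OF lin] linear_scale[OF lin])
    also have "\<dots> = dz f z * Complex (Re h) (Im h) + dzbar f z * Complex (Re h) (- Im h)"
      unfolding dz_def dzbar_def by (simp add: complex_eq_iff field_simps)
    also have "\<dots> = dz f z * h + dzbar f z * cnj h"
      by (metis complex_surj cnj.code complex_cnj)
    finally show ?thesis .
  qed
  then show ?thesis using D by presburger
qed

lemma wirtinger_eqI:
  assumes "(f has_derivative (\<lambda>h. a * h + b * cnj h)) (at z)"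
  shows "f differentiable (at z)" "dz f z = a" "dzbar f z = b"
proof -
  show "f differentiable (at z)" using assms differentiable_def by blast
  have D: "frechet_derivative f (at z) = (\<lambda>h. a * h + b * cnj h)"
    using frechet_derivative_at[OF assms] by simp
  show "dz f z = a" "dzbar f z = b" unfolding dz_def dzbar_def D by (simp_all add: field_simps)
qed

lemma wirtinger_cong:
  assumes "open S" "z \<in> S" "\<And>w. w \<in> S \<Longrightarrow> f w = g w"
  shows "f differentiable (at z) \<longleftrightarrow> g differentiable (at z)" "dz f z = dz g z" "dzbar f z = dzbar g z"
proof -
  have *: "(f has_derivative D) (at z) \<longleftrightarrow> (g has_derivative D) (at z)" for D
    using has_derivative_transform_within_open[OF _ assms(1,2), of f D UNIV g]
      has_derivative_transform_within_open[OF _ assms(1,2), of g D UNIV f] assms(3) by auto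
  then show "f differentiable (at z) \<longleftrightarrow> g differentiable (at z)" by (simp add: differentiable_def)
  have "frechet_derivative f (at z) = frechet_derivative g (at z)"
    unfolding frechet_derivative_def using * by presburger
  then show "dz f z = dz g z" "dzbar f z = dzbar g z" by (simp_all add: dz_def dzbar_def)
qed

lemma C1_intro:
  assumes "open S" and d: "\<And>z. z \<in> S \<Longrightarrow> (f has_derivative (\<lambda>h. a z * h + b z * cnj h)) (at z)"
    and "continuous_on S a" "continuous_on S b"
  shows "C1 f S"
  unfolding C1_def
proof (intro ballI conjI)
  fix z assume z: "z \<in> S"
  show "f differentiable (at z)" using wirtinger_eqI[OF d[OF z]] by blast
  have "isCont a z" "isCont b z" using assms z continuous_on_eq_continuous_at by blast+
  moreover have "eventually (\<lambda>w. dz f w = a w) (nhds z)" "eventually (\<lambda>w. dzbar f w = b w) (nhds z)"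
    using wirtinger_eqI(2,3)[OF d] assms(1) z by (auto simp: eventually_nhds)
  ultimately show "isCont (dz f) z" "isCont (dzbar f) z"
    by (simp_all add: isCont_cong)
qed

lemma C1_cong:
  assumes "open S" "\<And>w. w \<in> S \<Longrightarrow> f w = g w" "C1 f S"
  shows "C1 g S"
proof (rule C1_intro[OF assms(1), of g "dz f" "dzbar f"])
  show "continuous_on S (dz f)" "continuous_on S (dzbar f)"
    using assms(3) by (auto simp: C1_def intro: continuous_at_imp_continuous_on)
  fix z assume z: "z \<in> S"
  have "(f has_derivative (\<lambda>h. dz f z * h + dzbar f z * cnj h)) (at z)"
    using wirtinger_has_derivative assms(3) z by (auto simp: C1_def)
  then show "(g has_derivative (\<lambda>h. dz f z * h + dzbar f z * cnj h)) (at z)"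
    by (rule has_derivative_transform_within_open[OF _ assms(1) z]) (simp add: assms(2))
qed

lemma C1_D:
  assumes "C1 f S" "z \<in> S"
  shows "(f has_derivative (\<lambda>h. dz f z * h + dzbar f z * cnj h)) (at z)"
  using wirtinger_has_derivative assms by (auto simp: C1_def)

lemma C1_cont:
  assumes "C1 f S"
  shows "continuous_on S (dz f)" "continuous_on S (dzbar f)" "continuous_on S f"
  using assms by (auto simp: C1_def differentiable_imp_continuous_within intro!: continuous_at_imp_continuous_on)

lemma C1_subset: "C1 f S \<Longrightarrow> T \<subseteq> S \<Longrightarrow> C1 f T"
  by (auto simp: C1_def)

lemma C2_subset: "C2 f S \<Longrightarrow> T \<subseteq> S \<Longrightarrow> C2 f T"
  by (auto simp: C2_def intro: C1_subset)

lemma C1_Un: "C1 f S \<Longrightarrow> C1 f T \<Longrightarrow> C1 f (S \<union> T)"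
  by (auto simp: C1_def)

lemma C2_Un: "C2 f S \<Longrightarrow> C2 f T \<Longrightarrow> C2 f (S \<union> T)"
  by (auto simp: C2_def intro: C1_Un)

lemma C2_cong:
  assumes "open S" "\<And>w. w \<in> S \<Longrightarrow> f w = g w" "C2 f S"
  shows "C2 g S"
proof -
  have e: "dz f w = dz g w" "dzbar f w = dzbar g w" if "w \<in> S" for w
    using wirtinger_cong[OF assms(1) that assms(2)] by auto
  have e2: "dzbar (dz f) w = dzbar (dz g) w" "dz (dzbar f) w = dz (dzbar g) w" if "w \<in> S" for w
    using wirtinger_cong(3)[OF assms(1) that e(1)] wirtinger_cong(2)[OF assms(1) that e(2)] by auto
  show ?thesis
    using assms C1_cong[OF assms(1,2)] C1_cong[OF assms(1) e(1)] C1_cong[OF assms(1) e(2)] e2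
    by (auto simp: C2_def)
qed

lemma C1_const: "C1 (\<lambda>_. c) S" and dz_const: "dz (\<lambda>_. c) = (\<lambda>_. 0)" and dzbar_const: "dzbar (\<lambda>_. c) = (\<lambda>_. 0)"
proof -
  have "((\<lambda>_. c) has_derivative (\<lambda>h. 0 * h + 0 * cnj h)) (at z)" for z by simp
  note w = wirtinger_eqI[OF this]
  show "dz (\<lambda>_. c) = (\<lambda>_. 0)" "dzbar (\<lambda>_. c) = (\<lambda>_. 0)" using w by auto
  then show "C1 (\<lambda>_. c) S" by (simp add: C1_def)
qed

lemma C2_const: "C2 (\<lambda>_. c) S"
  by (simp add: C2_def C1_const dz_const dzbar_const)

lemma C1_mult:
  assumes "open S" "C1 f S" "C1 g S"
  shows "C1 (\<lambda>z. f z * g z) S"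
    "\<And>z. z \<in> S \<Longrightarrow> dz (\<lambda>z. f z * g z) z = dz f z * g z + f z * dz g z"
    "\<And>z. z \<in> S \<Longrightarrow> dzbar (\<lambda>z. f z * g z) z = dzbar f z * g z + f z * dzbar g z"
proof -
  have d: "((\<lambda>z. f z * g z) has_derivative
      (\<lambda>h. (dz f z * g z + f z * dz g z) * h + (dzbar f z * g z + f z * dzbar g z) * cnj h)) (at z)"
    if "z \<in> S" for z
    by (rule derivative_eq_intros C1_D[OF assms(2) that] C1_D[OF assms(3) that] refl)+
      (auto simp: fun_eq_iff algebra_simps)
  show "C1 (\<lambda>z. f z * g z) S"
    by (rule C1_intro[OF assms(1) d]) (use C1_cont[OF assms(2)] C1_cont[OF assms(3)] assms in \<open>auto intro!: continuous_intros\<close>)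
  show "\<And>z. z \<in> S \<Longrightarrow> dz (\<lambda>z. f z * g z) z = dz f z * g z + f z * dz g z"
    "\<And>z. z \<in> S \<Longrightarrow> dzbar (\<lambda>z. f z * g z) z = dzbar f z * g z + f z * dzbar g z"
    using wirtinger_eqI[OF d] by auto
qed

lemma C1_add:
  assumes "open S" "C1 f S" "C1 g S"
  shows "C1 (\<lambda>z. f z + g z) S"
    "\<And>z. z \<in> S \<Longrightarrow> dz (\<lambda>z. f z + g z) z = dz f z + dz g z"
    "\<And>z. z \<in> S \<Longrightarrow> dzbar (\<lambda>z. f z + g z) z = dzbar f z + dzbar g z"
proof -
  have d: "((\<lambda>z. f z + g z) has_derivative
      (\<lambda>h. (dz f z + dz g z) * h + (dzbar f z + dzbar g z) * cnj h)) (at z)"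
    if "z \<in> S" for z
    by (rule derivative_eq_intros C1_D[OF assms(2) that] C1_D[OF assms(3) that] refl)+
      (auto simp: fun_eq_iff algebra_simps)
  show "C1 (\<lambda>z. f z + g z) S"
    by (rule C1_intro[OF assms(1) d]) (use C1_cont[OF assms(2)] C1_cont[OF assms(3)] assms in \<open>auto intro!: continuous_intros\<close>)
  show "\<And>z. z \<in> S \<Longrightarrow> dz (\<lambda>z. f z + g z) z = dz f z + dz g z"
    "\<And>z. z \<in> S \<Longrightarrow> dzbar (\<lambda>z. f z + g z) z = dzbar f z + dzbar g z"
    using wirtinger_eqI[OF d] by auto
qed

lemma C1_inverse:
  assumes "open S" "C1 f S" "\<And>z. z \<in> S \<Longrightarrow> f z \<noteq> 0"
  shows "C1 (\<lambda>z. inverse (f z)) S"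
    "\<And>z. z \<in> S \<Longrightarrow> dz (\<lambda>z. inverse (f z)) z = - (dz f z * inverse (f z) * inverse (f z))"
    "\<And>z. z \<in> S \<Longrightarrow> dzbar (\<lambda>z. inverse (f z)) z = - (dzbar f z * inverse (f z) * inverse (f z))"
proof -
  have d: "((\<lambda>z. inverse (f z)) has_derivative
      (\<lambda>h. (- (dz f z * inverse (f z) * inverse (f z))) * h + (- (dzbar f z * inverse (f z) * inverse (f z))) * cnj h)) (at z)"
    if "z \<in> S" for z
    using Deriv.has_derivative_inverse[OF assms(3)[OF that] C1_D[OF assms(2) that]]
    by (simp add: algebra_simps)
  show "C1 (\<lambda>z. inverse (f z)) S"
    by (rule C1_intro[OF assms(1) d]) (use C1_cont[OF assms(2)] assms in \<open>auto intro!: continuous_intros\<close>)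
  show "\<And>z. z \<in> S \<Longrightarrow> dz (\<lambda>z. inverse (f z)) z = - (dz f z * inverse (f z) * inverse (f z))"
    "\<And>z. z \<in> S \<Longrightarrow> dzbar (\<lambda>z. inverse (f z)) z = - (dzbar f z * inverse (f z) * inverse (f z))"
    using wirtinger_eqI[OF d] by auto
qed

lemma C1_holomorphic:
  assumes "open S" "f holomorphic_on S"
  shows "C1 f S" "\<And>z. z \<in> S \<Longrightarrow> dz f z = deriv f z" "\<And>z. z \<in> S \<Longrightarrow> dzbar f z = 0"
proof -
  have d: "(f has_derivative (\<lambda>h. deriv f z * h + 0 * cnj h)) (at z)" if "z \<in> S" for z
    using holomorphic_derivI[OF assms(2,1) that] by (simp add: has_field_derivative_def)
  show "C1 f S"
    by (rule C1_intro[OF assms(1) d])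
      (auto intro!: holomorphic_on_imp_continuous_on holomorphic_deriv assms)
  show "\<And>z. z \<in> S \<Longrightarrow> dz f z = deriv f z" "\<And>z. z \<in> S \<Longrightarrow> dzbar f z = 0"
    using wirtinger_eqI[OF d] by auto
qed

lemma C1_cnj_holomorphic:
  assumes "open S" "f holomorphic_on S"
  shows "C1 (\<lambda>z. cnj (f z)) S" "\<And>z. z \<in> S \<Longrightarrow> dz (\<lambda>z. cnj (f z)) z = 0"
    "\<And>z. z \<in> S \<Longrightarrow> dzbar (\<lambda>z. cnj (f z)) z = cnj (deriv f z)"
proof -
  have d: "((\<lambda>z. cnj (f z)) has_derivative (\<lambda>h. 0 * h + cnj (deriv f z) * cnj h)) (at z)" if "z \<in> S" for z
    using has_derivative_cnj[OF holomorphic_derivI[OF assms(2,1) that, unfolded has_field_derivative_def]]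
    by simp
  show "C1 (\<lambda>z. cnj (f z)) S"
    by (rule C1_intro[OF assms(1) d])
      (use holomorphic_on_imp_continuous_on[OF holomorphic_deriv[OF assms(2,1)]] in \<open>auto intro!: continuous_intros\<close>)
  show "\<And>z. z \<in> S \<Longrightarrow> dz (\<lambda>z. cnj (f z)) z = 0"
    "\<And>z. z \<in> S \<Longrightarrow> dzbar (\<lambda>z. cnj (f z)) z = cnj (deriv f z)"
    using wirtinger_eqI[OF d] by auto
qed

lemma C1_compose:
  assumes "open S" "open T" "t holomorphic_on T" "t ` T \<subseteq> S" "C1 f S"
  shows "C1 (\<lambda>z. f (t z)) T"
    "\<And>z. z \<in> T \<Longrightarrow> dz (\<lambda>z. f (t z)) z = dz f (t z) * deriv t z"
    "\<And>z. z \<in> T \<Longrightarrow> dzbar (\<lambda>z. f (t z)) z = dzbar f (t z) * cnj (deriv t z)"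
proof -
  have d: "((\<lambda>z. f (t z)) has_derivative
      (\<lambda>h. (dz f (t z) * deriv t z) * h + (dzbar f (t z) * cnj (deriv t z)) * cnj h)) (at z)"
    if "z \<in> T" for z
  proof -
    have "t z \<in> S" using that assms by auto
    note has_derivative_compose[OF holomorphic_derivI[OF assms(3,2) that, unfolded has_field_derivative_def]
        C1_D[OF assms(5) this]]
    then show ?thesis by (simp add: algebra_simps)
  qed
  have ct: "continuous_on T t" using assms holomorphic_on_imp_continuous_on by blast
  have cd: "continuous_on T (deriv t)" using assms by (simp add: holomorphic_deriv holomorphic_on_imp_continuous_on)
  show "C1 (\<lambda>z. f (t z)) T"
    by (rule C1_intro[OF assms(2) d])
      (auto intro!: continuous_intros cd continuous_on_compose2[OF C1_cont(1)[OF assms(5)] ct]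
         continuous_on_compose2[OF C1_cont(2)[OF assms(5)] ct] simp: assms(4)[unfolded image_subset_iff])
  show "\<And>z. z \<in> T \<Longrightarrow> dz (\<lambda>z. f (t z)) z = dz f (t z) * deriv t z"
    "\<And>z. z \<in> T \<Longrightarrow> dzbar (\<lambda>z. f (t z)) z = dzbar f (t z) * cnj (deriv t z)"
    using wirtinger_eqI[OF d] by auto
qed

lemma C1_sum:
  assumes "open S" "finite I" "\<And>i. i \<in> I \<Longrightarrow> C1 (f i) S"
  shows "C1 (\<lambda>z. \<Sum>i\<in>I. f i z) S \<and> (\<forall>z\<in>S. dz (\<lambda>z. \<Sum>i\<in>I. f i z) z = (\<Sum>i\<in>I. dz (f i) z)
    \<and> dzbar (\<lambda>z. \<Sum>i\<in>I. f i z) z = (\<Sum>i\<in>I. dzbar (f i) z))"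
  using assms(2,3)
proof (induction I)
  case empty
  then show ?case by (simp add: C1_const dz_const dzbar_const)
next
  case (insert i I)
  have "C1 (f i) S" "C1 (\<lambda>z. \<Sum>i\<in>I. f i z) S" using insert by auto
  note a = C1_add[OF assms(1) this]
  show ?case using insert a by simp
qed

lemma C2_I:
  assumes "open S" "C1 f S" "C1 a S" "C1 b S"
    "\<And>z. z \<in> S \<Longrightarrow> dz f z = a z" "\<And>z. z \<in> S \<Longrightarrow> dzbar f z = b z"
    "\<And>z. z \<in> S \<Longrightarrow> dzbar a z = dz b z"
  shows "C2 f S"
proof -
  have "C1 (dz f) S" by (rule C1_cong[OF assms(1) _ assms(3)]) (simp add: assms)
  moreover have "C1 (dzbar f) S" by (rule C1_cong[OF assms(1) _ assms(4)]) (simp add: assms)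
  moreover have "dzbar (dz f) z = dz (dzbar f) z" if "z \<in> S" for z
    using wirtinger_cong(3)[OF assms(1) that assms(5)] wirtinger_cong(2)[OF assms(1) that assms(6)]
      assms(7)[OF that] by simp
  ultimately show ?thesis using assms(2) by (simp add: C2_def)
qed

lemma C2_mult:
  assumes S: "open S" and "C2 f S" "C2 g S"
  shows "C2 (\<lambda>z. f z * g z) S"
proof -
  have f: "C1 f S" "C1 (dz f) S" "C1 (dzbar f) S" "\<And>z. z \<in> S \<Longrightarrow> dzbar (dz f) z = dz (dzbar f) z"
   and g: "C1 g S" "C1 (dz g) S" "C1 (dzbar g) S" "\<And>z. z \<in> S \<Longrightarrow> dzbar (dz g) z = dz (dzbar g) z"
    using assms by (auto simp: C2_def)
  note i = C1_mult(1)[OF S] C1_add(1)[OF S]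
  note e = C1_mult(2,3)[OF S] C1_add(2,3)[OF S]
  show ?thesis
    by (rule C2_I[OF S, where a = "\<lambda>z. dz f z * g z + f z * dz g z" and b = "\<lambda>z. dzbar f z * g z + f z * dzbar g z"])
      (simp_all add: f g i e algebra_simps)
qed

lemma C2_inverse:
  assumes S: "open S" and "C2 f S" and nz: "\<And>z. z \<in> S \<Longrightarrow> f z \<noteq> 0"
  shows "C2 (\<lambda>z. inverse (f z)) S"
proof -
  have f: "C1 f S" "C1 (dz f) S" "C1 (dzbar f) S" "\<And>z. z \<in> S \<Longrightarrow> dzbar (dz f) z = dz (dzbar f) z"
    using assms by (auto simp: C2_def)
  note v = C1_inverse[OF S f(1) nz]
  note i = C1_mult(1)[OF S] v(1) C1_const
  note e = C1_mult(2,3)[OF S]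
  show ?thesis
    by (rule C2_I[OF S, where a = "\<lambda>z. (-1) * (dz f z * inverse (f z) * inverse (f z))"
          and b = "\<lambda>z. (-1) * (dzbar f z * inverse (f z) * inverse (f z))"])
      (simp_all only: f i e v dz_const dzbar_const, simp_all add: algebra_simps)
qed

lemma C2_compose:
  assumes S: "open S" and T: "open T" and t: "t holomorphic_on T" "t ` T \<subseteq> S" and "C2 f S"
  shows "C2 (\<lambda>z. f (t z)) T"
proof -
  have f: "C1 f S" "C1 (dz f) S" "C1 (dzbar f) S" "\<And>z. z \<in> S \<Longrightarrow> dzbar (dz f) z = dz (dzbar f) z"
    using assms by (auto simp: C2_def)
  have dt: "deriv t holomorphic_on T" using t T holomorphic_deriv by blast
  note c = C1_compose[OF S T t]
  note h = C1_holomorphic[OF T dt] C1_cnj_holomorphic[OF T dt]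
  show ?thesis
  proof (rule C2_I[OF T c(1)[OF f(1)], where a = "\<lambda>z. dz f (t z) * deriv t z"
        and b = "\<lambda>z. dzbar f (t z) * cnj (deriv t z)"])
    fix z assume z: "z \<in> T"
    then have tz: "t z \<in> S" using t by auto
    show "dzbar (\<lambda>z. dz f (t z) * deriv t z) z = dz (\<lambda>z. dzbar f (t z) * cnj (deriv t z)) z"
      using C1_mult(3)[OF T c(1)[OF f(2)] h(1) z] C1_mult(2)[OF T c(1)[OF f(3)] h(4) z]
        c(3)[OF f(2) z] c(2)[OF f(3) z] h(3)[OF z] h(5)[OF z] f(4)[OF tz] by simp
  qed (use c f h C1_mult(1)[OF T] in auto)
qed

lemma C2_sum:
  assumes S: "open S" and I: "finite I" and "\<And>i. i \<in> I \<Longrightarrow> C2 (f i) S"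
  shows "C2 (\<lambda>z. \<Sum>i\<in>I. f i z) S"
proof -
  have f: "\<And>i. i \<in> I \<Longrightarrow> C1 (f i) S" "\<And>i. i \<in> I \<Longrightarrow> C1 (dz (f i)) S" "\<And>i. i \<in> I \<Longrightarrow> C1 (dzbar (f i)) S"
    "\<And>i z. i \<in> I \<Longrightarrow> z \<in> S \<Longrightarrow> dzbar (dz (f i)) z = dz (dzbar (f i)) z"
    using assms by (auto simp: C2_def)
  show ?thesis
    by (rule C2_I[OF S, where a = "\<lambda>z. \<Sum>i\<in>I. dz (f i) z" and b = "\<lambda>z. \<Sum>i\<in>I. dzbar (f i) z"])
      (use C1_sum[OF S I f(1)] C1_sum[OF S I f(2)] C1_sum[OF S I f(3)] f(4) in \<open>auto intro: sum.cong\<close>)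
qed

section \<open>Radial functions and polynomial cut-offs\<close>

lemma C1_radial:
  fixes g g' :: "real \<Rightarrow> real"
  assumes "\<And>t. (g has_real_derivative g' t) (at t)" "continuous_on UNIV g'"
  shows "C1 (\<lambda>z. of_real (g (c + e * (cmod z)\<^sup>2))) UNIV"
    "dz (\<lambda>z. of_real (g (c + e * (cmod z)\<^sup>2))) z = of_real (e * g' (c + e * (cmod z)\<^sup>2)) * cnj z"
    "dzbar (\<lambda>z. of_real (g (c + e * (cmod z)\<^sup>2))) z = of_real (e * g' (c + e * (cmod z)\<^sup>2)) * z"
proof -
  let ?r = "\<lambda>z. c + e * (cmod z)\<^sup>2"
  have d: "((\<lambda>z. of_real (g (?r z)) :: complex) has_derivative
      (\<lambda>h. (of_real (e * g' (?r z)) * cnj z) * h + (of_real (e * g' (?r z)) * z) * cnj h)) (at z)" for z :: complex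
  proof -
    \<comment> \<open>As an inner product the squared modulus is visibly differentiable everywhere,
      whereas \<open>cmod\<close> is not at 0.\<close>
    have r: "?r = (\<lambda>z. c + e * (z \<bullet> z))" by (simp add: dot_square_norm)
    have "(?r has_derivative (\<lambda>h. e * (2 * (z \<bullet> h)))) (at z)"
      unfolding r by (auto intro!: derivative_eq_intros simp: inner_commute)
    then have "((\<lambda>z. g (?r z)) has_derivative (\<lambda>h. g' (?r z) * (e * (2 * (z \<bullet> h))))) (at z)"
      by (rule has_derivative_compose[where g = g and f = ?r and x = z, OF _ assms(1)[unfolded has_field_derivative_def]])
    then have "((\<lambda>z. of_real (g (?r z)) :: complex) has_derivative (\<lambda>h. of_real (g' (?r z) * (e * (2 * (z \<bullet> h)))))) (at z)"
      by (rule has_derivative_of_real)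
    moreover have "(\<lambda>h. of_real (g' (?r z) * (e * (2 * (z \<bullet> h))))) =
       (\<lambda>h. (of_real (e * g' (?r z)) * cnj z) * h + (of_real (e * g' (?r z)) * z) * cnj h)"
      by (rule ext) (simp add: complex_eq_iff inner_complex_def algebra_simps)
    ultimately show ?thesis by (simp only:)
  qed
  have c: "continuous_on UNIV (\<lambda>z. g' (?r z))"
    by (rule continuous_on_compose2[OF assms(2)]) (auto intro!: continuous_intros)
  show "C1 (\<lambda>z. of_real (g (?r z))) UNIV"
    by (rule C1_intro[OF open_UNIV d]) (auto intro!: continuous_intros c)
  show "dz (\<lambda>z. of_real (g (?r z))) z = of_real (e * g' (?r z)) * cnj z"
    "dzbar (\<lambda>z. of_real (g (?r z))) z = of_real (e * g' (?r z)) * z"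
    using wirtinger_eqI[OF d] by auto
qed

text \<open>Away from 0 this is the power rule or a constant; at 0 the difference quotient is
  squeezed by \<open>max 0 h ^ Suc n\<close>. Powers of the positive part thus give cut-offs of any
  prescribed finite smoothness.\<close>

lemma max_power_deriv:
  "((\<lambda>t::real. (max 0 t) ^ Suc (Suc n)) has_real_derivative (of_nat (Suc (Suc n)) * (max 0 t) ^ Suc n)) (at t)"
proof -
  consider "t > 0" | "t < 0" | "t = 0" by linarith
  then show ?thesis
  proof cases
    case 1
    have "((\<lambda>t::real. t ^ Suc (Suc n)) has_real_derivative (of_nat (Suc (Suc n)) * (max 0 t) ^ Suc n)) (at t)"
      using 1 DERIV_pow[of "Suc (Suc n)" t] by (simp add: max_def)
    then show ?thesis
      by (rule has_field_derivative_transform_within[where d = t]) (use 1 in \<open>auto simp: dist_real_def max_def\<close>)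
  next
    case 2
    have "((\<lambda>t::real. 0) has_real_derivative (of_nat (Suc (Suc n)) * (max 0 t) ^ Suc n)) (at t)"
      using 2 by (auto simp: max_def)
    then show ?thesis
      by (rule has_field_derivative_transform_within[where d = "- t"]) (use 2 in \<open>auto simp: dist_real_def max_def\<close>)
  next
    case 3
    have "((\<lambda>h::real. (max 0 h) ^ Suc (Suc n) / h) \<longlongrightarrow> 0) (at 0)"
    proof (rule Lim_null_comparison)
      show "\<forall>\<^sub>F h in at 0. norm ((max 0 h) ^ Suc (Suc n) / h) \<le> (max 0 h) ^ Suc n"
        by (intro always_eventually allI) (auto simp: max_def)
      have "isCont (\<lambda>h::real. (max 0 h) ^ Suc n) 0" by (intro continuous_intros)
      then show "((\<lambda>h::real. (max 0 h) ^ Suc n) \<longlongrightarrow> 0) (at 0)"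
        by (simp add: isCont_def)
    qed
    then show ?thesis using 3 by (simp add: DERIV_def)
  qed
qed

text \<open>The cube makes the function twice continuously differentiable across the circle of
  radius \<open>r\<close>, because second derivatives of the partition of unity occur in the residue
  theorem. The factor -1 fits the pattern of \<open>C1_radial\<close>.\<close>

definition bump :: "real \<Rightarrow> complex \<Rightarrow> complex" where
  "bump r z = of_real ((max 0 (r\<^sup>2 + (- 1) * (cmod z)\<^sup>2)) ^ 3)"

lemma bump_C2: "C2 (bump r) UNIV"
proof -
  let ?q = "\<lambda>z. of_real (3 * (max 0 (r\<^sup>2 + (- 1) * (cmod z)\<^sup>2)) ^ 2) :: complex"
  have d2: "((\<lambda>t::real. max 0 t ^ 3) has_real_derivative 3 * max 0 t ^ 2) (at t)" for t
    using max_power_deriv[of 1 t] by (simp add: numeral_eq_Suc)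
  have "((\<lambda>t::real. max 0 t ^ 2) has_real_derivative 2 * max 0 t) (at t)" for t
    using max_power_deriv[of 0 t] by (simp add: numeral_eq_Suc)
  from DERIV_cmult[OF this, of 3]
  have d1: "((\<lambda>t::real. 3 * max 0 t ^ 2) has_real_derivative 6 * max 0 t) (at t)" for t
    by simp
  have c: "continuous_on UNIV (\<lambda>t::real. 3 * max 0 t ^ 2)" "continuous_on UNIV (\<lambda>t::real. 6 * max 0 t)"
    by (auto intro!: continuous_intros)
  note r1 = C1_radial[OF d2 c(1), of "r\<^sup>2" "-1"] and r2 = C1_radial[OF d1 c(2), of "r\<^sup>2" "-1"]
  have h: "C1 (\<lambda>z. z) UNIV" "C1 cnj UNIV" "dz (\<lambda>z. z) z = 1" "dzbar (\<lambda>z. z) z = 0" "dz cnj z = 0" "dzbar cnj z = 1" for z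
    using C1_holomorphic[of UNIV "\<lambda>z. z"] C1_cnj_holomorphic[of UNIV "\<lambda>z. z"] by auto
  note m = C1_mult[OF open_UNIV]
  show ?thesis
    unfolding bump_def[abs_def]
  proof (rule C2_I[OF open_UNIV r1(1)])
    show "dz (\<lambda>z. of_real ((max 0 (r\<^sup>2 + - 1 * (cmod z)\<^sup>2)) ^ 3)) z = (-1) * (?q z * cnj z)"
      "dzbar (\<lambda>z. of_real ((max 0 (r\<^sup>2 + - 1 * (cmod z)\<^sup>2)) ^ 3)) z = (-1) * (?q z * z)" for z
      unfolding r1(2,3) by simp_all
    show "C1 (\<lambda>z. (-1) * (?q z * cnj z)) UNIV" "C1 (\<lambda>z. (-1) * (?q z * z)) UNIV"
      by (intro m(1) C1_const r2(1) h)+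
    fix z :: complex
    have "dzbar (\<lambda>z. (-1) * (?q z * cnj z)) z = (-1) * (dzbar ?q z * cnj z + ?q z)"
      using m(3)[OF C1_const m(1)[OF r2(1) h(2)], of z "-1"] m(3)[OF r2(1) h(2), of z] dzbar_const h(6)
      by simp
    moreover have "dz (\<lambda>z. (-1) * (?q z * z)) z = (-1) * (dz ?q z * z + ?q z)"
      using m(2)[OF C1_const m(1)[OF r2(1) h(1)], of z "-1"] m(2)[OF r2(1) h(1), of z] dz_const h(3)
      by simp
    moreover have "dzbar ?q z * cnj z = dz ?q z * z" unfolding r2(2,3) by simp
    ultimately show "dzbar (\<lambda>z. (-1) * (?q z * cnj z)) z = dz (\<lambda>z. (-1) * (?q z * z)) z" by simp
  qed
qed

lemma bump_nonneg: "Im (bump r z) = 0" "Re (bump r z) \<ge> 0"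
  by (simp_all add: bump_def)

lemma bump_pos: "0 < r \<Longrightarrow> Re (bump r z) > 0 \<longleftrightarrow> cmod z < r"
proof -
  assume r: "0 < r"
  have "Re (bump r z) > 0 \<longleftrightarrow> max 0 (r\<^sup>2 + (- 1) * (cmod z)\<^sup>2) > 0"
    by (simp add: bump_def zero_less_power_eq)
  also have "\<dots> \<longleftrightarrow> (cmod z)\<^sup>2 < r\<^sup>2" by auto
  also have "\<dots> \<longleftrightarrow> cmod z < r" using r by (metis less_imp_le norm_ge_zero power2_less_imp_less power_strict_mono zero_less_numeral)
  finally show ?thesis .
qed

section \<open>Integration over the plane\<close>

definition complex_of_vec :: "real^2 \<Rightarrow> complex" where "complex_of_vec v = Complex (v $ 1) (v $ 2)"
definition vec_of_complex :: "complex \<Rightarrow> real^2" where "vec_of_complex z = vector [Re z, Im z]"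

lemma complex_of_vec_of_complex [simp]: "complex_of_vec (vec_of_complex z) = z"
  by (simp add: complex_of_vec_def vec_of_complex_def)

lemma vec_of_complex_of_vec [simp]: "vec_of_complex (complex_of_vec v) = v"
  by (simp add: complex_of_vec_def vec_of_complex_def vec_eq_iff forall_2)

lemma bounded_linear_complex_of_vec: "bounded_linear complex_of_vec"
  by (intro linear_conv_bounded_linear[THEN iffD1] linearI) (simp_all add: complex_of_vec_def complex_eq_iff)

lemma bounded_linear_vec_of_complex: "bounded_linear vec_of_complex"
  by (intro linear_conv_bounded_linear[THEN iffD1] linearI) (simp_all add: vec_of_complex_def vec_eq_iff forall_2)

lemma norm_complex_of_vec [simp]: "cmod (complex_of_vec v) = norm v"
  by (simp add: complex_of_vec_def complex_norm norm_vec_def L2_set_def sum_2)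

lemma continuous_on_complex_of_vec [continuous_intros]: "continuous_on S complex_of_vec"
  using bounded_linear_complex_of_vec linear_continuous_on by blast

text \<open>The integral is taken over \<open>real^2\<close>, where the change of variables formula
  is stated with Jacobian determinants.\<close>

definition plane_integral :: "(complex \<Rightarrow> complex) \<Rightarrow> complex" where
  "plane_integral f = integral UNIV (\<lambda>v. f (complex_of_vec v))"

definition cts_compact_support :: "(complex \<Rightarrow> complex) \<Rightarrow> bool" where
  "cts_compact_support f \<longleftrightarrow> continuous_on UNIV f \<and> (\<exists>R. \<forall>z. cmod z \<ge> R \<longrightarrow> f z = 0)"

lemma cts_compact_support_integrable:
  assumes "cts_compact_support f"
  shows "(\<lambda>v. f (complex_of_vec v)) absolutely_integrable_on UNIV"
proof -
  obtain R where R: "\<And>z. cmod z \<ge> R \<Longrightarrow> f z = 0" and c: "continuous_on UNIV f"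
    using assms by (auto simp: cts_compact_support_def)
  obtain a :: "real^2" where a: "cball 0 R \<subseteq> cbox (- a) a"
    using bounded_subset_cbox_symmetric bounded_cball by metis
  have "continuous_on (cbox (- a) a) (\<lambda>v. f (complex_of_vec v))"
    by (rule continuous_on_compose2[OF c]) (auto intro!: continuous_intros)
  then have "(\<lambda>v. if v \<in> cbox (- a) a then f (complex_of_vec v) else 0) absolutely_integrable_on UNIV"
    by (simp only: absolutely_integrable_restrict_UNIV absolutely_integrable_continuous)
  moreover have "(\<lambda>v. if v \<in> cbox (- a) a then f (complex_of_vec v) else 0) = (\<lambda>v. f (complex_of_vec v))"
  proof
    fix v
    have "f (complex_of_vec v) = 0" if "v \<notin> cbox (- a) a"
    proof (rule R)
      have "v \<notin> cball 0 R" using a that by blast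
      then show "R \<le> cmod (complex_of_vec v)" by simp
    qed
    then show "(if v \<in> cbox (- a) a then f (complex_of_vec v) else 0) = f (complex_of_vec v)" by auto
  qed
  ultimately show ?thesis by simp
qed

lemma cts_compact_support_integrable_on: "cts_compact_support f \<Longrightarrow> (\<lambda>v. f (complex_of_vec v)) integrable_on UNIV"
  using cts_compact_support_integrable set_lebesgue_integral_eq_integral(1) by blast

lemma cts_compact_support_add: "cts_compact_support f \<Longrightarrow> cts_compact_support g \<Longrightarrow> cts_compact_support (\<lambda>z. f z + g z)"
  unfolding cts_compact_support_def
proof (elim conjE exE, intro conjI)
  fix R R' assume "\<forall>z. R \<le> cmod z \<longrightarrow> f z = 0" "\<forall>z. R' \<le> cmod z \<longrightarrow> g z = 0"
  then show "\<exists>R. \<forall>z. R \<le> cmod z \<longrightarrow> f z + g z = 0" by (intro exI[of _ "max R R'"]) auto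
qed (auto intro: continuous_intros)

lemma cts_compact_support_cmult: "cts_compact_support f \<Longrightarrow> cts_compact_support (\<lambda>z. c * f z)"
  by (auto simp: cts_compact_support_def intro: continuous_intros)

lemma plane_integral_add: "cts_compact_support f \<Longrightarrow> cts_compact_support g \<Longrightarrow> plane_integral (\<lambda>z. f z + g z) = plane_integral f + plane_integral g"
  unfolding plane_integral_def by (intro integral_add cts_compact_support_integrable_on)

lemma plane_integral_cmult: "plane_integral (\<lambda>z. c * f z) = c * plane_integral f"
  unfolding plane_integral_def by simp

lemma cts_compact_support_sum:
  assumes "finite I" "\<And>i. i \<in> I \<Longrightarrow> cts_compact_support (f i)"
  shows "cts_compact_support (\<lambda>z. \<Sum>i\<in>I. f i z) \<and> plane_integral (\<lambda>z. \<Sum>i\<in>I. f i z) = (\<Sum>i\<in>I. plane_integral (f i))"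
  using assms
proof (induction I)
  case empty
  then show ?case by (simp add: plane_integral_def cts_compact_support_def)
next
  case (insert i I)
  then show ?case by (simp add: cts_compact_support_add plane_integral_add)
qed

lemma det_complex_mult:
  "det (matrix (\<lambda>h. vec_of_complex (c * complex_of_vec h))) = (cmod c)\<^sup>2"
proof -
  have "complex_of_vec (axis 1 1) = 1" "complex_of_vec (axis 2 1) = \<i>" by (simp_all add: complex_of_vec_def axis_def complex_eq_iff)
  then show ?thesis
    using cmod_power2[of c] by (simp add: det_2 matrix_def vec_of_complex_def power2_eq_square)
qed

text \<open>A holomorphic map has the square of the modulus of its derivative as real Jacobian, so
  no orientation sign appears. As \<open>E\<close> vanishes off the image of \<open>S\<close>, both
  integrals may run over the whole plane.\<close>

lemma plane_integral_change_of_variables: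
  assumes S: "open S" and t: "t holomorphic_on S" "inj_on t S"
    and E: "cts_compact_support E" "\<And>w. w \<notin> t ` S \<Longrightarrow> E w = 0"
  shows "plane_integral (\<lambda>z. if z \<in> S then of_real ((cmod (deriv t z))\<^sup>2) * E (t z) else 0) = plane_integral E"
proof -
  define S' where "S' = complex_of_vec -` S"
  define g where "g = (\<lambda>v. vec_of_complex (t (complex_of_vec v)))"
  define g' where "g' = (\<lambda>v h. vec_of_complex (deriv t (complex_of_vec v) * complex_of_vec h))"
  define f where "f = (\<lambda>v. vec_of_complex (E (complex_of_vec v)))"
  have oS: "open S'" unfolding S'_def using S continuous_on_complex_of_vec[of UNIV]
    by (simp add: open_vimage)
  have der: "(g has_derivative g' v) (at v within S')" if "v \<in> S'" for v
  proof -
    have "(t has_derivative (*) (deriv t (complex_of_vec v))) (at (complex_of_vec v))"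
      using holomorphic_derivI[OF t(1) S] that by (simp add: S'_def has_field_derivative_def)
    from has_derivative_compose[OF bounded_linear_imp_has_derivative[OF bounded_linear_complex_of_vec, of "at v"] this]
    show ?thesis unfolding g_def g'_def
      by (rule has_derivative_at_withinI[OF bounded_linear.has_derivative[OF bounded_linear_vec_of_complex]])
  qed
  have inj: "inj_on g S'"
    unfolding inj_on_def g_def S'_def using t(2)
    by (metis vec_of_complex_of_vec inj_onD complex_of_vec_of_complex vimage_eq)
  have img: "g ` S' = complex_of_vec -` (t ` S)"
  proof (intro equalityI subsetI)
    fix w assume "w \<in> complex_of_vec -` (t ` S)"
    then obtain z where z: "z \<in> S" "complex_of_vec w = t z" by auto
    then have "w = g (vec_of_complex z)" "vec_of_complex z \<in> S'" by (auto simp: g_def S'_def simp flip: z(2))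
    then show "w \<in> g ` S'" by blast
  qed (auto simp: g_def S'_def)
  have absE: "(\<lambda>v. E (complex_of_vec v)) absolutely_integrable_on UNIV" by (rule cts_compact_support_integrable[OF E(1)])
  then have f_abs: "f absolutely_integrable_on UNIV"
    unfolding f_def using absolutely_integrable_linear[OF _ bounded_linear_vec_of_complex] by (auto simp: o_def)
  have f0: "(\<lambda>v. if v \<in> g ` S' then f v else 0) = f"
    using E(2) by (auto simp: f_def img vec_of_complex_def fun_eq_iff vec_eq_iff forall_2)
  have 1: "f absolutely_integrable_on g ` S'" "integral (g ` S') f = integral UNIV f"
    using f_abs absolutely_integrable_restrict_UNIV[of "g ` S'" f] integral_restrict_UNIV[of "g ` S'" f]
    unfolding f0 by auto
  have "(\<lambda>x. \<bar>det (matrix (g' x))\<bar> *\<^sub>R f (g x)) absolutely_integrable_on S' \<and>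
      integral S' (\<lambda>x. \<bar>det (matrix (g' x))\<bar> *\<^sub>R f (g x)) = integral UNIV f"
    by (rule has_absolute_integral_change_of_variables[OF _ der inj, THEN iffD2])
      (use 1 oS in \<open>auto simp: borel_open sets_completionI_sets\<close>)
  then have 2: "integral S' (\<lambda>x. \<bar>det (matrix (g' x))\<bar> *\<^sub>R f (g x)) = integral UNIV f"
     and 3: "(\<lambda>x. \<bar>det (matrix (g' x))\<bar> *\<^sub>R f (g x)) integrable_on S'"
    using set_lebesgue_integral_eq_integral(1) by blast+
  have eq: "complex_of_vec (\<bar>det (matrix (g' x))\<bar> *\<^sub>R f (g x)) = of_real ((cmod (deriv t (complex_of_vec x)))\<^sup>2) * E (t (complex_of_vec x))" for x
    unfolding g'_def det_complex_mult f_def g_def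
    by (simp add: linear_scale[OF bounded_linear.linear[OF bounded_linear_complex_of_vec]], simp add: scaleR_conv_of_real)
  have "complex_of_vec (integral S' (\<lambda>x. \<bar>det (matrix (g' x))\<bar> *\<^sub>R f (g x)))
      = integral S' (\<lambda>x. of_real ((cmod (deriv t (complex_of_vec x)))\<^sup>2) * E (t (complex_of_vec x)))"
    using integral_linear[OF 3 bounded_linear_complex_of_vec] by (simp add: o_def eq)
  also have "\<dots> = plane_integral (\<lambda>z. if z \<in> S then of_real ((cmod (deriv t z))\<^sup>2) * E (t z) else 0)"
    unfolding plane_integral_def
    by (subst integral_restrict_UNIV[symmetric]) (simp add: S'_def)
  finally have "plane_integral (\<lambda>z. if z \<in> S then of_real ((cmod (deriv t z))\<^sup>2) * E (t z) else 0)
     = complex_of_vec (integral UNIV f)" using 2 by simp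
  also have "\<dots> = plane_integral E"
    using integral_linear[OF _ bounded_linear_vec_of_complex, of "\<lambda>v. E (complex_of_vec v)" UNIV] cts_compact_support_integrable_on[OF E(1)]
    by (simp add: plane_integral_def f_def o_def)
  finally show ?thesis .
qed

section \<open>Stokes' formula for compactly supported functions\<close>

lemma plane_integral_shift: "cts_compact_support F \<Longrightarrow> plane_integral (\<lambda>z. F (z + c)) = plane_integral F"
proof -
  assume F: "cts_compact_support F"
  have "deriv (\<lambda>z. z + c) z = 1" for z
    by (rule DERIV_imp_deriv) (auto intro!: derivative_eq_intros)
  then show ?thesis
    using plane_integral_change_of_variables[of UNIV "\<lambda>z. z + c" F] F
    by (simp add: surj_plus_right holomorphic_intros)
qed

text \<open>The integrand is the derivative of \<open>F\<close> in direction \<open>e\<close>. It is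
  the limit of difference quotients, each of which has integral 0 by translation invariance. The
  quotients are dominated because \<open>F\<close> is Lipschitz, its derivatives being continuous
  with compact support.\<close>

lemma stokes_direction:
  assumes F: "C1 F UNIV" "\<And>z. cmod z \<ge> R \<Longrightarrow> F z = 0"
  shows "plane_integral (\<lambda>z. dz F z * e + dzbar F z * cnj e) = 0"
proof -
  have cF: "continuous_on UNIV F" and cd: "continuous_on UNIV (dz F)" "continuous_on UNIV (dzbar F)"
    using C1_cont[OF F(1)] by auto
  have F0: "cts_compact_support F" using cF F(2) by (auto simp: cts_compact_support_def)
  have z0: "dz F z = 0" "dzbar F z = 0" if "cmod z > R" for z
    using wirtinger_cong(2,3)[of "{z. cmod z > R}" z F "\<lambda>_. 0"] F(2) that
    by (auto simp: dz_const dzbar_const open_Collect_less continuous_intros)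
  have "\<exists>M. \<forall>z. cmod (dz F z) + cmod (dzbar F z) \<le> M"
  proof -
    have "compact ((\<lambda>z. cmod (dz F z) + cmod (dzbar F z)) ` cball 0 R)"
      by (intro compact_continuous_image continuous_intros continuous_on_subset[OF cd(1)]
            continuous_on_subset[OF cd(2)]) auto
    then obtain M where M: "\<And>z. z \<in> cball 0 R \<Longrightarrow> cmod (dz F z) + cmod (dzbar F z) \<le> M"
      using compact_imp_bounded bounded_real by (metis (no_types, lifting) abs_le_D1 imageI)
    have "cmod (dz F z) + cmod (dzbar F z) \<le> max M 0" for z
      using M[of z] z0[of z] by (cases "cmod z \<le> R") auto
    then show ?thesis by blast
  qed
  then obtain M where M: "\<And>z. cmod (dz F z) + cmod (dzbar F z) \<le> M" by blast
  have lip: "cmod (F w - F z) \<le> M * cmod (w - z)" for w z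
  proof (rule differentiable_bound[of UNIV F "\<lambda>z h. dz F z * h + dzbar F z * cnj h"])
    fix z
    show "(F has_derivative (\<lambda>h. dz F z * h + dzbar F z * cnj h)) (at z within UNIV)"
      using C1_D[OF F(1)] by simp
    show "onorm (\<lambda>h. dz F z * h + dzbar F z * cnj h) \<le> M"
    proof (rule onorm_le)
      fix h
      have "cmod (dz F z * h + dzbar F z * cnj h) \<le> (cmod (dz F z) + cmod (dzbar F z)) * cmod h"
        by (rule order_trans[OF norm_triangle_ineq]) (simp add: norm_mult algebra_simps)
      also have "\<dots> \<le> M * cmod h" using M by (intro mult_right_mono) auto
      finally show "cmod (dz F z * h + dzbar F z * cnj h) \<le> M * cmod h" .
    qed
  qed auto
  \<comment> \<open>Difference quotients with step \<open>e / (k + 1)\<close>; the shift by one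
    avoids a division by zero at \<open>k = 0\<close>.\<close>
  define Q where "Q = (\<lambda>k::nat. \<lambda>z. (of_nat k + 1) * (F (z + e / (of_nat k + 1)) + (-1) * F z))"
  have Fs: "cts_compact_support (\<lambda>z. F (z + c))" for c
    unfolding cts_compact_support_def
  proof (intro conjI exI[of _ "R + cmod c"] allI impI)
    show "continuous_on UNIV (\<lambda>z. F (z + c))"
      by (rule continuous_on_compose2[OF cF]) (auto intro!: continuous_intros)
    fix z assume "R + cmod c \<le> cmod z"
    then show "F (z + c) = 0" using norm_triangle_ineq2[of z "- c"] by (intro F(2)) auto
  qed
  have Q0: "cts_compact_support (Q k)" for k unfolding Q_def by (intro cts_compact_support_cmult cts_compact_support_add Fs F0)
  have Qint: "plane_integral (Q k) = 0" for k
    unfolding Q_def plane_integral_cmult plane_integral_add[OF Fs cts_compact_support_cmult[OF F0]] plane_integral_shift[OF F0] by simp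
  obtain a :: "real^2" where a: "cball 0 (R + cmod e) \<subseteq> cbox (- a) a"
    using bounded_subset_cbox_symmetric bounded_cball by metis
  \<comment> \<open>A common integrable bound: all steps have length at most \<open>cmod e\<close>,
    so every quotient lives in the ball of radius \<open>R + cmod e\<close>, hence in this
    box.\<close>
  define h where "h = (\<lambda>v. if v \<in> cbox (- a) a then M * cmod e else 0)"
  have hint: "h integrable_on UNIV"
    unfolding h_def integrable_restrict_UNIV by (rule integrable_const)
  have M0: "0 \<le> M" using M[of 0] by (meson add_nonneg_nonneg norm_ge_zero order_trans)
  have dom: "norm (Q k (complex_of_vec v)) \<le> h v" for k v
  proof (cases "v \<in> cbox (- a) a")
    case True
    have k: "cmod (of_nat k + 1) = real k + 1"
      by (metis norm_of_nat of_nat_Suc add.commute)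
    have "cmod (Q k (complex_of_vec v)) \<le> (real k + 1) * (M * cmod (e / (of_nat k + 1)))"
      unfolding Q_def norm_mult k
      using lip[of "complex_of_vec v + e / (of_nat k + 1)" "complex_of_vec v"] by (intro mult_left_mono) auto
    also have "\<dots> = M * cmod e" by (simp add: norm_divide k)
    finally show ?thesis using True by (simp add: h_def)
  next
    case False
    have v: "cmod (complex_of_vec v) > R + cmod e"
      using a False by (metis mem_cball_0 norm_complex_of_vec not_le subsetD)
    have "cmod (e / (of_nat k + 1)) \<le> cmod e"
    proof -
      have k: "cmod (of_nat k + 1) = real k + 1"
        by (metis norm_of_nat of_nat_Suc add.commute)
      show ?thesis unfolding norm_divide k by (simp add: field_simps)
    qed
    then have "R \<le> cmod (complex_of_vec v + e / (of_nat k + 1))"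
      using v norm_triangle_ineq2[of "complex_of_vec v" "- (e / (of_nat k + 1))"] by simp
    moreover have "R \<le> cmod (complex_of_vec v)" using v norm_ge_zero[of e] by linarith
    ultimately have "Q k (complex_of_vec v) = 0" using F(2) by (simp add: Q_def)
    then show ?thesis using False by (simp add: h_def)
  qed
  have lim: "(\<lambda>k. Q k z) \<longlonglongrightarrow> dz F z * e + dzbar F z * cnj e" for z
  proof -
    have "((\<lambda>s. F (z + of_real s * e)) has_vector_derivative (dz F z * e + dzbar F z * cnj e)) (at 0)"
    proof -
      have l: "((\<lambda>s. z + of_real s * e) has_derivative (\<lambda>s. of_real s * e)) (at 0)"
        by (auto intro!: derivative_eq_intros)
      have "((\<lambda>s::real. F (z + of_real s * e)) has_derivative
          (\<lambda>s. dz F z * (of_real s * e) + dzbar F z * cnj (of_real s * e))) (at 0)"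
        by (rule has_derivative_compose[OF l]) (use C1_D[OF F(1), of z] in simp)
      then show ?thesis
        by (simp add: has_vector_derivative_def scaleR_conv_of_real algebra_simps)
    qed
    then have "((\<lambda>s. cmod (F (z + of_real s * e) - F z - s *\<^sub>R (dz F z * e + dzbar F z * cnj e)) / \<bar>s\<bar>) \<longlongrightarrow> 0) (at 0)"
      (is "(?q \<longlongrightarrow> 0) (at 0)")
      unfolding has_vector_derivative_def has_derivative_at by simp
    moreover have eq: "cmod (F (z + of_real s * e) - F z - s *\<^sub>R v) / \<bar>s\<bar> = cmod ((F (z + of_real s * e) - F z) /\<^sub>R s - v)"
      if "s \<noteq> 0" for s v
    proof -
      have "(F (z + of_real s * e) - F z) /\<^sub>R s - v = (F (z + of_real s * e) - F z - s *\<^sub>R v) /\<^sub>R s"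
        using that by (simp add: algebra_simps)
      then show ?thesis by (simp add: divide_inverse mult.commute)
    qed
    then have "\<forall>\<^sub>F s in at 0. ?q s = cmod ((F (z + of_real s * e) - F z) /\<^sub>R s - (dz F z * e + dzbar F z * cnj e))"
      unfolding eventually_at_filter by (intro always_eventually allI impI) blast
    ultimately have "((\<lambda>s. cmod ((F (z + of_real s * e) - F z) /\<^sub>R s - (dz F z * e + dzbar F z * cnj e))) \<longlongrightarrow> 0) (at 0)"
      by (rule Lim_transform_eventually)
    then have "((\<lambda>s. (F (z + of_real s * e) - F z) /\<^sub>R s) \<longlongrightarrow> dz F z * e + dzbar F z * cnj e) (at 0)"
      by (rule LIM_zero_cancel[OF tendsto_norm_zero_cancel])
    moreover have "filterlim (\<lambda>k. 1 / (real k + 1)) (at 0) sequentially"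
      using LIMSEQ_inverse_real_of_nat
      by (auto simp: filterlim_at inverse_eq_divide add.commute)
    ultimately have "(\<lambda>k. (F (z + of_real (1 / (real k + 1)) * e) - F z) /\<^sub>R (1 / (real k + 1)))
        \<longlonglongrightarrow> dz F z * e + dzbar F z * cnj e"
      by (rule filterlim_compose)
    then show ?thesis
      by (simp add: Q_def scaleR_conv_of_real add.commute)
  qed
  have "(\<lambda>k. integral UNIV (\<lambda>v. Q k (complex_of_vec v))) \<longlonglongrightarrow> integral UNIV (\<lambda>v. dz F (complex_of_vec v) * e + dzbar F (complex_of_vec v) * cnj e)"
    by (rule dominated_convergence(2)[OF cts_compact_support_integrable_on[OF Q0] hint dom lim])
  then show ?thesis using Qint LIMSEQ_unique[OF _ tendsto_const] unfolding plane_integral_def by simp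
qed

lemma stokes:
  assumes F: "C1 F UNIV" "\<And>z. cmod z \<ge> R \<Longrightarrow> F z = 0"
  shows "cts_compact_support (dz F)" "cts_compact_support (dzbar F)" "plane_integral (dz F) = 0" "plane_integral (dzbar F) = 0"
proof -
  have z0: "dz F z = 0" "dzbar F z = 0" if "cmod z > R" for z
    using wirtinger_cong(2,3)[of "{z. cmod z > R}" z F "\<lambda>_. 0"] F(2) that
    by (auto simp: dz_const dzbar_const open_Collect_less continuous_intros)
  show c: "cts_compact_support (dz F)" "cts_compact_support (dzbar F)"
    using C1_cont[OF F(1)] z0 by (auto simp: cts_compact_support_def intro!: exI[of _ "R + 1"])
  note p = plane_integral_add[OF cts_compact_support_cmult cts_compact_support_cmult, OF c]
  have "plane_integral (\<lambda>z. e * dz F z + cnj e * dzbar F z) = 0" for e :: complex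
    using stokes_direction[OF F, where e = e] by (simp add: mult.commute)
  then have "e * plane_integral (dz F) + cnj e * plane_integral (dzbar F) = 0" for e :: complex
    unfolding p by (simp add: plane_integral_cmult)
  \<comment> \<open>The directions 1 and \<open>\<i>\<close> yield the sum and the difference of the
    two integrals.\<close>
  from this[of 1] this[of \<i>] have "plane_integral (dz F) + plane_integral (dzbar F) = 0" "plane_integral (dz F) - plane_integral (dzbar F) = 0"
    by (auto simp: algebra_simps complex_eq_iff)
  then show "plane_integral (dz F) = 0" "plane_integral (dzbar F) = 0" by (auto simp: complex_eq_iff)
qed

text \<open>By the Cauchy-Pompeiu formula the constant is -pi; what matters is that it is the same
  for all cut-offs and not 0. For two cut-offs the difference divided by \<open>z\<close> is smooth
  everywhere, since the difference vanishes near 0, so Stokes' formula gives independence.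
  Non-vanishing is checked on one radial cut-off, for which the integrand is real and of constant
  sign.\<close>

lemma dbar_integral_over_z:
  "\<exists>C. C \<noteq> 0 \<and> (\<forall>\<phi> r R. C1 \<phi> UNIV \<and> r > 0 \<and> (\<forall>z. cmod z < r \<longrightarrow> \<phi> z = 1) \<and> (\<forall>z. cmod z \<ge> R \<longrightarrow> \<phi> z = 0)
     \<longrightarrow> cts_compact_support (\<lambda>z. dzbar \<phi> z / z) \<and> plane_integral (\<lambda>z. dzbar \<phi> z / z) = C)"
proof -
  have dbar_cts: "cts_compact_support (\<lambda>z. dzbar \<phi> z / z) \<and> (\<forall>z. cmod z < r \<longrightarrow> dzbar \<phi> z = 0)"
    if "C1 \<phi> UNIV" "r > 0" "\<And>z. cmod z < r \<Longrightarrow> \<phi> z = 1" "\<And>z. cmod z \<ge> R \<Longrightarrow> \<phi> z = 0" for \<phi> r R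
  proof -
    have z: "dzbar \<phi> z = 0" if "cmod z < r" for z
      using wirtinger_cong(3)[of "ball 0 r" z \<phi> "\<lambda>_. 1"] \<open>\<And>z. cmod z < r \<Longrightarrow> \<phi> z = 1\<close> that by (simp add: dzbar_const)
    have "continuous_on (ball 0 r) (\<lambda>z. dzbar \<phi> z / z)"
      by (rule continuous_on_eq[where f = "\<lambda>_. 0"]) (use z in auto)
    moreover have "continuous_on (- {0}) (\<lambda>z. dzbar \<phi> z / z)"
      by (auto intro!: continuous_intros continuous_on_subset[OF C1_cont(2)[OF that(1)]])
    ultimately have "continuous_on (ball 0 r \<union> - {0}) (\<lambda>z. dzbar \<phi> z / z)"
      by (intro continuous_on_open_Un) auto
    moreover have "ball 0 r \<union> - {0} = (UNIV :: complex set)" using that by auto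
    ultimately show ?thesis using z stokes(2)[of \<phi> R] that by (auto simp: cts_compact_support_def)
  qed
  have quot: "p * inverse (a + b) + a * (- ((p + q) * inverse (a + b) * inverse (a + b)))
      = (p * b - a * q) / (a + b)\<^sup>2" if "a + b \<noteq> 0" for a b p q :: complex
    using that by (simp add: divide_simps) (simp add: algebra_simps power2_eq_square)
  define g where "g = (\<lambda>t::real. max 0 t ^ 2)"
  have dg: "(g has_real_derivative 2 * max 0 t) (at t)" for t
    unfolding g_def using max_power_deriv[of 0 t] by (simp add: numeral_eq_Suc)
  have cg: "continuous_on UNIV (\<lambda>t::real. 2 * max 0 t)" by (auto intro!: continuous_intros)
  \<comment> \<open>\<open>A\<close> vanishes where the squared modulus is at least 2 and
    \<open>B\<close> where it is at most 1. Hence \<open>A + B\<close> has no zero, and the quotient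
    \<open>A / (A + B)\<close> is 1 on the unit disc and 0 outside a larger one.\<close>
  define A B where "A = (\<lambda>z. of_real (g (2 + (-1) * (cmod z)\<^sup>2)) :: complex)"
    and "B = (\<lambda>z. of_real (g (- 1 + 1 * (cmod z)\<^sup>2)) :: complex)"
  note A = C1_radial[OF dg cg, of 2 "-1", folded A_def] and B = C1_radial[OF dg cg, of "-1" 1, folded B_def]
  have gpos: "g (2 + (-1) * t) + g (-1 + 1 * t) > 0" for t
    by (cases "t < 2") (auto simp: g_def add_pos_nonneg add_nonneg_pos)
  have nz: "A z + B z \<noteq> 0" for z
    using gpos[of "(cmod z)\<^sup>2"] unfolding A_def B_def by (metis less_irrefl of_real_add of_real_eq_0_iff)
  define \<phi>0 where "\<phi>0 = (\<lambda>z. A z * inverse (A z + B z))"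
  note AB = C1_add[OF open_UNIV A(1) B(1)]
  note AB' = C1_inverse[OF open_UNIV AB(1) nz]
  note \<phi>0 = C1_mult[OF open_UNIV A(1) AB'(1), folded \<phi>0_def]
  have \<phi>0_1: "\<phi>0 z = 1" if "cmod z < 1" for z
  proof -
    have "(cmod z)\<^sup>2 < 1" using that by (simp add: abs_square_less_1)
    then have "B z = 0" by (simp add: B_def g_def)
    then show ?thesis using nz[of z] by (simp add: \<phi>0_def)
  qed
  have \<phi>0_0: "\<phi>0 z = 0" if "cmod z \<ge> 2" for z
  proof -
    have "(cmod z)\<^sup>2 \<ge> 2\<^sup>2" using that by (intro power_mono) auto
    then have "A z = 0" by (simp add: A_def g_def)
    then show ?thesis by (simp add: \<phi>0_def)
  qed
  have c0: "cts_compact_support (\<lambda>z. dzbar \<phi>0 z / z)" using dbar_cts[OF \<phi>0(1), of 1 2] \<phi>0_0 \<phi>0_1 by auto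
  define q where "q = (\<lambda>z. 2 * (max 0 (2 + (-1) * (cmod z)\<^sup>2) * g (- 1 + 1 * (cmod z)\<^sup>2)
      + g (2 + (-1) * (cmod z)\<^sup>2) * max 0 (- 1 + 1 * (cmod z)\<^sup>2))
      / (g (2 + (-1) * (cmod z)\<^sup>2) + g (-1 + 1 * (cmod z)\<^sup>2))\<^sup>2)"
  have q: "dzbar \<phi>0 z / z = - of_real (q z)" for z
  proof (cases "z = 0")
    case True then show ?thesis by (simp add: q_def g_def)
  next
    case False
    have "dzbar \<phi>0 z = (dzbar A z * B z - A z * dzbar B z) / (A z + B z)\<^sup>2"
    proof -
      have "dzbar \<phi>0 z = dzbar A z * inverse (A z + B z)
          + A z * (- ((dzbar A z + dzbar B z) * inverse (A z + B z) * inverse (A z + B z)))"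
        by (simp only: \<phi>0(3)[OF UNIV_I] AB'(3)[OF UNIV_I] AB(3)[OF UNIV_I])
      also have "\<dots> = (dzbar A z * B z - A z * dzbar B z) / (A z + B z)\<^sup>2"
        using nz[of z] by (rule quot)
      finally show ?thesis .
    qed
    also have "\<dots> = - z * of_real (q z)"
      unfolding A(3) B(3) unfolding A_def B_def q_def by (simp add: algebra_simps add_divide_distrib diff_divide_distrib)
    finally show ?thesis using False by simp
  qed
  have q0: "q z \<ge> 0" for z unfolding q_def by (auto simp: g_def)
  \<comment> \<open>At this point the squared modulus is 3/2, midway between 1 and 2, where both
    positive parts are non-zero.\<close>
  have q1: "q (of_real (sqrt (3/2))) > 0" unfolding q_def by (simp add: g_def)
  define C where "C = plane_integral (\<lambda>z. dzbar \<phi>0 z / z)"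
  have "C \<noteq> 0"
  proof
    assume C0: "C = 0"
    have cq: "continuous_on UNIV q"
    proof -
      have "continuous_on UNIV (\<lambda>z. Re (- (dzbar \<phi>0 z / z)))"
        using c0 unfolding cts_compact_support_def by (intro continuous_on_Re continuous_on_minus) auto
      then show ?thesis by (simp add: q)
    qed
    have "((\<lambda>v. dzbar \<phi>0 (complex_of_vec v) / complex_of_vec v) has_integral 0) UNIV"
      using C0 cts_compact_support_integrable_on[OF c0] unfolding C_def plane_integral_def by (metis integrable_integral)
    from has_integral_linear[OF this bounded_linear_Re] have "((\<lambda>v. - q (complex_of_vec v)) has_integral 0) UNIV"
      by (simp add: o_def q)
    from has_integral_neg[OF this] have i0: "((\<lambda>v. q (complex_of_vec v)) has_integral 0) UNIV" by simp
    obtain a :: "real^2" where a: "cball 0 3 \<subseteq> cbox (- a) a"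
      using bounded_subset_cbox_symmetric bounded_cball by metis
    have out: "q (complex_of_vec v) = 0" if "v \<notin> cbox (- a) a" for v
    proof -
      have "v \<notin> cball 0 3" using a that by blast
      then have n: "norm v > 2" by simp
      then have "dzbar \<phi>0 (complex_of_vec v) = 0"
        using wirtinger_cong(3)[of "{z. cmod z > 2}" "complex_of_vec v" \<phi>0 "\<lambda>_. 0"] \<phi>0_0
        by (auto simp: dzbar_const open_Collect_less continuous_intros)
      then show ?thesis using q[of "complex_of_vec v"] by simp
    qed
    have "(\<lambda>v. if v \<in> cbox (- a) a then q (complex_of_vec v) else 0) = (\<lambda>v. q (complex_of_vec v))"
      using out by auto
    then have i1: "((\<lambda>v. q (complex_of_vec v)) has_integral 0) (cbox (- a) a)"
      using i0 has_integral_restrict_UNIV[of "cbox (- a) a" "\<lambda>v. q (complex_of_vec v)" 0] by simp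
    have "(0::real^2) \<in> interior (cbox (- a) a)"
      using interior_mono[OF a] by auto
    then have ne: "box (- a) a \<noteq> {}" by auto
    let ?v = "vec_of_complex (of_real (sqrt (3/2)))"
    have "sqrt (3/2) \<le> 3" by (rule real_le_lsqrt) auto
    then have "cmod (complex_of_vec ?v) \<le> 3" unfolding complex_of_vec_of_complex by simp
    then have "?v \<in> cbox (- a) a" using a unfolding norm_complex_of_vec by auto
    then have "q (complex_of_vec ?v) = 0"
      by (intro has_integral_0_cbox_imp_0[where f = "\<lambda>v. q (complex_of_vec v)", OF _ _ i1 ne])
        (auto intro!: continuous_on_compose2[OF cq] continuous_intros q0)
    then show False using q1 by simp
  qed
  moreover have "cts_compact_support (\<lambda>z. dzbar \<phi> z / z) \<and> plane_integral (\<lambda>z. dzbar \<phi> z / z) = C"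
    if \<phi>: "C1 \<phi> UNIV" "r > 0" "\<forall>z. cmod z < r \<longrightarrow> \<phi> z = 1" "\<forall>z. cmod z \<ge> R \<longrightarrow> \<phi> z = 0" for \<phi> r R
  proof -
    have c1: "cts_compact_support (\<lambda>z. dzbar \<phi> z / z)" using dbar_cts[OF \<phi>(1,2), of R] \<phi> by auto
    define F where "F = (\<lambda>z. (\<phi> z + (-1) * \<phi>0 z) * inverse z)"
    have oS: "open (- {0::complex})" by auto
    note id = C1_holomorphic[OF oS, of "\<lambda>z. z", OF holomorphic_on_ident]
    have nz0: "\<And>z. z \<in> - {0} \<Longrightarrow> z \<noteq> 0" by simp
    note iv = C1_inverse[OF oS id(1) nz0]
    note m0 = C1_mult[OF open_UNIV C1_const[where c = "-1"] \<phi>0(1)]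
    note a0 = C1_add[OF open_UNIV \<phi>(1) m0(1)]
    note a1 = C1_mult[OF oS C1_subset[OF a0(1) subset_UNIV] iv(1)]
    have F1: "C1 F (- {0})" unfolding F_def by (rule a1(1))
    have Fz: "F z = 0" if "z \<in> ball 0 (min r 1)" for z using that \<phi> \<phi>0_1 by (simp add: F_def)
    have F2: "C1 F (ball 0 (min r 1))"
      by (rule C1_cong[OF open_ball _ C1_const[of 0]]) (simp add: Fz)
    have "C1 F (- {0} \<union> ball 0 (min r 1))" by (rule C1_Un[OF F1 F2])
    moreover have "- {0} \<union> ball 0 (min r 1) = (UNIV :: complex set)" using \<phi>(2) by auto
    ultimately have F: "C1 F UNIV" by simp
    have "plane_integral (dzbar F) = 0"
      by (rule stokes(4)[OF F, of "max R 2"]) (use \<phi> \<phi>0_0 in \<open>auto simp: F_def\<close>)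
    moreover have "dzbar F z = dzbar \<phi> z / z + (-1) * (dzbar \<phi>0 z / z)" for z
    proof (cases "z = 0")
      case True
      then show ?thesis using wirtinger_cong(3)[of "ball 0 (min r 1)" z F "\<lambda>_. 0"] Fz \<phi>(2) by (simp add: dzbar_const)
    next
      case False
      then have z: "z \<in> - {0}" by simp
      have mm: "dzbar (\<lambda>z. - 1 * \<phi>0 z) z = - 1 * dzbar \<phi>0 z"
        using m0(3)[of z] by (simp add: dzbar_const)
      have triv: "\<And>w::complex. w \<in> - {0} \<Longrightarrow> w \<in> - {0}" .
      have "dzbar F z = (dzbar \<phi> z + - 1 * dzbar \<phi>0 z) * inverse z
          + (\<phi> z + - 1 * \<phi>0 z) * (- (0 * inverse z * inverse z))"
        unfolding F_def by (simp only: a1(3)[OF triv z] iv(3)[OF triv z] id(3)[OF z] a0(3)[OF UNIV_I] mm)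
      then show ?thesis by (simp add: divide_inverse algebra_simps)
    qed
    then have "dzbar F = (\<lambda>z. dzbar \<phi> z / z + (-1) * (dzbar \<phi>0 z / z))" by (rule ext)
    ultimately have "plane_integral (\<lambda>z. dzbar \<phi> z / z + (-1) * (dzbar \<phi>0 z / z)) = 0" by (simp only:)
    then show ?thesis
      using c1 unfolding plane_integral_add[OF c1 cts_compact_support_cmult[OF c0]] plane_integral_cmult C_def by simp
  qed
  ultimately show ?thesis by blast
qed

section \<open>The residue theorem on a compact surface\<close>

text \<open>The data encode a 1-form \<open>\<theta>\<close> on the compact surface \<open>T\<close> with poles in \<open>Z\<close>: in the chart \<open>x p\<close>
  (with inverse \<open>y p\<close>) one has \<open>\<theta> = \<rho> p dx\<^sub>p / x\<^sub>p + d(G p)\<close>. As \<open>G p\<close> is merely continuous, only the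
  differences \<open>G p - G q\<close> are differentiated, and the condition \<open>G_deriv\<close> says that the local
  expressions agree.\<close>

locale residue_data =
  fixes T :: "'a topology" and U :: "'a \<Rightarrow> 'a set" and x :: "'a \<Rightarrow> 'a \<Rightarrow> complex"
    and y :: "'a \<Rightarrow> complex \<Rightarrow> 'a" and R :: "'a \<Rightarrow> real" and Z :: "'a set"
    and \<rho> :: "'a \<Rightarrow> complex" and G :: "'a \<Rightarrow> 'a \<Rightarrow> complex"
  assumes comp: "compact_space T" and haus: "Hausdorff_space T"
    and U_open: "p \<in> topspace T \<Longrightarrow> openin T (U p)"
    and center: "p \<in> topspace T \<Longrightarrow> p \<in> U p" "p \<in> topspace T \<Longrightarrow> x p p = 0"
    and R_pos: "p \<in> topspace T \<Longrightarrow> R p > 0"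
    and homeo: "p \<in> topspace T \<Longrightarrow>
      homeomorphic_maps (subtopology T (U p)) (top_of_set (ball 0 (R p))) (x p) (y p)"
    and Z: "finite Z" "Z \<subseteq> topspace T" "p \<in> topspace T \<Longrightarrow> U p \<inter> Z \<subseteq> {p}"
    and rho0: "p \<in> topspace T \<Longrightarrow> p \<notin> Z \<Longrightarrow> \<rho> p = 0"
    and G_cont: "p \<in> topspace T \<Longrightarrow>
      continuous_on {z \<in> ball 0 (R p). y p z \<notin> Z} (\<lambda>z. G p (y p z))"
    and trans: "p \<in> topspace T \<Longrightarrow> q \<in> topspace T \<Longrightarrow>
      (\<lambda>z. x q (y p z)) holomorphic_on {z \<in> ball 0 (R p). y p z \<in> U q}"
    and G_deriv: "p \<in> topspace T \<Longrightarrow> q \<in> topspace T \<Longrightarrow> z \<in> ball 0 (R p) \<Longrightarrow> y p z \<in> U q \<Longrightarrow> y p z \<notin> Z \<Longrightarrow>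
      ((\<lambda>z. G p (y p z) - G q (y p z)) has_field_derivative
        (\<rho> q * deriv (\<lambda>z. x q (y p z)) z / x q (y p z) - \<rho> p / z)) (at z)"
begin

abbreviation D :: "'a \<Rightarrow> complex set" where "D p \<equiv> ball 0 (R p)"

lemma U_sub: "p \<in> topspace T \<Longrightarrow> U p \<subseteq> topspace T"
  using U_open openin_subset by blast

lemma chart_maps:
  assumes "p \<in> topspace T"
  shows "t \<in> U p \<Longrightarrow> x p t \<in> D p" "t \<in> U p \<Longrightarrow> y p (x p t) = t"
    "z \<in> D p \<Longrightarrow> y p z \<in> U p" "z \<in> D p \<Longrightarrow> x p (y p z) = z"
    "continuous_map (top_of_set (D p)) T (y p)"
proof -
  note h = homeo[OF assms, unfolded homeomorphic_maps_def]
  have top: "topspace (subtopology T (U p)) = U p" using U_sub[OF assms] by auto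
  show "t \<in> U p \<Longrightarrow> x p t \<in> D p" "t \<in> U p \<Longrightarrow> y p (x p t) = t"
    "z \<in> D p \<Longrightarrow> y p z \<in> U p" "z \<in> D p \<Longrightarrow> x p (y p z) = z"
    using h top by (auto simp: continuous_map_def Pi_iff)
  show "continuous_map (top_of_set (D p)) T (y p)"
    using h by (simp add: continuous_map_in_subtopology)
qed

lemma open_pre:
  assumes "p \<in> topspace T" "openin T W"
  shows "open {z \<in> D p. y p z \<in> W}"
proof -
  have "openin (top_of_set (D p)) {z \<in> topspace (top_of_set (D p)). y p z \<in> W}"
    using chart_maps(5)[OF assms(1)] assms(2) openin_continuous_map_preimage by blast
  then show ?thesis using openin_open_trans[of "D p"] by simp
qed

section \<open>Smaller discs and bump functions on the surface\<close>

definition r :: "'a \<Rightarrow> real" where "r p = R p / 2"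
text \<open>Halving the radius makes the closed disc compact inside its chart domain. The supports
  of the bump functions lie in these closed sets, while the open discs \<open>B p\<close> are the
  ones required to cover.\<close>

definition K :: "'a \<Rightarrow> 'a set" where "K p = y p ` cball 0 (r p)"
definition B :: "'a \<Rightarrow> 'a set" where "B p = y p ` ball 0 (r p)"

lemma r_pos: "p \<in> topspace T \<Longrightarrow> 0 < r p" "p \<in> topspace T \<Longrightarrow> r p < R p"
  using R_pos by (auto simp: r_def)

lemma cball_r: "p \<in> topspace T \<Longrightarrow> z \<in> cball 0 (r p) \<Longrightarrow> z \<in> D p"
  using r_pos[of p] by auto

lemma K_sub: "p \<in> topspace T \<Longrightarrow> K p \<subseteq> U p"
  unfolding K_def using chart_maps(3) cball_r by blast

lemma K_closed: "p \<in> topspace T \<Longrightarrow> closedin T (K p)"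
proof -
  assume p: "p \<in> topspace T"
  have "compactin (top_of_set (D p)) (cball 0 (r p))"
  proof -
    have "cball 0 (r p) \<subseteq> D p" using cball_r[OF p] by blast
    then show ?thesis unfolding compactin_subtopology compactin_euclidean_iff using compact_cball by blast
  qed
  then have "compactin T (K p)" unfolding K_def
    using image_compactin chart_maps(5)[OF p] by blast
  then show ?thesis using haus compactin_imp_closedin by blast
qed

lemma K_iff: "p \<in> topspace T \<Longrightarrow> z \<in> D p \<Longrightarrow> y p z \<in> K p \<longleftrightarrow> cmod z \<le> r p"
  unfolding K_def using chart_maps(4) cball_r by (metis (no_types, lifting) image_iff mem_cball_0)

lemma B_open: "p \<in> topspace T \<Longrightarrow> openin T (B p)"
proof -
  assume p: "p \<in> topspace T"
  have "homeomorphic_map (top_of_set (D p)) (subtopology T (U p)) (y p)"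
    using homeo[OF p] homeomorphic_maps_map homeomorphic_maps_sym by blast
  moreover have "openin (top_of_set (D p)) (ball 0 (r p))"
  proof -
    have "ball 0 (r p) \<subseteq> D p" using cball_r[OF p] ball_subset_cball by blast
    then show ?thesis by (intro open_subset) auto
  qed
  ultimately have "openin (subtopology T (U p)) (B p)"
    unfolding B_def using homeomorphic_map_openness_eq homeomorphic_imp_open_map open_map_def by blast
  then show ?thesis using U_open[OF p] openin_trans_full by blast
qed

lemma B_center: "p \<in> topspace T \<Longrightarrow> p \<in> B p"
  unfolding B_def using chart_maps(2)[of p p] center r_pos by (metis centre_in_ball image_eqI)

lemma Z_in_D: "p \<in> topspace T \<Longrightarrow> z \<in> D p \<Longrightarrow> y p z \<in> Z \<Longrightarrow> z = 0 \<and> p \<in> Z"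
  using Z(3)[of p] chart_maps(3,4)[of p z] center(2)[of p] by fastforce

lemma y0: "p \<in> topspace T \<Longrightarrow> y p 0 = p"
  using chart_maps(2)[of p p] center by simp

definition \<psi> :: "'a \<Rightarrow> 'a \<Rightarrow> complex" where
  "\<psi> p t = (if t \<in> U p then bump (r p) (x p t) else 0)"

lemma psi_supp: "p \<in> topspace T \<Longrightarrow> t \<notin> K p \<Longrightarrow> \<psi> p t = 0"
proof (cases "t \<in> U p")
  case True
  assume p: "p \<in> topspace T" and t: "t \<notin> K p"
  have "cmod (x p t) > r p"
    using t K_iff[OF p, of "x p t"] chart_maps(1,2)[OF p True] by simp
  then have "(cmod (x p t))\<^sup>2 \<ge> (r p)\<^sup>2" using r_pos(1)[OF p] by (intro power_mono) auto
  then show ?thesis using True by (simp add: \<psi>_def bump_def)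
qed (simp add: \<psi>_def)

lemma psi_pos:
  assumes "p \<in> topspace T"
  shows "Im (\<psi> p t) = 0" "Re (\<psi> p t) \<ge> 0" "t \<in> B p \<Longrightarrow> Re (\<psi> p t) > 0"
proof -
  show "Im (\<psi> p t) = 0" "Re (\<psi> p t) \<ge> 0" by (auto simp: \<psi>_def bump_nonneg)
  assume "t \<in> B p"
  then obtain z where z: "t = y p z" "cmod z < r p" by (auto simp: B_def)
  then have "z \<in> D p" using r_pos[OF assms] by auto
  then show "Re (\<psi> p t) > 0"
    using z chart_maps(3,4)[OF assms] bump_pos[OF r_pos(1)[OF assms]] by (auto simp: \<psi>_def)
qed

text \<open>In the chart of \<open>k\<close> the function is a bump composed with a holomorphic
  transition over \<open>U p\<close>, and zero over the complement of the closed set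
  \<open>K p\<close>. The two open sets cover the disc because \<open>K p\<close> lies in
  \<open>U p\<close>.\<close>

lemma psi_C2:
  assumes p: "p \<in> topspace T" and k: "k \<in> topspace T"
  shows "C2 (\<lambda>z. \<psi> p (y k z)) (D k)"
proof -
  let ?S = "{z \<in> D k. y k z \<in> U p}" and ?N = "{z \<in> D k. y k z \<in> topspace T - K p}"
  have oS: "open ?S" by (rule open_pre[OF k U_open[OF p]])
  have oN: "open ?N" by (rule open_pre[OF k]) (use K_closed[OF p] in blast)
  have "C2 (\<lambda>z. bump (r p) (x p (y k z))) ?S"
    by (rule C2_compose[OF open_UNIV oS trans[OF k p] _ bump_C2]) auto
  then have 1: "C2 (\<lambda>z. \<psi> p (y k z)) ?S"
    by (rule C2_cong[OF oS, rotated]) (simp add: \<psi>_def)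
  have 2: "C2 (\<lambda>z. \<psi> p (y k z)) ?N"
    by (rule C2_cong[OF oN _ C2_const[of 0]]) (use psi_supp[OF p] in auto)
  have "D k \<subseteq> ?S \<union> ?N" using K_sub[OF p] chart_maps(3)[OF k] U_sub[OF k] by auto
  then show ?thesis using C2_Un[OF 1 2] C2_subset by blast
qed

lemma finite_cover:
  "\<exists>I. finite I \<and> I \<subseteq> topspace T \<and> (\<forall>t\<in>topspace T. \<exists>p\<in>I. t \<in> B p)"
proof -
  have "\<exists>\<F>. finite \<F> \<and> \<F> \<subseteq> B ` topspace T \<and> topspace T \<subseteq> \<Union>\<F>"
  proof -
    have "\<forall>U\<in>B ` topspace T. openin T U" using B_open by blast
    moreover have "topspace T \<subseteq> \<Union> (B ` topspace T)" using B_center by blast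
    ultimately show ?thesis using comp unfolding compact_space_def compactin_def by metis
  qed
  then obtain \<F> where "finite \<F>" "\<F> \<subseteq> B ` topspace T" "topspace T \<subseteq> \<Union>\<F>" by blast
  moreover obtain I where "I \<subseteq> topspace T" "finite I" "\<F> = B ` I"
    using finite_subset_image[OF calculation(1,2)] by blast
  ultimately have "\<exists>p\<in>I. t \<in> B p" if "t \<in> topspace T" for t
    using that by (metis UN_E subsetD)
  then show ?thesis using \<open>I \<subseteq> topspace T\<close> \<open>finite I\<close> by metis
qed

end

locale residue_cover = residue_data +
  fixes I :: "'a set"
  assumes I: "finite I" "I \<subseteq> topspace T" "\<And>t. t \<in> topspace T \<Longrightarrow> \<exists>p\<in>I. t \<in> B p"
begin

lemma I_top: "p \<in> I \<Longrightarrow> p \<in> topspace T" using I by blast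

text \<open>A pole lies in some covering disc, and a chart domain contains no pole except possibly
  its own centre. So every pole is the centre of a member of the cover.\<close>

lemma Z_sub_I: "Z \<subseteq> I"
proof
  fix q assume q: "q \<in> Z"
  then obtain p where p: "p \<in> I" "q \<in> B p" using I(3) Z(2) by blast
  have "B p \<subseteq> K p" by (auto simp: B_def K_def)
  then have "q \<in> U p" using p K_sub[OF I_top] by blast
  then show "q \<in> I" using Z(3)[OF I_top[OF p(1)]] q p by auto
qed

section \<open>The partition of unity read in the charts\<close>

definition S :: "'a \<Rightarrow> complex" where "S t = (\<Sum>p\<in>I. \<psi> p t)"
definition \<phi> :: "'a \<Rightarrow> 'a \<Rightarrow> complex" where "\<phi> p t = \<psi> p t * inverse (S t)"

lemma S_nz: "t \<in> topspace T \<Longrightarrow> S t \<noteq> 0"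
proof -
  assume "t \<in> topspace T"
  then obtain p where p: "p \<in> I" "t \<in> B p" using I by blast
  have "(\<Sum>q\<in>I. Re (\<psi> q t)) > 0"
    by (rule sum_pos2[OF I(1) p(1)]) (use psi_pos I_top p in auto)
  then have "Re (S t) > 0" by (simp add: S_def)
  then show ?thesis by auto
qed

lemma phi_sum: "t \<in> topspace T \<Longrightarrow> (\<Sum>p\<in>I. \<phi> p t) = 1"
  using S_nz[of t] by (simp add: \<phi>_def sum_distrib_right[symmetric] S_def[symmetric])

lemma phi_supp: "p \<in> I \<Longrightarrow> t \<notin> K p \<Longrightarrow> \<phi> p t = 0"
  using psi_supp I_top by (simp add: \<phi>_def)

definition f :: "'a \<Rightarrow> 'a \<Rightarrow> complex \<Rightarrow> complex" where "f k p z = \<phi> p (y k z)"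

lemma y_top: "k \<in> I \<Longrightarrow> z \<in> D k \<Longrightarrow> y k z \<in> topspace T"
  using chart_maps(3) U_sub I_top by blast

lemma f_C2: "k \<in> I \<Longrightarrow> p \<in> I \<Longrightarrow> C2 (f k p) (D k)"
proof -
  assume kp: "k \<in> I" "p \<in> I"
  have "C2 (\<lambda>z. S (y k z)) (D k)"
    unfolding S_def by (rule C2_sum[OF open_ball I(1)]) (use psi_C2 I_top kp in auto)
  then have "C2 (\<lambda>z. inverse (S (y k z))) (D k)"
    by (rule C2_inverse[OF open_ball]) (use S_nz y_top kp in auto)
  then have "C2 (\<lambda>z. \<psi> p (y k z) * inverse (S (y k z))) (D k)"
    using C2_mult[OF open_ball psi_C2] I_top kp by blast
  then show ?thesis by (simp add: f_def[abs_def] \<phi>_def)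
qed

lemma f_C1: "k \<in> I \<Longrightarrow> p \<in> I \<Longrightarrow> C1 (f k p) (D k)"
  using f_C2 by (simp add: C2_def)

lemma f_supp:
  assumes "k \<in> I" "p \<in> I" "z \<in> D k" "y k z \<notin> K p"
  shows "f k p z = 0" "dz (f k p) z = 0" "dzbar (f k p) z = 0"
proof -
  let ?N = "{z \<in> D k. y k z \<in> topspace T - K p}"
  have oN: "open ?N" by (rule open_pre) (use K_closed I_top assms in blast)+
  have "z \<in> ?N" using assms y_top by auto
  then show "dz (f k p) z = 0" "dzbar (f k p) z = 0"
    using wirtinger_cong(2,3)[OF oN, of z "f k p" "\<lambda>_. 0"] phi_supp[OF assms(2)]
    by (auto simp: f_def dz_const dzbar_const)
  show "f k p z = 0" using assms phi_supp by (simp add: f_def)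
qed

lemma f_sum:
  assumes "k \<in> I" "z \<in> D k"
  shows "(\<Sum>p\<in>I. f k p z) = 1" "(\<Sum>p\<in>I. dz (f k p) z) = 0" "(\<Sum>p\<in>I. dzbar (f k p) z) = 0"
proof -
  have e: "(\<Sum>p\<in>I. f k p z) = 1" if "z \<in> D k" for z
    using phi_sum y_top assms that by (simp add: f_def)
  then show "(\<Sum>p\<in>I. f k p z) = 1" using assms by blast
  have "dz (\<lambda>z. \<Sum>p\<in>I. f k p z) z = dz (\<lambda>_. 1) z" "dzbar (\<lambda>z. \<Sum>p\<in>I. f k p z) z = dzbar (\<lambda>_. 1) z"
    by (rule wirtinger_cong[OF open_ball assms(2) e], assumption)+
  then show "(\<Sum>p\<in>I. dz (f k p) z) = 0" "(\<Sum>p\<in>I. dzbar (f k p) z) = 0"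
    using C1_sum[OF open_ball I(1) f_C1[OF assms(1)]] assms by (auto simp: dz_const dzbar_const)
qed

text \<open>The support of any other partition function lies in a chart domain that avoids the pole
  \<open>k\<close>. So \<open>\<phi> k\<close> is the only one left near \<open>k\<close> and must
  be 1 there. Consequently the singularities of the form at its poles never meet a derivative of the
  partition.\<close>

lemma near_Z:
  assumes k: "k \<in> Z"
  shows "\<exists>e>0. e \<le> R k \<and> (\<forall>p\<in>I. \<forall>z\<in>ball 0 e. f k p z = (if p = k then 1 else 0)
     \<and> dz (f k p) z = 0 \<and> dzbar (f k p) z = 0)"
proof -
  have kI: "k \<in> I" using k Z_sub_I by blast
  note kt = I_top[OF kI]
  let ?W = "topspace T - (\<Union>p\<in>I - {k}. K p)"
  have oW: "openin T ?W"
    by (intro openin_diff openin_topspace closedin_Union) (use I K_closed I_top in auto)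
  let ?N = "{z \<in> D k. y k z \<in> ?W}"
  have oN: "open ?N" by (rule open_pre[OF kt oW])
  have "k \<notin> K p" if "p \<in> I - {k}" for p
    using that K_sub[OF I_top, of p] Z(3)[OF I_top, of p] k by blast
  then have "0 \<in> ?N" using y0[OF kt] kt R_pos[OF kt] by auto
  then obtain e where e: "e > 0" "ball 0 e \<subseteq> ?N"
    by (rule openE[OF oN])
  have v: "f k p z = (if p = k then 1 else 0)" if "p \<in> I" "z \<in> ball 0 (min e (R k))" for p z
  proof -
    have z: "z \<in> D k" "y k z \<in> ?W" using e that by auto
    have o: "f k q z = 0" if "q \<in> I - {k}" for q
      using z that phi_supp[of q "y k z"] by (auto simp: f_def)
    show ?thesis
    proof (cases "p = k")
      case True
      have "(\<Sum>q\<in>I. f k q z) = f k k z + (\<Sum>q\<in>I - {k}. f k q z)" using I(1) kI by (rule sum.remove)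
      then show ?thesis using f_sum(1)[OF kI z(1)] o True by simp
    qed (use o that in auto)
  qed
  have "dz (f k p) z = 0 \<and> dzbar (f k p) z = 0" if "p \<in> I" "z \<in> ball 0 (min e (R k))" for p z
    using wirtinger_cong(2,3)[OF open_ball that(2) v[OF that(1)]] by (simp add: dz_const dzbar_const)
  with v have "\<forall>p\<in>I. \<forall>z\<in>ball 0 (min e (R k)). f k p z = (if p = k then 1 else 0)
     \<and> dz (f k p) z = 0 \<and> dzbar (f k p) z = 0" by blast
  moreover have "min e (R k) > 0" "min e (R k) \<le> R k" using e(1) R_pos[OF kt] by auto
  ultimately show ?thesis by blast
qed

section \<open>The densities and their change of charts\<close>

lemma Z_closed: "closedin T Z"
  using Z haus by (simp add: closedin_Hausdorff_finite)

lemma open_off_Z: "k \<in> topspace T \<Longrightarrow> open {w \<in> D k. y k w \<notin> Z}"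
proof -
  assume k: "k \<in> topspace T"
  have "{w \<in> D k. y k w \<notin> Z} = {w \<in> D k. y k w \<in> topspace T - Z}"
    using chart_maps(3)[OF k] U_sub[OF k] by auto
  then show ?thesis using open_pre[OF k, of "topspace T - Z"] Z_closed by auto
qed

text \<open>\<open>E i k\<close> is the density of \<open>\<phi>\<^sub>i \<theta> \<and> d\<phi>\<^sub>k\<close> in the chart of \<open>i\<close>, after integration by parts has moved
  the derivative from \<open>G i\<close> to \<open>\<phi>\<^sub>i\<close>. Since \<open>\<Sum>\<^sub>k \<phi>\<^sub>k = 1\<close> the sum over \<open>k\<close> vanishes, whereas the
  integral of the sum over \<open>i\<close> is a fixed multiple of \<open>\<rho> k\<close>.\<close>

definition E :: "'a \<Rightarrow> 'a \<Rightarrow> complex \<Rightarrow> complex" where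
  "E i k z = (if z \<in> D i then \<rho> i * f i i z * dzbar (f i k) z / z
     + G i (y i z) * (dz (f i k) z * dzbar (f i i) z - dzbar (f i k) z * dz (f i i) z) else 0)"

lemma E_supp: "i \<in> I \<Longrightarrow> k \<in> I \<Longrightarrow> \<not> (z \<in> cball 0 (r i) \<and> y i z \<in> K k) \<Longrightarrow> E i k z = 0"
  using f_supp[of i k z] f_supp[of i i z] K_iff[of i z] I_top[of i]
  by (cases "z \<in> D i") (auto simp: E_def)

lemma cts_compact_support_local:
  assumes "\<And>z. \<exists>W. open W \<and> z \<in> W \<and> continuous_on W h" "\<And>z. R' \<le> cmod z \<Longrightarrow> h z = 0"
  shows "cts_compact_support h"
proof -
  have "continuous_on UNIV h"
    using assms(1) by (metis UNIV_I continuous_on_eq_continuous_at continuous_at_imp_continuous_on)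
  then show ?thesis using assms(2) by (auto simp: cts_compact_support_def)
qed

lemma E_cts:
  assumes i: "i \<in> I" and k: "k \<in> I"
  shows "cts_compact_support (E i k)"
proof (rule cts_compact_support_local[where R' = "R i"])
  fix z :: complex
  note it = I_top[OF i]
  show "\<exists>W. open W \<and> z \<in> W \<and> continuous_on W (E i k)"
  proof (cases "z \<in> D i")
    case False
    then have "z \<in> - cball 0 (r i)" using cball_r[OF it] by blast
    moreover have "continuous_on (- cball 0 (r i)) (E i k)"
      by (rule continuous_on_eq[OF continuous_on_const[of _ 0]]) (use E_supp[OF i k] in auto)
    ultimately show ?thesis by (intro exI[of _ "- cball 0 (r i)"]) (auto intro: open_Compl)
  next
    case zD: True
    show ?thesis
    proof (cases "y i z \<in> Z")
      case True
      then have z0: "z = 0" "i \<in> Z" using Z_in_D[OF it zD] by auto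
      obtain e where e: "e > 0" "e \<le> R i" "\<And>p z. p \<in> I \<Longrightarrow> z \<in> ball 0 e \<Longrightarrow>
          dz (f i p) z = 0 \<and> dzbar (f i p) z = 0"
        using near_Z[OF z0(2)] by blast
      have "continuous_on (ball 0 e) (E i k)"
        by (rule continuous_on_eq[OF continuous_on_const[of _ 0]]) (use e i k in \<open>auto simp: E_def\<close>)
      then show ?thesis using z0 e by (intro exI[of _ "ball 0 e"]) auto
    next
      case False
      let ?W = "{w \<in> D i. y i w \<notin> Z}"
      have oW: "open ?W" by (rule open_off_Z[OF it])
      note c = C1_cont[OF f_C1[OF i k]] C1_cont[OF f_C1[OF i i]]
      have c': "continuous_on ?W g" if "continuous_on (D i) g" for g :: "complex \<Rightarrow> complex"
        by (rule continuous_on_subset[OF that]) auto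
      \<comment> \<open>Division by \<open>z\<close> is harmless: if \<open>i\<close> is a pole, 0
        is not in the set, and otherwise \<open>\<rho> i = 0\<close>.\<close>
      have t1: "continuous_on ?W (\<lambda>z. \<rho> i * f i i z * dzbar (f i k) z / z)"
      proof (cases "i \<in> Z")
        case True
        then have "w \<noteq> 0" if "w \<in> ?W" for w using that y0[OF it] by auto
        then show ?thesis by (intro continuous_intros c[THEN c']) auto
      qed (use rho0[OF it] in auto)
      have "continuous_on ?W (\<lambda>z. \<rho> i * f i i z * dzbar (f i k) z / z
          + G i (y i z) * (dz (f i k) z * dzbar (f i i) z - dzbar (f i k) z * dz (f i i) z))"
        by (intro continuous_intros t1 c[THEN c'] G_cont[OF it])
      then have "continuous_on ?W (E i k)"
        by (rule continuous_on_eq) (auto simp: E_def)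
      then show ?thesis using oW zD False by blast
    qed
  qed
next
  fix z assume "R i \<le> cmod z"
  then show "E i k z = 0" by (simp add: E_def)
qed

lemma E_sum_k: "i \<in> I \<Longrightarrow> (\<Sum>k\<in>I. plane_integral (E i k)) = 0"
proof -
  assume i: "i \<in> I"
  have "(\<Sum>k\<in>I. E i k z) = 0" for z
  proof (cases "z \<in> D i")
    case True
    have "(\<Sum>k\<in>I. E i k z) = \<rho> i * f i i z * (\<Sum>k\<in>I. dzbar (f i k) z) / z
     + G i (y i z) * ((\<Sum>k\<in>I. dz (f i k) z) * dzbar (f i i) z - (\<Sum>k\<in>I. dzbar (f i k) z) * dz (f i i) z)"
      using True by (simp add: E_def sum.distrib sum_distrib_left sum_distrib_right sum_subtractf
          sum_divide_distrib right_diff_distrib)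
    then show ?thesis using f_sum[OF i True] by simp
  qed (simp add: E_def)
  then have "plane_integral (\<lambda>z. \<Sum>k\<in>I. E i k z) = 0" by (simp add: plane_integral_def)
  then show ?thesis using cts_compact_support_sum[OF I(1), of "E i"] E_cts[OF i] by simp
qed

abbreviation "\<tau> k i z \<equiv> x i (y k z)"
abbreviation "V k i \<equiv> {z \<in> D k. y k z \<in> U i}"

text \<open>\<open>E i k\<close> pulled back to the chart of \<open>k\<close>. For fixed
  \<open>k\<close> all these functions live on one disc, so they can be added over \<open>i\<close>
  before integrating.\<close>

definition E' :: "'a \<Rightarrow> 'a \<Rightarrow> complex \<Rightarrow> complex" where
  "E' i k z = (if z \<in> V k i then of_real ((cmod (deriv (\<tau> k i) z))\<^sup>2) * E i k (\<tau> k i z) else 0)"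

lemma tau_props:
  assumes "i \<in> I" "k \<in> I"
  shows "open (V k i)" "\<tau> k i holomorphic_on V k i" "inj_on (\<tau> k i) (V k i)" "\<tau> k i ` V k i = V i k"
    "z \<in> V k i \<Longrightarrow> y i (\<tau> k i z) = y k z" "z \<in> V k i \<Longrightarrow> \<tau> k i z \<in> D i"
proof -
  note it = I_top[OF assms(1)] and kt = I_top[OF assms(2)]
  show "open (V k i)" by (rule open_pre[OF kt U_open[OF it]])
  show "\<tau> k i holomorphic_on V k i" by (rule trans[OF kt it])
  show y: "y i (\<tau> k i z) = y k z" "\<tau> k i z \<in> D i" if "z \<in> V k i" for z
    using that chart_maps[OF it] by auto
  show "inj_on (\<tau> k i) (V k i)"
    by (rule inj_on_inverseI[where g = "\<tau> i k"]) (use y chart_maps(4)[OF kt] in auto)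
  show "\<tau> k i ` V k i = V i k"
  proof (intro equalityI subsetI)
    fix w assume w: "w \<in> V i k"
    have "w = \<tau> k i (\<tau> i k w)" "\<tau> i k w \<in> V k i"
      using w chart_maps[OF kt] chart_maps[OF it] by auto
    then show "w \<in> \<tau> k i ` V k i" by blast
  next
    fix w assume "w \<in> \<tau> k i ` V k i"
    then show "w \<in> V i k" using chart_maps[OF kt] chart_maps[OF it] by auto
  qed
qed

lemma E'_plane_integral: "i \<in> I \<Longrightarrow> k \<in> I \<Longrightarrow> plane_integral (E' i k) = plane_integral (E i k)"
  unfolding E'_def[abs_def]
proof (rule plane_integral_change_of_variables)
  assume ik: "i \<in> I" "k \<in> I"
  note t = tau_props[OF ik]
  show "open (V k i)" "\<tau> k i holomorphic_on V k i" "inj_on (\<tau> k i) (V k i)" "cts_compact_support (E i k)"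
    using t E_cts ik by auto
  fix w assume "w \<notin> \<tau> k i ` V k i"
  then have "w \<notin> V i k" using t(4) by blast
  then show "E i k w = 0"
    using E_supp[OF ik, of w] K_sub[OF I_top[OF ik(2)]] cball_r[OF I_top[OF ik(1)]] by blast
qed

text \<open>The Jacobian is the derivative of the transition times its conjugate. The conjugate
  factor is absorbed by \<open>dzbar\<close>, the other one by \<open>dz\<close> or, in the polar
  term, by turning \<open>1 / z\<close> into the logarithmic derivative of the transition.\<close>

lemma E'_formula:
  assumes "i \<in> I" "k \<in> I" "z \<in> V k i"
  shows "E' i k z = \<rho> i * f k i z * dzbar (f k k) z * (deriv (\<tau> k i) z / \<tau> k i z)
     + G i (y k z) * (dz (f k k) z * dzbar (f k i) z - dzbar (f k k) z * dz (f k i) z)"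
proof -
  note t = tau_props[OF assms(1,2)]
  have e: "f k p w = f i p (\<tau> k i w)" if "w \<in> V k i" for p w
    using t(5)[OF that] by (simp add: f_def)
  have sub: "\<tau> k i ` V k i \<subseteq> D i" using t(6) by blast
  have d: "dz (f k p) z = dz (f i p) (\<tau> k i z) * deriv (\<tau> k i) z"
    "dzbar (f k p) z = dzbar (f i p) (\<tau> k i z) * cnj (deriv (\<tau> k i) z)" if "p \<in> I" for p
    using wirtinger_cong(2,3)[OF t(1) assms(3) e[of _ p]]
      C1_compose(2,3)[OF open_ball t(1,2) sub f_C1[OF assms(1) that] assms(3)] by auto
  have n: "of_real ((cmod (deriv (\<tau> k i) z))\<^sup>2) = deriv (\<tau> k i) z * cnj (deriv (\<tau> k i) z)"
    by (rule complex_norm_square)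
  show ?thesis
    unfolding E'_def n d[OF assms(1)] d[OF assms(2)] e[OF assms(3)] E_def t(5)[OF assms(3)]
    using assms(3) t(6)[OF assms(3)] by (simp add: algebra_simps)
qed

lemma E'_supp:
  assumes "i \<in> I" "k \<in> I" "\<not> (z \<in> cball 0 (r k) \<and> y k z \<in> K i)"
  shows "E' i k z = 0"
proof (cases "z \<in> V k i")
  case True
  then have "\<not> (y k z \<in> K k \<and> y k z \<in> K i)" using assms K_iff[OF I_top[OF assms(2)]] by auto
  then show ?thesis
    using f_supp[of k k z] f_supp[of k i z] True assms by (auto simp: E'_formula)
qed (simp only: E'_def if_False)

lemma E'_cts:
  assumes i: "i \<in> I" and k: "k \<in> I"
  shows "cts_compact_support (E' i k)"
proof (rule cts_compact_support_local[where R' = "R k"])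
  fix z :: complex
  note it = I_top[OF i] and kt = I_top[OF k] and t = tau_props[OF i k]
  let ?N = "{w \<in> D k. y k w \<in> topspace T - K i}"
  have oN: "open (- cball 0 (r k) \<union> ?N)"
    by (intro open_Un open_Compl closed_cball open_pre[OF kt]) (use K_closed[OF it] in blast)
  show "\<exists>W. open W \<and> z \<in> W \<and> continuous_on W (E' i k)"
  proof (cases "z \<in> V k i")
    case True
    have cE: "continuous_on UNIV (E i k)" using E_cts[OF i k] by (simp add: cts_compact_support_def)
    have "continuous_on (V k i) (\<lambda>z. of_real ((cmod (deriv (\<tau> k i) z))\<^sup>2) * E i k (\<tau> k i z))"
      using holomorphic_on_imp_continuous_on[OF t(2)]
        holomorphic_on_imp_continuous_on[OF holomorphic_deriv[OF t(2,1)]]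
      by (intro continuous_intros continuous_on_compose2[OF cE]) auto
    then have "continuous_on (V k i) (E' i k)"
      by (rule continuous_on_eq) (simp add: E'_def)
    then show ?thesis using True t(1) by blast
  next
    case False
    have "z \<in> - cball 0 (r k) \<union> ?N"
      using False K_sub[OF it] r_pos(2)[OF kt] y_top[OF k, of z] by (cases "cmod z \<le> r k") auto
    moreover have "continuous_on (- cball 0 (r k) \<union> ?N) (E' i k)"
      by (rule continuous_on_eq[OF continuous_on_const[of _ 0]]) (use E'_supp[OF i k] in auto)
    ultimately show ?thesis using oN by blast
  qed
next
  fix z assume "R k \<le> cmod z"
  then show "E' i k z = 0" by (simp add: E'_def)
qed

section \<open>Exactness of the sum up to its polar term\<close>

abbreviation "W k \<equiv> {w \<in> D k. y k w \<notin> Z}"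

lemma E'_formula_all:
  assumes "i \<in> I" "k \<in> I" "z \<in> D k"
  shows "E' i k z = \<rho> i * f k i z * dzbar (f k k) z * (deriv (\<tau> k i) z / \<tau> k i z)
     + G i (y k z) * (dz (f k k) z * dzbar (f k i) z - dzbar (f k k) z * dz (f k i) z)"
proof (cases "y k z \<in> U i")
  case True then show ?thesis using E'_formula assms by simp
next
  case False
  then have "y k z \<notin> K i" using K_sub[OF I_top[OF assms(1)]] by blast
  then show ?thesis using f_supp[OF assms(2,1,3)] E'_supp[OF assms(1,2)] by auto
qed

definition G_diff :: "'a \<Rightarrow> 'a \<Rightarrow> complex \<Rightarrow> complex" where
  "G_diff k i z = f k i z * (G k (y k z) - G i (y k z))"

lemma G_diff_C1:
  assumes i: "i \<in> I" and k: "k \<in> I"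
  shows "C1 (G_diff k i) (W k)"
    "z \<in> W k \<Longrightarrow> dz (G_diff k i) z = dz (f k i) z * (G k (y k z) - G i (y k z))
        + f k i z * (\<rho> i * (deriv (\<tau> k i) z / \<tau> k i z) - \<rho> k / z)"
    "z \<in> W k \<Longrightarrow> dzbar (G_diff k i) z = dzbar (f k i) z * (G k (y k z) - G i (y k z))"
proof -
  note it = I_top[OF i] and kt = I_top[OF k]
  let ?A = "V k i \<inter> W k" and ?N = "{w \<in> D k. y k w \<in> topspace T - K i}"
  have oA: "open ?A" using open_off_Z[OF kt] tau_props(1)[OF i k] by blast
  have oN: "open ?N" by (intro open_pre[OF kt]) (use K_closed[OF it] in blast)
  have der: "((\<lambda>z. G k (y k z) - G i (y k z)) has_field_derivative
      (\<rho> i * (deriv (\<tau> k i) z / \<tau> k i z) - \<rho> k / z)) (at z)" if "z \<in> ?A" for z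
    using G_deriv[OF kt it, of z] that by simp
  then have hol: "(\<lambda>z. G k (y k z) - G i (y k z)) holomorphic_on ?A"
    using oA by (auto simp: holomorphic_on_open)
  note h = C1_holomorphic[OF oA hol]
  have fA: "C1 (f k i) ?A" by (rule C1_subset[OF f_C1[OF k i]]) auto
  have eqt: "G_diff k i = (\<lambda>z. f k i z * (G k (y k z) - G i (y k z)))" by (rule ext) (simp add: G_diff_def)
  note m = C1_mult[OF oA fA h(1), folded eqt]
  have N0: "G_diff k i z = 0" if "z \<in> ?N" for z
    using that f_supp(1)[OF k i, of z] by (auto simp: G_diff_def)
  have CN: "C1 (G_diff k i) ?N" by (rule C1_cong[OF oN _ C1_const[of 0]]) (simp add: N0)
  have "W k \<subseteq> ?A \<union> ?N" using K_sub[OF it] y_top[OF k] by auto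
  then show "C1 (G_diff k i) (W k)" using C1_Un[OF m(1) CN] C1_subset by blast
  assume z: "z \<in> W k"
  show "dz (G_diff k i) z = dz (f k i) z * (G k (y k z) - G i (y k z))
        + f k i z * (\<rho> i * (deriv (\<tau> k i) z / \<tau> k i z) - \<rho> k / z)"
    "dzbar (G_diff k i) z = dzbar (f k i) z * (G k (y k z) - G i (y k z))"
  proof -
    show "dz (G_diff k i) z = dz (f k i) z * (G k (y k z) - G i (y k z))
        + f k i z * (\<rho> i * (deriv (\<tau> k i) z / \<tau> k i z) - \<rho> k / z)"
    proof (cases "y k z \<in> U i")
      case True
      then have zA: "z \<in> ?A" using z by auto
      show ?thesis using m(2)[OF zA] h(2)[OF zA] DERIV_imp_deriv[OF der[OF zA]] by simp
    next
      case False
      then have zN: "z \<in> ?N" using z K_sub[OF it] y_top[OF k] by auto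
      have "dz (G_diff k i) z = 0"
        using wirtinger_cong(2)[OF oN zN N0] by (simp add: dz_const)
      then show ?thesis using f_supp[OF k i, of z] zN by auto
    qed
    show "dzbar (G_diff k i) z = dzbar (f k i) z * (G k (y k z) - G i (y k z))"
    proof (cases "y k z \<in> U i")
      case True
      then have zA: "z \<in> ?A" using z by auto
      show ?thesis using m(3)[OF zA] h(3)[OF zA] by simp
    next
      case False
      then have zN: "z \<in> ?N" using z K_sub[OF it] y_top[OF k] by auto
      have "dzbar (G_diff k i) z = 0"
        using wirtinger_cong(3)[OF oN zN N0] by (simp add: dzbar_const)
      then show ?thesis using f_supp[OF k i, of z] zN by auto
    qed
  qed
qed

text \<open>Since the partition functions sum to 1, this is \<open>G k\<close> minus the average of
  all \<open>G i\<close>. Written through differences it is continuously differentiable off the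
  poles, although no single \<open>G i\<close> need be: each difference is holomorphic where it is
  not cut off.\<close>

definition h :: "'a \<Rightarrow> complex \<Rightarrow> complex" where "h k z = (\<Sum>i\<in>I. G_diff k i z)"

lemma h_C1:
  assumes k: "k \<in> I"
  shows "C1 (h k) (W k)"
    "z \<in> W k \<Longrightarrow> dz (h k) z = (\<Sum>i\<in>I. \<rho> i * f k i z * (deriv (\<tau> k i) z / \<tau> k i z))
        - (\<Sum>i\<in>I. G i (y k z) * dz (f k i) z) - \<rho> k / z"
    "z \<in> W k \<Longrightarrow> dzbar (h k) z = - (\<Sum>i\<in>I. G i (y k z) * dzbar (f k i) z)"
proof -
  have s: "C1 (h k) (W k) \<and> (\<forall>z\<in>W k. dz (h k) z = (\<Sum>i\<in>I. dz (G_diff k i) z) \<and> dzbar (h k) z = (\<Sum>i\<in>I. dzbar (G_diff k i) z))"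
    using C1_sum[OF open_off_Z[OF I_top[OF k]] I(1), of "G_diff k"] G_diff_C1(1)[OF _ k] unfolding h_def[abs_def] by blast
  then show "C1 (h k) (W k)" by blast
  assume z: "z \<in> W k"
  then have zD: "z \<in> D k" by blast
  have "dz (h k) z = (\<Sum>i\<in>I. dz (f k i) z) * G k (y k z) + (\<Sum>i\<in>I. \<rho> i * f k i z * (deriv (\<tau> k i) z / \<tau> k i z))
        - (\<Sum>i\<in>I. G i (y k z) * dz (f k i) z) - (\<Sum>i\<in>I. f k i z) * (\<rho> k / z)"
  proof -
    have "dz (h k) z = (\<Sum>i\<in>I. dz (f k i) z * G k (y k z) + \<rho> i * f k i z * (deriv (\<tau> k i) z / \<tau> k i z)
        - G i (y k z) * dz (f k i) z - f k i z * (\<rho> k / z))"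
      using s[THEN conjunct2, rule_format, OF z] G_diff_C1(2)[OF _ k z] by (simp only:) (intro sum.cong refl, simp add: algebra_simps)
    then show ?thesis by (simp only: sum.distrib sum_subtractf sum_distrib_right)
  qed
  then show "dz (h k) z = (\<Sum>i\<in>I. \<rho> i * f k i z * (deriv (\<tau> k i) z / \<tau> k i z))
        - (\<Sum>i\<in>I. G i (y k z) * dz (f k i) z) - \<rho> k / z"
    by (simp add: f_sum[OF k zD])
  have "dzbar (h k) z = (\<Sum>i\<in>I. dzbar (f k i) z) * G k (y k z) - (\<Sum>i\<in>I. G i (y k z) * dzbar (f k i) z)"
  proof -
    have "dzbar (h k) z = (\<Sum>i\<in>I. dzbar (f k i) z * G k (y k z) - G i (y k z) * dzbar (f k i) z)"
      using s[THEN conjunct2, rule_format, OF z] G_diff_C1(3)[OF _ k z] by (simp only:) (intro sum.cong refl, simp add: algebra_simps)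
    then show ?thesis by (simp only: sum_subtractf sum_distrib_right)
  qed
  then show "dzbar (h k) z = - (\<Sum>i\<in>I. G i (y k z) * dzbar (f k i) z)"
    by (simp add: f_sum[OF k zD])
qed

text \<open>The averages of the \<open>G i\<close> against derivatives of the partition are
  derivatives of \<open>h k\<close>. With \<open>f\<close> for \<open>f k k\<close> the sum becomes
  the density of the exact form \<open>d(h df)\<close> plus the polar term
  \<open>\<rho> k * dzbar f / z\<close>.\<close>

lemma E'_sum:
  assumes k: "k \<in> I" and z: "z \<in> W k"
  shows "(\<Sum>i\<in>I. E' i k z) = dzbar (f k k) z * (dz (h k) z + \<rho> k / z) - dz (f k k) z * dzbar (h k) z"
proof -
  have zD: "z \<in> D k" using z by blast
  have "(\<Sum>i\<in>I. E' i k z) = dzbar (f k k) z * (\<Sum>i\<in>I. \<rho> i * f k i z * (deriv (\<tau> k i) z / \<tau> k i z))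
      + dz (f k k) z * (\<Sum>i\<in>I. G i (y k z) * dzbar (f k i) z)
      - dzbar (f k k) z * (\<Sum>i\<in>I. G i (y k z) * dz (f k i) z)"
    unfolding sum_distrib_left sum.distrib[symmetric] sum_subtractf[symmetric]
    by (intro sum.cong refl, subst E'_formula_all[OF _ k zD]) (simp_all add: algebra_simps)
  then show ?thesis unfolding h_C1(2,3)[OF k z] by (simp add: algebra_simps)
qed

text \<open>Off \<open>W k\<close> there are two kinds of points: those outside the disc, near which
  the partition function is 0, and a pole at the centre, near which it is 1. Hence it is locally
  constant there, which lets products with its derivatives be extended by zero.\<close>

lemma off_W:
  assumes k: "k \<in> I" and z: "z \<notin> W k"
  shows "\<exists>N c. open N \<and> z \<in> N \<and> (\<forall>w\<in>N \<inter> D k. dz (f k k) w = 0 \<and> dzbar (f k k) w = 0)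
    \<and> (\<forall>w\<in>N. (if w \<in> D k then f k k w else 0) = c)"
proof (cases "z \<in> D k")
  case False
  note kt = I_top[OF k]
  have "y k w \<notin> K k" if "w \<in> - cball 0 (r k) \<inter> D k" for w
    using that K_iff[OF kt, of w] by auto
  then show ?thesis using False cball_r[OF kt, of z] f_supp[OF k k]
    by (intro exI[of _ "- cball 0 (r k)"] exI[of _ 0]) (auto intro: open_Compl)
next
  case True
  note kt = I_top[OF k]
  have z0: "z = 0" "k \<in> Z" using z True Z_in_D[OF kt True] by auto
  obtain e where e: "e > 0" "e \<le> R k" "\<forall>p\<in>I. \<forall>z\<in>ball 0 e. f k p z = (if p = k then 1 else 0)
     \<and> dz (f k p) z = 0 \<and> dzbar (f k p) z = 0" using near_Z[OF z0(2)] by blast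
  then show ?thesis using z0 k by (intro exI[of _ "ball 0 e"] exI[of _ 1]) auto
qed

text \<open>\<open>h k\<close> has no meaning outside the disc and no control at a pole, but the
  factor \<open>g\<close> vanishes wherever both derivatives of the partition function do, that is,
  near all these points. It will be applied with \<open>g\<close> equal to either
  derivative.\<close>

lemma ext_C1:
  assumes k: "k \<in> I" and g: "C1 g (D k)"
    and g0: "\<forall>w\<in>D k. dz (f k k) w = 0 \<and> dzbar (f k k) w = 0 \<longrightarrow> g w = 0"
  defines "H \<equiv> \<lambda>z. if z \<in> D k then h k z * g z else 0"
  shows "C1 H UNIV" "z \<in> W k \<Longrightarrow> dz H z = dz (h k) z * g z + h k z * dz g z"
    "z \<in> W k \<Longrightarrow> dzbar H z = dzbar (h k) z * g z + h k z * dzbar g z"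
    "z \<notin> W k \<Longrightarrow> dz H z = 0" "z \<notin> W k \<Longrightarrow> dzbar H z = 0"
proof -
  have oW: "open (W k)" by (rule open_off_Z[OF I_top[OF k]])
  have gW: "C1 g (W k)" by (rule C1_subset[OF g]) auto
  note m = C1_mult[OF oW h_C1(1)[OF k] gW]
  have eq: "H w = h k w * g w" if "w \<in> W k" for w using that by (simp add: H_def)
  have CW: "C1 H (W k)" by (rule C1_cong[OF oW eq[symmetric] m(1)])
  show "z \<in> W k \<Longrightarrow> dz H z = dz (h k) z * g z + h k z * dz g z"
    "z \<in> W k \<Longrightarrow> dzbar H z = dzbar (h k) z * g z + h k z * dzbar g z"
    using wirtinger_cong(2,3)[OF oW _ eq, of z] m(2,3)[of z] by auto
  have off: "\<exists>N. open N \<and> z \<in> N \<and> (\<forall>w\<in>N. H w = 0)" if z: "z \<notin> W k" for z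
  proof -
    obtain N where N: "open N" "z \<in> N" "\<forall>w\<in>N \<inter> D k. dz (f k k) w = 0 \<and> dzbar (f k k) w = 0"
      using off_W[OF k z] by blast
    then have "\<forall>w\<in>N. H w = 0" using g0 by (auto simp: H_def)
    then show ?thesis using N by blast
  qed
  show "dz H z = 0" "dzbar H z = 0" if zW: "z \<notin> W k"
  proof -
    obtain N where N: "open N" "z \<in> N" "\<And>w. w \<in> N \<Longrightarrow> H w = 0" using off[OF zW] by blast
    show "dz H z = 0" "dzbar H z = 0"
      using wirtinger_cong(2,3)[OF N(1,2), of H "\<lambda>_. 0"] N(3) by (simp_all add: dz_const dzbar_const)
  qed
  have "C1 H {z}" for z
  proof (cases "z \<in> W k")
    case True then show ?thesis using CW C1_subset by blast
  next
    case False
    then obtain N where N: "open N" "z \<in> N" "\<And>w. w \<in> N \<Longrightarrow> H w = 0" using off[OF False] by metis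
    have "C1 H N" by (rule C1_cong[OF N(1) _ C1_const[of 0]]) (simp add: N(3))
    then show ?thesis using N C1_subset by blast
  qed
  then show "C1 H UNIV" unfolding C1_def by blast
qed

lemma residue_sum_cover: "(\<Sum>p\<in>Z. \<rho> p) = 0"
proof -
  obtain C where C: "C \<noteq> 0" "\<forall>\<phi> r R. C1 \<phi> UNIV \<and> r > 0 \<and> (\<forall>z. cmod z < r \<longrightarrow> \<phi> z = 1) \<and> (\<forall>z. cmod z \<ge> R \<longrightarrow> \<phi> z = 0)
     \<longrightarrow> cts_compact_support (\<lambda>z. dzbar \<phi> z / z) \<and> plane_integral (\<lambda>z. dzbar \<phi> z / z) = C"
    using dbar_integral_over_z by (elim exE conjE)
  have main: "(\<Sum>i\<in>I. plane_integral (E i k)) = C * \<rho> k" if k: "k \<in> I" for k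
  proof -
    note kt = I_top[OF k]
    have C2: "C1 (f k k) (D k)" "C1 (dz (f k k)) (D k)" "C1 (dzbar (f k k)) (D k)"
      "\<And>z. z \<in> D k \<Longrightarrow> dzbar (dz (f k k)) z = dz (dzbar (f k k)) z"
      using f_C2[OF k k] by (auto simp: C2_def)
    \<comment> \<open>The exact form \<open>d(h df)\<close> has density
      \<open>dz H1 - dzbar H2\<close>, and both terms integrate to 0 by Stokes' formula.\<close>
    define H1 where "H1 = (\<lambda>z. if z \<in> D k then h k z * dzbar (f k k) z else 0)"
    define H2 where "H2 = (\<lambda>z. if z \<in> D k then h k z * dz (f k k) z else 0)"
    \<comment> \<open>If \<open>k\<close> is a pole, this extension by zero is 1 near 0 and hence an
      admissible cut-off for the constant \<open>C\<close>.\<close>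
    define \<Phi> where "\<Phi> = (\<lambda>z. if z \<in> D k then f k k z else 0)"
    have g1: "\<forall>w\<in>D k. dz (f k k) w = 0 \<and> dzbar (f k k) w = 0 \<longrightarrow> dzbar (f k k) w = 0"
      and g2: "\<forall>w\<in>D k. dz (f k k) w = 0 \<and> dzbar (f k k) w = 0 \<longrightarrow> dz (f k k) w = 0" by blast+
    note H1 = ext_C1[OF k C2(3) g1, folded H1_def] and H2 = ext_C1[OF k C2(2) g2, folded H2_def]
    have o1: "H1 z = 0" and o2: "H2 z = 0" if "R k \<le> cmod z" for z using that by (simp_all add: H1_def H2_def)
    have s1: "cts_compact_support (dz H1)" "plane_integral (dz H1) = 0"
      by (rule stokes[where R = "R k", OF H1(1) o1], assumption)+
    have s2: "cts_compact_support (dzbar H2)" "plane_integral (dzbar H2) = 0"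
      by (rule stokes[where R = "R k", OF H2(1) o2], assumption)+
    have \<Phi>W: "dzbar \<Phi> z = dzbar (f k k) z" if "z \<in> D k" for z
      by (rule wirtinger_cong(3)[OF open_ball that]) (simp add: \<Phi>_def)
    have \<Phi>off: "C1 \<Phi> {z} \<and> dzbar \<Phi> z = 0" if z: "z \<notin> W k" for z
    proof -
      obtain N c where N: "open N" "z \<in> N" "\<And>w. w \<in> N \<Longrightarrow> \<Phi> w = c"
        using off_W[OF k z] unfolding \<Phi>_def by blast
      have "C1 \<Phi> N" by (rule C1_cong[OF N(1) _ C1_const[of c]]) (simp add: N(3))
      then show ?thesis
        using N(2) C1_subset[of \<Phi> N "{z}"] wirtinger_cong(3)[OF N(1,2), of \<Phi> "\<lambda>_. c"] N(3) by (auto simp: dzbar_const)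
    qed
    have "C1 \<Phi> {z}" for z
    proof (cases "z \<in> D k")
      case True
      have "C1 \<Phi> (D k)" by (rule C1_cong[OF open_ball _ C2(1)]) (simp add: \<Phi>_def)
      then show ?thesis using C1_subset True by blast
    qed (use \<Phi>off in blast)
    then have C\<Phi>: "C1 \<Phi> UNIV" unfolding C1_def by blast
    have \<Phi>int: "cts_compact_support (\<lambda>z. \<rho> k * (dzbar \<Phi> z / z)) \<and> plane_integral (\<lambda>z. \<rho> k * (dzbar \<Phi> z / z)) = C * \<rho> k"
    proof (cases "k \<in> Z")
      case True
      obtain e where e: "e > 0" "e \<le> R k" "\<forall>p\<in>I. \<forall>z\<in>ball 0 e. f k p z = (if p = k then 1 else 0)"
        using near_Z[OF True] by blast
      have "cts_compact_support (\<lambda>z. dzbar \<Phi> z / z) \<and> plane_integral (\<lambda>z. dzbar \<Phi> z / z) = C"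
        by (rule C(2)[rule_format, of _ e "R k"]) (use C\<Phi> e k in \<open>auto simp: \<Phi>_def\<close>)
      then show ?thesis using cts_compact_support_cmult[of "\<lambda>z. dzbar \<Phi> z / z" "\<rho> k"] plane_integral_cmult[of "\<rho> k" "\<lambda>z. dzbar \<Phi> z / z"]
        by (simp only: mult.commute)
    next
      case False
      then show ?thesis using rho0[OF kt] by (simp add: cts_compact_support_def plane_integral_def)
    qed
    \<comment> \<open>The second derivatives of \<open>f k k\<close> in \<open>dz H1\<close> and
      \<open>dzbar H2\<close> cancel because mixed derivatives agree.\<close>
    have pt: "(\<Sum>i\<in>I. E' i k z) = \<rho> k * (dzbar \<Phi> z / z) + (dz H1 z + (-1) * dzbar H2 z)" for z
    proof (cases "z \<in> W k")
      case True
      then have zD: "z \<in> D k" by blast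
      show ?thesis
        unfolding E'_sum[OF k True] \<Phi>W[OF zD]
        using H1(2)[OF True] H2(3)[OF True] C2(4)[OF zD] by (simp add: algebra_simps)
    next
      case False
      have "E' i k z = 0" if i: "i \<in> I" for i
      proof (cases "z \<in> D k")
        case True
        then have "z = 0" "k \<in> Z" using False Z_in_D[OF kt True] by auto
        then obtain e where "e > 0" "\<forall>p\<in>I. \<forall>z\<in>ball 0 e. dz (f k p) z = 0 \<and> dzbar (f k p) z = 0"
          using near_Z by blast
        then show ?thesis using E'_formula_all[OF i k True] i k \<open>z = 0\<close> by simp
      next
        case False
        then show ?thesis by (simp add: E'_def)
      qed
      then show ?thesis using H1(4)[OF False] H2(5)[OF False] \<Phi>off[OF False] by simp
    qed
    have "(\<Sum>i\<in>I. plane_integral (E i k)) = (\<Sum>i\<in>I. plane_integral (E' i k))"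
      using E'_plane_integral[OF _ k] by simp
    also have "\<dots> = plane_integral (\<lambda>z. \<Sum>i\<in>I. E' i k z)"
      using cts_compact_support_sum[OF I(1), of "\<lambda>i. E' i k"] E'_cts[OF _ k] by simp
    also have "\<dots> = C * \<rho> k"
    proof -
      have c: "cts_compact_support (\<lambda>z. (-1) * dzbar H2 z)" by (rule cts_compact_support_cmult[OF s2(1)])
      have "plane_integral (\<lambda>z. dz H1 z + (-1) * dzbar H2 z) = 0"
        unfolding plane_integral_add[OF s1(1) c] plane_integral_cmult using s1 s2 by simp
      then show ?thesis unfolding pt plane_integral_add[OF conjunct1[OF \<Phi>int] cts_compact_support_add[OF s1(1) c]] using \<Phi>int[THEN conjunct2] by (simp only: add_0_right)
    qed
    finally show ?thesis .
  qed
  have "C * (\<Sum>k\<in>I. \<rho> k) = (\<Sum>k\<in>I. \<Sum>i\<in>I. plane_integral (E i k))" by (simp add: main sum_distrib_left)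
  also have "\<dots> = (\<Sum>i\<in>I. \<Sum>k\<in>I. plane_integral (E i k))" by (rule sum.swap)
  also have "\<dots> = 0" by (simp add: E_sum_k)
  finally have "(\<Sum>k\<in>I. \<rho> k) = 0" using C(1) by simp
  moreover have "(\<Sum>k\<in>I. \<rho> k) = (\<Sum>k\<in>Z. \<rho> k)"
    by (rule sum.mono_neutral_right[OF I(1) Z_sub_I]) (use rho0 I_top in auto)
  ultimately show ?thesis by simp
qed

end

theorem (in residue_data) residue_sum: "(\<Sum>p\<in>Z. \<rho> p) = 0"
proof -
  obtain I where "finite I" "I \<subseteq> topspace T" "\<forall>t\<in>topspace T. \<exists>p\<in>I. t \<in> B p"
    using finite_cover by blast
  then interpret residue_cover T U x y R Z \<rho> G I by unfold_locales auto
  show ?thesis by (rule residue_sum_cover)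
qed

section \<open>Logarithms and primitives on punctured discs\<close>

abbreviation punctured_ball :: "real \<Rightarrow> complex set" where "punctured_ball R \<equiv> ball 0 R - {0}"

text \<open>\<open>exp\<close> is the universal covering of the punctured disc by a half-plane.
  Logarithms and primitives exist on the half-plane and descend as soon as they are
  periodic.\<close>

lemma exp_mem_punctured_ball: "0 < R \<Longrightarrow> Re w < ln R \<longleftrightarrow> exp w \<in> punctured_ball R"
  by (simp add: ln_ge_iff flip: not_le) (metis exp_le_cancel_iff exp_ln not_le)

text \<open>\<open>w\<close> and \<open>Ln (exp w)\<close> differ by an integral number of periods.
  Since periodicity is given for one step upwards, the induction starts from whichever of the two is
  lower.\<close>

lemma periodic_Ln:
  assumes "0 < R" "\<And>w. Re w < ln R \<Longrightarrow> H (w + 2 * of_real pi * \<i>) = H w" "Re w < ln R"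
  shows "H (Ln (exp w)) = H w"
proof -
  have up: "H (w + of_nat n * (2 * of_real pi * \<i>)) = H w" if "Re w < ln R" for n w
    using that
  proof (induction n)
    case (Suc n)
    have e: "w + of_nat (Suc n) * (2 * of_real pi * \<i>) = (w + of_nat n * (2 * of_real pi * \<i>)) + 2 * of_real pi * \<i>"
      by (simp add: algebra_simps)
    have "Re (w + of_nat n * (2 * of_real pi * \<i>)) < ln R" using Suc.prems by simp
    from assms(2)[OF this] show ?case unfolding e using Suc.IH[OF Suc.prems] by (simp only:)
  qed simp
  obtain n :: int where n: "w = Ln (exp w) + of_int (2 * n) * pi * \<i>"
    using exp_eq[of w "Ln (exp w)"] by auto
  have re: "Re (Ln (exp w)) < ln R" using n assms(3) by (metis Re_Ln exp_not_eq_zero norm_exp_eq_Re ln_exp)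
  show ?thesis
  proof (cases "n \<ge> 0")
    case True
    then have "w = Ln (exp w) + of_nat (nat n) * (2 * of_real pi * \<i>)" using n by (simp add: algebra_simps)
    then show ?thesis using up[OF re, of "nat n"] by simp
  next
    case False
    then have "Ln (exp w) = w + of_nat (nat (- n)) * (2 * of_real pi * \<i>)" using n by (simp add: algebra_simps)
    then show ?thesis using up[OF assms(3), of "nat (- n)"] by simp
  qed
qed

text \<open>Division by \<open>z\<close> turns the cut of \<open>Ln\<close> away from
  \<open>z\<close>, and adding \<open>w\<close> selects the branch with the prescribed
  value.\<close>

lemma local_log:
  assumes "exp w = z"
  shows "\<exists>l N. open N \<and> z \<in> N \<and> l z = w \<and> l holomorphic_on N \<and> (l has_field_derivative 1 / z) (at z)
    \<and> (\<forall>x\<in>N. exp (l x) = x)"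
proof -
  have z: "z \<noteq> 0" using assms by auto
  let ?l = "\<lambda>x. Ln (x / z) + w" and ?N = "{x. x / z \<notin> \<real>\<^sub>\<le>\<^sub>0}"
  have "open ((\<lambda>x. x / z) -` (- \<real>\<^sub>\<le>\<^sub>0))"
    by (intro open_vimage) (use z in \<open>auto intro!: continuous_intros\<close>)
  moreover have "(\<lambda>x. x / z) -` (- \<real>\<^sub>\<le>\<^sub>0) = ?N" by auto
  ultimately have "open ?N" by simp
  moreover have "z \<in> ?N" "?l z = w" using z by auto
  moreover have "?l holomorphic_on ?N" using z by (intro holomorphic_intros) auto
  moreover have "(?l has_field_derivative 1 / z) (at z)"
    by (rule derivative_eq_intros refl | (use z in simp))+
  moreover have "\<forall>x\<in>?N. exp (?l x) = x"
  proof
    fix x assume "x \<in> ?N"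
    then have "x / z \<noteq> 0" by auto
    then show "exp (?l x) = x" using z assms by (simp add: exp_add)
  qed
  ultimately show ?thesis by (intro exI[of _ ?l] exI[of _ ?N] conjI)
qed

text \<open>The function is \<open>H\<close> composed with \<open>Ln\<close>: the jump of
  \<open>Ln\<close> across its cut is a period of \<open>H\<close>, so near any point
  \<open>Ln\<close> may be replaced by a holomorphic branch. Continuity and differentiability
  descend separately, as one use is merely continuous.\<close>

lemma descend_exp:
  assumes R: "0 < R" and per: "\<And>w. Re w < ln R \<Longrightarrow> H (w + 2 * of_real pi * \<i>) = H w"
  obtains h where "\<And>w. Re w < ln R \<Longrightarrow> h (exp w) = H w"
    "continuous_on {w. Re w < ln R} H \<Longrightarrow> continuous_on (punctured_ball R) h"
    "\<And>w d. Re w < ln R \<Longrightarrow> (H has_field_derivative d) (at w) \<Longrightarrow> (h has_field_derivative d / exp w) (at (exp w))"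
proof
  let ?h = "\<lambda>z. H (Ln z)"
  show h: "?h (exp w) = H w" if "Re w < ln R" for w using periodic_Ln[where H = H, OF R per that] by simp
  have local: "\<exists>l N. open N \<and> exp w \<in> N \<and> l (exp w) = w \<and> l holomorphic_on N \<and> (l has_field_derivative 1 / exp w) (at (exp w))
      \<and> (\<forall>x\<in>N. ?h x = H (l x) \<and> Re (l x) < ln R)" if w: "Re w < ln R" for w
  proof -
    obtain l N where l: "open N" "exp w \<in> N" "l (exp w) = w" "l holomorphic_on N" "(l has_field_derivative 1 / exp w) (at (exp w))"
      "\<forall>x\<in>N. exp (l x) = x" using local_log[OF refl] by metis
    let ?N = "N \<inter> punctured_ball R"
    have "open ?N" using l by (intro open_Int open_Diff) auto
    moreover have "exp w \<in> ?N" using l exp_mem_punctured_ball[OF R] w by auto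
    moreover have "?h x = H (l x) \<and> Re (l x) < ln R" if "x \<in> ?N" for x
    proof -
      have "exp (l x) \<in> punctured_ball R" using l(6) that by simp
      then have "Re (l x) < ln R" using exp_mem_punctured_ball[OF R] by blast
      then show ?thesis using h[of "l x"] l(6) that by auto
    qed
    moreover have "l holomorphic_on ?N" using l(4) holomorphic_on_subset by blast
    ultimately show ?thesis using l by blast
  qed
  show "continuous_on (punctured_ball R) ?h" if cH: "continuous_on {w. Re w < ln R} H"
  proof (rule continuous_at_imp_continuous_on, rule ballI)
    fix z assume z: "z \<in> punctured_ball R"
    define w where "w = Ln z"
    have w: "exp w = z" "Re w < ln R" using z exp_mem_punctured_ball[OF R, of w] by (auto simp: w_def)
    obtain l N where l: "open N" "z \<in> N" "l holomorphic_on N" "\<forall>x\<in>N. ?h x = H (l x) \<and> Re (l x) < ln R"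
      using local[OF w(2)] w(1) by metis
    have "continuous_on N (\<lambda>x. H (l x))"
      using l by (intro continuous_on_compose2[OF cH] holomorphic_on_imp_continuous_on) auto
    then have "continuous_on N ?h" by (rule continuous_on_eq) (use l in auto)
    then show "isCont ?h z" using l continuous_on_eq_continuous_at by blast
  qed
  show "(?h has_field_derivative d / exp w) (at (exp w))"
    if w: "Re w < ln R" and d: "(H has_field_derivative d) (at w)" for w d
  proof -
    obtain l N where l: "open N" "exp w \<in> N" "l (exp w) = w" "(l has_field_derivative 1 / exp w) (at (exp w))"
       "\<forall>x\<in>N. ?h x = H (l x) \<and> Re (l x) < ln R"
      using local[OF w] by metis
    have "((\<lambda>x. H (l x)) has_field_derivative d * (1 / exp w)) (at (exp w))"
      by (rule DERIV_chain2[OF _ l(4)]) (use d l in simp)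
    then have "(?h has_field_derivative d * (1 / exp w)) (at (exp w))"
      by (rule has_field_derivative_transform_within_open[OF _ l(1,2)]) (use l in auto)
    then show ?thesis by simp
  qed
qed

section \<open>Winding numbers, residues and their invariance\<close>

lemma integer_valued_constant:
  assumes "connected S" "continuous_on S f" "\<And>x. x \<in> S \<Longrightarrow> \<exists>n::int. f x = (of_int n :: complex)"
  shows "\<exists>n::int. \<forall>x\<in>S. f x = of_int n"
proof (cases "S = {}")
  case False
  then obtain x0 where x0: "x0 \<in> S" by blast
  have "\<exists>e. 0 < e \<and> (\<forall>y. y \<in> S \<and> f y \<noteq> f x \<longrightarrow> e \<le> norm (f y - f x))" if xS: "x \<in> S" for x
  proof (intro exI[of _ 1] conjI allI impI)
    fix y assume y: "y \<in> S \<and> f y \<noteq> f x"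
    obtain m n where mn: "f x = of_int m" "f y = of_int n" using assms(3)[OF xS] assms(3)[of y] y by metis
    then have "norm (f y - f x) = of_int \<bar>n - m\<bar>" by (metis norm_of_int of_int_diff of_int_abs)
    moreover have "n \<noteq> m" using y mn by auto
    ultimately show "1 \<le> norm (f y - f x)" by linarith
  qed simp
  then have "f constant_on S"
    using continuous_discrete_range_constant_eq[THEN iffD1, rule_format, OF assms(1)] assms(2) by blast
  then show ?thesis using assms(3)[OF x0] x0 unfolding constant_on_def by metis
qed simp

lemma halfplane: "convex {w. Re w < a}" "open {w. Re w < a}" "connected {w. Re w < a}"
proof -
  show c: "convex {w. Re w < a}" by (rule convex_halfspace_Re_lt)
  show "open {w. Re w < a}" by (rule open_halfspace_Re_lt)
  show "connected {w. Re w < a}" using c convex_connected by blast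
qed

text \<open>On the half-plane \<open>s\<close> has a continuous logarithm. Its increment over one
  period is an integral multiple of \<open>2 * pi * \<i>\<close>, constant by connectedness, and
  this multiple is the winding number on every circle.\<close>

lemma punctured_log:
  assumes R: "0 < R" and s: "continuous_on (punctured_ball R) s" "\<And>z. z \<in> punctured_ball R \<Longrightarrow> s z \<noteq> 0"
  obtains k :: int and g where "continuous_on (punctured_ball R) g" "\<And>z. z \<in> punctured_ball R \<Longrightarrow> s z = z powi k * exp (g z)"
    "\<And>r. 0 < r \<Longrightarrow> r < R \<Longrightarrow> winding_number (\<lambda>t. s (circlepath 0 r t)) 0 = of_int k"
proof -
  let ?Q = "{w. Re w < ln R}" and ?c = "2 * of_real pi * \<i>"
  have eQ: "exp w \<in> punctured_ball R" if "w \<in> ?Q" for w using that exp_mem_punctured_ball[OF R] by blast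
  have "continuous_on ?Q (\<lambda>w. s (exp w))"
    by (rule continuous_on_compose2[OF s(1)]) (use eQ in \<open>auto intro!: continuous_intros\<close>)
  then obtain L where L: "continuous_on ?Q L" "\<And>w. w \<in> ?Q \<Longrightarrow> s (exp w) = exp (L w)"
    using continuous_logarithm_on_contractible[of ?Q "\<lambda>w. s (exp w)"] s(2) eQ
      convex_imp_contractible[OF halfplane(1)] by metis
  have cs: "continuous_on ?Q (\<lambda>w. L (w + ?c))"
    by (rule continuous_on_compose2[OF L(1)]) (auto intro!: continuous_intros)
  have "\<exists>k::int. \<forall>w\<in>?Q. (L (w + ?c) - L w) / ?c = of_int k"
  proof (rule integer_valued_constant[OF halfplane(3)])
    show "continuous_on ?Q (\<lambda>w. (L (w + ?c) - L w) / ?c)"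
      using L(1) cs by (intro continuous_intros) auto
    fix w assume w: "w \<in> ?Q"
    have "exp (L (w + ?c)) = exp (L w)"
      using L(2)[of w] L(2)[of "w + ?c"] w by (simp add: exp_add)
    then obtain n :: int where "L (w + ?c) = L w + of_int (2 * n) * pi * \<i>" using exp_eq by metis
    then have "(L (w + ?c) - L w) / ?c = of_int n" by (simp add: field_simps)
    then show "\<exists>n::int. (L (w + ?c) - L w) / ?c = of_int n" by blast
  qed
  then obtain k :: int where k: "\<And>w. w \<in> ?Q \<Longrightarrow> L (w + ?c) - L w = of_int k * ?c"
    by (auto simp: field_simps)
  \<comment> \<open>Subtracting \<open>k * w\<close> removes the increment; downstairs it
    corresponds to dividing \<open>s\<close> by \<open>z powi k\<close>.\<close>
  define H where "H = (\<lambda>w. L w - of_int k * w)"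
  have per: "H (w + ?c) = H w" if "Re w < ln R" for w
    using k[of w] that by (simp add: H_def algebra_simps)
  obtain g where g: "\<And>w. Re w < ln R \<Longrightarrow> g (exp w) = H w" "continuous_on ?Q H \<Longrightarrow> continuous_on (punctured_ball R) g"
    using descend_exp[where H = H, OF R per] by metis
  show ?thesis
  proof (rule that)
    show "continuous_on (punctured_ball R) g" by (rule g(2)) (auto simp: H_def intro!: continuous_intros L(1))
    fix z assume z: "z \<in> punctured_ball R"
    have w: "Re (Ln z) < ln R" using exp_mem_punctured_ball[OF R, of "Ln z"] z by auto
    have "s z = exp (L (Ln z))" using L(2)[of "Ln z"] w z by auto
    also have "\<dots> = exp (of_int k * Ln z) * exp (g z)"
      using g(1)[OF w] z by (simp add: H_def flip: exp_add)
    also have "exp (of_int k * Ln z) = z powi k"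
      using z exp_power_int[of "Ln z" k] by simp
    finally show "s z = z powi k * exp (g z)" .
  next
    fix r :: real assume r: "0 < r" "r < R"
    \<comment> \<open>The circle of radius \<open>r\<close> lifts to the vertical segment of one
      period above \<open>ln r\<close>.\<close>
    define p where "p = (\<lambda>t. L (of_real (ln r) + ?c * of_real t))"
    have inQ: "of_real (ln r) + ?c * of_real t \<in> ?Q" for t using r by simp
    have pp: "path p" unfolding path_def p_def
      by (rule continuous_on_compose2[OF L(1)]) (use inQ in \<open>auto intro!: continuous_intros\<close>)
    have "s (circlepath 0 r t) = exp (p t)" for t
    proof -
      have "circlepath 0 r t = exp (of_real (ln r) + ?c * of_real t)"
        using r by (simp add: circlepath exp_add exp_of_real algebra_simps)
      then show ?thesis using L(2)[OF inQ[of t]] by (simp add: p_def)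
    qed
    then have "winding_number (\<lambda>t. s (circlepath 0 r t)) 0 = winding_number (exp \<circ> p) 0"
      by (simp add: o_def)
    also have "\<dots> = (p 1 - p 0) / ?c"
      using winding_number_compose_exp[OF pp] by (simp add: pathfinish_def pathstart_def mult.assoc)
    also have "\<dots> = of_int k"
      using k[OF inQ[of 0]] by (simp add: p_def)
    finally show "winding_number (\<lambda>t. s (circlepath 0 r t)) 0 = of_int k" .
  qed
qed

text \<open>A function with a single-valued primitive has integral 0 over a circle, while
  \<open>c / z\<close> contributes \<open>2 * pi * \<i> * c\<close>. Residues are identified through
  this lemma.\<close>

lemma primitive_pole_zero:
  assumes R: "0 < R" and h: "\<And>z. z \<in> punctured_ball R \<Longrightarrow> (h has_field_derivative f z - c / z) (at z)"
    and f: "(f has_contour_integral 2 * pi * \<i> * d) (circlepath 0 (R / 2))"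
  shows "c = d"
proof -
  have img: "path_image (circlepath 0 (R / 2)) \<subseteq> punctured_ball R" using R by auto
  have 1: "((\<lambda>z. f z - c / z) has_contour_integral 0) (circlepath 0 (R / 2))"
    by (rule Cauchy_theorem_primitive[where f = h, OF has_field_derivative_at_within[OF h] _ img]) auto
  have "((\<lambda>u. c / (u - 0)) has_contour_integral 2 * of_real pi * \<i> * c) (circlepath 0 (R / 2))"
    by (rule Cauchy_integral_circlepath_simple[where f = "\<lambda>_. c"]) (use R in auto)
  then have "((\<lambda>z. f z - c / z) has_contour_integral 2 * pi * \<i> * d - 2 * of_real pi * \<i> * c) (circlepath 0 (R / 2))"
    using has_contour_integral_diff[OF f] by simp
  from has_contour_integral_unique[OF 1 this] have "2 * of_real pi * \<i> * (d - c) = 0"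
    by (simp add: algebra_simps)
  then show ?thesis by simp
qed

lemma period_correction:
  fixes A :: "complex \<Rightarrow> complex"
  assumes "c \<noteq> 0" "A (w + c) - A w = d"
  shows "A (w + c) - d / c * (w + c) = A w - d / c * w"
  using assms by (simp add: distrib_left diff_eq_eq)

text \<open>On the half-plane the pulled-back form has a primitive. Its increment over one period is
  constant, and subtracting a linear function makes it periodic; the slope of that function is the
  residue by \<open>primitive_pole_zero\<close>.\<close>

lemma punctured_primitive:
  assumes R: "0 < R" and f: "f holomorphic_on (punctured_ball R)"
  obtains h where "\<And>z. z \<in> punctured_ball R \<Longrightarrow> (h has_field_derivative f z - residue f 0 / z) (at z)"
proof -
  let ?Q = "{w. Re w < ln R}" and ?c = "2 * of_real pi * \<i>"
  have eQ: "exp w \<in> punctured_ball R" if "w \<in> ?Q" for w using that exp_mem_punctured_ball[OF R] by blast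
  have "(\<lambda>w. f (exp w)) holomorphic_on ?Q"
    by (rule holomorphic_on_compose_gen[OF holomorphic_on_exp f, unfolded o_def]) (rule image_subsetI, erule eQ)
  then have hol: "(\<lambda>w. f (exp w) * exp w) holomorphic_on ?Q" by (intro holomorphic_intros)
  obtain \<Phi> where "\<And>w. w \<in> ?Q \<Longrightarrow> (\<Phi> has_field_derivative f (exp w) * exp w) (at w within ?Q)"
    using holomorphic_convex_primitive'[OF halfplane(1,2) hol] by blast
  then have \<Phi>: "\<And>w. w \<in> ?Q \<Longrightarrow> (\<Phi> has_field_derivative f (exp w) * exp w) (at w)"
    using at_within_open[OF _ halfplane(2)] by metis
  have "\<exists>c. \<forall>w\<in>?Q. \<Phi> (w + ?c) - \<Phi> w = c"
  proof (rule has_field_derivative_zero_constant[OF halfplane(1)])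
    fix w assume w: "w \<in> ?Q"
    have "((\<lambda>w. \<Phi> (w + ?c)) has_field_derivative f (exp w) * exp w) (at w)"
      using \<Phi>[of "w + ?c"] w DERIV_shift[of \<Phi> "f (exp w) * exp w" w ?c] by (simp add: exp_add)
    then have "((\<lambda>w. \<Phi> (w + ?c) - \<Phi> w) has_field_derivative 0) (at w)"
      using DERIV_diff[OF _ \<Phi>[OF w]] by fastforce
    then show "((\<lambda>w. \<Phi> (w + ?c) - \<Phi> w) has_field_derivative 0) (at w within ?Q)"
      by (rule has_field_derivative_at_within)
  qed
  then obtain c where c: "\<And>w. w \<in> ?Q \<Longrightarrow> \<Phi> (w + ?c) - \<Phi> w = c" by blast
  define H where "H = (\<lambda>w. \<Phi> w - c / ?c * w)"
  have per: "H (w + ?c) = H w" if "Re w < ln R" for w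
    unfolding H_def by (rule period_correction) (use c[of w] that in auto)
  obtain h where h: "\<And>w d. Re w < ln R \<Longrightarrow> (H has_field_derivative d) (at w) \<Longrightarrow> (h has_field_derivative d / exp w) (at (exp w))"
    using descend_exp[where H = H, OF R per] by metis
  have hd: "(h has_field_derivative f z - c / ?c / z) (at z)" if z: "z \<in> punctured_ball R" for z
  proof -
    have w: "Re (Ln z) < ln R" "exp (Ln z) = z" using exp_mem_punctured_ball[OF R, of "Ln z"] z by auto
    have "(H has_field_derivative f z * z - c / ?c) (at (Ln z))"
      unfolding H_def using \<Phi>[of "Ln z"] w by (auto intro!: derivative_eq_intros)
    from h[OF w(1) this] show ?thesis using z by (simp add: w(2) diff_divide_distrib)
  qed
  have "(f has_contour_integral 2 * pi * \<i> * residue f 0) (circlepath 0 (R / 2))"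
    by (rule base_residue[of "ball 0 R"]) (use R f in auto)
  from primitive_pole_zero[OF R hd this] show ?thesis using hd that by metis
qed

text \<open>Near \<open>z0\<close> a continuous logarithm must be
  \<open>Ln (f z / f z0) + L z0\<close>, because its imaginary part moves by less than
  \<open>pi\<close>. So differentiability comes for nothing; this recovers derivatives from the
  merely continuous logarithms of a section.\<close>

lemma continuous_log_deriv:
  fixes f :: "complex \<Rightarrow> complex"
  assumes S: "open S" "z0 \<in> S" and L: "continuous_on S L" "\<And>z. z \<in> S \<Longrightarrow> exp (L z) = f z"
    and f: "(f has_field_derivative d) (at z0)"
  shows "(L has_field_derivative d / f z0) (at z0)"
proof -
  have f0: "f z0 \<noteq> 0" using L(2)[OF S(2)] by (metis exp_not_eq_zero)
  have "isCont L z0" using L(1) S continuous_on_eq_continuous_at by blast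
  then obtain e where e: "e > 0" "\<And>z. dist z z0 < e \<Longrightarrow> dist (L z) (L z0) < pi"
    using pi_gt_zero unfolding continuous_at_eps_delta by blast
  have eq: "Ln (f z / f z0) + L z0 = L z" if "z \<in> S \<inter> ball z0 e" for z
  proof -
    have "\<bar>Im (L z - L z0)\<bar> < pi"
      using e(2)[of z] that abs_Im_le_cmod[of "L z - L z0"] by (simp add: dist_norm norm_minus_commute)
    then have "Ln (exp (L z - L z0)) = L z - L z0" by (intro Ln_exp) auto
    then show ?thesis using L(2) that S(2) by (simp add: exp_diff)
  qed
  have "((\<lambda>z. Ln (f z / f z0) + L z0) has_field_derivative d / f z0) (at z0)"
    by (rule derivative_eq_intros f refl | (use f0 in simp))+
  then show ?thesis
    by (rule has_field_derivative_transform_within_open[of _ _ _ "S \<inter> ball z0 e"])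
      (use S e eq in auto)
qed

text \<open>The terms \<open>du/u\<close> and \<open>dt/t - dz/z\<close> have single-valued
  logarithms on the disc, as \<open>u\<close> and \<open>t z / z\<close> have no zeros. Combining
  these with primitives of both forms gives a function with derivative a multiple of
  \<open>1 / z\<close>; the multiple, the difference of the residues, must be 0.\<close>

lemma residue_transform:
  assumes R: "0 < R" and R2: "0 < R2"
    and t: "t holomorphic_on ball 0 R" "t 0 = 0" "\<And>z. z \<in> ball 0 R \<Longrightarrow> deriv t z \<noteq> 0"
      "\<And>z. z \<in> punctured_ball R \<Longrightarrow> t z \<in> punctured_ball R2"
    and w1: "\<omega>1 holomorphic_on punctured_ball R" and w2: "\<omega>2 holomorphic_on punctured_ball R2"
    and u: "u holomorphic_on ball 0 R" "\<And>z. z \<in> ball 0 R \<Longrightarrow> u z \<noteq> 0"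
    and rel: "\<And>z. z \<in> punctured_ball R \<Longrightarrow> \<omega>2 (t z) * deriv t z = \<omega>1 z + deriv u z / u z"
  shows "residue \<omega>1 0 = residue \<omega>2 0"
proof -
  obtain h1 where h1: "\<And>z. z \<in> punctured_ball R \<Longrightarrow> (h1 has_field_derivative \<omega>1 z - residue \<omega>1 0 / z) (at z)"
    using punctured_primitive[OF R w1] by metis
  obtain h2 where h2: "\<And>z. z \<in> punctured_ball R2 \<Longrightarrow> (h2 has_field_derivative \<omega>2 z - residue \<omega>2 0 / z) (at z)"
    using punctured_primitive[OF R2 w2] by metis
  \<comment> \<open>The quotient \<open>t z / z\<close> with its removable singularity filled in; it
    is non-zero at 0 because the derivative of \<open>t\<close> is.\<close>
  define v where "v = (\<lambda>z. if z = 0 then deriv t 0 else (t z - t 0) / (z - 0))"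
  have v: "v holomorphic_on ball 0 R" unfolding v_def
    by (rule pole_lemma[OF t(1)]) (use R in auto)
  have v0: "v z \<noteq> 0" if "z \<in> ball 0 R" for z
    using t(3)[OF that] t(4)[of z] that t(2) by (auto simp: v_def)
  obtain V where V: "V holomorphic_on ball 0 R" "\<And>z. z \<in> ball 0 R \<Longrightarrow> exp (V z) = v z"
    using holomorphic_logarithm_exists[OF convex_ball open_ball v v0, of 0] R by (metis centre_in_ball)
  obtain W where W: "W holomorphic_on ball 0 R" "\<And>z. z \<in> ball 0 R \<Longrightarrow> exp (W z) = u z"
    using holomorphic_logarithm_exists[OF convex_ball open_ball u, of 0] R by (metis centre_in_ball)
  have "((\<lambda>z. h1 z - h2 (t z) + W z - residue \<omega>2 0 * V z) has_field_derivative
      0 - (residue \<omega>1 0 - residue \<omega>2 0) / z) (at z)" if z: "z \<in> punctured_ball R" for z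
  proof -
    have zb: "z \<in> ball 0 R" "z \<noteq> 0" using z by auto
    have dt: "(t has_field_derivative deriv t z) (at z)" using holomorphic_derivI[OF t(1) open_ball zb(1)] .
    have du: "(u has_field_derivative deriv u z) (at z)" using holomorphic_derivI[OF u(1) open_ball zb(1)] .
    have dW: "(W has_field_derivative deriv u z / u z) (at z)"
      by (rule continuous_log_deriv[OF open_ball zb(1) holomorphic_on_imp_continuous_on[OF W(1)] W(2) du])
    have tz: "t z \<noteq> 0" using t(4)[OF z] by auto
    have "((\<lambda>z. t z / z) has_field_derivative (deriv t z * z - t z * 1) / (z * z)) (at z)"
      by (rule DERIV_divide[OF dt DERIV_ident zb(2)])
    then have dv: "(v has_field_derivative (deriv t z * z - t z) / (z * z)) (at z)"
      by (intro has_field_derivative_transform_within_open[of "\<lambda>z. t z / z" _ z "- {0}" v])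
        (use zb t(2) in \<open>auto simp: v_def\<close>)
    have dV: "(V has_field_derivative ((deriv t z * z - t z) / (z * z)) / v z) (at z)"
      by (rule continuous_log_deriv[OF open_ball zb(1) holomorphic_on_imp_continuous_on[OF V(1)] V(2) dv])
    have vz: "((deriv t z * z - t z) / (z * z)) / v z = deriv t z / t z - 1 / z"
      using zb t(2) tz by (simp add: v_def field_simps)
    have dh: "((\<lambda>z. h2 (t z)) has_field_derivative (\<omega>2 (t z) - residue \<omega>2 0 / t z) * deriv t z) (at z)"
      by (rule DERIV_chain2[OF h2[OF t(4)[OF z]] dt])
    have "((\<lambda>z. h1 z - h2 (t z) + W z - residue \<omega>2 0 * V z) has_field_derivative
       (\<omega>1 z - residue \<omega>1 0 / z) - (\<omega>2 (t z) - residue \<omega>2 0 / t z) * deriv t z + deriv u z / u z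
       - residue \<omega>2 0 * (((deriv t z * z - t z) / (z * z)) / v z)) (at z)"
      by (intro DERIV_diff DERIV_add DERIV_cmult h1[OF z] dh dW dV)
    moreover have "(\<omega>1 z - residue \<omega>1 0 / z) - (\<omega>2 (t z) - residue \<omega>2 0 / t z) * deriv t z + deriv u z / u z
       - residue \<omega>2 0 * (((deriv t z * z - t z) / (z * z)) / v z) = 0 - (residue \<omega>1 0 - residue \<omega>2 0) / z"
      unfolding vz left_diff_distrib rel[OF z] by (simp add: algebra_simps diff_divide_distrib)
    ultimately show ?thesis by simp
  qed
  from primitive_pole_zero[where f = "\<lambda>_. 0" and d = 0, OF R this] show ?thesis
    by (simp add: has_contour_integral_0)
qed

text \<open>Outside small discs about the zeros the phase of \<open>f\<close> extends to the plane minus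
  finitely many points, and the modulus extends by Tietze's theorem.\<close>

lemma extend_finitely_many_zeros:
  fixes f :: "complex \<Rightarrow> complex"
  assumes F: "compact F" and f: "continuous_on F f" and fin: "finite {z \<in> F. f z = 0}"
    and int: "{z \<in> F. f z = 0} \<subseteq> interior F"
  obtains g where "continuous_on UNIV g" "\<And>z. z \<in> F \<Longrightarrow> g z = f z" "finite {z. g z = 0}"
proof -
  let ?Z = "{z \<in> F. f z = 0}"
  define Q where "Q = interior F"
  have "\<exists>e>0. \<forall>z\<in>?Z. ball z e \<subseteq> Q"
  proof -
    have "\<forall>z\<in>?Z. \<exists>e>0. ball z e \<subseteq> Q" using int openE[OF open_interior] unfolding Q_def by (metis subsetD)
    then obtain e where e: "\<And>z. z \<in> ?Z \<Longrightarrow> e z > 0 \<and> ball z (e z) \<subseteq> Q" by metis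
    let ?e = "Min (insert 1 (e ` ?Z))"
    have "?e > 0" using fin e by (subst Min_gr_iff) auto
    moreover have "ball z ?e \<subseteq> Q" if "z \<in> ?Z" for z
    proof -
      have "?e \<le> e z" using fin that by (intro Min_le) auto
      then show ?thesis using e[OF that] subset_ball by blast
    qed
    ultimately show ?thesis by blast
  qed
  then obtain e where e: "e > 0" "\<And>z. z \<in> ?Z \<Longrightarrow> ball z e \<subseteq> F" using interior_subset Q_def by blast
  define B where "B = (\<Union>z\<in>?Z. ball z e)"
  have BF: "B \<subseteq> F" "open B" "?Z \<subseteq> B" using e by (auto simp: B_def)
  define F' where "F' = F - B"
  have F': "compact F'" unfolding F'_def using F BF(2) by (rule compact_diff)
  have nz: "f z \<noteq> 0" if "z \<in> F'" for z using that BF(3) by (auto simp: F'_def)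
  have cf: "continuous_on F' f" unfolding F'_def by (rule continuous_on_subset[OF f]) auto
  obtain K p where K: "finite K" "disjnt K F'" "continuous_on (UNIV - K) p"
      "p \<in> (UNIV - K) \<rightarrow> rel_frontier (cball 0 1)" "\<And>z. z \<in> F' \<Longrightarrow> p z = sgn (f z)"
  \<comment> \<open>The unit circle is the relative frontier of the unit disc, and the disc has the
    dimension of the plane; under this condition finitely many exceptional points suffice.\<close>
  proof (rule extend_map_affine_to_sphere_cofinite_simple[of F' "cball (0::complex) 1" UNIV "\<lambda>z. sgn (f z)"])
    show "continuous_on F' (\<lambda>z. sgn (f z))" using cf nz by (intro continuous_intros) auto
    show "(\<lambda>z. sgn (f z)) \<in> F' \<rightarrow> rel_frontier (cball 0 1)" using nz by (auto simp: norm_sgn)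
  qed (use F' aff_dim_cball[of 1 "0::complex"] in auto)
  have p1: "cmod (p z) = 1" if "z \<notin> K" for z using K(4) that by (auto simp: Pi_iff)
  have "compact ((\<lambda>z. ln (cmod (f z))) ` F')"
    by (intro compact_continuous_image F' continuous_intros cf) (use nz in auto)
  then obtain b where b: "\<And>z. z \<in> F' \<Longrightarrow> norm (ln (cmod (f z))) \<le> b"
    using compact_imp_bounded bounded_iff by (metis imageI)
  \<comment> \<open>Tietze's theorem asks for a non-negative bound; \<open>b\<close> may be negative
    when \<open>F'\<close> is empty, hence the absolute value.\<close>
  obtain v :: "complex \<Rightarrow> real" where v: "continuous_on UNIV v" "\<And>z. z \<in> F' \<Longrightarrow> v z = ln (cmod (f z))" "\<And>z. norm (v z) \<le> \<bar>b\<bar>"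
  proof (rule Tietze[of F' "\<lambda>z. ln (cmod (f z))" UNIV "\<bar>b\<bar>"])
    show "continuous_on F' (\<lambda>z. ln (cmod (f z)))" by (intro continuous_intros cf) (use nz in auto)
    show "closedin (top_of_set UNIV) F'" using F' compact_imp_closed by auto
    show "norm (ln (cmod (f z))) \<le> \<bar>b\<bar>" if "z \<in> F'" for z using b[OF that] by linarith
  qed auto
  \<comment> \<open>Exceptional points inside \<open>B\<close> are discarded, since the given
    \<open>f\<close> is kept there.\<close>
  define K' where "K' = K - B"
  have K'F: "K' \<inter> F = {}" using K(2) by (auto simp: K'_def F'_def disjnt_def)
  \<comment> \<open>A continuous factor that is 1 on \<open>F'\<close> and vanishes exactly at the
    remaining exceptional points; it turns them into zeros of the extension.\<close>
  obtain \<delta> :: "complex \<Rightarrow> real" where d: "continuous_on UNIV \<delta>" "\<And>z. z \<in> F' \<Longrightarrow> \<delta> z = 1" "\<And>z. \<delta> z = 0 \<longleftrightarrow> z \<in> K'"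
  proof (cases "F' = {}")
    case True
    have "continuous_on UNIV (\<lambda>z. if K' = {} then 1 else infdist z K')"
      by (cases "K' = {}") (auto intro!: continuous_intros)
    moreover have "(if K' = {} then 1 else infdist z K') = 0 \<longleftrightarrow> z \<in> K'" for z
      using K(1) in_closed_iff_infdist_zero[of K' z] by (auto simp: K'_def finite_imp_closed)
    ultimately show ?thesis using that[of "\<lambda>z. if K' = {} then 1 else infdist z K'"] True by auto
  next
    case ne: False
    show ?thesis
    proof (cases "K' = {}")
      case True then show ?thesis using that[of "\<lambda>_. 1"] by auto
    next
      case False
      have cl: "closed K'" "closed F'" using K(1) F' by (auto simp: K'_def finite_imp_closed compact_imp_closed)
      have disj: "infdist z F' + infdist z K' > 0" for z
      proof -
        have "infdist z F' \<noteq> 0 \<or> infdist z K' \<noteq> 0"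
          using in_closed_iff_infdist_zero[OF cl(1) False, of z] in_closed_iff_infdist_zero[OF cl(2) ne, of z]
            K'F by (auto simp: F'_def)
        then show ?thesis using infdist_nonneg[of z F'] infdist_nonneg[of z K'] by linarith
      qed
      let ?d = "\<lambda>z. infdist z K' / (infdist z F' + infdist z K')"
      have "continuous_on UNIV ?d" using disj by (auto intro!: continuous_intros simp: less_imp_neq[symmetric])
      moreover have "?d z = 1" if "z \<in> F'" for z using that disj[of z] by (simp add: in_closed_iff_infdist_zero[OF cl(2) ne])
      moreover have "?d z = 0 \<longleftrightarrow> z \<in> K'" for z
        using disj[of z] in_closed_iff_infdist_zero[OF cl(1) False, of z] by auto
      ultimately show ?thesis using that by blast
    qed
  qed
  define q where "q = (\<lambda>z. of_real (\<delta> z * exp (v z)) * p z)"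
  have qF: "q z = f z" if "z \<in> F'" for z
  proof -
    have "q z = of_real (cmod (f z)) * sgn (f z)" using that d v K nz by (simp add: q_def)
    then show ?thesis by (simp add: sgn_div_norm scaleR_conv_of_real nz[OF that])
  qed
  have cq: "continuous_on (UNIV - B) q"
  proof (rule continuous_on_eq_continuous_within[THEN iffD2, rule_format])
    fix z assume z: "z \<in> UNIV - B"
    show "continuous (at z within UNIV - B) q"
    proof (cases "z \<in> K")
      case False
      have "open (UNIV - K)" using K(1) finite_imp_closed by blast
      moreover have "continuous_on (UNIV - K) q" unfolding q_def
        by (intro continuous_intros K(3) continuous_on_subset[OF d(1)] continuous_on_subset[OF v(1)]) auto
      ultimately have "isCont q z" using False continuous_on_eq_continuous_at by blast
      then show ?thesis by (rule continuous_at_imp_continuous_within)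
    next
      case True
      then have zK: "z \<in> K'" using z by (auto simp: K'_def)
      then have q0: "q z = 0" using d(3) by (simp add: q_def)
      \<comment> \<open>The phase \<open>p\<close> may have no limit at \<open>z\<close>, but near
        \<open>z\<close> it has modulus 1 and the modulus factor is bounded, so
        \<open>\<delta>\<close> forces the product to 0.\<close>
      have "(\<delta> \<longlongrightarrow> \<delta> z) (at z)" using d(1) by (simp add: continuous_on_eq_continuous_at isCont_def)
      then have "((\<lambda>w. \<bar>\<delta> w\<bar> * exp \<bar>b\<bar>) \<longlongrightarrow> \<bar>\<delta> z\<bar> * exp \<bar>b\<bar>) (at z)"
        by (intro tendsto_intros)
      moreover have "\<bar>\<delta> z\<bar> * exp \<bar>b\<bar> = 0" using zK d(3)[of z] by simp
      ultimately have l0: "((\<lambda>w. \<bar>\<delta> w\<bar> * exp \<bar>b\<bar>) \<longlongrightarrow> 0) (at z)" by simp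
      have "closed (K - {z})" using K(1) by (intro finite_imp_closed) auto
      then have "open (- (K - {z}))" by (rule open_Compl)
      then have "\<forall>\<^sub>F w in at z. w \<notin> K"
        unfolding eventually_at_topological by (intro exI[of _ "- (K - {z})"]) auto
      then have "\<forall>\<^sub>F w in at z. norm (q w) \<le> \<bar>\<delta> w\<bar> * exp \<bar>b\<bar>"
      proof (rule eventually_mono)
        fix w assume "w \<notin> K"
        moreover have "exp (v w) \<le> exp \<bar>b\<bar>" using v(3)[of w] by simp
        ultimately show "norm (q w) \<le> \<bar>\<delta> w\<bar> * exp \<bar>b\<bar>"
          using p1[of w] by (simp add: q_def norm_mult mult_left_mono)
      qed
      then have "(q \<longlongrightarrow> 0) (at z)" by (rule Lim_null_comparison[OF _ l0])
      then have "isCont q z" using q0 by (simp add: isCont_def)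
      then show ?thesis by (rule continuous_at_imp_continuous_within)
    qed
  qed
  define g where "g = (\<lambda>z. if z \<in> F then f z else q z)"
  have gq: "g z = q z" if "z \<in> UNIV - B" for z using that qF by (auto simp: g_def F'_def)
  show ?thesis
  proof (rule that)
    have "continuous_on (F \<union> (UNIV - B)) g"
    proof (rule continuous_on_closed_Un)
      show "closed F" "closed (UNIV - B)" using F BF(2) by (auto simp: compact_imp_closed)
      show "continuous_on F g" by (rule continuous_on_eq[OF f]) (simp add: g_def)
      show "continuous_on (UNIV - B) g" by (rule continuous_on_eq[OF cq]) (simp add: gq)
    qed
    moreover have "F \<union> (UNIV - B) = UNIV" using BF by auto
    ultimately show "continuous_on UNIV g" by simp
    show "g z = f z" if "z \<in> F" for z using that by (simp add: g_def)
    have "{z. g z = 0} \<subseteq> ?Z \<union> K"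
    proof
      fix z assume z: "z \<in> {z. g z = 0}"
      show "z \<in> ?Z \<union> K"
      proof (cases "z \<in> F")
        case False
        then have q0: "q z = 0" "z \<notin> B" using z BF by (auto simp: g_def)
        have "z \<in> K" 
        proof (rule ccontr)
          assume "z \<notin> K"
          then have "p z \<noteq> 0" using p1 by force
          moreover have "\<delta> z \<noteq> 0" using d(3) \<open>z \<notin> K\<close> by (auto simp: K'_def)
          ultimately show False using q0 by (simp add: q_def)
        qed
        then show ?thesis by blast
      qed (use z in \<open>auto simp: g_def\<close>)
    qed
    then show "finite {z. g z = 0}" using fin K(1) finite_subset by blast
  qed
qed

section \<open>Holomorphic functions of two variables\<close>

definition D1 :: "(cplane \<Rightarrow> complex) \<Rightarrow> cplane \<Rightarrow> complex" where
  "D1 f z = frechet_derivative f (at z) (1, 0)"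
definition D2 :: "(cplane \<Rightarrow> complex) \<Rightarrow> cplane \<Rightarrow> complex" where
  "D2 f z = frechet_derivative f (at z) (0, 1)"

lemma hol2_derivI:
  assumes "(f has_derivative (\<lambda>(h, k). a * h + b * k)) (at z)"
  shows "D1 f z = a" "D2 f z = b"
  by (simp_all add: D1_def D2_def frechet_derivative_at[OF assms, symmetric])

lemma hol2_has_derivative:
  assumes "holomorphic2_on f S" "z \<in> S"
  shows "(f has_derivative (\<lambda>(h, k). D1 f z * h + D2 f z * k)) (at z)"
  using assms hol2_derivI unfolding holomorphic2_on_def by metis

lemma hol2_continuous: "holomorphic2_on f S \<Longrightarrow> continuous_on S f"
  using has_derivative_continuous hol2_has_derivative continuous_at_imp_continuous_on by metis

lemma hol2_subset: "holomorphic2_on f S \<Longrightarrow> T \<subseteq> S \<Longrightarrow> holomorphic2_on f T"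
  by (auto simp: holomorphic2_on_def)

lemma hol2_partial1:
  assumes "holomorphic2_on f S" "(x, y) \<in> S"
  shows "((\<lambda>x. f (x, y)) has_field_derivative D1 f (x, y)) (at x)"
proof -
  have "((\<lambda>x. (x, y)) has_derivative (\<lambda>h. (h, 0))) (at x)" by (auto intro!: derivative_eq_intros)
  from has_derivative_compose[OF this hol2_has_derivative[OF assms]]
  show ?thesis by (simp add: has_field_derivative_def)
qed

lemma hol2_partial2:
  assumes "holomorphic2_on f S" "(x, y) \<in> S"
  shows "((\<lambda>y. f (x, y)) has_field_derivative D2 f (x, y)) (at y)"
proof -
  have "((\<lambda>y. (x, y)) has_derivative (\<lambda>k. (0, k))) (at y)" by (auto intro!: derivative_eq_intros)
  from has_derivative_compose[OF this hol2_has_derivative[OF assms]]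
  show ?thesis by (simp add: has_field_derivative_def)
qed

section \<open>Osgood's lemma and holomorphy of the partial derivatives\<close>

lemma polydisc:
  assumes "open S" "(x, y) \<in> S"
  obtains r where "r > 0" "cball x r \<times> cball y r \<subseteq> (S :: cplane set)"
proof -
  obtain A B where AB: "open A" "open B" "x \<in> A" "y \<in> B" "A \<times> B \<subseteq> S"
    using assms by (auto elim: open_prod_elim)
  obtain a b where ab: "a > 0" "cball x a \<subseteq> A" "b > 0" "cball y b \<subseteq> B"
    using AB open_contains_cball by metis
  have "cball x (min a b) \<subseteq> A" "cball y (min a b) \<subseteq> B"
    using subset_cball[of "min a b" a x] subset_cball[of "min a b" b y] ab by auto
  then have "cball x (min a b) \<times> cball y (min a b) \<subseteq> S" using AB(5) by blast
  then show ?thesis using that[of "min a b"] ab by auto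
qed

text \<open>The integrand of Cauchy's formula for the derivative in \<open>y\<close>, with the
  circle parametrised by the unit interval and the factor \<open>1 / (2 * pi * \<i>)\<close>
  included. As an integral with parameters, the partial derivative inherits continuity and
  holomorphy from \<open>f\<close>.\<close>

definition cauchy_D2 :: "(cplane \<Rightarrow> complex) \<Rightarrow> complex \<Rightarrow> real \<Rightarrow> complex \<Rightarrow> complex \<Rightarrow> real \<Rightarrow> complex" where
  "cauchy_D2 f y0 r x y t = f (x, circlepath y0 r t) / (circlepath y0 r t - y)\<^sup>2 * (2 * pi * \<i> * r * exp (2 * of_real pi * \<i> * t))
     / (2 * of_real pi * \<i>)"

lemma cauchy_D2_cont:
  assumes "continuous_on (X \<times> cball y0 r) f" "r > 0"
  shows "continuous_on ((X \<times> ball y0 r) \<times> cbox 0 1) (\<lambda>(z, t). cauchy_D2 f y0 r (fst z) (snd z) t)"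
proof -
  have c: "circlepath y0 r t \<in> cball y0 r" for t
    using assms(2) by (simp add: circlepath dist_norm norm_mult)
  have ct: "continuous_on A (\<lambda>w. circlepath y0 r (snd w))" for A :: "(cplane \<times> real) set"
    unfolding circlepath by (intro continuous_intros)
  have nz: "circlepath y0 r t - y \<noteq> 0" if "y \<in> ball y0 r" for y t
    using that assms(2) by (auto simp: circlepath dist_norm norm_mult norm_minus_commute)
  have "continuous_on ((X \<times> ball y0 r) \<times> cbox 0 1) (\<lambda>w. f (fst (fst w), circlepath y0 r (snd w)))"
    by (rule continuous_on_compose2[OF assms(1)]) (use c in \<open>auto intro!: continuous_intros ct\<close>)
  then show ?thesis unfolding split_beta cauchy_D2_def
    by (intro continuous_intros ct) (use nz in auto)
qed

lemma cauchy_D2_integral: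
  assumes "continuous_on (cball y0 r) (\<lambda>y. f (x, y))" "(\<lambda>y. f (x, y)) holomorphic_on ball y0 r" "y \<in> ball y0 r"
  shows "((\<lambda>y. f (x, y)) has_field_derivative integral (cbox 0 1) (cauchy_D2 f y0 r x y)) (at y)"
proof -
  have "1 / (2 * of_real pi * \<i>) * contour_integral (circlepath y0 r) (\<lambda>u. f (x, u) / (u - y)\<^sup>2)
      = integral (cbox 0 1) (cauchy_D2 f y0 r x y)"
    unfolding contour_integral_integral vector_derivative_circlepath cauchy_D2_def cbox_interval
      integral_divide by simp
  then show ?thesis using Cauchy_derivative_integral_circlepath(2)[OF assms] by simp
qed

text \<open>Cauchy's formula makes the partial derivative in \<open>y\<close> jointly continuous.
  Existence of one partial derivative together with continuity of the other one implies joint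
  differentiability.\<close>

lemma holomorphic2_osgood:
  assumes S: "open S" and c: "continuous_on S f"
    and 1: "\<And>x y. (x, y) \<in> S \<Longrightarrow> (\<lambda>x. f (x, y)) field_differentiable at x"
    and 2: "\<And>x y. (x, y) \<in> S \<Longrightarrow> (\<lambda>y. f (x, y)) field_differentiable at y"
  shows "holomorphic2_on f S"
  unfolding holomorphic2_on_def
proof
  fix z assume "z \<in> S"
  then obtain x0 y0 where z: "z = (x0, y0)" "(x0, y0) \<in> S" by (cases z) auto
  obtain r where r: "r > 0" "cball x0 r \<times> cball y0 r \<subseteq> S" using polydisc[OF S z(2)] .
  let ?X = "ball x0 r" and ?Y = "ball y0 r"
  define J where "J = (\<lambda>x y. integral (cbox 0 1) (cauchy_D2 f y0 r x y))"
  have J: "((\<lambda>y. f (x, y)) has_field_derivative J x y) (at y)" if "x \<in> ?X" "y \<in> ?Y" for x y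
    unfolding J_def
  proof (rule cauchy_D2_integral[OF _ _ that(2)])
    show "continuous_on (cball y0 r) (\<lambda>y. f (x, y))"
      by (rule continuous_on_compose2[OF c]) (use r that in \<open>auto intro!: continuous_intros\<close>)
    show "(\<lambda>y. f (x, y)) holomorphic_on ball y0 r"
    proof (rule holomorphic_onI)
      fix w assume w: "w \<in> ball y0 r"
      have "(x, w) \<in> cball x0 r \<times> cball y0 r" using that(1) w by simp
      then have "(x, w) \<in> S" using r(2) by blast
      from 2[OF this] show "(\<lambda>y. f (x, y)) field_differentiable at w within ball y0 r"
        by (rule field_differentiable_at_within)
    qed
  qed
  have "continuous_on (?X \<times> ?Y) (\<lambda>z. integral (cbox 0 1) (\<lambda>t. cauchy_D2 f y0 r (fst z) (snd z) t))"
    by (rule integral_continuous_on_param, rule cauchy_D2_cont[OF continuous_on_subset[OF c] r(1)]) (use r in auto)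
  then have cJ: "continuous_on (?X \<times> ?Y) (\<lambda>z. J (fst z) (snd z))" by (simp add: J_def)
  obtain a where a: "((\<lambda>x. f (x, y0)) has_field_derivative a) (at x0)"
    using 1[OF z(2)] by (auto simp: field_differentiable_def)
  have "((\<lambda>(x, y). f (x, y)) has_derivative (\<lambda>(tx, ty). (*) a tx + blinfun_apply (blinfun_mult_right (J x0 y0)) ty)) (at (x0, y0) within ?X \<times> ?Y)"
  proof (rule has_derivative_partialsI[where f = "\<lambda>x y. f (x, y)" and fy = "\<lambda>x y. blinfun_mult_right (J x y)"])
    show "((\<lambda>x. f (x, y0)) has_derivative (*) a) (at x0 within ?X)"
      using a by (simp add: has_field_derivative_def has_derivative_at_withinI)
    show "((\<lambda>y. f (x, y)) has_derivative blinfun_apply (blinfun_mult_right (J x y))) (at y within ?Y)"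
      if "x \<in> ?X" "y \<in> ?Y" for x y
      using J[OF that] by (simp add: has_field_derivative_def has_derivative_at_withinI blinfun_mult_right.rep_eq)
    have "continuous_on (?X \<times> ?Y) (\<lambda>z. blinfun_mult_right (J (fst z) (snd z)))"
      by (rule bounded_linear.continuous_on[OF bounded_linear_blinfun_mult_right cJ])
    then show "continuous (at (x0, y0) within ?X \<times> ?Y) (\<lambda>(x, y). blinfun_mult_right (J x y))"
      using r by (simp add: continuous_on_eq_continuous_within case_prod_unfold)
  qed (use r in auto)
  moreover have "at (x0, y0) within ?X \<times> ?Y = at (x0, y0)"
    by (rule at_within_open) (use r in \<open>auto intro: open_Times\<close>)
  ultimately show "\<exists>a b. (f has_derivative (\<lambda>(h, k). a * h + b * k)) (at z)"
    unfolding z(1) by (auto simp: blinfun_mult_right.rep_eq)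
qed

lemma D2_local:
  assumes S: "open S" and f: "holomorphic2_on f S" and z: "(x0, y0) \<in> S"
  obtains r where "r > 0" "cball x0 r \<times> cball y0 r \<subseteq> S"
    "\<And>x y. x \<in> ball x0 r \<Longrightarrow> y \<in> ball y0 r \<Longrightarrow> D2 f (x, y) = integral (cbox 0 1) (cauchy_D2 f y0 r x y)"
proof -
  obtain r where r: "r > 0" "cball x0 r \<times> cball y0 r \<subseteq> S" using polydisc[OF S z] .
  have "D2 f (x, y) = integral (cbox 0 1) (cauchy_D2 f y0 r x y)" if xy: "x \<in> ball x0 r" "y \<in> ball y0 r" for x y
  proof (rule DERIV_unique)
    have *: "(x, y) \<in> S" if "y \<in> cball y0 r" for y using that r xy by auto
    show "((\<lambda>y. f (x, y)) has_field_derivative D2 f (x, y)) (at y)"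
      by (rule hol2_partial2[OF f *]) (use xy in auto)
    show "((\<lambda>y. f (x, y)) has_field_derivative integral (cbox 0 1) (cauchy_D2 f y0 r x y)) (at y)"
    proof (rule cauchy_D2_integral[OF _ _ xy(2)])
      show "continuous_on (cball y0 r) (\<lambda>y. f (x, y))"
        by (rule continuous_on_compose2[OF hol2_continuous[OF f]]) (use * in \<open>auto intro!: continuous_intros\<close>)
      show "(\<lambda>y. f (x, y)) holomorphic_on ball y0 r"
      proof (rule holomorphic_onI)
        fix w assume "w \<in> ball y0 r"
        then have "w \<in> cball y0 r" by simp
        then show "(\<lambda>y. f (x, y)) field_differentiable at w within ball y0 r"
          using hol2_partial2[OF f *] field_differentiable_at_within unfolding field_differentiable_def by blast
      qed
    qed
  qed
  then show ?thesis using that r by blast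
qed

lemma D2_continuous:
  assumes S: "open S" and f: "holomorphic2_on f S"
  shows "continuous_on S (D2 f)"
proof (rule continuous_at_imp_continuous_on, rule ballI)
  fix z assume "z \<in> S"
  then obtain x0 y0 where z: "z = (x0, y0)" "(x0, y0) \<in> S" by (cases z) auto
  obtain r where r: "r > 0" "cball x0 r \<times> cball y0 r \<subseteq> S"
    "\<And>x y. x \<in> ball x0 r \<Longrightarrow> y \<in> ball y0 r \<Longrightarrow> D2 f (x, y) = integral (cbox 0 1) (cauchy_D2 f y0 r x y)"
    using D2_local[OF S f z(2)] by blast
  have "continuous_on (ball x0 r \<times> ball y0 r) (\<lambda>z. integral (cbox 0 1) (\<lambda>t. cauchy_D2 f y0 r (fst z) (snd z) t))"
    by (rule integral_continuous_on_param, rule cauchy_D2_cont[OF continuous_on_subset[OF hol2_continuous[OF f]] r(1)])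
      (use r in auto)
  then have "continuous_on (ball x0 r \<times> ball y0 r) (D2 f)"
    by (rule continuous_on_eq) (use r(3) in auto)
  moreover have "open (ball x0 r \<times> ball y0 r)" "z \<in> ball x0 r \<times> ball y0 r" using r z by (auto intro: open_Times)
  ultimately show "isCont (D2 f) z" using continuous_on_eq_continuous_at by blast
qed

lemma bounded_linear_swap: "bounded_linear (prod.swap :: cplane \<Rightarrow> cplane)"
proof -
  have "bounded_linear (\<lambda>z::cplane. (snd z, fst z))"
    by (intro bounded_linear_Pair bounded_linear_fst bounded_linear_snd)
  moreover have "(\<lambda>z::cplane. (snd z, fst z)) = prod.swap" by (simp add: fun_eq_iff)
  ultimately show ?thesis by simp
qed

lemma open_swap: "open S \<Longrightarrow> open (prod.swap ` (S :: cplane set))"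
proof -
  assume "open S"
  moreover have "prod.swap ` S = prod.swap -` S"
  proof (intro equalityI subsetI)
    fix z assume "z \<in> prod.swap -` S"
    then show "z \<in> prod.swap ` S" by (intro image_eqI[of _ _ "prod.swap z"]) auto
  qed auto
  ultimately show ?thesis
    using open_vimage linear_continuous_on[OF bounded_linear_swap] by metis
qed

text \<open>Exchanging the variables transfers results on \<open>D2\<close> to \<open>D1\<close>,
  and later exchanges the two branches at a corner.\<close>

lemma hol2_swap:
  assumes "holomorphic2_on f S"
  shows "holomorphic2_on (\<lambda>z. f (prod.swap z)) (prod.swap ` S)"
    "z \<in> S \<Longrightarrow> D2 (\<lambda>z. f (prod.swap z)) (prod.swap z) = D1 f z"
    "z \<in> S \<Longrightarrow> D1 (\<lambda>z. f (prod.swap z)) (prod.swap z) = D2 f z"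
proof -
  have d: "((\<lambda>z. f (prod.swap z)) has_derivative (\<lambda>(h, k). D2 f z * h + D1 f z * k)) (at (prod.swap z))" if "z \<in> S" for z
  proof -
    have "(f has_derivative (\<lambda>(h, k). D1 f z * h + D2 f z * k)) (at (prod.swap (prod.swap z)))"
      using hol2_has_derivative[OF assms that] by simp
    from has_derivative_compose[OF bounded_linear_imp_has_derivative[OF bounded_linear_swap] this]
    show ?thesis by (simp add: case_prod_unfold add.commute)
  qed
  show "holomorphic2_on (\<lambda>z. f (prod.swap z)) (prod.swap ` S)"
    unfolding holomorphic2_on_def using d by blast
  show "z \<in> S \<Longrightarrow> D2 (\<lambda>z. f (prod.swap z)) (prod.swap z) = D1 f z"
    "z \<in> S \<Longrightarrow> D1 (\<lambda>z. f (prod.swap z)) (prod.swap z) = D2 f z"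
    using hol2_derivI[OF d] by auto
qed

lemma D1_continuous:
  assumes S: "open S" and f: "holomorphic2_on f S"
  shows "continuous_on S (D1 f)"
proof -
  have "continuous_on (prod.swap ` S) (D2 (\<lambda>z. f (prod.swap z)))"
    by (rule D2_continuous[OF open_swap[OF S] hol2_swap(1)[OF f]])
  then have "continuous_on S (\<lambda>z. D2 (\<lambda>z. f (prod.swap z)) (prod.swap z))"
    by (rule continuous_on_compose2) (auto intro: linear_continuous_on[OF bounded_linear_swap])
  then show ?thesis by (rule continuous_on_eq) (simp add: hol2_swap(2)[OF f])
qed

text \<open>By Osgood's lemma the two variables can be treated separately: in \<open>x\<close>
  Cauchy's integral is differentiated under the integral sign, and in \<open>y\<close> this is the
  derivative of a holomorphic function of one variable.\<close>

lemma D2_hol2: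
  assumes S: "open S" and f: "holomorphic2_on f S"
  shows "holomorphic2_on (D2 f) S"
proof (rule holomorphic2_osgood[OF S D2_continuous[OF S f]])
  fix x0 y0 assume z: "(x0, y0) \<in> S"
  obtain r where r: "r > 0" "cball x0 r \<times> cball y0 r \<subseteq> S"
    "\<And>x y. x \<in> ball x0 r \<Longrightarrow> y \<in> ball y0 r \<Longrightarrow> D2 f (x, y) = integral (cbox 0 1) (cauchy_D2 f y0 r x y)"
    using D2_local[OF S f z] by blast
  have c: "circlepath y0 r t \<in> cball y0 r" for t
    using r(1) by (simp add: circlepath dist_norm norm_mult)
  have in_S: "(x, circlepath y0 r t) \<in> S" if "x \<in> ball x0 r" for x t using r(2) c[of t] that by auto
  have cn: "continuous_on (ball x0 r \<times> cbox 0 1) (\<lambda>(x, t). cauchy_D2 g y0 r x y0 t)" if g: "continuous_on S g" for g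
  proof -
    have "continuous_on ((ball x0 r \<times> ball y0 r) \<times> cbox 0 1) (\<lambda>(z, t). cauchy_D2 g y0 r (fst z) (snd z) t)"
      by (rule cauchy_D2_cont[OF continuous_on_subset[OF g] r(1)]) (use r in auto)
    then have "continuous_on (ball x0 r \<times> cbox 0 1) (\<lambda>w. (\<lambda>(z, t). cauchy_D2 g y0 r (fst z) (snd z) t) ((fst w, y0), snd w))"
      by (rule continuous_on_compose2) (use r in \<open>auto intro!: continuous_intros\<close>)
    then show ?thesis by (simp add: split_beta)
  qed
  have "(\<lambda>x. integral (cbox 0 1) (cauchy_D2 f y0 r x y0)) field_differentiable at x0 within ball x0 r"
  proof (rule leibniz_rule_field_differentiable[where fx = "\<lambda>x t. cauchy_D2 (D1 f) y0 r x y0 t"])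
    fix x t assume x: "x \<in> ball x0 r"
    have "((\<lambda>x. f (x, circlepath y0 r t)) has_field_derivative D1 f (x, circlepath y0 r t)) (at x within ball x0 r)"
      by (rule has_field_derivative_at_within[OF hol2_partial1[OF f in_S[OF x]]])
    from DERIV_cmult_right[OF this, of "1 / (circlepath y0 r t - y0)\<^sup>2 * (2 * pi * \<i> * r * exp (2 * of_real pi * \<i> * t)) / (2 * of_real pi * \<i>)"]
    show "((\<lambda>x. cauchy_D2 f y0 r x y0 t) has_field_derivative cauchy_D2 (D1 f) y0 r x y0 t) (at x within ball x0 r)"
      by (simp add: cauchy_D2_def)
  next
    fix x assume x: "x \<in> ball x0 r"
    have "continuous_on (cbox 0 1) (\<lambda>t. (\<lambda>(x, t). cauchy_D2 f y0 r x y0 t) (x, t))"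
      by (rule continuous_on_compose2[OF cn[OF hol2_continuous[OF f]]]) (use x in \<open>auto intro!: continuous_intros\<close>)
    then show "cauchy_D2 f y0 r x y0 integrable_on cbox 0 1" by (intro integrable_continuous) simp
  qed (use r cn[OF D1_continuous[OF S f]] in auto)
  then obtain d where d: "((\<lambda>x. integral (cbox 0 1) (cauchy_D2 f y0 r x y0)) has_field_derivative d) (at x0)"
    using r(1) at_within_open[of x0 "ball x0 r"] by (auto simp: field_differentiable_def)
  have "((\<lambda>x. D2 f (x, y0)) has_field_derivative d) (at x0)"
    by (rule has_field_derivative_transform_within_open[OF d open_ball[of x0 r]]) (use r in auto)
  then show "(\<lambda>x. D2 f (x, y0)) field_differentiable at x0"
    unfolding field_differentiable_def by blast
next
  fix x0 y0 assume z: "(x0, y0) \<in> S"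
  obtain r where r: "r > 0" "cball x0 r \<times> cball y0 r \<subseteq> S" using polydisc[OF S z] .
  have d: "((\<lambda>y. f (x0, y)) has_field_derivative D2 f (x0, y)) (at y)" if "y \<in> ball y0 r" for y
    by (rule hol2_partial2[OF f]) (use r that in auto)
  then have "(\<lambda>y. f (x0, y)) holomorphic_on ball y0 r" unfolding holomorphic_on_open[OF open_ball] by blast
  then have "deriv (\<lambda>y. f (x0, y)) holomorphic_on ball y0 r" by (rule holomorphic_deriv) simp
  then have "(\<lambda>y. D2 f (x0, y)) holomorphic_on ball y0 r"
    by (rule holomorphic_transform) (use d DERIV_imp_deriv in auto)
  then show "(\<lambda>y. D2 f (x0, y)) field_differentiable at y0"
    using r(1) holomorphic_on_imp_differentiable_at by (meson centre_in_ball open_ball)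
qed

lemma D1_hol2:
  assumes S: "open S" and f: "holomorphic2_on f S"
  shows "holomorphic2_on (D1 f) S"
proof -
  have "holomorphic2_on (D2 (\<lambda>z. f (prod.swap z))) (prod.swap ` S)"
    by (rule D2_hol2[OF open_swap[OF S] hol2_swap(1)[OF f]])
  from hol2_swap(1)[OF this] have h: "holomorphic2_on (\<lambda>z. D2 (\<lambda>z. f (prod.swap z)) (prod.swap z)) S"
    by (simp add: image_comp o_def)
  show ?thesis unfolding holomorphic2_on_def
  proof
    fix z assume z: "z \<in> S"
    obtain a b where "((\<lambda>z. D2 (\<lambda>z. f (prod.swap z)) (prod.swap z)) has_derivative (\<lambda>(h, k). a * h + b * k)) (at z)"
      using h z by (auto simp: holomorphic2_on_def)
    then have "(D1 f has_derivative (\<lambda>(h, k). a * h + b * k)) (at z)"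
      by (rule has_derivative_transform_within_open[OF _ S z]) (simp add: hol2_swap(2)[OF f])
    then show "\<exists>a b. (D1 f has_derivative (\<lambda>(h, k). a * h + b * k)) (at z)" by blast
  qed
qed

text \<open>A holomorphic function vanishing on the axis \<open>y = 0\<close> is divisible by
  \<open>y\<close>. Once the quotient is known to be continuous, Osgood's lemma applies. The lemma
  produces the factor \<open>B\<close> of an invariant field, the normal factor of a change of
  adapted charts and the factor \<open>x\<close> at a corner.\<close>

lemma hol2_divide_y:
  assumes S: "open S" and f: "holomorphic2_on f S" and f0': "\<forall>x. (x, 0) \<in> S \<longrightarrow> f (x, 0) = 0"
  defines "B \<equiv> \<lambda>(x, y). if y = 0 then D2 f (x, y) else f (x, y) / y"
  shows "holomorphic2_on B S" "(x, y) \<in> S \<Longrightarrow> f (x, y) = y * B (x, y)" "B (x, 0) = D2 f (x, 0)"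
proof -
  note f0 = f0'[rule_format]
  show "(x, y) \<in> S \<Longrightarrow> f (x, y) = y * B (x, y)" "B (x, 0) = D2 f (x, 0)" using f0 by (auto simp: B_def)
  have cont: "continuous_on S B"
  proof (rule continuous_at_imp_continuous_on, rule ballI)
    fix z assume "z \<in> S"
    then obtain x0 y0 where z: "z = (x0, y0)" "(x0, y0) \<in> S" by (cases z) auto
    show "isCont B z"
    proof (cases "y0 = 0")
      case False
      let ?T = "S \<inter> {w. snd w \<noteq> 0}"
      have oT: "open ?T" by (intro open_Int S open_Collect_neq continuous_intros)
      have "continuous_on ?T (\<lambda>w. f w / snd w)"
        by (intro continuous_intros continuous_on_subset[OF hol2_continuous[OF f]]) auto
      then have "continuous_on ?T B" by (rule continuous_on_eq) (auto simp: B_def split_beta)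
      then show ?thesis using oT z False continuous_on_eq_continuous_at by fastforce
    next
      case True
      define c where "c = D2 f (x0, 0)"
      show ?thesis unfolding continuous_at_eps_delta
      proof (intro allI impI)
        fix e :: real assume e: "e > 0"
        have "isCont (D2 f) (x0, 0)"
          using D2_continuous[OF S f] S z True continuous_on_eq_continuous_at by blast
        then obtain d where d: "d > 0" "\<And>w. dist w (x0, 0) < d \<Longrightarrow> dist (D2 f w) c < e / 2"
          using e unfolding continuous_at_eps_delta c_def by (meson half_gt_zero)
        obtain r where r: "r > 0" "cball x0 r \<times> cball 0 r \<subseteq> S" using polydisc[OF S z(2)] True by blast
        define q where "q = min (d / 2) r"
        have q: "q > 0" using d r by (simp add: q_def)
        \<comment> \<open>The mean value inequality in \<open>y\<close> alone, with
          \<open>D2 f\<close> close to its value \<open>c\<close> at the centre, makes the quotient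
          close to \<open>c\<close> uniformly in \<open>x\<close>.\<close>
        have near: "norm (f (x, y) - c * y) \<le> e / 2 * norm y" if xy: "x \<in> ball x0 q" "y \<in> ball 0 q" for x y
        proof -
          have "norm ((f (x, y) - c * y) - (f (x, 0) - c * 0)) \<le> e / 2 * norm (y - 0)"
          proof (rule field_differentiable_bound[where S = "ball 0 q" and f = "\<lambda>y. f (x, y) - c * y" and f' = "\<lambda>y. D2 f (x, y) - c"])
            fix w assume w: "w \<in> ball (0::complex) q"
            have S': "(x, w) \<in> S" using r(2) w xy by (auto simp: q_def)
            show "((\<lambda>y. f (x, y) - c * y) has_field_derivative D2 f (x, w) - c) (at w within ball 0 q)"
              by (rule derivative_eq_intros has_field_derivative_at_within[OF hol2_partial2[OF f S']] refl | simp)+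
            have "dist (x, w) (x0, 0) \<le> dist x x0 + dist w 0"
              by (simp add: dist_Pair_Pair sqrt_sum_squares_le_sum)
            also have "\<dots> < d" using w xy by (auto simp: q_def dist_commute)
            finally show "norm (D2 f (x, w) - c) \<le> e / 2" using d(2) by (auto simp: dist_norm less_imp_le)
          qed (use q xy in auto)
          moreover have "f (x, 0) = 0" using r(2) xy q by (intro f0) (auto simp: q_def)
          ultimately show ?thesis by simp
        qed
        have "dist (B w) (B z) < e" if w: "dist w z < q" for w
        proof -
          obtain x y where xy: "w = (x, y)" by (cases w)
          have b: "x \<in> ball x0 q" "y \<in> ball 0 q"
            using w dist_fst_le[of w z] dist_snd_le[of w z] by (auto simp: xy z True dist_commute)
          have Bz: "B z = c" by (simp add: B_def z True c_def)
          show ?thesis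
          proof (cases "y = 0")
            case True
            have "dist w (x0, 0) < d" using w d by (simp add: q_def z \<open>y0 = 0\<close>)
            then show ?thesis using d(2)[of w] e unfolding Bz by (simp add: B_def xy True)
          next
            case False
            have "norm (B w - c) = norm (f (x, y) - c * y) / norm y"
              using False by (simp add: B_def xy field_simps flip: norm_divide)
            also have "\<dots> \<le> e / 2" using near[OF b] False by (simp add: divide_le_eq)
            finally show ?thesis using e by (simp add: Bz dist_norm)
          qed
        qed
        then show "\<exists>d>0. \<forall>w. dist w z < d \<longrightarrow> dist (B w) (B z) < e" using q by blast
      qed
    qed
  qed
  show "holomorphic2_on B S"
  proof (rule holomorphic2_osgood[OF S cont])
    fix x y assume z: "(x, y) \<in> S"
    show "(\<lambda>x. B (x, y)) field_differentiable at x"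
    proof (cases "y = 0")
      case True
      show ?thesis using hol2_partial1[OF D2_hol2[OF S f] z] True
        by (auto simp: B_def field_differentiable_def)
    next
      case False
      then show ?thesis using DERIV_cdivide[OF hol2_partial1[OF f z], of y]
        by (auto simp: B_def field_differentiable_def)
    qed
    show "(\<lambda>y. B (x, y)) field_differentiable at y"
    proof -
      obtain r where r: "r > 0" "cball x r \<times> cball y r \<subseteq> S" using polydisc[OF S z] .
      have d: "((\<lambda>y. f (x, y)) has_field_derivative D2 f (x, w)) (at w)" if "w \<in> ball y r" for w
        by (rule hol2_partial2[OF f]) (use r that in auto)
      then have h: "(\<lambda>y. f (x, y)) holomorphic_on ball y r" unfolding holomorphic_on_open[OF open_ball] by blast
      show ?thesis
      proof (cases "y = 0")
        case True
        have "(\<lambda>w. if w = 0 then deriv (\<lambda>y. f (x, y)) 0 else (f (x, w) - f (x, 0)) / (w - 0)) holomorphic_on ball y r"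
          by (rule pole_lemma[OF h]) (use r True in auto)
        then have "(\<lambda>w. B (x, w)) holomorphic_on ball y r"
          by (rule holomorphic_transform) (use DERIV_imp_deriv[OF d] True f0[of x] z in \<open>auto simp: B_def\<close>)
        then show ?thesis using r(1) holomorphic_on_imp_differentiable_at by (meson centre_in_ball open_ball)
      next
        case False
        have "((\<lambda>w. f (x, w) / w) has_field_derivative (D2 f (x, y) * y - f (x, y) * 1) / (y * y)) (at y)"
          by (rule DERIV_divide[OF hol2_partial2[OF f z] DERIV_ident False])
        then have "((\<lambda>w. B (x, w)) has_field_derivative (D2 f (x, y) * y - f (x, y) * 1) / (y * y)) (at y)"
          by (rule has_field_derivative_transform_within_open[of _ _ _ "- {0}"]) (use False in \<open>auto simp: B_def\<close>)
        then show ?thesis by (auto simp: field_differentiable_def)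
      qed
    qed
  qed
qed

section \<open>Algebra and composition of holomorphic functions of two variables\<close>

lemma hol2_const: "holomorphic2_on (\<lambda>_. c) S"
  unfolding holomorphic2_on_def by (intro ballI exI[of _ 0]) (simp add: case_prod_unfold)

lemma hol2_fst: "holomorphic2_on fst S" and hol2_snd: "holomorphic2_on snd S"
proof -
  have "(\<lambda>(h, k). 1 * h + 0 * k) = (fst :: cplane \<Rightarrow> complex)" "(\<lambda>(h, k). 0 * h + 1 * k) = (snd :: cplane \<Rightarrow> complex)"
    by auto
  then show "holomorphic2_on fst S" "holomorphic2_on snd S" unfolding holomorphic2_on_def
    by (metis bounded_linear_fst bounded_linear_imp_has_derivative, metis bounded_linear_snd bounded_linear_imp_has_derivative)
qed

lemma hol2_add:
  assumes "holomorphic2_on f S" "holomorphic2_on g S"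
  shows "holomorphic2_on (\<lambda>z. f z + g z) S"
  unfolding holomorphic2_on_def
proof
  fix z assume z: "z \<in> S"
  have "((\<lambda>z. f z + g z) has_derivative (\<lambda>(h, k). (D1 f z + D1 g z) * h + (D2 f z + D2 g z) * k)) (at z)"
    by (rule derivative_eq_intros hol2_has_derivative[OF assms(1) z] hol2_has_derivative[OF assms(2) z])+
      (auto simp: algebra_simps)
  then show "\<exists>a b. ((\<lambda>z. f z + g z) has_derivative (\<lambda>(h, k). a * h + b * k)) (at z)" by blast
qed

lemma hol2_mult:
  assumes "holomorphic2_on f S" "holomorphic2_on g S"
  shows "holomorphic2_on (\<lambda>z. f z * g z) S"
  unfolding holomorphic2_on_def
proof
  fix z assume z: "z \<in> S"
  have "((\<lambda>z. f z * g z) has_derivative (\<lambda>(h, k). (f z * D1 g z + D1 f z * g z) * h + (f z * D2 g z + D2 f z * g z) * k)) (at z)"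
    by (rule derivative_eq_intros hol2_has_derivative[OF assms(1) z] hol2_has_derivative[OF assms(2) z])+
      (auto simp: algebra_simps)
  then show "\<exists>a b. ((\<lambda>z. f z * g z) has_derivative (\<lambda>(h, k). a * h + b * k)) (at z)" by blast
qed

lemma hol2_inverse:
  assumes "holomorphic2_on f S" "\<And>z. z \<in> S \<Longrightarrow> f z \<noteq> 0"
  shows "holomorphic2_on (\<lambda>z. inverse (f z)) S"
  unfolding holomorphic2_on_def
proof
  fix z assume z: "z \<in> S"
  from Deriv.has_derivative_inverse[OF assms(2)[OF z] hol2_has_derivative[OF assms(1) z]]
  have "((\<lambda>z. inverse (f z)) has_derivative (\<lambda>(h, k). (- inverse (f z) * D1 f z * inverse (f z)) * h
      + (- inverse (f z) * D2 f z * inverse (f z)) * k)) (at z)"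
    by (rule has_derivative_eq_rhs) (auto simp: algebra_simps)
  then show "\<exists>a b. ((\<lambda>z. inverse (f z)) has_derivative (\<lambda>(h, k). a * h + b * k)) (at z)" by blast
qed

lemma hol2_cong:
  assumes "open S" "\<And>z. z \<in> S \<Longrightarrow> f z = g z" "holomorphic2_on f S"
  shows "holomorphic2_on g S"
  using assms unfolding holomorphic2_on_def
  by (metis has_derivative_transform_within_open)

lemma hol2_map_derivative:
  assumes "holomorphic2_map_on T S" "z \<in> S"
  shows "(T has_derivative frechet_derivative T (at z)) (at z)"
    "frechet_derivative T (at z) (h, k) =
      (D1 (\<lambda>z. fst (T z)) z * h + D2 (\<lambda>z. fst (T z)) z * k, D1 (\<lambda>z. snd (T z)) z * h + D2 (\<lambda>z. snd (T z)) z * k)"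
proof -
  have 12: "holomorphic2_on (\<lambda>z. fst (T z)) S" "holomorphic2_on (\<lambda>z. snd (T z)) S"
    using assms by (auto simp: holomorphic2_map_on_def)
  have d: "(T has_derivative (\<lambda>v. ((\<lambda>(h, k). D1 (\<lambda>z. fst (T z)) z * h + D2 (\<lambda>z. fst (T z)) z * k) v,
      (\<lambda>(h, k). D1 (\<lambda>z. snd (T z)) z * h + D2 (\<lambda>z. snd (T z)) z * k) v))) (at z)"
    using has_derivative_Pair[OF hol2_has_derivative[OF 12(1) assms(2)] hol2_has_derivative[OF 12(2) assms(2)]] by simp
  then show "(T has_derivative frechet_derivative T (at z)) (at z)"
    using differentiable_def frechet_derivative_works by blast
  show "frechet_derivative T (at z) (h, k) =
      (D1 (\<lambda>z. fst (T z)) z * h + D2 (\<lambda>z. fst (T z)) z * k, D1 (\<lambda>z. snd (T z)) z * h + D2 (\<lambda>z. snd (T z)) z * k)"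
    using frechet_derivative_at[OF d] by (metis (no_types, lifting) case_prod_conv)
qed

lemma hol2_compose:
  assumes "holomorphic2_on f S'" "holomorphic2_map_on T S" "T ` S \<subseteq> S'"
  shows "holomorphic2_on (\<lambda>z. f (T z)) S"
  unfolding holomorphic2_on_def
proof
  fix z assume z: "z \<in> S"
  then have Tz: "T z \<in> S'" using assms(3) by blast
  note m = hol2_map_derivative[OF assms(2) z]
  from has_derivative_compose[OF m(1) hol2_has_derivative[OF assms(1) Tz]]
  have "((\<lambda>z. f (T z)) has_derivative (\<lambda>(h, k).
     (D1 f (T z) * D1 (\<lambda>z. fst (T z)) z + D2 f (T z) * D1 (\<lambda>z. snd (T z)) z) * h
     + (D1 f (T z) * D2 (\<lambda>z. fst (T z)) z + D2 f (T z) * D2 (\<lambda>z. snd (T z)) z) * k)) (at z)"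
    by (rule has_derivative_eq_rhs) (auto simp: m(2) algebra_simps)
  then show "\<exists>a b. ((\<lambda>z. f (T z)) has_derivative (\<lambda>(h, k). a * h + b * k)) (at z)" by blast
qed

lemma hol2_map_compose:
  assumes "holomorphic2_map_on f S'" "holomorphic2_map_on T S" "T ` S \<subseteq> S'"
  shows "holomorphic2_map_on (\<lambda>z. f (T z)) S"
  using hol2_compose[OF _ assms(2,3)] assms(1) unfolding holomorphic2_map_on_def by blast

section \<open>Camacho--Sad indices in adapted charts\<close>

locale surface_atlas =
  fixes X :: "'a topology" and \<A> :: "'a chart set"
  assumes surf: "complex_surface X \<A>"
begin

abbreviation "coord \<equiv> coordinates X \<A>"
abbreviation iv :: "'a chart \<Rightarrow> cplane \<Rightarrow> 'a" where "iv c \<equiv> inv_into (fst c) (snd c)"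
abbreviation img :: "'a chart \<Rightarrow> 'a set \<Rightarrow> cplane set" where "img c W \<equiv> snd c ` (fst c \<inter> W)"
text \<open>The differential is indexed by the point of the surface instead of its coordinates, so
  that the chain rule takes the form of a cocycle identity.\<close>

definition J :: "'a chart \<Rightarrow> 'a chart \<Rightarrow> 'a \<Rightarrow> cplane \<Rightarrow> cplane" where
  "J c d q = frechet_derivative (transition c d) (at (snd c q))"

lemma haus: "Hausdorff_space X"
  using surf by (simp add: complex_surface_def)

lemma chart_open:
  assumes "coord c"
  shows "openin X (fst c)" "open (snd c ` fst c)"
    "homeomorphic_map (subtopology X (fst c)) (top_of_set (snd c ` fst c)) (snd c)"
  using assms by (auto simp: coordinates_def chart_on_def)

lemma chart_inj: "coord c \<Longrightarrow> inj_on (snd c) (fst c)"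
  using homeomorphic_imp_injective_map[OF chart_open(3)] openin_subset[OF chart_open(1)]
  by (metis topspace_subtopology_subset)

lemma iv_left: "coord c \<Longrightarrow> q \<in> fst c \<Longrightarrow> iv c (snd c q) = q"
  using chart_inj inv_into_f_f by metis

lemma iv_mem: "z \<in> snd c ` fst c \<Longrightarrow> iv c z \<in> fst c"
  by (rule inv_into_into)

lemma img_open: "coord c \<Longrightarrow> openin X W \<Longrightarrow> open (img c W)"
proof -
  assume c: "coord c" and W: "openin X W"
  have "openin (subtopology X (fst c)) (fst c \<inter> W)"
    using W openin_subtopology_Int2 by blast
  then have "openin (top_of_set (snd c ` fst c)) (img c W)"
    using homeomorphic_imp_open_map[OF chart_open(3)[OF c]] by (simp add: open_map_def)
  then show ?thesis using chart_open(2)[OF c] openin_open_trans by blast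
qed

lemma chart_cont: "coord c \<Longrightarrow> continuous_map (subtopology X (fst c)) euclidean (snd c)"
  using homeomorphic_imp_continuous_map[OF chart_open(3)] continuous_map_in_subtopology by blast

lemma chart_preimage_open:
  assumes c: "coord c" and B: "open B"
  shows "openin X {q \<in> fst c. snd c q \<in> B}"
proof -
  have "openin (subtopology X (fst c)) {q \<in> topspace (subtopology X (fst c)). snd c q \<in> B}"
    using chart_cont[OF c] B openin_continuous_map_preimage open_openin by blast
  moreover have top: "topspace (subtopology X (fst c)) = fst c"
    using openin_subset[OF chart_open(1)[OF c]] by auto
  ultimately have "openin (subtopology X (fst c)) {q \<in> fst c. snd c q \<in> B}" by (simp only: top)
  then show ?thesis using chart_open(1)[OF c] by (rule openin_trans_full)
qed

lemma iv_cont: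
  assumes c: "coord c"
  shows "continuous_map (top_of_set (snd c ` fst c)) X (iv c)"
proof -
  obtain g where g: "homeomorphic_maps (subtopology X (fst c)) (top_of_set (snd c ` fst c)) (snd c) g"
    using chart_open(3)[OF c] homeomorphic_map_maps by blast
  have top: "topspace (subtopology X (fst c)) = fst c"
    using openin_subset[OF chart_open(1)[OF c]] by auto
  have "continuous_map (top_of_set (snd c ` fst c)) (subtopology X (fst c)) g"
    using g by (simp add: homeomorphic_maps_def)
  moreover have giv: "g z = iv c z" if zz: "z \<in> snd c ` fst c" for z
  proof -
    obtain q where q: "q \<in> fst c" "z = snd c q" using zz by blast
    then have "g z = q" using g top by (simp add: homeomorphic_maps_def)
    then show ?thesis using q iv_left[OF c] by simp
  qed
  ultimately have "continuous_map (top_of_set (snd c ` fst c)) X g"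
    by (simp add: continuous_map_in_subtopology)
  then show ?thesis by (rule continuous_map_eq) (simp add: giv)
qed

lemma transition_at: "coord c \<Longrightarrow> q \<in> fst c \<Longrightarrow> transition c d (snd c q) = snd d q"
  by (simp add: transition_def iv_left)

lemma atlas_cover: "q \<in> topspace X \<Longrightarrow> \<exists>e\<in>\<A>. q \<in> fst e"
  using surf by (auto simp: complex_surface_def)

lemma atlas_coord: "e \<in> \<A> \<Longrightarrow> coord e"
  using surf by (auto simp: complex_surface_def coordinates_def)

lemma fst_topspace: "coord c \<Longrightarrow> fst c \<subseteq> topspace X"
  using chart_open(1) openin_subset by blast

lemma hol2_map_local:
  assumes "\<And>z. z \<in> S \<Longrightarrow> \<exists>V g. open V \<and> z \<in> V \<and> holomorphic2_map_on g V \<and> (\<forall>w\<in>V. f w = g w)"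
  shows "holomorphic2_map_on f S"
proof -
  have "\<exists>a b. ((\<lambda>z. fst (f z)) has_derivative (\<lambda>(h, k). a * h + b * k)) (at z)"
    "\<exists>a b. ((\<lambda>z. snd (f z)) has_derivative (\<lambda>(h, k). a * h + b * k)) (at z)" if zz: "z \<in> S" for z
  proof -
    obtain V g where V: "open V" "z \<in> V" "holomorphic2_map_on g V" "\<forall>w\<in>V. f w = g w"
      using assms[OF zz] by blast
    have "holomorphic2_on (\<lambda>z. fst (f z)) V" "holomorphic2_on (\<lambda>z. snd (f z)) V"
      using V hol2_cong[OF V(1), of "\<lambda>z. fst (g z)" "\<lambda>z. fst (f z)"]
        hol2_cong[OF V(1), of "\<lambda>z. snd (g z)" "\<lambda>z. snd (f z)"]
      by (auto simp: holomorphic2_map_on_def)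
    then show "\<exists>a b. ((\<lambda>z. fst (f z)) has_derivative (\<lambda>(h, k). a * h + b * k)) (at z)"
      "\<exists>a b. ((\<lambda>z. snd (f z)) has_derivative (\<lambda>(h, k). a * h + b * k)) (at z)"
      using V(2) by (auto simp: holomorphic2_on_def)
  qed
  then show ?thesis by (simp add: holomorphic2_map_on_def holomorphic2_on_def)
qed

text \<open>Members of the maximal atlas are by definition compatible with the charts of the atlas
  only. Compatibility with each other is local and follows by passing through an atlas chart around
  each point.\<close>

lemma transition_hol:
  assumes c: "coord c" and d: "coord d"
  shows "holomorphic2_map_on (transition c d) (img c (fst d))"
proof (rule hol2_map_local)
  fix z assume "z \<in> img c (fst d)"
  then obtain q where q: "q \<in> fst c" "q \<in> fst d" "z = snd c q" by blast
  obtain e where e: "e \<in> \<A>" "q \<in> fst e" using atlas_cover fst_topspace[OF c] q(1) by blast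
  note ec = atlas_coord[OF e(1)]
  let ?V = "img c (fst d \<inter> fst e)"
  have 1: "holomorphic2_map_on (transition c e) ?V"
  proof -
    have "holomorphic2_map_on (transition c e) (img c (fst e))"
      using c e(1) by (simp add: coordinates_def compatible_charts_def)
    moreover have "?V \<subseteq> img c (fst e)" by blast
    ultimately show ?thesis unfolding holomorphic2_map_on_def using hol2_subset by blast
  qed
  have 2: "holomorphic2_map_on (transition e d) (img e (fst d))"
    using d e(1) by (auto simp: coordinates_def compatible_charts_def Int_commute)
  have sub: "transition c e ` ?V \<subseteq> img e (fst d)"
    using transition_at[OF c, where d = e] by fastforce
  have "holomorphic2_map_on (\<lambda>w. transition e d (transition c e w)) ?V"
    by (rule hol2_map_compose[OF 2 1 sub])
  moreover have "transition c d w = transition e d (transition c e w)" if "w \<in> ?V" for w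
    using that transition_at[OF c, where d = e] transition_at[OF c, where d = d]
      transition_at[OF ec, where d = d] by fastforce
  moreover have "open ?V" by (rule img_open[OF c]) (use chart_open d ec in blast)
  ultimately show "\<exists>V g. open V \<and> z \<in> V \<and> holomorphic2_map_on g V \<and> (\<forall>w\<in>V. transition c d w = g w)"
    using q e by (intro exI[of _ ?V] exI[of _ "\<lambda>w. transition e d (transition c e w)"]) auto
qed

lemma J_deriv:
  assumes "coord c" "coord d" "q \<in> fst c" "q \<in> fst d"
  shows "(transition c d has_derivative J c d q) (at (snd c q))"
  unfolding J_def using hol2_map_derivative(1)[OF transition_hol] assms by blast

lemma J_local:
  assumes "coord c" "coord d" "q \<in> fst c" "q \<in> fst d" "openin X W" "q \<in> W"
    and "\<And>q'. q' \<in> fst c \<inter> W \<Longrightarrow> g (snd c q') = snd d q'"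
  shows "(g has_derivative J c d q) (at (snd c q))"
proof (rule has_derivative_transform_within_open[OF J_deriv[OF assms(1-4)] img_open[OF assms(1,5)]])
  show "snd c q \<in> img c W" using assms by blast
  show "transition c d w = g w" if "w \<in> img c W" for w
    using that assms(7) transition_at[OF assms(1), where d = d] by fastforce
qed

lemma J_chain:
  assumes "coord c" "coord d" "coord e" "q \<in> fst c" "q \<in> fst d" "q \<in> fst e"
  shows "J c e q v = J d e q (J c d q v)"
proof -
  have "((\<lambda>w. transition d e (transition c d w)) has_derivative (\<lambda>v. J d e q (J c d q v))) (at (snd c q))"
    by (rule has_derivative_compose[OF J_deriv[OF assms(1,2,4,5)]])
      (use J_deriv[OF assms(2,3,5,6)] transition_at[OF assms(1,4)] in simp)
  moreover have "((\<lambda>w. transition d e (transition c d w)) has_derivative J c e q) (at (snd c q))"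
    by (rule J_local[OF assms(1,3,4,6) chart_open(1)[OF assms(2)] assms(5)])
      (use transition_at[OF assms(1)] transition_at[OF assms(2)] in auto)
  ultimately show ?thesis using has_derivative_unique by (metis)
qed

lemma J_id: "coord c \<Longrightarrow> q \<in> fst c \<Longrightarrow> J c c q v = v"
proof -
  assume c: "coord c" and q: "q \<in> fst c"
  have "((\<lambda>w. w) has_derivative J c c q) (at (snd c q))"
    by (rule J_local[OF c c q q chart_open(1)[OF c] q]) simp
  then show ?thesis using has_derivative_unique[OF _ has_derivative_ident] by metis
qed

lemma J_inverse: "coord c \<Longrightarrow> coord d \<Longrightarrow> q \<in> fst c \<Longrightarrow> q \<in> fst d \<Longrightarrow> J d c q (J c d q v) = v"
  using J_chain[of c d c q v] J_id[of c q v] by simp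

lemma J_linear:
  assumes "coord c" "coord d" "q \<in> fst c" "q \<in> fst d"
  shows "J c d q (cscale g v) = cscale g (J c d q v)" "J c d q 0 = 0"
proof -
  have "snd c q \<in> img c (fst d)" using assms by blast
  note h = hol2_map_derivative(2)[OF transition_hol[OF assms(1,2)] this]
  show "J c d q (cscale g v) = cscale g (J c d q v)"
    by (cases v) (simp add: J_def h cscale_def algebra_simps)
  show "J c d q 0 = 0" by (simp add: J_def h zero_prod_def)
qed

definition restrict_chart :: "'a chart \<Rightarrow> 'a set \<Rightarrow> 'a chart" where "restrict_chart c W = (fst c \<inter> W, snd c)"

lemma restrict_chart_simps [simp]: "fst (restrict_chart c W) = fst c \<inter> W" "snd (restrict_chart c W) = snd c"
  by (simp_all add: restrict_chart_def)

text \<open>The coordinate map is kept, but \<open>transition\<close> uses an inverse that depends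
  on the chart domain. By injectivity the old and the new inverse agree on the smaller
  image.\<close>

lemma restrict_chart_coord:
  assumes c: "coord c" and W: "openin X W"
  shows "coord (restrict_chart c W)"
  unfolding coordinates_def
proof (intro conjI ballI)
  have sub: "fst c \<inter> W \<subseteq> fst c" by blast
  have h: "homeomorphic_map (subtopology (subtopology X (fst c)) (fst c \<inter> W)) (subtopology (top_of_set (snd c ` fst c)) (snd c ` (fst c \<inter> W))) (snd c)"
    by (rule homeomorphic_map_subtopologies[OF chart_open(3)[OF c]])
      (use openin_subset[OF chart_open(1)[OF c]] in auto)
  moreover have "subtopology (subtopology X (fst c)) (fst c \<inter> W) = subtopology X (fst c \<inter> W)"
    by (simp add: subtopology_subtopology Int_absorb1 inf.left_commute inf_assoc[symmetric])
  moreover have "subtopology (top_of_set (snd c ` fst c)) (snd c ` (fst c \<inter> W)) = top_of_set (snd c ` (fst c \<inter> W))"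
    by (simp add: subtopology_subtopology Int_absorb1 image_mono)
  ultimately show "chart_on X (restrict_chart c W)"
    unfolding chart_on_def using img_open[OF c W] openin_Int[OF chart_open(1)[OF c] W] by simp
  fix d assume d: "d \<in> \<A>"
  note dc = atlas_coord[OF d]
  have o: "open (img c (W \<inter> fst d))" by (rule img_open[OF c]) (use W chart_open(1)[OF dc] in blast)
  have eq: "transition (restrict_chart c W) d z = transition c d z" if zz: "z \<in> img c (W \<inter> fst d)" for z
  proof -
    obtain q where q: "q \<in> fst c" "q \<in> W" "q \<in> fst d" "z = snd c q" using zz by blast
    have "inj_on (snd c) (fst c \<inter> W)" using chart_inj[OF c] inj_on_subset sub by blast
    then have "inv_into (fst c \<inter> W) (snd c) z = q" using q by (simp add: inv_into_f_eq)
    then show ?thesis using q transition_at[OF c q(1)] by (simp add: transition_def)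
  qed
  have t: "holomorphic2_map_on (transition c d) (img c (W \<inter> fst d))"
    using transition_hol[OF c dc] hol2_subset[of _ "img c (fst d)" "img c (W \<inter> fst d)"]
    unfolding holomorphic2_map_on_def by blast
  have "holomorphic2_map_on (transition (restrict_chart c W) d) (img c (W \<inter> fst d))"
    by (rule hol2_map_local) (use o eq t in blast)
  moreover have "holomorphic2_map_on (transition d c) (img d (fst c \<inter> W))"
    using transition_hol[OF dc c] hol2_subset[of _ "img d (fst c)" "img d (fst c \<inter> W)"]
    unfolding holomorphic2_map_on_def by blast
  ultimately show "compatible_charts (restrict_chart c W) d"
    unfolding compatible_charts_def by (simp add: transition_def Int_ac)
qed

lemma J_restrict_chart:
  assumes "coord c" "coord d" "q \<in> fst c" "q \<in> fst d" "openin X W" "q \<in> W"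
  shows "J (restrict_chart c W) d q = J c d q" "J d (restrict_chart c W) q = J d c q"
proof -
  have "(transition c d has_derivative J (restrict_chart c W) d q) (at (snd (restrict_chart c W) q))"
  proof (rule J_local[OF restrict_chart_coord[OF assms(1,5)] assms(2) _ assms(4) assms(5,6)])
    show "q \<in> fst (restrict_chart c W)" using assms by simp
    show "transition c d (snd (restrict_chart c W) q') = snd d q'" if "q' \<in> fst (restrict_chart c W) \<inter> W" for q'
      using that transition_at[OF assms(1), of q' d] by simp
  qed
  then have "(transition c d has_derivative J (restrict_chart c W) d q) (at (snd c q))" by simp
  from has_derivative_unique[OF this J_deriv[OF assms(1-4)]] show "J (restrict_chart c W) d q = J c d q" .
  show "J d (restrict_chart c W) q = J d c q" by (simp add: J_def transition_def)
qed

end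

section \<open>Adapted charts along a curve\<close>

locale surface_curve = surface_atlas +
  fixes P :: "'a set"
  assumes P_top: "P \<subseteq> topspace X"
begin

abbreviation "adapted \<equiv> adapted_chart X \<A> P"

lemma adaptedD: "adapted c \<Longrightarrow> coord c" "adapted c \<Longrightarrow> q \<in> fst c \<Longrightarrow> q \<in> P \<longleftrightarrow> snd (snd c q) = 0"
  by (auto simp: adapted_chart_def)

lemma restrict_chart_adapted: "adapted c \<Longrightarrow> openin X W \<Longrightarrow> adapted (restrict_chart c W)"
  using restrict_chart_coord by (auto simp: adapted_chart_def)

text \<open>The differential of a change of adapted charts along \<open>P\<close> is triangular with diagonal entries \<open>\<alpha>\<close>
  and \<open>u\<close>; \<open>u\<close> is the cocycle of the normal bundle of \<open>P\<close>.\<close>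

definition u :: "'a chart \<Rightarrow> 'a chart \<Rightarrow> 'a \<Rightarrow> complex" where "u c d q = snd (J c d q (0, 1))"
definition \<alpha> :: "'a chart \<Rightarrow> 'a chart \<Rightarrow> 'a \<Rightarrow> complex" where "\<alpha> c d q = fst (J c d q (1, 0))"

definition slice :: "'a chart \<Rightarrow> 'a set \<Rightarrow> complex set" where "slice c W = {x. (x, 0) \<in> img c W}"

lemma slice_open: "coord c \<Longrightarrow> openin X W \<Longrightarrow> open (slice c W)"
proof -
  assume "coord c" "openin X W"
  then have "open ((\<lambda>x. (x, 0)) -` img c W)"
    by (intro open_vimage img_open) (auto intro!: continuous_intros)
  then show ?thesis by (simp add: slice_def vimage_def)
qed

lemma slice_point:
  assumes "adapted c" "x \<in> slice c W"
  shows "iv c (x, 0) \<in> P" "iv c (x, 0) \<in> fst c" "iv c (x, 0) \<in> W" "snd c (iv c (x, 0)) = (x, 0)"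
proof -
  obtain q where q: "q \<in> fst c" "q \<in> W" "snd c q = (x, 0)" using assms(2) by (auto simp: slice_def)
  have "iv c (x, 0) = q" using iv_left[OF adaptedD(1)[OF assms(1)] q(1)] q(3) by simp
  then show "iv c (x, 0) \<in> P" "iv c (x, 0) \<in> fst c" "iv c (x, 0) \<in> W" "snd c (iv c (x, 0)) = (x, 0)"
    using q adaptedD(2)[OF assms(1) q(1)] by auto
qed

lemma P_coord: "adapted c \<Longrightarrow> q \<in> P \<Longrightarrow> q \<in> fst c \<Longrightarrow> snd c q = (fst (snd c q), 0)"
  using adaptedD(2) by (simp add: prod_eq_iff)

lemma in_slice: "adapted c \<Longrightarrow> q \<in> P \<Longrightarrow> q \<in> fst c \<Longrightarrow> q \<in> W \<Longrightarrow> fst (snd c q) \<in> slice c W"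
  unfolding slice_def using P_coord by (metis IntI imageI mem_Collect_eq)

lemma J_shape:
  assumes c: "adapted c" and d: "adapted d" and q: "q \<in> P" "q \<in> fst c" "q \<in> fst d"
  shows "snd (J c d q (h, k)) = u c d q * k" "fst (J c d q (h, 0)) = \<alpha> c d q * h"
    "u c d q = D2 (\<lambda>z. snd (transition c d z)) (snd c q)"
    "\<alpha> c d q = D1 (\<lambda>z. fst (transition c d z)) (snd c q)"
    "D1 (\<lambda>z. snd (transition c d z)) (snd c q) = 0"
proof -
  note cc = adaptedD(1)[OF c] and dd = adaptedD(1)[OF d]
  note T = transition_hol[OF cc dd]
  have qi: "snd c q \<in> img c (fst d)" using q by blast
  note h = hol2_map_derivative(2)[OF T qi, folded J_def]
  \<comment> \<open>Both charts cut out the curve by the vanishing of their second coordinate, so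
    the second component of the transition is identically 0 along the slice.\<close>
  show 5: "D1 (\<lambda>z. snd (transition c d z)) (snd c q) = 0"
  proof -
    let ?x = "fst (snd c q)"
    have "((\<lambda>x. snd (transition c d (x, 0))) has_field_derivative D1 (\<lambda>z. snd (transition c d z)) (?x, 0)) (at ?x)"
      by (rule hol2_partial1) (use T qi P_coord[OF c q(1,2)] in \<open>auto simp: holomorphic2_map_on_def\<close>)
    moreover have "((\<lambda>x. snd (transition c d (x, 0))) has_field_derivative 0) (at ?x)"
    proof (rule has_field_derivative_transform_within_open[of "\<lambda>_. 0" 0 _ "slice c (fst d)"])
      show "open (slice c (fst d))" by (rule slice_open[OF cc chart_open(1)[OF dd]])
      show "?x \<in> slice c (fst d)" by (rule in_slice[OF c q(1,2,3)])
      fix x assume x: "x \<in> slice c (fst d)"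
      note p = slice_point[OF c x]
      have "snd (snd d (iv c (x, 0))) = 0" using adaptedD(2)[OF d p(3)] p(1) by simp
      then show "0 = snd (transition c d (x, 0))" using transition_at[OF cc p(2), of d] p(4) by simp
    qed simp
    ultimately show ?thesis using DERIV_unique P_coord[OF c q(1,2)] by metis
  qed
  show "u c d q = D2 (\<lambda>z. snd (transition c d z)) (snd c q)"
    "\<alpha> c d q = D1 (\<lambda>z. fst (transition c d z)) (snd c q)"
    by (simp_all add: u_def \<alpha>_def h)
  then show "snd (J c d q (h, k)) = u c d q * k" "fst (J c d q (h, 0)) = \<alpha> c d q * h"
    by (simp_all add: h 5)
qed

lemma u_chain:
  assumes "adapted c" "adapted d" "adapted e" "q \<in> P" "q \<in> fst c" "q \<in> fst d" "q \<in> fst e"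
  shows "u c e q = u d e q * u c d q" "\<alpha> c e q = \<alpha> d e q * \<alpha> c d q"
proof -
  note ch = J_chain[OF adaptedD(1)[OF assms(1)] adaptedD(1)[OF assms(2)] adaptedD(1)[OF assms(3)] assms(5-7)]
  note s1 = J_shape[OF assms(1,2,4,5,6)] and s2 = J_shape[OF assms(2,3,4,6,7)]
  have "u c e q = snd (J d e q (fst (J c d q (0, 1)), snd (J c d q (0, 1))))" by (simp add: u_def ch)
  then show "u c e q = u d e q * u c d q" using s2(1) s1(1)[of 0 1] by simp
  have "\<alpha> c e q = fst (J d e q (fst (J c d q (1, 0)), snd (J c d q (1, 0))))" by (simp add: \<alpha>_def ch)
  then show "\<alpha> c e q = \<alpha> d e q * \<alpha> c d q" using s2(2) s1(1)[of 1 0] s1(2)[of 1] by simp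
qed

lemma u_id: "adapted c \<Longrightarrow> q \<in> P \<Longrightarrow> q \<in> fst c \<Longrightarrow> u c c q = 1"
  "adapted c \<Longrightarrow> q \<in> P \<Longrightarrow> q \<in> fst c \<Longrightarrow> \<alpha> c c q = 1"
  using J_id[OF adaptedD(1)] by (simp_all add: u_def \<alpha>_def)

lemma u_nz:
  assumes "adapted c" "adapted d" "q \<in> P" "q \<in> fst c" "q \<in> fst d"
  shows "u c d q \<noteq> 0" "\<alpha> c d q \<noteq> 0"
  using u_chain[OF assms(1,2,1,3,4,5,4)] u_id[OF assms(1,3,4)] by auto

definition slice_transition :: "'a chart \<Rightarrow> 'a chart \<Rightarrow> complex \<Rightarrow> complex" where
  "slice_transition c d x = fst (transition c d (x, 0))"

lemma slice_transition_props:
  assumes c: "adapted c" and d: "adapted d" and x: "x \<in> slice c (fst d)"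
  defines "q \<equiv> iv c (x, 0)"
  shows "(slice_transition c d has_field_derivative \<alpha> c d q) (at x)" "snd d q = (slice_transition c d x, 0)"
    "slice_transition c d x = fst (snd d q)" "q \<in> P" "q \<in> fst c" "q \<in> fst d" "snd c q = (x, 0)"
proof -
  note cc = adaptedD(1)[OF c] and dd = adaptedD(1)[OF d]
  show p: "q \<in> P" "q \<in> fst c" "q \<in> fst d" "snd c q = (x, 0)"
    using slice_point[OF c x] by (auto simp: q_def)
  show "slice_transition c d x = fst (snd d q)" using transition_at[OF cc p(2), of d] p(4) by (simp add: slice_transition_def)
  then show "snd d q = (slice_transition c d x, 0)" using P_coord[OF d p(1,3)] by simp
  have "((\<lambda>x. fst (transition c d (x, 0))) has_field_derivative D1 (\<lambda>z. fst (transition c d z)) (x, 0)) (at x)"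
    by (rule hol2_partial1) (use transition_hol[OF cc dd] x in \<open>auto simp: holomorphic2_map_on_def slice_def\<close>)
  then show "(slice_transition c d has_field_derivative \<alpha> c d q) (at x)"
    using J_shape(4)[OF c d p(1-3)] p(4) by (simp add: slice_transition_def[abs_def])
qed

lemma u_holomorphic:
  assumes c: "adapted c" and d: "adapted d"
  shows "(\<lambda>x. u c d (iv c (x, 0))) holomorphic_on slice c (fst d)"
    "x \<in> slice c (fst d) \<Longrightarrow> ((\<lambda>x. u c d (iv c (x, 0))) has_field_derivative
      D1 (D2 (\<lambda>z. snd (transition c d z))) (x, 0)) (at x)"
proof -
  note cc = adaptedD(1)[OF c] and dd = adaptedD(1)[OF d]
  have o: "open (img c (fst d))" by (rule img_open[OF cc chart_open(1)[OF dd]])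
  have h: "holomorphic2_on (D2 (\<lambda>z. snd (transition c d z))) (img c (fst d))"
    using D2_hol2[OF o] transition_hol[OF cc dd] by (simp add: holomorphic2_map_on_def)
  show *: "((\<lambda>x. u c d (iv c (x, 0))) has_field_derivative D1 (D2 (\<lambda>z. snd (transition c d z))) (x, 0)) (at x)"
    if x: "x \<in> slice c (fst d)" for x
  proof (rule has_field_derivative_transform_within_open[OF _ slice_open[OF cc chart_open(1)[OF dd]] x])
    show "((\<lambda>x. D2 (\<lambda>z. snd (transition c d z)) (x, 0)) has_field_derivative D1 (D2 (\<lambda>z. snd (transition c d z))) (x, 0)) (at x)"
      by (rule hol2_partial1[OF h]) (use x in \<open>simp add: slice_def\<close>)
    fix w assume w: "w \<in> slice c (fst d)"
    show "D2 (\<lambda>z. snd (transition c d z)) (w, 0) = u c d (iv c (w, 0))"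
      using J_shape(3)[OF c d slice_point(1,2,3)[OF c w]] slice_point(4)[OF c w] by simp
  qed
  show "(\<lambda>x. u c d (iv c (x, 0))) holomorphic_on slice c (fst d)"
    unfolding holomorphic_on_open[OF slice_open[OF cc chart_open(1)[OF dd]]] using * by blast
qed

end

section \<open>Generators of the foliation and their normal forms\<close>

locale foliated = surface_curve +
  fixes N :: "'a set" and \<F> :: "'a local_field set"
  assumes fol: "holomorphic_foliation X \<A> N \<F>" and PN: "P \<subseteq> N" and inv: "invariant_curve X \<A> \<F> P"
begin

abbreviation "lgen c V \<equiv> local_generator X \<A> N \<F> (c, V)"
abbreviation "sing \<equiv> singular_point \<F>"

lemma fieldD:
  assumes "(c, V) \<in> \<F>"
  shows "coord c" "fst c \<subseteq> N" "holomorphic2_map_on V (snd c ` fst c)" "lgen c V"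
    "z \<in> snd c ` fst c \<Longrightarrow> \<not> z islimpt {w \<in> snd c ` fst c. V w = 0}"
proof -
  show 1: "coord c" "fst c \<subseteq> N" "holomorphic2_map_on V (snd c ` fst c)"
    "z \<in> snd c ` fst c \<Longrightarrow> \<not> z islimpt {w \<in> snd c ` fst c. V w = 0}"
    using fol assms unfolding holomorphic_foliation_def by blast+
  have "\<forall>w\<in>\<F>. same_foliation (c, V) w" using fol assms by (auto simp: holomorphic_foliation_def)
  then show "lgen c V" using 1 by (simp add: local_generator_def)
qed

lemma N_cover: "q \<in> N \<Longrightarrow> \<exists>c V. (c, V) \<in> \<F> \<and> q \<in> fst c"
  using fol by (fastforce simp: holomorphic_foliation_def)

lemma lgenD:
  assumes "lgen c V"
  shows "coord c" "fst c \<subseteq> N" "holomorphic2_map_on V (snd c ` fst c)" "w \<in> \<F> \<Longrightarrow> same_foliation (c, V) w"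
  using assms by (auto simp: local_generator_def)

text \<open>Proportionality of two generators at one point, without holomorphy of the factor.
  Symmetry and transitivity then reduce to the chain rule, and the later comparisons eliminate the
  factor.\<close>

definition agree :: "'a chart \<Rightarrow> (cplane \<Rightarrow> cplane) \<Rightarrow> 'a chart \<Rightarrow> (cplane \<Rightarrow> cplane) \<Rightarrow> 'a \<Rightarrow> bool" where
  "agree c V d W q \<longleftrightarrow> (\<exists>g. g \<noteq> 0 \<and> J c d q (V (snd c q)) = cscale g (W (snd d q)))"

lemma cscale_cscale: "cscale g (cscale h v) = cscale (g * h) v"
  by (simp add: cscale_def mult.assoc)

lemma same_foliation_agree:
  assumes "same_foliation (c, V) (d, W)" "coord c" "q \<in> fst c" "q \<in> fst d"
  shows "agree c V d W q"
proof -
  obtain g where "\<forall>z \<in> img c (fst d). g z \<noteq> 0 \<and>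
      frechet_derivative (transition c d) (at z) (V z) = cscale (g z) (W (transition c d z))"
    using assms(1) by (auto simp: same_foliation_def)
  then have "g (snd c q) \<noteq> 0 \<and> J c d q (V (snd c q)) = cscale (g (snd c q)) (W (transition c d (snd c q)))"
    unfolding J_def using assms(3,4) by blast
  then show ?thesis unfolding agree_def transition_at[OF assms(2,3)] by blast
qed

lemma agree_trans:
  assumes "coord c" "coord d" "coord e" "q \<in> fst c" "q \<in> fst d" "q \<in> fst e" "agree c V d W q" "agree d W e Y q"
  shows "agree c V e Y q"
proof -
  obtain g h where g: "g \<noteq> 0" "J c d q (V (snd c q)) = cscale g (W (snd d q))"
    and h: "h \<noteq> 0" "J d e q (W (snd d q)) = cscale h (Y (snd e q))"
    using assms(7,8) by (auto simp: agree_def)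
  have "J c e q (V (snd c q)) = cscale (g * h) (Y (snd e q))"
    using J_chain[OF assms(1-6)] g h J_linear(1)[OF assms(2,3,5,6)] by (simp add: cscale_cscale)
  then show ?thesis unfolding agree_def using g h by (intro exI[of _ "g * h"]) simp
qed

lemma agree_sym:
  assumes "coord c" "coord d" "q \<in> fst c" "q \<in> fst d" "agree c V d W q"
  shows "agree d W c V q"
proof -
  obtain g where g: "g \<noteq> 0" "J c d q (V (snd c q)) = cscale g (W (snd d q))"
    using assms(5) by (auto simp: agree_def)
  have "V (snd c q) = J d c q (cscale g (W (snd d q)))"
    using J_inverse[OF assms(1-4), of "V (snd c q)"] g by simp
  also have "\<dots> = cscale g (J d c q (W (snd d q)))" by (rule J_linear(1)[OF assms(2,1,4,3)])
  finally have "J d c q (W (snd d q)) = cscale (1 / g) (V (snd c q))" using g by (simp add: cscale_def)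
  then show ?thesis unfolding agree_def using g by (intro exI[of _ "1 / g"]) simp
qed

text \<open>Arbitrary generators are related by definition to the members of \<open>\<F>\<close>
  only; a member defined at \<open>q\<close> serves as intermediary.\<close>

lemma lgen_agree:
  assumes "lgen c V" "lgen d W" "q \<in> fst c" "q \<in> fst d"
  shows "agree c V d W q"
proof -
  note c = lgenD[OF assms(1)] and d = lgenD[OF assms(2)]
  obtain e Y where e: "(e, Y) \<in> \<F>" "q \<in> fst e" using N_cover c(2) assms(3) by blast
  note ec = fieldD(1)[OF e(1)]
  show ?thesis
    by (rule agree_trans[OF c(1) ec d(1) assms(3) e(2) assms(4)
        same_foliation_agree[OF c(4)[OF e(1)] c(1) assms(3) e(2)]
        agree_sym[OF d(1) ec assms(4) e(2) same_foliation_agree[OF d(4)[OF e(1)] d(1) assms(4) e(2)]]])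
qed

lemma agree_zero:
  assumes "coord c" "coord d" "q \<in> fst c" "q \<in> fst d" "agree c V d W q"
  shows "V (snd c q) = 0 \<longleftrightarrow> W (snd d q) = 0"
proof -
  have *: "W (snd d q) = 0" if "coord c" "coord d" "q \<in> fst c" "q \<in> fst d" "agree c V d W q" "V (snd c q) = 0" for c d V W
    using that J_linear(2)[OF that(1-4)] by (auto simp: agree_def cscale_def prod_eq_iff)
  show ?thesis using *[OF assms] *[OF assms(2,1,4,3) agree_sym[OF assms]] by blast
qed

lemma sing_iff: "lgen c V \<Longrightarrow> q \<in> fst c \<Longrightarrow> sing q \<longleftrightarrow> V (snd c q) = 0"
proof -
  assume c: "lgen c V" and q: "q \<in> fst c"
  have *: "W (snd d q) = 0 \<longleftrightarrow> V (snd c q) = 0" if "(d, W) \<in> \<F>" "q \<in> fst d" for d W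
    by (rule agree_zero[OF fieldD(1)[OF that(1)] lgenD(1)[OF c] that(2) q lgen_agree[OF fieldD(4)[OF that(1)] c that(2) q]])
  obtain d W where dW: "(d, W) \<in> \<F>" "q \<in> fst d" using N_cover lgenD(2)[OF c] q by blast
  show ?thesis
  proof
    assume "sing q"
    then obtain e Y where "(e, Y) \<in> \<F>" "q \<in> fst e" "Y (snd e q) = 0" by (auto simp: singular_point_def)
    then show "V (snd c q) = 0" using * by blast
  next
    assume "V (snd c q) = 0"
    then have "W (snd d q) = 0" using *[OF dW] by blast
    then show "sing q" unfolding singular_point_def using dW by blast
  qed
qed

lemma sing_isolated:
  assumes "q \<in> N"
  shows "\<exists>W. openin X W \<and> q \<in> W \<and> (\<forall>q'\<in>W. sing q' \<longrightarrow> q' = q)"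
proof -
  obtain c V where c: "(c, V) \<in> \<F>" "q \<in> fst c" using N_cover[OF assms] by blast
  note f = fieldD[OF c(1)]
  obtain B where B: "open B" "snd c q \<in> B" "\<And>z. z \<in> snd c ` fst c \<Longrightarrow> z \<in> B \<Longrightarrow> V z = 0 \<Longrightarrow> z = snd c q"
    using f(5)[of "snd c q"] c(2) unfolding islimpt_def by blast
  let ?W = "{q' \<in> fst c. snd c q' \<in> B}"
  have "q' = q" if "q' \<in> ?W" "sing q'" for q'
  proof -
    have "V (snd c q') = 0" using sing_iff[OF f(4), of q'] that by blast
    then have "snd c q' = snd c q" using B(3)[of "snd c q'"] that by blast
    then show ?thesis using chart_inj[OF f(1)] that c(2) by (auto dest: inj_onD)
  qed
  then show ?thesis using chart_preimage_open[OF f(1) B(1)] c(2) B(2) by blast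
qed

definition normal_form :: "'a chart \<Rightarrow> (cplane \<Rightarrow> complex) \<Rightarrow> (cplane \<Rightarrow> complex) \<Rightarrow> bool" where
  "normal_form c A B \<longleftrightarrow> adapted c \<and> holomorphic2_on A (snd c ` fst c) \<and> holomorphic2_on B (snd c ` fst c) \<and>
     lgen c (\<lambda>(x, y). (A (x, y), y * B (x, y)))"

lemma lgen_restrict:
  assumes "lgen c V" "openin X W"
  shows "lgen (restrict_chart c W) V"
proof -
  note c = lgenD[OF assms(1)]
  have h: "holomorphic2_map_on V (img c W)"
    using c(3) hol2_subset[of _ "snd c ` fst c" "img c W"] unfolding holomorphic2_map_on_def by blast
  have "same_foliation (restrict_chart c W, V) (d, Y)" if d: "(d, Y) \<in> \<F>" for d Y
  proof -
    obtain g where g: "holomorphic2_on g (img c (fst d))" "\<forall>z \<in> img c (fst d). g z \<noteq> 0 \<and>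
        frechet_derivative (transition c d) (at z) (V z) = cscale (g z) (Y (transition c d z))"
      using c(4)[OF d] by (auto simp: same_foliation_def)
    note dc = fieldD(1)[OF d]
    have "frechet_derivative (transition (restrict_chart c W) d) (at z) (V z) = cscale (g z) (Y (transition (restrict_chart c W) d z)) \<and> g z \<noteq> 0"
      if z: "z \<in> img c (W \<inter> fst d)" for z
    proof -
      obtain q where q: "q \<in> fst c" "q \<in> W" "q \<in> fst d" "z = snd c q" using z by blast
      have t1: "transition (restrict_chart c W) d z = snd d q"
        using transition_at[OF restrict_chart_coord[OF c(1) assms(2)], of q d] q by simp
      have t2: "transition c d z = snd d q" using transition_at[OF c(1) q(1), of d] q by simp
      have "g z \<noteq> 0 \<and> frechet_derivative (transition c d) (at z) (V z) = cscale (g z) (Y (transition c d z))"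
        using g(2) q by blast
      moreover have "frechet_derivative (transition (restrict_chart c W) d) (at z) = frechet_derivative (transition c d) (at z)"
        using J_restrict_chart(1)[OF c(1) dc q(1,3) assms(2) q(2)] q(4) by (simp add: J_def)
      ultimately show ?thesis unfolding t1 t2 by simp
    qed
    moreover have "holomorphic2_on g (img c (W \<inter> fst d))"
      by (rule hol2_subset[OF g(1)]) blast
    ultimately show ?thesis
      unfolding same_foliation_def prod.case restrict_chart_simps Int_assoc by blast
  qed
  then show ?thesis
    using restrict_chart_coord[OF c(1) assms(2)] c(2) h by (auto simp: local_generator_def)
qed

lemma normal_form_restrict:
  assumes "normal_form c A B" "openin X W"
  shows "normal_form (restrict_chart c W) A B"
proof -
  have "img c W \<subseteq> snd c ` fst c" by blast
  then show ?thesis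
    using assms lgen_restrict[of c _ W] restrict_chart_adapted[of c W] hol2_subset[of _ "snd c ` fst c" "img c W"]
    unfolding normal_form_def restrict_chart_simps by blast
qed

text \<open>A generator of the foliation is pushed forward to the adapted chart. Invariance of the
  curve means that its second component vanishes on \<open>y = 0\<close>, hence is divisible by
  \<open>y\<close>. The chart has to shrink to the domain of the generator.\<close>

lemma normal_form_exists:
  assumes c: "adapted c" and p: "p \<in> P" "p \<in> fst c"
  shows "\<exists>W A B. openin X W \<and> p \<in> W \<and> normal_form (restrict_chart c W) A B"
proof -
  obtain c0 V where c0: "(c0, V) \<in> \<F>" "p \<in> fst c0" using N_cover PN p by blast
  note f = fieldD[OF c0(1)] and cc = adaptedD(1)[OF c]
  let ?W = "fst c0"
  let ?S = "img c ?W" and ?t = "transition c c0" and ?T = "transition c0 c"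
  have oW: "openin X ?W" by (rule chart_open(1)[OF f(1)])
  have oS: "open ?S" by (rule img_open[OF cc oW])
  have oS0: "open (img c0 (fst c))" by (rule img_open[OF f(1) chart_open(1)[OF cc]])
  have t: "holomorphic2_map_on ?t ?S" by (rule transition_hol[OF cc f(1)])
  have T: "holomorphic2_map_on ?T (img c0 (fst c))" by (rule transition_hol[OF f(1) cc])
  have tS: "?t ` ?S \<subseteq> img c0 (fst c)"
    using transition_at[OF cc, where d = c0] by fastforce
  \<comment> \<open>The push-forward of \<open>V\<close>, as a function of the coordinates in
    \<open>c\<close>.\<close>
  define V' where "V' = (\<lambda>w. frechet_derivative ?T (at (?t w)) (V (?t w)))"
  have V'J: "V' (snd c q) = J c0 c q (V (snd c0 q))" if "q \<in> fst c" for q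
    by (simp add: V'_def J_def transition_at[OF cc that])
  have V'_eq: "V' w = (D1 (\<lambda>z. fst (?T z)) (?t w) * fst (V (?t w)) + D2 (\<lambda>z. fst (?T z)) (?t w) * snd (V (?t w)),
      D1 (\<lambda>z. snd (?T z)) (?t w) * fst (V (?t w)) + D2 (\<lambda>z. snd (?T z)) (?t w) * snd (V (?t w)))" if "w \<in> ?S" for w
  proof -
    have "?t w \<in> img c0 (fst c)" using that tS by blast
    from hol2_map_derivative(2)[OF T this, of "fst (V (?t w))" "snd (V (?t w))"] show ?thesis by (simp add: V'_def)
  qed
  have Th: "holomorphic2_on (\<lambda>z. fst (?T z)) (img c0 (fst c))" "holomorphic2_on (\<lambda>z. snd (?T z)) (img c0 (fst c))"
    using T by (auto simp: holomorphic2_map_on_def)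
  note co = hol2_compose[OF _ t tS]
  have Vh: "holomorphic2_on (\<lambda>z. fst (V z)) (img c0 (fst c))" "holomorphic2_on (\<lambda>z. snd (V z)) (img c0 (fst c))"
    using f(3) hol2_subset[of _ "snd c0 ` fst c0" "img c0 (fst c)"] by (auto simp: holomorphic2_map_on_def)
  note hh = co[OF D1_hol2[OF oS0 Th(1)]] co[OF D2_hol2[OF oS0 Th(1)]] co[OF D1_hol2[OF oS0 Th(2)]]
    co[OF D2_hol2[OF oS0 Th(2)]] co[OF Vh(1)] co[OF Vh(2)]
  have h1: "holomorphic2_on (\<lambda>w. fst (V' w)) ?S"
    by (rule hol2_cong[OF oS _ hol2_add[OF hol2_mult[OF hh(1,5)] hol2_mult[OF hh(2,6)]]]) (simp add: V'_eq)
  have h2: "holomorphic2_on (\<lambda>w. snd (V' w)) ?S"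
    by (rule hol2_cong[OF oS _ hol2_add[OF hol2_mult[OF hh(3,5)] hol2_mult[OF hh(4,6)]]]) (simp add: V'_eq)
  have V'0: "snd (V' (x, 0)) = 0" if x: "(x, 0) \<in> ?S" for x
  proof -
    have "x \<in> slice c ?W" using x by (simp add: slice_def)
    note q = slice_point[OF c this]
    have "snd (J c0 c (iv c (x, 0)) (V (snd c0 (iv c (x, 0))))) = 0"
      using inv c0(1) c q(1-3) unfolding invariant_curve_def J_def by blast
    then show ?thesis using V'J[OF q(2)] q(4) by simp
  qed
  define B where "B = (\<lambda>(x, y). if y = 0 then D2 (\<lambda>w. snd (V' w)) (x, y) else snd (V' (x, y)) / y)"
  have V'0': "\<forall>x. (x, 0) \<in> ?S \<longrightarrow> snd (V' (x, 0)) = 0" using V'0 by blast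
  note B = hol2_divide_y[OF oS h2 V'0', folded B_def]
  define A where "A = (\<lambda>w. fst (V' w))"
  define Y where "Y = (\<lambda>(x, y). (A (x, y), y * B (x, y)))"
  have Y: "Y w = V' w" if "w \<in> ?S" for w
  proof -
    obtain x y where w: "w = (x, y)" by (cases w)
    then have "snd (V' (x, y)) = y * B (x, y)" using B(2) that by blast
    then show ?thesis by (simp add: Y_def A_def w prod_eq_iff)
  qed
  let ?c = "restrict_chart c ?W"
  have sf: "same_foliation (?c, Y) (d, Z)" if d: "(d, Z) \<in> \<F>" for d Z
  proof -
    note dc = fieldD(1)[OF d]
    obtain g where g: "holomorphic2_on g (img c0 (fst d))" "\<forall>z \<in> img c0 (fst d). g z \<noteq> 0 \<and>
        frechet_derivative (transition c0 d) (at z) (V z) = cscale (g z) (Z (transition c0 d z))"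
      using lgenD(4)[OF f(4) d] by (auto simp: same_foliation_def)
    let ?Sd = "img c (?W \<inter> fst d)"
    have sub: "?t ` ?Sd \<subseteq> img c0 (fst d)" using transition_at[OF cc, where d = c0] by fastforce
    have t': "holomorphic2_map_on ?t ?Sd"
      using t hol2_subset[of _ ?S ?Sd] unfolding holomorphic2_map_on_def by blast
    have "holomorphic2_on (\<lambda>z. g (?t z)) ?Sd" by (rule hol2_compose[OF g(1) t' sub])
    moreover have "g (?t z) \<noteq> 0 \<and> frechet_derivative (transition ?c d) (at z) (Y z) = cscale (g (?t z)) (Z (transition ?c d z))"
      if z: "z \<in> ?Sd" for z
    proof -
      obtain q where q: "q \<in> fst c" "q \<in> ?W" "q \<in> fst d" "z = snd c q" using z by blast
      have tz: "?t z = snd c0 q" using transition_at[OF cc q(1)] q(4) by simp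
      have cq: "transition ?c d z = snd d q"
        using transition_at[OF restrict_chart_coord[OF cc oW], of q d] q by simp
      have "frechet_derivative (transition ?c d) (at z) (Y z) = J ?c d q (V' (snd c q))"
        using Y[of z] q by (simp add: J_def)
      also have "\<dots> = J c d q (J c0 c q (V (snd c0 q)))"
        using J_restrict_chart(1)[OF cc dc q(1,3) oW q(2)] V'J[OF q(1)] by simp
      also have "\<dots> = J c0 d q (V (snd c0 q))"
        using J_chain[OF f(1) cc dc q(2,1,3)] by simp
      also have "\<dots> = cscale (g (snd c0 q)) (Z (snd d q))"
        using g(2) q transition_at[OF f(1) q(2), of d] unfolding J_def by (metis IntI imageI)
      finally show ?thesis using g(2) q tz cq by auto
    qed
    ultimately show ?thesis
      unfolding same_foliation_def prod.case restrict_chart_simps Int_assoc by (intro exI[of _ "\<lambda>z. g (?t z)"] conjI ballI) blast+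
  qed
  have "holomorphic2_map_on Y (img c ?W)"
    unfolding holomorphic2_map_on_def
    using hol2_cong[OF oS _ h1, of "\<lambda>w. fst (Y w)"] hol2_cong[OF oS _ h2, of "\<lambda>w. snd (Y w)"] Y by auto
  then have "lgen ?c Y"
    using restrict_chart_coord[OF cc oW] f(2) sf by (auto simp: local_generator_def)
  then have "normal_form ?c A B"
    unfolding normal_form_def Y_def using restrict_chart_adapted[OF c oW] h1 B(1) by (simp add: A_def)
  then show ?thesis using oW c0(2) by blast
qed

lemma normal_formD:
  assumes "normal_form c A B"
  shows "adapted c" "coord c" "holomorphic2_on A (snd c ` fst c)" "holomorphic2_on B (snd c ` fst c)"
    "lgen c (\<lambda>(x, y). (A (x, y), y * B (x, y)))"
  using assms adaptedD(1) by (auto simp: normal_form_def)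

lemma normal_form_sing:
  assumes "normal_form c A B" "x \<in> slice c W"
  shows "sing (iv c (x, 0)) \<longleftrightarrow> A (x, 0) = 0"
  using sing_iff[OF normal_formD(5)[OF assms(1)] slice_point(2)[OF normal_formD(1)[OF assms(1)] assms(2)]]
    slice_point(4)[OF normal_formD(1)[OF assms(1)] assms(2)] by (simp add: zero_prod_def)

text \<open>Under a change of adapted charts \<open>(B/A) dx\<close> changes by \<open>du/u\<close>, hence is a connection form on the normal bundle.\<close>

lemma omega_transform:
  assumes c: "normal_form c A B" and d: "normal_form d A' B'" and x: "x \<in> slice c (fst d)" and ns: "\<not> sing (iv c (x, 0))"
  shows "B' (slice_transition c d x, 0) / A' (slice_transition c d x, 0) * \<alpha> c d (iv c (x, 0))
    = B (x, 0) / A (x, 0) + D1 (D2 (\<lambda>z. snd (transition c d z))) (x, 0) / u c d (iv c (x, 0))"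
proof -
  note C = normal_formD[OF c] and D = normal_formD[OF d]
  define T where "T = transition c d"
  define T1 where "T1 = (\<lambda>z. fst (T z))"
  define T2 where "T2 = (\<lambda>z. snd (T z))"
  define q where "q = iv c (x, 0)"
  let ?S = "img c (fst d)"
  note tp = slice_transition_props[OF C(1) D(1) x, folded q_def]
  have oS: "open ?S" by (rule img_open[OF C(2) chart_open(1)[OF D(2)]])
  have T: "holomorphic2_map_on T ?S" unfolding T_def by (rule transition_hol[OF C(2) D(2)])
  then have T12: "holomorphic2_on T1 ?S" "holomorphic2_on T2 ?S" by (auto simp: holomorphic2_map_on_def T1_def T2_def)
  have T20: "T2 (x, 0) = 0" if "(x, 0) \<in> ?S" for x
  proof -
    have "x \<in> slice c (fst d)" using that by (simp add: slice_def)
    note p = slice_transition_props[OF C(1) D(1) this]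
    show ?thesis using transition_at[OF C(2) p(5), of d] p(2,7) by (simp add: T2_def T_def)
  qed
  \<comment> \<open>The second component of the transition is \<open>y * U\<close>, and on
    \<open>y = 0\<close> the factor \<open>U\<close> is the cocycle \<open>u\<close>.\<close>
  define U where "U = (\<lambda>(x, y). if y = 0 then D2 T2 (x, y) else T2 (x, y) / y)"
  have T20': "\<forall>x. (x, 0) \<in> ?S \<longrightarrow> T2 (x, 0) = 0" using T20 by blast
  note U = hol2_divide_y[OF oS T12(2) T20', folded U_def]
  have xS: "(x, 0) \<in> ?S" using x by (simp add: slice_def)
  have dT2: "D1 T2 (x, y) = y * D1 U (x, y)" "D2 T2 (x, y) = U (x, y) + y * D2 U (x, y)" if "(x, y) \<in> ?S" for x y
  proof -
    have h: "holomorphic2_on (\<lambda>z. snd z * U z) ?S" by (rule hol2_mult[OF hol2_snd U(1)])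
    have "(T2 has_derivative (\<lambda>(h, k). D1 T2 (x, y) * h + D2 T2 (x, y) * k)) (at (x, y))"
      by (rule hol2_has_derivative[OF T12(2) that])
    moreover have "(T2 has_derivative (\<lambda>v. snd (x, y) * (case v of (h, k) \<Rightarrow> D1 U (x, y) * h + D2 U (x, y) * k) + snd v * U (x, y))) (at (x, y))"
    proof (rule has_derivative_transform_within_open[OF _ oS that])
      show "((\<lambda>z. snd z * U z) has_derivative (\<lambda>v. snd (x, y) * (case v of (h, k) \<Rightarrow> D1 U (x, y) * h + D2 U (x, y) * k) + snd v * U (x, y))) (at (x, y))"
        by (rule has_derivative_mult[OF bounded_linear_imp_has_derivative[OF bounded_linear_snd] hol2_has_derivative[OF U(1) that]])
      fix w assume w: "w \<in> ?S"
      obtain a b where ab: "w = (a, b)" by (cases w)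
      show "snd w * U w = T2 w" using U(2)[of a b] w unfolding ab by simp
    qed
    ultimately have eq: "(\<lambda>(h, k). D1 T2 (x, y) * h + D2 T2 (x, y) * k) =
      (\<lambda>v. snd (x, y) * (case v of (h, k) \<Rightarrow> D1 U (x, y) * h + D2 U (x, y) * k) + snd v * U (x, y))"
      by (rule has_derivative_unique)
    from fun_cong[OF eq, of "(1, 0)"] fun_cong[OF eq, of "(0, 1)"]
    show "D1 T2 (x, y) = y * D1 U (x, y)" "D2 T2 (x, y) = U (x, y) + y * D2 U (x, y)" by (simp_all add: add.commute)
  qed
  \<comment> \<open>The two components of the proportionality of the fields, with the unknown factor
    eliminated and a common factor \<open>y\<close> cancelled. The cancellation is legitimate for
    non-zero \<open>y\<close>; the wanted relation on \<open>y = 0\<close> follows by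
    continuity.\<close>
  define L where "L = (\<lambda>z. (D1 U z * A z + (U z + snd z * D2 U z) * B z) * A' (T z)
      - U z * B' (T z) * (D1 T1 z * A z + D2 T1 z * (snd z * B z)))"
  have L0: "L (x, y) = 0" if z: "(x, y) \<in> ?S" "y \<noteq> 0" for x y
  proof -
    obtain p where p: "p \<in> fst c" "p \<in> fst d" "(x, y) = snd c p" using z(1) by blast
    have Tz: "T (x, y) = snd d p" using transition_at[OF C(2) p(1)] p(3) by (simp add: T_def)
    obtain g where g: "J c d p (A (x, y), y * B (x, y)) = cscale g (A' (T (x, y)), T2 (x, y) * B' (T (x, y)))"
      using lgen_agree[OF C(5) D(5) p(1,2)] unfolding agree_def p(3)[symmetric] Tz[symmetric]
      by (auto simp: case_prod_unfold T2_def)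
    have "J c d p (A (x, y), y * B (x, y)) = (D1 T1 (x, y) * A (x, y) + D2 T1 (x, y) * (y * B (x, y)),
        D1 T2 (x, y) * A (x, y) + D2 T2 (x, y) * (y * B (x, y)))"
      using hol2_map_derivative(2)[OF T z(1)] unfolding J_def p(3)[symmetric] T_def[symmetric] T1_def T2_def by simp
    then have 1: "D1 T1 (x, y) * A (x, y) + D2 T1 (x, y) * (y * B (x, y)) = g * A' (T (x, y))"
      and 2: "D1 T2 (x, y) * A (x, y) + D2 T2 (x, y) * (y * B (x, y)) = g * (T2 (x, y) * B' (T (x, y)))"
      using g by (auto simp: cscale_def)
    have "y * (D1 U (x, y) * A (x, y) + (U (x, y) + y * D2 U (x, y)) * B (x, y)) = y * (g * (U (x, y) * B' (T (x, y))))"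
      using 2 unfolding dT2[OF z(1)] U(2)[OF z(1)] by (simp add: algebra_simps)
    then have "D1 U (x, y) * A (x, y) + (U (x, y) + y * D2 U (x, y)) * B (x, y) = g * (U (x, y) * B' (T (x, y)))"
      using z(2) by simp
    then show ?thesis unfolding L_def snd_conv 1 by (simp add: algebra_simps)
  qed
  have TS: "T ` ?S \<subseteq> snd d ` fst d" unfolding T_def using transition_at[OF C(2), where d = d] by fastforce
  have subS: "?S \<subseteq> snd c ` fst c" by blast
  have "holomorphic2_on L ?S"
  proof -
    note h = hol2_compose[OF D(3) T TS] hol2_compose[OF D(4) T TS] hol2_subset[OF C(3) subS] hol2_subset[OF C(4) subS]
      U(1) D1_hol2[OF oS U(1)] D2_hol2[OF oS U(1)] D1_hol2[OF oS T12(1)] D2_hol2[OF oS T12(1)] hol2_snd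
    have "holomorphic2_on (\<lambda>z. (D1 U z * A z + (U z + snd z * D2 U z) * B z) * A' (T z)
      + (- 1) * (U z * B' (T z) * (D1 T1 z * A z + D2 T1 z * (snd z * B z)))) ?S"
      by (intro hol2_add hol2_mult h hol2_const)
    then show ?thesis by (simp add: L_def)
  qed
  then have "continuous_on ?S L" by (rule hol2_continuous)
  then have "isCont L (x, 0)" using oS xS continuous_on_eq_continuous_at by blast
  then have "isCont (\<lambda>y. L (x, y)) 0"
    using continuous_at_compose[of 0 "\<lambda>y. (x, y)" L] by (simp add: o_def continuous_intros)
  then have lim: "((\<lambda>y. L (x, y)) \<longlongrightarrow> L (x, 0)) (at 0)" by (simp add: isCont_def)
  have "open ((\<lambda>y. (x, y)) -` ?S)" by (intro open_vimage oS continuous_intros)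
  then have "\<forall>\<^sub>F y in at 0. (x, y) \<in> ?S"
    unfolding eventually_at_topological using xS by (intro exI[of _ "(\<lambda>y. (x, y)) -` ?S"]) auto
  moreover have "\<forall>\<^sub>F y in at 0. y \<noteq> (0::complex)" by (simp add: eventually_at_filter)
  ultimately have "\<forall>\<^sub>F y in at 0. L (x, y) = 0" by eventually_elim (rule L0)
  then have "((\<lambda>y. L (x, y)) \<longlongrightarrow> 0) (at 0)" by (rule tendsto_eventually)
  from tendsto_unique[OF _ lim this] have L00: "L (x, 0) = 0" by simp
  have Tx: "T (x, 0) = (slice_transition c d x, 0)" using tp(2) transition_at[OF C(2) tp(5), of d] tp(7) by (simp add: T_def)
  have Ax: "A (x, 0) \<noteq> 0" using normal_form_sing[OF c x] ns by simp
  have A'x: "A' (slice_transition c d x, 0) \<noteq> 0"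
    using sing_iff[OF D(5) tp(6)] ns tp(2) by (auto simp: q_def zero_prod_def)
  have ux: "U (x, 0) = u c d q" "D1 T1 (x, 0) = \<alpha> c d q"
    using J_shape(3,4)[OF C(1) D(1) tp(4,5,6)] tp(7) U(3) by (auto simp: T1_def T2_def T_def)
  have uz: "u c d q \<noteq> 0" by (rule u_nz(1)[OF C(1) D(1) tp(4,5,6)])
  have du: "D1 U (x, 0) = D1 (D2 T2) (x, 0)"
  proof (rule DERIV_unique)
    show "((\<lambda>x. U (x, 0)) has_field_derivative D1 U (x, 0)) (at x)" by (rule hol2_partial1[OF U(1) xS])
    have "((\<lambda>x. D2 T2 (x, 0)) has_field_derivative D1 (D2 T2) (x, 0)) (at x)"
      by (rule hol2_partial1[OF D2_hol2[OF oS T12(2)] xS])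
    then show "((\<lambda>x. U (x, 0)) has_field_derivative D1 (D2 T2) (x, 0)) (at x)" by (simp add: U(3))
  qed
  have "(D1 (D2 T2) (x, 0) * A (x, 0) + u c d q * B (x, 0)) * A' (slice_transition c d x, 0)
      = u c d q * B' (slice_transition c d x, 0) * (\<alpha> c d q * A (x, 0))"
    using L00 by (simp add: L_def Tx ux du)
  then show ?thesis
    using Ax A'x uz unfolding T2_def T_def q_def by (simp add: field_simps)
qed

lemma omega_holomorphic:
  assumes d: "normal_form c A B" and W: "openin X W" and V: "V \<subseteq> slice c W"
    and ns: "\<And>x. x \<in> V \<Longrightarrow> \<not> sing (iv c (x, 0))" and oV: "open V"
  shows "(\<lambda>x. B (x, 0) / A (x, 0)) holomorphic_on V"
proof -
  note D = normal_formD[OF d]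
  have "(x, 0) \<in> snd c ` fst c" if "x \<in> V" for x using that V by (auto simp: slice_def)
  then have "(\<lambda>x. A (x, 0)) holomorphic_on V" "(\<lambda>x. B (x, 0)) holomorphic_on V"
    unfolding holomorphic_on_open[OF oV] using hol2_partial1[OF D(3)] hol2_partial1[OF D(4)] by blast+
  moreover have "A (x, 0) \<noteq> 0" if "x \<in> V" for x using normal_form_sing[OF d, of x W] ns[OF that] V that by blast
  ultimately show ?thesis by (intro holomorphic_intros)
qed

text \<open>This makes the Camacho-Sad index well defined. On discs so small that \<open>q\<close>
  is the only singularity, the change of the connection form is exactly the situation of
  \<open>residue_transform\<close>, with the cocycle \<open>u\<close> of the normal bundle as the
  unit.\<close>

lemma residue_unique:
  assumes c: "normal_form c A B" and d: "normal_form d A' B'" and q: "q \<in> P" "centered_at c q" "centered_at d q"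
  shows "residue (\<lambda>x. B (x, 0) / A (x, 0)) 0 = residue (\<lambda>x. B' (x, 0) / A' (x, 0)) 0"
proof -
  note C = normal_formD[OF c] and D = normal_formD[OF d]
  have qc: "q \<in> fst c" "snd c q = (0, 0)" and qd: "q \<in> fst d" "snd d q = (0, 0)"
    using q by (auto simp: centered_at_def)
  obtain W where W: "openin X W" "q \<in> W" "\<forall>q'\<in>W. sing q' \<longrightarrow> q' = q" using sing_isolated q(1) PN by blast
  have oW: "openin X (fst d \<inter> W)" using W(1) chart_open(1)[OF D(2)] by blast
  let ?S = "slice c (fst d \<inter> W)"
  have S0: "0 \<in> ?S" using in_slice[OF C(1) q(1) qc(1), of "fst d \<inter> W"] qc qd W by simp
  have S0': "0 \<in> slice d W" using in_slice[OF D(1) q(1) qd(1), of W] qd W by simp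
  have oS: "open ?S" by (rule slice_open[OF C(2) oW])
  have sub: "x \<in> slice c (fst d)" if "x \<in> ?S" for x using that by (auto simp: slice_def)
  obtain R2 where R2: "R2 > 0" "ball 0 R2 \<subseteq> slice d W"
    using openE[OF slice_open[OF D(2) W(1)] S0'] by blast
  have ivc: "iv c (0, 0) = q" using iv_left[OF C(2) qc(1)] qc(2) by simp
  have tr0: "slice_transition c d 0 = 0" using slice_transition_props(3)[OF C(1) D(1) sub[OF S0]] ivc qd by simp
  have ct: "continuous_on ?S (slice_transition c d)"
    using slice_transition_props(1)[OF C(1) D(1) sub] DERIV_isCont continuous_at_imp_continuous_on by blast
  have "open (?S \<inter> slice_transition c d -` ball 0 R2)" by (rule continuous_open_preimage[OF ct oS open_ball])
  moreover have "0 \<in> ?S \<inter> slice_transition c d -` ball 0 R2" using S0 tr0 R2 by simp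
  ultimately obtain R where R: "R > 0" "ball 0 R \<subseteq> ?S \<inter> slice_transition c d -` ball 0 R2" by (rule openE)
  have Rs: "x \<in> ?S" "x \<in> slice c (fst d)" "slice_transition c d x \<in> ball 0 R2" if "x \<in> ball 0 R" for x using R(2) that sub by auto
  have uq: "iv c (x, 0) \<noteq> q" if "x \<in> punctured_ball R" for x
    using slice_point(4)[OF C(1) Rs(1)[of x]] that qc(2) by auto
  have ns: "\<not> sing (iv c (x, 0))" if "x \<in> punctured_ball R" for x
    using W(3) slice_point(3)[OF C(1) Rs(1)[of x]] uq[OF that] that by blast
  have ns2: "\<not> sing (iv d (x, 0))" if x: "x \<in> punctured_ball R2" for x
  proof -
    have xs: "x \<in> slice d W" using R2(2) x by blast
    have "iv d (x, 0) \<noteq> q" using slice_point(4)[OF D(1) xs] x qd(2) by auto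
    then show ?thesis using W(3) slice_point(3)[OF D(1) xs] by blast
  qed
  show ?thesis
  proof (rule residue_transform[OF R(1) R2(1), where t = "slice_transition c d" and u = "\<lambda>x. u c d (iv c (x, 0))"])
    have der: "(slice_transition c d has_field_derivative \<alpha> c d (iv c (x, 0))) (at x)" if "x \<in> ball 0 R" for x
      by (rule slice_transition_props(1)[OF C(1) D(1) Rs(2)[OF that]])
    then show "slice_transition c d holomorphic_on ball 0 R" unfolding holomorphic_on_open[OF open_ball] by blast
    show "slice_transition c d 0 = 0" by (rule tr0)
    show "deriv (slice_transition c d) z \<noteq> 0" if "z \<in> ball 0 R" for z
      using DERIV_imp_deriv[OF der[OF that]] u_nz(2)[OF C(1) D(1) slice_transition_props(4-6)[OF C(1) D(1) Rs(2)[OF that]]] by simp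
    show "slice_transition c d z \<in> punctured_ball R2" if z: "z \<in> punctured_ball R" for z
    proof -
      have zb: "z \<in> ball 0 R" using z by blast
      note p = slice_transition_props[OF C(1) D(1) Rs(2)[OF zb]]
      have "slice_transition c d z \<noteq> 0"
      proof
        assume "slice_transition c d z = 0"
        then have "snd d (iv c (z, 0)) = snd d q" using p(2) qd by simp
        then have "iv c (z, 0) = q" using chart_inj[OF D(2)] p(6) qd(1) by (auto dest: inj_onD)
        then show False using uq[OF z] by simp
      qed
      then show ?thesis using Rs(3)[OF zb] by blast
    qed
    show "(\<lambda>x. B (x, 0) / A (x, 0)) holomorphic_on punctured_ball R"
      by (rule omega_holomorphic[OF c oW]) (use Rs(1) ns in \<open>auto intro: open_Diff\<close>)
    show "(\<lambda>x. B' (x, 0) / A' (x, 0)) holomorphic_on punctured_ball R2"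
      by (rule omega_holomorphic[OF d W(1)]) (use R2 ns2 in \<open>auto intro: open_Diff\<close>)
    show "(\<lambda>x. u c d (iv c (x, 0))) holomorphic_on ball 0 R"
      by (rule holomorphic_on_subset[OF u_holomorphic(1)[OF C(1) D(1)]]) (use Rs(2) in blast)
    show "u c d (iv c (z, 0)) \<noteq> 0" if "z \<in> ball 0 R" for z
      by (rule u_nz(1)[OF C(1) D(1) slice_transition_props(4-6)[OF C(1) D(1) Rs(2)[OF that]]])
    show "B' (slice_transition c d z, 0) / A' (slice_transition c d z, 0) * deriv (slice_transition c d) z = B (z, 0) / A (z, 0) +
         deriv (\<lambda>x. u c d (iv c (x, 0))) z / u c d (iv c (z, 0))" if z: "z \<in> punctured_ball R" for z
    proof -
      have zb: "z \<in> ball 0 R" using z by blast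
      show ?thesis
        using omega_transform[OF c d Rs(2)[OF zb] ns[OF z]] DERIV_imp_deriv[OF der[OF zb]]
          DERIV_imp_deriv[OF u_holomorphic(2)[OF C(1) D(1) Rs(2)[OF zb]]] by simp
    qed
  qed
qed

lemma camacho_sad_eq:
  assumes "normal_form c A B" "centered_at c q" "q \<in> P"
  shows "camacho_sad X \<A> N \<F> P q = residue (\<lambda>x. B (x, 0) / A (x, 0)) 0"
  unfolding camacho_sad_def
proof (rule the_equality)
  show "\<exists>c A' B'. adapted c \<and> centered_at c q \<and> holomorphic2_on A' (snd c ` fst c) \<and> holomorphic2_on B' (snd c ` fst c) \<and>
       lgen c (\<lambda>(x, y). (A' (x, y), y * B' (x, y))) \<and>
       residue (\<lambda>x. B (x, 0) / A (x, 0)) 0 = residue (\<lambda>x. B' (x, 0) / A' (x, 0)) 0"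
    using assms unfolding normal_form_def by blast
  fix \<kappa> assume "\<exists>c A B. adapted c \<and> centered_at c q \<and> holomorphic2_on A (snd c ` fst c) \<and> holomorphic2_on B (snd c ` fst c) \<and>
       lgen c (\<lambda>(x, y). (A (x, y), y * B (x, y))) \<and> \<kappa> = residue (\<lambda>x. B (x, 0) / A (x, 0)) 0"
  then obtain d A' B' where "normal_form d A' B'" "centered_at d q" "\<kappa> = residue (\<lambda>x. B' (x, 0) / A' (x, 0)) 0"
    unfolding normal_form_def by blast
  then show "\<kappa> = residue (\<lambda>x. B (x, 0) / A (x, 0)) 0"
    using residue_unique[OF assms(1) _ assms(3,2)] by simp
qed

end

section \<open>The index formula for a section of the normal bundle\<close>

locale compact_foliated = foliated +
  assumes crc: "compact_regular_curve X \<A> P"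
begin

lemma adapted_centered: "q \<in> P \<Longrightarrow> \<exists>c. adapted c \<and> centered_at c q"
  using crc by (simp add: compact_regular_curve_def)

lemma P_compact: "compactin X P"
  using crc by (simp add: compact_regular_curve_def)

lemma finite_sing: "finite {q \<in> P. sing q}"
proof -
  have "\<exists>W. \<forall>q\<in>P. openin X (W q) \<and> q \<in> W q \<and> (\<forall>q'\<in>W q. sing q' \<longrightarrow> q' = q)"
    using sing_isolated PN by (intro bchoice) blast
  then obtain W where W: "\<And>q. q \<in> P \<Longrightarrow> openin X (W q) \<and> q \<in> W q \<and> (\<forall>q'\<in>W q. sing q' \<longrightarrow> q' = q)" by blast
  have "\<forall>U\<in>W ` P. openin X U" "P \<subseteq> \<Union> (W ` P)" using W by auto
  then obtain \<G> where "finite \<G>" "\<G> \<subseteq> W ` P" "P \<subseteq> \<Union> \<G>"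
    using P_compact unfolding compactin_def by metis
  moreover obtain Q where Q: "finite Q" "Q \<subseteq> P" "\<G> = W ` Q"
    using finite_subset_image[OF calculation(1,2)] by blast
  ultimately have cov: "P \<subseteq> \<Union> (W ` Q)" by simp
  have "{q \<in> P. sing q} \<subseteq> Q"
  proof
    fix q assume q: "q \<in> {q \<in> P. sing q}"
    then obtain p where p: "p \<in> Q" "q \<in> W p" using cov by blast
    then have "q = p" using W[of p] Q(2) q by blast
    then show "q \<in> Q" using p by simp
  qed
  then show ?thesis using Q(1) finite_subset by blast
qed

lemma slice_cont:
  assumes c: "adapted c" and V: "V \<subseteq> slice c W"
    and f: "continuous_map (subtopology X (P \<inter> fst c)) euclidean (f :: 'a \<Rightarrow> complex)"
  shows "continuous_on V (\<lambda>z. f (iv c (z, 0)))"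
proof -
  have sub: "(\<lambda>z. (z, 0)) ` V \<subseteq> snd c ` fst c" using V by (auto simp: slice_def)
  have "continuous_map (top_of_set V) (top_of_set (snd c ` fst c)) (\<lambda>z. (z, 0))"
    using sub by (auto intro!: continuous_intros simp: continuous_map_in_subtopology)
  then have "continuous_map (top_of_set V) X (iv c \<circ> (\<lambda>z. (z, 0)))"
    using continuous_map_compose iv_cont[OF adaptedD(1)[OF c]] by blast
  then have "continuous_map (top_of_set V) (subtopology X (P \<inter> fst c)) (\<lambda>z. iv c (z, 0))"
    using slice_point(1,2)[OF c] V by (auto simp: continuous_map_in_subtopology o_def)
  then have "continuous_map (top_of_set V) euclidean (f \<circ> (\<lambda>z. iv c (z, 0)))"
    using f continuous_map_compose by blast
  then show ?thesis by (simp add: o_def)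
qed

end

section \<open>Logarithms of a section and primitives of the connection form\<close>

locale section_data = compact_foliated +
  fixes s :: "'a chart \<Rightarrow> 'a \<Rightarrow> complex" and m :: "'a \<Rightarrow> int"
  assumes sec: "normal_section X \<A> P s" and fin0: "finite (section_zeros X \<A> P s)"
    and idx: "q \<in> section_zeros X \<A> P s \<Longrightarrow> has_zero_index X \<A> P s q (m q)"
begin

abbreviation "zeros \<equiv> section_zeros X \<A> P s"
definition Z :: "'a set" where "Z = zeros \<union> {q \<in> P. sing q}"

lemma Z: "finite Z" "Z \<subseteq> P"
  using fin0 finite_sing by (auto simp: Z_def section_zeros_def)

lemma sec_trans: "adapted c \<Longrightarrow> adapted d \<Longrightarrow> q \<in> P \<Longrightarrow> q \<in> fst c \<Longrightarrow> q \<in> fst d \<Longrightarrow> s d q = u c d q * s c q"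
  using sec unfolding normal_section_def u_def J_def by blast

lemma sec_cont: "adapted c \<Longrightarrow> continuous_map (subtopology X (P \<inter> fst c)) euclidean (s c)"
  using sec unfolding normal_section_def by blast

text \<open>A section assigns a component to every adapted chart, including restrictions of charts;
  shrinking the domain leaves the component unchanged because the cocycle between the two charts is
  1.\<close>

lemma sec_restrict: "adapted c \<Longrightarrow> openin X W \<Longrightarrow> q \<in> P \<Longrightarrow> q \<in> fst c \<Longrightarrow> q \<in> W \<Longrightarrow> s (restrict_chart c W) q = s c q"
proof -
  assume *: "adapted c" "openin X W" "q \<in> P" "q \<in> fst c" "q \<in> W"
  have "u c (restrict_chart c W) q = u c c q"
    using J_restrict_chart(2)[OF adaptedD(1)[OF *(1)] adaptedD(1)[OF *(1)] *(4,4,2,5)] by (simp add: u_def)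
  then show ?thesis using sec_trans[OF *(1) restrict_chart_adapted[OF *(1,2)] *(3,4)] * u_id(1)[OF *(1,3,4)] by simp
qed

lemma sec_nz: "adapted c \<Longrightarrow> q \<in> P \<Longrightarrow> q \<in> fst c \<Longrightarrow> q \<notin> zeros \<Longrightarrow> s c q \<noteq> 0"
  unfolding section_zeros_def by blast

definition disc_off_Z :: "'a chart \<Rightarrow> real \<Rightarrow> complex set" where
  "disc_off_Z c R = {z \<in> ball 0 R. iv c (z, 0) \<notin> Z}"

text \<open>The data represent \<open>ds/s - \<omega>\<close> on a disc as
  \<open>(k - \<kappa>) dz / z + d(g - h)\<close>: \<open>g\<close> is a logarithm of the section
  divided by \<open>z powi k\<close>, and \<open>h\<close> is a primitive of
  \<open>\<omega> - \<kappa> dz / z\<close>. If \<open>p\<close> is not in \<open>Z\<close>, both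
  numbers are 0 and the disc is not punctured.\<close>

definition local_branch :: "'a \<Rightarrow> 'a chart \<Rightarrow> (cplane \<Rightarrow> complex) \<Rightarrow> (cplane \<Rightarrow> complex) \<Rightarrow> real \<Rightarrow> int \<Rightarrow> (complex \<Rightarrow> complex)
    \<Rightarrow> complex \<Rightarrow> (complex \<Rightarrow> complex) \<Rightarrow> bool" where
  "local_branch p c A B R k g \<kappa> h \<longleftrightarrow> normal_form c A B \<and> centered_at c p \<and> fst c \<inter> Z \<subseteq> {p} \<and> R > 0 \<and> ball 0 R \<subseteq> slice c UNIV \<and>
     k = (if p \<in> zeros then m p else 0) \<and> \<kappa> = (if sing p then camacho_sad X \<A> N \<F> P p else 0) \<and>
     continuous_on (disc_off_Z c R) g \<and> (\<forall>z\<in>disc_off_Z c R. s c (iv c (z, 0)) = z powi k * exp (g z)) \<and>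
     (\<forall>z\<in>disc_off_Z c R. (h has_field_derivative B (z, 0) / A (z, 0) - \<kappa> / z) (at z))"

text \<open>At a zero the multiplicity is known through a chart supplied by
  \<open>has_zero_index\<close>, so that chart must be used. Shrinking it gives a normal form and
  removes the other points of \<open>Z\<close>; the winding number on small circles does not
  notice.\<close>

lemma good_chart:
  assumes p: "p \<in> P"
  shows "\<exists>c A B. normal_form c A B \<and> centered_at c p \<and> fst c \<inter> Z \<subseteq> {p} \<and> (p \<in> zeros \<longrightarrow>
    (\<forall>\<^sub>F r in at_right 0. winding_number (\<lambda>t. s c (iv c (circlepath 0 r t, 0))) 0 = of_int (m p)))"
proof -
  have "\<exists>c. adapted c \<and> centered_at c p \<and> (p \<in> zeros \<longrightarrow>
    (\<forall>\<^sub>F r in at_right 0. winding_number (\<lambda>t. s c (iv c (circlepath 0 r t, 0))) 0 = of_int (m p)))"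
  proof (cases "p \<in> zeros")
    case True
    then show ?thesis using idx[OF True] unfolding has_zero_index_def by blast
  next
    case False
    then show ?thesis using adapted_centered[OF p] by blast
  qed
  then obtain c where c: "adapted c" "centered_at c p" "p \<in> zeros \<Longrightarrow>
    \<forall>\<^sub>F r in at_right 0. winding_number (\<lambda>t. s c (iv c (circlepath 0 r t, 0))) 0 = of_int (m p)" by blast
  have pc: "p \<in> fst c" "snd c p = (0, 0)" using c(2) by (auto simp: centered_at_def)
  obtain W A B where W: "openin X W" "p \<in> W" "normal_form (restrict_chart c W) A B" using normal_form_exists[OF c(1) p pc(1)] by blast
  let ?W = "topspace X - (Z - {p})"
  have "closedin X (Z - {p})"
    using Z P_top haus by (intro closedin_Hausdorff_finite) auto
  then have oW': "openin X ?W" by blast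
  let ?c = "restrict_chart (restrict_chart c W) ?W"
  have "normal_form ?c A B" by (rule normal_form_restrict[OF W(3) oW'])
  moreover have "centered_at ?c p" using pc W(2) P_top p by (auto simp: centered_at_def)
  moreover have "fst ?c \<inter> Z \<subseteq> {p}" by auto
  moreover have "\<forall>\<^sub>F r in at_right 0. winding_number (\<lambda>t. s ?c (iv ?c (circlepath 0 r t, 0))) 0 = of_int (m p)" if "p \<in> zeros"
  proof -
    have oWW: "openin X (W \<inter> ?W)" using W(1) oW' by blast
    have ceq: "?c = restrict_chart c (W \<inter> ?W)" by (simp add: restrict_chart_def Int_assoc)
    have "0 \<in> slice c (W \<inter> ?W)" using in_slice[OF c(1) p pc(1), of "W \<inter> ?W"] pc(2) W(2) p P_top by auto
    then obtain e where e: "e > 0" "ball 0 e \<subseteq> slice c (W \<inter> ?W)"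
      using openE[OF slice_open[OF adaptedD(1)[OF c(1)] oWW]] by blast
    have "\<forall>\<^sub>F r in at_right 0. r < e \<and> r > 0" using e(1) by (auto simp: eventually_at_right intro: exI[of _ e])
    then show ?thesis
      using c(3)[OF that]
    proof eventually_elim
      case (elim r)
      have "s ?c (iv ?c (circlepath 0 r t, 0)) = s c (iv c (circlepath 0 r t, 0))" for t
      proof -
        have "circlepath 0 r t \<in> ball 0 e" using elim by (simp add: circlepath norm_mult)
        then have x: "circlepath 0 r t \<in> slice c (W \<inter> ?W)" using e(2) by blast
        note q = slice_point[OF c(1) x]
        have "iv ?c (snd ?c (iv c (circlepath 0 r t, 0))) = iv c (circlepath 0 r t, 0)"
          unfolding ceq by (rule iv_left[OF restrict_chart_coord[OF adaptedD(1)[OF c(1)] oWW]]) (use q in simp)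
        then have "iv ?c (circlepath 0 r t, 0) = iv c (circlepath 0 r t, 0)" using q(4) by simp
        moreover have "s ?c (iv c (circlepath 0 r t, 0)) = s c (iv c (circlepath 0 r t, 0))"
          unfolding ceq by (rule sec_restrict[OF c(1) oWW q(1,2,3)])
        ultimately show ?thesis by simp
      qed
      then show ?case using elim(2) by simp
    qed
  qed
  ultimately show ?thesis by blast
qed

lemma local_branch_exists:
  assumes p: "p \<in> P"
  shows "\<exists>c A B R k g \<kappa> h. local_branch p c A B R k g \<kappa> h"
proof -
  obtain c A B where c: "normal_form c A B" "centered_at c p" "fst c \<inter> Z \<subseteq> {p}" "p \<in> zeros \<Longrightarrow>
    \<forall>\<^sub>F r in at_right 0. winding_number (\<lambda>t. s c (iv c (circlepath 0 r t, 0))) 0 = of_int (m p)"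
    using good_chart[OF p] by blast
  note C = normal_formD[OF c(1)]
  have pc: "p \<in> fst c" "snd c p = (0, 0)" using c(2) by (auto simp: centered_at_def)
  have iv0: "iv c (0, 0) = p" using iv_left[OF C(2) pc(1)] pc(2) by simp
  have "0 \<in> slice c UNIV" using in_slice[OF C(1) p pc(1), of UNIV] pc(2) by simp
  moreover have oU: "openin X (topspace X)" by simp
  have slU: "slice c UNIV = slice c (topspace X)" using fst_topspace[OF C(2)] by (auto simp: slice_def)
  ultimately obtain R where R: "R > 0" "ball 0 R \<subseteq> slice c UNIV"
    using openE[OF slice_open[OF C(2) oU]] by (metis slU)
  have ivz: "iv c (z, 0) \<in> P" "iv c (z, 0) \<in> fst c" "snd c (iv c (z, 0)) = (z, 0)" if "z \<in> ball 0 R" for z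
    using slice_point[OF C(1), of z UNIV] R(2) that by auto
  have notZ: "iv c (z, 0) \<notin> Z" if "z \<in> punctured_ball R" for z
    using c(3) ivz[of z] that pc(2) by auto
  have off_sub: "disc_off_Z c R \<subseteq> ball 0 R" by (auto simp: disc_off_Z_def)
  have off_p: "disc_off_Z c R \<subseteq> punctured_ball R" if "p \<in> Z"
    using that iv0 by (auto simp: disc_off_Z_def)
  define f where "f = (\<lambda>z. s c (iv c (z, 0)))"
  have cf: "continuous_on (ball 0 R) f" unfolding f_def by (rule slice_cont[OF C(1) R(2) sec_cont[OF C(1)]])
  have fnz: "f z \<noteq> 0" if "z \<in> ball 0 R" "iv c (z, 0) \<notin> zeros" for z
    unfolding f_def by (rule sec_nz[OF C(1) ivz(1,2)[OF that(1)] that(2)])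
  have "\<exists>k g. k = (if p \<in> zeros then m p else 0) \<and> continuous_on (disc_off_Z c R) g \<and> (\<forall>z\<in>disc_off_Z c R. f z = z powi k * exp (g z))"
  proof (cases "p \<in> zeros")
    case True
    then have pZ: "p \<in> Z" by (simp add: Z_def)
    have cf': "continuous_on (punctured_ball R) f" by (rule continuous_on_subset[OF cf]) auto
    have fnz': "f z \<noteq> 0" if "z \<in> punctured_ball R" for z using fnz[of z] notZ[OF that] that by (auto simp: Z_def)
    obtain k g where kg: "continuous_on (punctured_ball R) g" "\<And>z. z \<in> punctured_ball R \<Longrightarrow> f z = z powi k * exp (g z)"
      "\<And>r. 0 < r \<Longrightarrow> r < R \<Longrightarrow> winding_number (\<lambda>t. f (circlepath 0 r t)) 0 = of_int k"
      using punctured_log[OF R(1) cf' fnz'] by metis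
    have "\<forall>\<^sub>F r in at_right 0. r < R \<and> r > 0" using R(1) by (auto simp: eventually_at_right intro: exI[of _ R])
    \<comment> \<open>Both integers are the winding number on the same small circles.\<close>
    then have "\<forall>\<^sub>F r in at_right (0::real). (of_int k :: complex) = of_int (m p)"
      using c(4)[OF True] by eventually_elim (use kg(3) in \<open>simp add: f_def\<close>)
    then have "k = m p" by simp
    moreover have "continuous_on (disc_off_Z c R) g" by (rule continuous_on_subset[OF kg(1) off_p[OF pZ]])
    moreover have "\<forall>z\<in>disc_off_Z c R. f z = z powi k * exp (g z)" using kg(2) off_p[OF pZ] by blast
    ultimately show ?thesis using True by auto
  next
    case False
    have nz: "f z \<noteq> 0" if "z \<in> ball 0 R" for z
      using fnz[OF that] notZ[of z] that iv0 False by (cases "z = 0") (auto simp: Z_def)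
    obtain g where g: "continuous_on (ball 0 R) g" "\<And>z. z \<in> ball 0 R \<Longrightarrow> f z = exp (g z)"
      using continuous_logarithm_on_ball[OF cf nz] by metis
    then show ?thesis using False off_sub continuous_on_subset by (intro exI[of _ 0] exI[of _ g]) auto
  qed
  moreover have "\<exists>\<kappa> h. \<kappa> = (if sing p then camacho_sad X \<A> N \<F> P p else 0) \<and>
     (\<forall>z\<in>disc_off_Z c R. (h has_field_derivative B (z, 0) / A (z, 0) - \<kappa> / z) (at z))"
  proof (cases "sing p")
    case True
    then have pZ: "p \<in> Z" using p by (simp add: Z_def)
    have hol: "(\<lambda>x. B (x, 0) / A (x, 0)) holomorphic_on punctured_ball R"
    proof (rule omega_holomorphic[OF c(1) oU])
      show "punctured_ball R \<subseteq> slice c (topspace X)" using R(2) slU by blast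
      show "\<not> sing (iv c (x, 0))" if "x \<in> punctured_ball R" for x
        using notZ[OF that] ivz(1)[of x] that by (auto simp: Z_def)
    qed (auto intro: open_Diff)
    obtain h where h: "\<And>z. z \<in> punctured_ball R \<Longrightarrow> (h has_field_derivative B (z, 0) / A (z, 0) - residue (\<lambda>x. B (x, 0) / A (x, 0)) 0 / z) (at z)"
      using punctured_primitive[OF R(1) hol] by blast
    then have "\<forall>z\<in>disc_off_Z c R. (h has_field_derivative B (z, 0) / A (z, 0) - camacho_sad X \<A> N \<F> P p / z) (at z)"
      unfolding camacho_sad_eq[OF c(1,2) p] using off_p[OF pZ] by blast
    then show ?thesis using True by auto
  next
    case False
    have "(\<lambda>x. B (x, 0) / A (x, 0)) holomorphic_on ball 0 R"
    proof (rule omega_holomorphic[OF c(1) oU])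
      show "ball 0 R \<subseteq> slice c (topspace X)" using R(2) slU by blast
      show "\<not> sing (iv c (x, 0))" if "x \<in> ball 0 R" for x
      proof (cases "x = 0")
        case True then show ?thesis using iv0 False by simp
      next
        case x0: False
        then show ?thesis using notZ[of x] ivz(1)[OF that] that by (auto simp: Z_def)
      qed
    qed auto
    from holomorphic_convex_primitive'[OF convex_ball open_ball this] obtain h where
      "\<And>z. z \<in> ball 0 R \<Longrightarrow> (h has_field_derivative B (z, 0) / A (z, 0)) (at z within ball 0 R)" by metis
    then have "(h has_field_derivative B (z, 0) / A (z, 0)) (at z)" if "z \<in> ball 0 R" for z
      using at_within_open[OF that open_ball] that by metis
    then show ?thesis using False off_sub by (intro exI[of _ 0] exI[of _ h]) auto
  qed
  ultimately show ?thesis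
    unfolding local_branch_def using c(1-3) R unfolding f_def by blast
qed

text \<open>The alternative \<open>n = 0\<close> covers the centre of a disc without zero of the
  section, where \<open>t z\<close> may be 0 and the logarithmic derivative takes its default value
  0.\<close>

lemma powi_deriv:
  assumes "(t has_field_derivative t') (at z)" "t z \<noteq> 0 \<or> n = 0"
  shows "((\<lambda>z. t z powi n) has_field_derivative of_int n * t' / t z * t z powi n) (at z)"
proof (cases "n = 0")
  case False
  then have nz: "t z \<noteq> 0" using assms by auto
  have "((\<lambda>z. t z powi n) has_field_derivative of_int n * t z powi (n - 1) * t') (at z)"
    by (rule DERIV_power_int[OF assms(1)]) (use nz in simp)
  then show ?thesis using nz by (simp add: power_int_diff field_simps)
qed simp

theorem index_sum:
  "of_int (\<Sum>q\<in>zeros. m q) = (\<Sum>q | q \<in> P \<and> sing q. camacho_sad X \<A> N \<F> P q)"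
proof -
  obtain c A B R k g \<kappa> h where local_branch: "\<And>p. p \<in> P \<Longrightarrow> local_branch p (c p) (A p) (B p) (R p) (k p) (g p) (\<kappa> p) (h p)"
    using local_branch_exists by metis
  note Zfin = Z
  define T where "T = subtopology X P"
  define x where "x = (\<lambda>p t. fst (snd (c p) t))"
  define y where "y = (\<lambda>p z. iv (c p) (z, 0))"
  define U where "U = (\<lambda>p. {t \<in> P \<inter> fst (c p). x p t \<in> ball 0 (R p)})"
  define G where "G = (\<lambda>p t. g p (x p t) - h p (x p t))"
  have topT: "topspace T = P" using P_top by (auto simp: T_def)
  have D: "normal_form (c p) (A p) (B p)" "adapted (c p)" "coord (c p)" "p \<in> fst (c p)" "snd (c p) p = (0, 0)"
      "fst (c p) \<inter> Z \<subseteq> {p}" "R p > 0" "ball 0 (R p) \<subseteq> slice (c p) UNIV"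
      "k p = (if p \<in> zeros then m p else 0)" "\<kappa> p = (if sing p then camacho_sad X \<A> N \<F> P p else 0)"
      "continuous_on (disc_off_Z (c p) (R p)) (g p)"
      "\<And>z. z \<in> disc_off_Z (c p) (R p) \<Longrightarrow> s (c p) (y p z) = z powi k p * exp (g p z)"
      "\<And>z. z \<in> disc_off_Z (c p) (R p) \<Longrightarrow> (h p has_field_derivative B p (z, 0) / A p (z, 0) - \<kappa> p / z) (at z)"
    if "p \<in> P" for p
    using local_branch[OF that] normal_formD(1,2)[of "c p" "A p" "B p"] by (auto simp: local_branch_def centered_at_def y_def)
  have yz: "y p z \<in> P" "y p z \<in> fst (c p)" "snd (c p) (y p z) = (z, 0)" "x p (y p z) = z" "y p z \<in> U p"
    if "p \<in> P" "z \<in> ball 0 (R p)" for p z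
    using slice_point[OF D(2)[OF that(1)], of z UNIV] D(8)[OF that(1)] that(2) by (auto simp: y_def x_def U_def)
  have yx: "y p (x p t) = t" if "p \<in> P" "t \<in> U p" for p t
    using P_coord[OF D(2)[OF that(1)], of t] iv_left[OF D(3)[OF that(1)], of t] that(2)
    by (auto simp: y_def x_def U_def)
  have oU: "openin T (U p)" if p: "p \<in> P" for p
  proof -
    have "openin X {q \<in> fst (c p). snd (c p) q \<in> ball 0 (R p) \<times> UNIV}"
      by (rule chart_preimage_open[OF D(3)[OF p]]) (auto intro: open_Times)
    moreover have "U p = P \<inter> {q \<in> fst (c p). snd (c p) q \<in> ball 0 (R p) \<times> UNIV}"
      by (auto simp: U_def x_def mem_Times_iff)
    ultimately show ?thesis by (simp add: T_def openin_subtopology_Int2)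
  qed
  have offy: "disc_off_Z (c p) (R p) = {z \<in> ball 0 (R p). y p z \<notin> Z}" for p by (simp add: disc_off_Z_def y_def)
  have ycont: "continuous_map (top_of_set (ball 0 (R p))) (subtopology X (U p)) (y p)" if p: "p \<in> P" for p
  proof -
    have "continuous_map (top_of_set (ball 0 (R p))) (top_of_set (snd (c p) ` fst (c p))) (\<lambda>z. (z, 0))"
      using D(8)[OF p] by (auto intro!: continuous_intros simp: continuous_map_in_subtopology slice_def)
    then have "continuous_map (top_of_set (ball 0 (R p))) X (iv (c p) \<circ> (\<lambda>z. (z, 0)))"
      using continuous_map_compose iv_cont[OF D(3)[OF p]] by blast
    then show ?thesis using yz(5)[OF p] by (auto simp: continuous_map_in_subtopology o_def y_def[abs_def])
  qed
  have xcont: "continuous_map (subtopology X (U p)) (top_of_set (ball 0 (R p))) (x p)" if p: "p \<in> P" for p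
  proof -
    have "continuous_map (subtopology X (fst (c p))) euclidean (fst \<circ> snd (c p))"
      by (rule continuous_map_compose[OF chart_cont[OF D(3)[OF p]]]) (auto intro: continuous_intros)
    then have "continuous_map (subtopology X (fst (c p))) euclidean (x p)" by (simp add: x_def o_def)
    then have "continuous_map (subtopology X (U p)) euclidean (x p)"
      by (rule continuous_map_from_subtopology_mono) (auto simp: U_def)
    then show ?thesis by (auto simp: continuous_map_in_subtopology U_def)
  qed
  have tau: "(\<lambda>z. x q (y p z)) = slice_transition (c p) (c q)" for p q
    by (simp add: fun_eq_iff x_def y_def slice_transition_def transition_def)
  have slq: "z \<in> slice (c p) (fst (c q))" if "p \<in> P" "z \<in> ball 0 (R p)" "y p z \<in> U q" for p q z
    using yz(2,3)[OF that(1,2)] that(3) by (force simp: slice_def U_def)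
  have y0: "y p 0 = p" if "p \<in> P" for p using iv_left[OF D(3,4)[OF that]] D(5)[OF that] by (simp add: y_def)
  have yinj: "z = 0 \<Longrightarrow> y p z \<notin> Z \<Longrightarrow> k p = 0" if "p \<in> P" for p z
    using y0[OF that] D(9)[OF that] by (auto simp: Z_def)
  interpret residue_data T U x y R Z "\<lambda>p. of_int (k p) - \<kappa> p" G
  proof (unfold_locales, unfold topT)
    show "compact_space T" unfolding T_def using P_compact by (simp add: compact_space_subtopology)
    show "Hausdorff_space T" unfolding T_def using haus Hausdorff_space_subtopology by blast
    show "finite Z" "Z \<subseteq> P" using Z by auto
    fix p assume p: "p \<in> P"
    show "openin T (U p)" by (rule oU[OF p])
    show "p \<in> U p" using D(4,5,7)[OF p] p by (simp add: U_def x_def)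
    show "x p p = 0" using D(5)[OF p] by (simp add: x_def)
    show "0 < R p" by (rule D(7)[OF p])
    have "P \<inter> U p = U p" by (auto simp: U_def)
    then have "subtopology T (U p) = subtopology X (U p)" by (simp add: T_def subtopology_subtopology)
    moreover have "topspace (subtopology X (U p)) = U p" using P_top by (auto simp: U_def)
    ultimately show "homeomorphic_maps (subtopology T (U p)) (top_of_set (ball 0 (R p))) (x p) (y p)"
      unfolding homeomorphic_maps_def using xcont[OF p] ycont[OF p] yz(4)[OF p] yx[OF p] by simp
    show "U p \<inter> Z \<subseteq> {p}" using D(6)[OF p] by (auto simp: U_def)
    show "of_int (k p) - \<kappa> p = 0" if "p \<notin> Z" using that D(9,10)[OF p] p by (auto simp: Z_def)
    show "continuous_on {z \<in> ball 0 (R p). y p z \<notin> Z} (\<lambda>z. G p (y p z))"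
    proof -
      have "continuous_on (disc_off_Z (c p) (R p)) (h p)"
        using D(13)[OF p] DERIV_isCont continuous_at_imp_continuous_on by blast
      then have "continuous_on (disc_off_Z (c p) (R p)) (\<lambda>z. g p z - h p z)" using D(11)[OF p] by (intro continuous_intros)
      then show ?thesis unfolding offy by (rule continuous_on_eq) (use yz(4)[OF p] in \<open>simp add: G_def\<close>)
    qed
    fix q assume q: "q \<in> P"
    note Dp = D(2)[OF p] and Dq = D(2)[OF q]
    have der: "(slice_transition (c p) (c q) has_field_derivative \<alpha> (c p) (c q) (y p z)) (at z)" if "z \<in> ball 0 (R p)" "y p z \<in> U q" for z
      using slice_transition_props(1)[OF Dp Dq slq[OF p that]] by (simp add: y_def)
    have oN: "open {z \<in> ball 0 (R p). y p z \<in> U q \<inter> W}" if "openin X W" for W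
    proof -
      have "openin (top_of_set (ball 0 (R p))) {z \<in> topspace (top_of_set (ball 0 (R p))). y p z \<in> U q \<inter> W}"
      proof (rule openin_continuous_map_preimage)
        show "continuous_map (top_of_set (ball 0 (R p))) T (y p)"
          using ycont[OF p] yz(1)[OF p] by (auto simp: T_def continuous_map_in_subtopology)
        have "openin T (P \<inter> W)" unfolding T_def using that openin_subtopology_Int2 by blast
        then have "openin T (U q \<inter> (P \<inter> W))" using oU[OF q] by blast
        moreover have "U q \<inter> (P \<inter> W) = U q \<inter> W" by (auto simp: U_def)
        ultimately show "openin T (U q \<inter> W)" by simp
      qed
      then show ?thesis using openin_open_trans[of "ball 0 (R p)"] by simp
    qed
    show "(\<lambda>z. x q (y p z)) holomorphic_on {z \<in> ball 0 (R p). y p z \<in> U q}"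
    proof -
      have "{z \<in> ball 0 (R p). y p z \<in> U q} = {z \<in> ball 0 (R p). y p z \<in> U q \<inter> topspace X}"
        using P_top by (auto simp: U_def)
      then have "open {z \<in> ball 0 (R p). y p z \<in> U q}" using oN[OF openin_topspace] by simp
      then show ?thesis unfolding tau using der by (auto simp: holomorphic_on_open)
    qed
    fix z assume z: "z \<in> ball 0 (R p)" "y p z \<in> U q" "y p z \<notin> Z"
    let ?Nb = "{z \<in> ball 0 (R p). y p z \<in> U q \<inter> (topspace X - Z)}"
    let ?t = "slice_transition (c p) (c q)" and ?u = "\<lambda>z. u (c p) (c q) (y p z)"
    have "closedin X Z" using Z P_top haus by (intro closedin_Hausdorff_finite) auto
    then have oNb: "open ?Nb" by (intro oN) blast
    have zN: "z \<in> ?Nb" using z yz(1)[OF p z(1)] P_top by auto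
    have N: "w \<in> ball 0 (R p)" "y p w \<in> U q" "y p w \<notin> Z" "w \<in> disc_off_Z (c p) (R p)" "?t w \<in> disc_off_Z (c q) (R q)"
        "y q (?t w) = y p w" "x q (y p w) = ?t w" "w \<in> slice (c p) (fst (c q))" if w: "w \<in> ?Nb" for w
    proof -
      show 1: "w \<in> ball 0 (R p)" "y p w \<in> U q" "y p w \<notin> Z" using w by auto
      then show "w \<in> disc_off_Z (c p) (R p)" by (simp add: offy)
      show 2: "x q (y p w) = ?t w" using fun_cong[OF tau] by blast
      show 3: "y q (?t w) = y p w" using yx[OF q 1(2)] 2 by simp
      have "x q (y p w) \<in> ball 0 (R q)" using 1(2) by (simp add: U_def)
      then show "?t w \<in> disc_off_Z (c q) (R q)" using 1 2 3 by (simp add: offy)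
      show "w \<in> slice (c p) (fst (c q))" by (rule slq[OF p 1(1,2)])
    qed
    define a where "a = \<alpha> (c p) (c q) (y p z)"
    define u' where "u' = D1 (D2 (\<lambda>w. snd (transition (c p) (c q) w))) (z, 0)"
    have dt: "(?t has_field_derivative a) (at z)" unfolding a_def by (rule der[OF z(1,2)])
    have du: "(?u has_field_derivative u') (at z)"
      using u_holomorphic(2)[OF Dp Dq N(8)[OF zN]] by (simp add: y_def u'_def)
    have unz: "?u w \<noteq> 0" if "w \<in> ?Nb" for w
      using u_nz(1)[OF Dp Dq slice_point(1,2,3)[OF Dp N(8)[OF that]]] by (simp add: y_def)
    have zk: "w \<noteq> 0 \<or> k p = 0" "?t w \<noteq> 0 \<or> k q = 0" if "w \<in> ?Nb" for w
      using yinj[OF p, of w] yinj[OF q, of "?t w"] N(3,6)[OF that] by auto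
    \<comment> \<open>The relation between the components of the section in two charts shows that
      \<open>exp (g p w - g q (?t w))\<close> equals this function. It is differentiable, so by
      \<open>continuous_log_deriv\<close> the difference of the continuous logarithms is
      differentiable too.\<close>
    define f where "f = (\<lambda>w. w powi (- k p) * ?t w powi k q * inverse (?u w))"
    have df: "(f has_field_derivative (- of_int (k p) / z + of_int (k q) * a / ?t z - u' / ?u z) * f z) (at z)"
    proof -
      have d1: "((\<lambda>w. w powi (- k p)) has_field_derivative of_int (- k p) * 1 / z * z powi (- k p)) (at z)"
        by (rule powi_deriv[OF DERIV_ident]) (use zk(1)[OF zN] in auto)
      have d2: "((\<lambda>w. ?t w powi k q) has_field_derivative of_int (k q) * a / ?t z * ?t z powi k q) (at z)"
        by (rule powi_deriv[OF dt zk(2)[OF zN]])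
      have d3: "((\<lambda>w. inverse (?u w)) has_field_derivative - (inverse (?u z) * u' * inverse (?u z))) (at z)"
        by (rule DERIV_inverse'[OF du unz[OF zN]])
      show ?thesis unfolding f_def
        by (rule DERIV_cong[OF DERIV_mult[OF DERIV_mult[OF d1 d2] d3]]) (simp add: algebra_simps divide_inverse)
    qed
    define L where "L = (\<lambda>w. g p w - g q (?t w))"
    have cL: "continuous_on ?Nb L"
    proof -
      have ct: "continuous_on ?Nb ?t"
        using der N(1,2) DERIV_isCont by (intro continuous_at_imp_continuous_on ballI) blast
      have "continuous_on ?Nb (\<lambda>w. g q (?t w))"
        by (rule continuous_on_compose2[OF D(11)[OF q] ct]) (use N(5) in blast)
      moreover have "continuous_on ?Nb (g p)"
        by (rule continuous_on_subset[OF D(11)[OF p]]) (use N(4) in blast)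
      ultimately show ?thesis unfolding L_def by (intro continuous_intros)
    qed
    have eL: "exp (L w) = f w" if w: "w \<in> ?Nb" for w
    proof -
      have 1: "s (c p) (y p w) = w powi k p * exp (g p w)" by (rule D(12)[OF p N(4)[OF w]])
      have 2: "s (c q) (y p w) = ?t w powi k q * exp (g q (?t w))" using D(12)[OF q N(5)[OF w]] N(6)[OF w] by simp
      have "s (c q) (y p w) = ?u w * s (c p) (y p w)"
        by (rule sec_trans[OF Dp Dq]) (use yz[OF p N(1)[OF w]] N(2)[OF w] in \<open>auto simp: U_def\<close>)
      then have eq: "?t w powi k q * exp (g q (?t w)) = ?u w * (w powi k p * exp (g p w))" using 1 2 by simp
      have nz: "w powi k p \<noteq> 0" using zk(1)[OF w] by auto
      show ?thesis
        using eq nz unz[OF w] unfolding L_def f_def exp_diff power_int_minus by (simp add: field_simps)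
    qed
    have dL: "(L has_field_derivative - of_int (k p) / z + of_int (k q) * a / ?t z - u' / ?u z) (at z)"
    proof -
      have "f z \<noteq> 0" using eL[OF zN] by (metis exp_not_eq_zero)
      then show ?thesis using continuous_log_deriv[OF oNb zN cL eL df] by simp
    qed
    have dhp: "(h p has_field_derivative B p (z, 0) / A p (z, 0) - \<kappa> p / z) (at z)" by (rule D(13)[OF p N(4)[OF zN]])
    have dhq: "((\<lambda>w. h q (?t w)) has_field_derivative (B q (?t z, 0) / A q (?t z, 0) - \<kappa> q / ?t z) * a) (at z)"
      by (rule DERIV_chain2[OF D(13)[OF q N(5)[OF zN]] dt])
    \<comment> \<open>The term \<open>u' / u\<close> coming from the section is the one by which the
      connection form changes, so it cancels and only the polar terms remain.\<close>
    have om: "B q (?t z, 0) / A q (?t z, 0) * a = B p (z, 0) / A p (z, 0) + u' / ?u z"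
    proof -
      have "\<not> sing (y p z)" using z(3) yz(1)[OF p z(1)] by (auto simp: Z_def)
      then show ?thesis
        using omega_transform[OF D(1)[OF p] D(1)[OF q] N(8)[OF zN]] by (simp add: a_def u'_def y_def)
    qed
    have "((\<lambda>w. L w - h p w + h q (?t w)) has_field_derivative
       (- of_int (k p) / z + of_int (k q) * a / ?t z - u' / ?u z) - (B p (z, 0) / A p (z, 0) - \<kappa> p / z)
        + (B q (?t z, 0) / A q (?t z, 0) - \<kappa> q / ?t z) * a) (at z)"
      by (intro DERIV_add DERIV_diff dL dhp dhq)
    moreover have "(- of_int (k p) / z + of_int (k q) * a / ?t z - u' / ?u z) - (B p (z, 0) / A p (z, 0) - \<kappa> p / z)
        + (B q (?t z, 0) / A q (?t z, 0) - \<kappa> q / ?t z) * a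
       = (of_int (k q) - \<kappa> q) * a / ?t z - (of_int (k p) - \<kappa> p) / z"
      using om by (simp add: algebra_simps diff_divide_distrib)
    ultimately have "((\<lambda>w. L w - h p w + h q (?t w)) has_field_derivative
       (of_int (k q) - \<kappa> q) * a / ?t z - (of_int (k p) - \<kappa> p) / z) (at z)" by simp
    then have "((\<lambda>w. G p (y p w) - G q (y p w)) has_field_derivative
       (of_int (k q) - \<kappa> q) * a / ?t z - (of_int (k p) - \<kappa> p) / z) (at z)"
      by (rule has_field_derivative_transform_within_open[OF _ oNb zN])
        (use N(7) yz(4)[OF p N(1)] in \<open>simp add: G_def L_def\<close>)
    then show "((\<lambda>w. G p (y p w) - G q (y p w)) has_field_derivative
       (of_int (k q) - \<kappa> q) * deriv (\<lambda>z. x q (y p z)) z / x q (y p z) - (of_int (k p) - \<kappa> p) / z) (at z)"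
      unfolding tau N(7)[OF zN] using DERIV_imp_deriv[OF dt] by simp
  qed
  have "(\<Sum>p\<in>Z. of_int (k p) - \<kappa> p) = 0" by (rule residue_sum)
  then have "(\<Sum>p\<in>Z. of_int (k p)) = (\<Sum>p\<in>Z. \<kappa> p)" by (simp add: sum_subtractf)
  moreover have "(\<Sum>p\<in>Z. of_int (k p)) = (\<Sum>p\<in>zeros. of_int (m p) :: complex)"
    by (rule sum.mono_neutral_cong_right) (use Zfin D(9) in \<open>auto simp: Z_def\<close>)
  moreover have "(\<Sum>p\<in>Z. \<kappa> p) = (\<Sum>q | q \<in> P \<and> sing q. camacho_sad X \<A> N \<F> P q)"
  proof (rule sum.mono_neutral_cong_right[OF Zfin(1)])
    show "{q \<in> P. sing q} \<subseteq> Z" by (auto simp: Z_def)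
    show "\<forall>p\<in>Z - {q \<in> P. sing q}. \<kappa> p = 0"
    proof
      fix p assume p: "p \<in> Z - {q \<in> P. sing q}"
      then have "p \<in> P" using Zfin(2) by blast
      then show "\<kappa> p = 0" using D(10) p by simp
    qed
    show "\<kappa> p = camacho_sad X \<A> N \<F> P p" if "p \<in> {q \<in> P. sing q}" for p using D(10)[of p] that by simp
  qed
  ultimately show ?thesis by simp
qed

end

section \<open>Sections with finitely many zeros\<close>

context compact_foliated
begin

definition section_on :: "'a set \<Rightarrow> ('a chart \<Rightarrow> 'a \<Rightarrow> complex) \<Rightarrow> bool" where
  "section_on K s \<longleftrightarrow> (\<forall>c. adapted c \<longrightarrow> continuous_map (subtopology X (P \<inter> fst c \<inter> K)) euclidean (s c)) \<and>
     (\<forall>c d q. adapted c \<longrightarrow> adapted d \<longrightarrow> q \<in> P \<inter> fst c \<inter> fst d \<inter> K \<longrightarrow> s d q = u c d q * s c q)"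

definition zeros_on :: "'a set \<Rightarrow> ('a chart \<Rightarrow> 'a \<Rightarrow> complex) \<Rightarrow> 'a set" where
  "zeros_on K s = {q \<in> P \<inter> K. \<exists>c. adapted c \<and> q \<in> fst c \<and> s c q = 0}"

text \<open>The interior relative to \<open>P\<close>. Keeping the zeros in it ensures that, in the
  next disc, they are interior to the part over \<open>K\<close>, as
  \<open>extend_finitely_many_zeros\<close> demands.\<close>

definition interior_on :: "'a set \<Rightarrow> 'a set" where
  "interior_on K = {q. \<exists>W. openin X W \<and> q \<in> W \<and> P \<inter> W \<subseteq> K}"

lemma section_onD:
  assumes "section_on K s" "adapted c"
  shows "continuous_map (subtopology X (P \<inter> fst c \<inter> K)) euclidean (s c)"
    "adapted d \<Longrightarrow> q \<in> P \<Longrightarrow> q \<in> fst c \<Longrightarrow> q \<in> fst d \<Longrightarrow> q \<in> K \<Longrightarrow> s d q = u c d q * s c q"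
  using assms unfolding section_on_def by blast+

lemma continuous_map_mult:
  fixes f g :: "'b \<Rightarrow> complex"
  assumes "continuous_map Y euclidean f" "continuous_map Y euclidean g"
  shows "continuous_map Y euclidean (\<lambda>q. f q * g q)"
  using assms by (auto simp: continuous_map_atin intro: tendsto_mult)

lemma u_cont:
  assumes c: "adapted c" and d: "adapted d"
  shows "continuous_map (subtopology X (P \<inter> fst c \<inter> fst d)) euclidean (u c d)"
proof -
  note cc = adaptedD(1)[OF c] and dd = adaptedD(1)[OF d]
  have o: "open (img c (fst d))" by (rule img_open[OF cc chart_open(1)[OF dd]])
  have h: "continuous_on (img c (fst d)) (D2 (\<lambda>z. snd (transition c d z)))"
    using D2_continuous[OF o] transition_hol[OF cc dd] by (simp add: holomorphic2_map_on_def)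
  have "continuous_map (subtopology X (P \<inter> fst c \<inter> fst d)) euclidean (snd c)"
    by (rule continuous_map_from_subtopology_mono[OF chart_cont[OF cc]]) auto
  then have "continuous_map (subtopology X (P \<inter> fst c \<inter> fst d)) (top_of_set (img c (fst d))) (snd c)"
    by (auto simp: continuous_map_in_subtopology)
  then have "continuous_map (subtopology X (P \<inter> fst c \<inter> fst d)) euclidean (D2 (\<lambda>z. snd (transition c d z)) \<circ> snd c)"
    using h by (intro continuous_map_compose) auto
  then show ?thesis
    by (rule continuous_map_eq) (use J_shape(3)[OF c d] in auto)
qed

lemma avoid_finite:
  fixes a b :: real
  assumes "finite S" "a < b"
  shows "\<exists>r. a < r \<and> r < b \<and> r \<notin> S"
proof -
  have "infinite {a<..<b}" using assms(2) by (simp add: infinite_Ioo)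
  then have "\<not> {a<..<b} \<subseteq> S" using assms(1) finite_subset by blast
  then show ?thesis by auto
qed

definition disc :: "'a chart \<Rightarrow> real \<Rightarrow> 'a set" where
  "disc e \<rho> = (\<lambda>z. iv e (z, 0)) ` cball 0 \<rho>"

lemma disc_props:
  assumes e: "adapted e" and R: "cball 0 \<rho> \<subseteq> slice e UNIV"
  shows "closedin X (disc e \<rho>)" "disc e \<rho> \<subseteq> P \<inter> fst e" "q \<in> P \<Longrightarrow> q \<in> fst e \<Longrightarrow> q \<in> disc e \<rho> \<longleftrightarrow> cmod (fst (snd e q)) \<le> \<rho>"
proof -
  have sub: "(\<lambda>z. (z, 0)) ` cball 0 \<rho> \<subseteq> snd e ` fst e" using R by (auto simp: slice_def)
  show sub2: "disc e \<rho> \<subseteq> P \<inter> fst e"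
    unfolding disc_def using slice_point(1,2)[OF e] R by blast
  have "continuous_map (top_of_set (cball 0 \<rho>)) (top_of_set (snd e ` fst e)) (\<lambda>z. (z, 0))"
    using sub by (auto intro!: continuous_intros simp: continuous_map_in_subtopology)
  then have "continuous_map (top_of_set (cball 0 \<rho>)) X (iv e \<circ> (\<lambda>z. (z, 0)))"
    using continuous_map_compose iv_cont[OF adaptedD(1)[OF e]] by blast
  moreover have "compactin (top_of_set (cball (0::complex) \<rho>)) (cball 0 \<rho>)" by (simp add: compactin_subtopology)
  ultimately have "compactin X ((iv e \<circ> (\<lambda>z. (z, 0))) ` cball 0 \<rho>)" using image_compactin by blast
  then show "closedin X (disc e \<rho>)"
    using haus compactin_imp_closedin unfolding disc_def by (metis (no_types, lifting) comp_apply image_cong)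
  assume q: "q \<in> P" "q \<in> fst e"
  show "q \<in> disc e \<rho> \<longleftrightarrow> cmod (fst (snd e q)) \<le> \<rho>"
  proof
    assume "q \<in> disc e \<rho>"
    then obtain z where z: "z \<in> cball 0 \<rho>" "q = iv e (z, 0)" by (auto simp: disc_def)
    then have "snd e q = (z, 0)" using slice_point(4)[OF e, of z UNIV] R by blast
    then show "cmod (fst (snd e q)) \<le> \<rho>" using z by simp
  next
    assume "cmod (fst (snd e q)) \<le> \<rho>"
    moreover have "q = iv e (fst (snd e q), 0)"
      using P_coord[OF e q] iv_left[OF adaptedD(1)[OF e] q(2)] by metis
    ultimately show "q \<in> disc e \<rho>" unfolding disc_def by (intro image_eqI) auto
  qed
qed

text \<open>The section is pulled back to a closed disc, whose radius avoids the zeros already present, and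
  extended from the part of the disc over \<open>K\<close>.\<close>

lemma extend_over_disc:
  assumes K: "closedin X K" "K \<subseteq> P" and s: "section_on K s" and fin: "finite (zeros_on K s)" and zin: "zeros_on K s \<subseteq> interior_on K"
    and e: "adapted e" and r: "r < R" and R: "cball 0 R \<subseteq> slice e UNIV"
  shows "\<exists>K' s'. closedin X K' \<and> K' \<subseteq> P \<and> K \<union> disc e r \<subseteq> K' \<and> section_on K' s' \<and> finite (zeros_on K' s') \<and> zeros_on K' s' \<subseteq> interior_on K'"
proof -
  note ec = adaptedD(1)[OF e]
  \<comment> \<open>No zero already present may lie on the boundary circle, since it would not be
    interior to \<open>F\<close>.\<close>
  obtain \<rho> where \<rho>: "r < \<rho>" "\<rho> < R" "\<rho> \<notin> (\<lambda>q. cmod (fst (snd e q))) ` zeros_on K s"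
    using avoid_finite[OF finite_imageI[OF fin] r] by blast
  have R\<rho>: "cball 0 \<rho> \<subseteq> slice e UNIV" using R \<rho>(2) by (meson less_imp_le order_trans subset_cball)
  have pt: "iv e (z, 0) \<in> P" "iv e (z, 0) \<in> fst e" "snd e (iv e (z, 0)) = (z, 0)" if "z \<in> cball 0 \<rho>" for z
    using slice_point[OF e, of z UNIV] R\<rho> that by auto
  define F where "F = {z \<in> cball 0 \<rho>. iv e (z, 0) \<in> K}"
  define f where "f = (\<lambda>z. s e (iv e (z, 0)))"
  have icont: "continuous_map (top_of_set (cball 0 \<rho>)) X (\<lambda>z. iv e (z, 0))"
  proof -
    have "continuous_map (top_of_set (cball 0 \<rho>)) (top_of_set (snd e ` fst e)) (\<lambda>z. (z, 0))"
      using R\<rho> by (auto intro!: continuous_intros simp: continuous_map_in_subtopology slice_def)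
    then have "continuous_map (top_of_set (cball 0 \<rho>)) X (iv e \<circ> (\<lambda>z. (z, 0)))"
      using continuous_map_compose iv_cont[OF ec] by blast
    then show ?thesis by (simp add: o_def)
  qed
  have cF: "compact F"
  proof -
    have "closedin (top_of_set (cball 0 \<rho>)) {z \<in> topspace (top_of_set (cball 0 \<rho>)). iv e (z, 0) \<in> K}"
      by (rule closedin_continuous_map_preimage[OF icont K(1)])
    then have "closedin (top_of_set (cball 0 \<rho>)) F" by (simp add: F_def)
    then show ?thesis using closedin_compact compact_cball by blast
  qed
  have cf: "continuous_on F f"
  proof -
    have "continuous_map (top_of_set F) X (\<lambda>z. iv e (z, 0))"
      by (rule continuous_map_from_subtopology_mono[OF icont]) (auto simp: F_def)
    then have "continuous_map (top_of_set F) (subtopology X (P \<inter> fst e \<inter> K)) (\<lambda>z. iv e (z, 0))"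
      using pt(1,2) by (auto simp: continuous_map_in_subtopology F_def)
    moreover have "continuous_map (subtopology X (P \<inter> fst e \<inter> K)) euclidean (s e)" by (rule section_onD(1)[OF s e])
    ultimately have "continuous_map (top_of_set F) euclidean (s e \<circ> (\<lambda>z. iv e (z, 0)))" by (rule continuous_map_compose)
    then show ?thesis by (simp add: f_def o_def)
  qed
  have fz: "iv e (z, 0) \<in> zeros_on K s" if "z \<in> F" "f z = 0" for z
    using that pt[of z] e unfolding F_def f_def zeros_on_def by blast
  have ffin: "finite {z \<in> F. f z = 0}"
  proof (rule finite_subset)
    show "{z \<in> F. f z = 0} \<subseteq> (\<lambda>q. fst (snd e q)) ` zeros_on K s"
    proof
      fix z assume z: "z \<in> {z \<in> F. f z = 0}"
      then have "z = fst (snd e (iv e (z, 0)))" using pt(3)[of z] by (simp add: F_def)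
      then show "z \<in> (\<lambda>q. fst (snd e q)) ` zeros_on K s" using fz z by blast
    qed
  qed (use fin in simp)
  have fint: "{z \<in> F. f z = 0} \<subseteq> interior F"
  proof
    fix z assume z: "z \<in> {z \<in> F. f z = 0}"
    then have zz: "iv e (z, 0) \<in> zeros_on K s" using fz by blast
    then obtain W where W: "openin X W" "iv e (z, 0) \<in> W" "P \<inter> W \<subseteq> K" using zin by (auto simp: interior_on_def)
    have zc: "z \<in> cball 0 \<rho>" using z by (simp add: F_def)
    have "cmod z \<noteq> \<rho>" using \<rho>(3) zz pt(3)[OF zc] by force
    then have zb: "z \<in> ball 0 \<rho>" using zc by simp
    have "open (ball 0 \<rho> \<inter> slice e W)" using slice_open[OF ec W(1)] by blast
    moreover have "z \<in> slice e W" using in_slice[OF e pt(1,2)[OF zc] W(2)] pt(3)[OF zc] by simp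
    moreover have "ball 0 \<rho> \<inter> slice e W \<subseteq> F"
    proof
      fix w assume w: "w \<in> ball 0 \<rho> \<inter> slice e W"
      then have "iv e (w, 0) \<in> K" using W(3) slice_point(1,3)[OF e, of w W] by blast
      then show "w \<in> F" using w by (simp add: F_def)
    qed
    ultimately show "z \<in> interior F" using zb by (meson IntI interiorI)
  qed
  obtain g where g: "continuous_on UNIV g" "\<And>z. z \<in> F \<Longrightarrow> g z = f z" "finite {z. g z = 0}"
    using extend_finitely_many_zeros[OF cF cf ffin fint] by metis
  \<comment> \<open>A second, smaller radius avoids the zeros of \<open>g\<close>, so that the new
    zeros are interior to the enlarged set.\<close>
  obtain \<sigma> where \<sigma>: "r < \<sigma>" "\<sigma> < \<rho>" "\<sigma> \<notin> cmod ` {z. g z = 0}"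
    using avoid_finite[OF finite_imageI[OF g(3)] \<rho>(1)] by blast
  have R\<sigma>: "cball 0 \<sigma> \<subseteq> slice e UNIV" using R\<rho> \<sigma>(2) by (meson less_imp_le order_trans subset_cball)
  note D = disc_props[OF e R\<sigma>]
  let ?K' = "K \<union> disc e \<sigma>"
  define x where "x = (\<lambda>q. fst (snd e q))"
  \<comment> \<open>The extension is found in the chart \<open>e\<close> and carried to the other
    charts by the cocycle, as a section must be.\<close>
  define s' where "s' = (\<lambda>c q. if q \<in> K then s c q else u e c q * g (x q))"
  have sD: "s' c q = u e c q * g (x q)" if c: "adapted c" and q: "q \<in> fst c" "q \<in> disc e \<sigma>" for c q
  proof (cases "q \<in> K")
    case True
    have qe: "q \<in> P" "q \<in> fst e" using q D(2) by auto
    have "cmod (x q) \<le> \<rho>" using D(3)[OF qe] q(2) \<sigma>(2) by (simp add: x_def)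
    moreover have iq: "iv e (x q, 0) = q" using P_coord[OF e qe] iv_left[OF ec qe(2)] by (metis x_def)
    ultimately have "x q \<in> F" using True by (simp add: F_def)
    then have "g (x q) = s e q" using g(2) iq by (simp add: f_def)
    moreover have "s c q = u e c q * s e q" using section_onD(2)[OF s e c] qe q True by blast
    ultimately show ?thesis using True by (simp add: s'_def)
  qed (simp add: s'_def)
  have n: "section_on ?K' s'"
    unfolding section_on_def
  proof (intro conjI allI impI)
    fix c d q assume c: "adapted c" "adapted d" and q: "q \<in> P \<inter> fst c \<inter> fst d \<inter> ?K'"
    show "s' d q = u c d q * s' c q"
    proof (cases "q \<in> K")
      case True
      then show ?thesis using section_onD(2)[OF s c] q by (simp add: s'_def)
    next
      case False
      then have qd: "q \<in> disc e \<sigma>" "q \<in> fst e" using q D(2) by auto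
      then show ?thesis using u_chain(1)[OF e c, of q] q sD[OF c(1)] sD[OF c(2)] by auto
    qed
  next
    fix c assume c: "adapted c"
    let ?Y = "subtopology X (P \<inter> fst c \<inter> ?K')"
    let ?T = "\<lambda>b. if b then K \<inter> (P \<inter> fst c \<inter> ?K') else disc e \<sigma> \<inter> (P \<inter> fst c \<inter> ?K')"
    let ?f = "\<lambda>b. if b then s c else (\<lambda>q. u e c q * g (x q))"
    have Ytop: "topspace ?Y = P \<inter> fst c \<inter> ?K'" using P_top by auto
    show "continuous_map ?Y euclidean (s' c)"
    \<comment> \<open>The two pieces are closed, and by \<open>sD\<close> both formulas give
      \<open>s'\<close> on their overlap.\<close>
    proof (rule pasting_lemma_closed[where I = "UNIV :: bool set" and T = ?T and f = ?f])
      fix b :: bool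
      show "closedin ?Y (?T b)"
      proof (cases b)
        case True
        then show ?thesis using closedin_subtopology_Int_closed[OF K(1), of "P \<inter> fst c \<inter> ?K'"] by (simp add: Int_commute)
      next
        case False
        then show ?thesis using closedin_subtopology_Int_closed[OF D(1), of "P \<inter> fst c \<inter> ?K'"] by (simp add: Int_commute)
      qed
      show "continuous_map (subtopology ?Y (?T b)) euclidean (?f b)"
      proof (cases b)
        case True
        have "continuous_map (subtopology X (P \<inter> fst c \<inter> K)) euclidean (s c)" by (rule section_onD(1)[OF s c])
        then have "continuous_map (subtopology X ((P \<inter> fst c \<inter> ?K') \<inter> (K \<inter> (P \<inter> fst c \<inter> ?K')))) euclidean (s c)"
          by (rule continuous_map_from_subtopology_mono) auto
        then show ?thesis using True by (simp add: subtopology_subtopology)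
      next
        case False
        let ?S = "(P \<inter> fst c \<inter> ?K') \<inter> (disc e \<sigma> \<inter> (P \<inter> fst c \<inter> ?K'))"
        have 1: "continuous_map (subtopology X ?S) euclidean (u e c)"
          by (rule continuous_map_from_subtopology_mono[OF u_cont[OF e c]]) (use D(2) in auto)
        have "continuous_map (subtopology X ?S) euclidean (snd e)"
          by (rule continuous_map_from_subtopology_mono[OF chart_cont[OF ec]]) (use D(2) in auto)
        then have "continuous_map (subtopology X ?S) euclidean ((\<lambda>z. g (fst z)) \<circ> snd e)"
          by (rule continuous_map_compose)
            (auto intro!: continuous_on_compose2[OF g(1)] continuous_intros)
        then have 2: "continuous_map (subtopology X ?S) euclidean (\<lambda>q. g (x q))" by (simp add: o_def x_def)
        have "continuous_map (subtopology X ?S) euclidean (\<lambda>q. u e c q * g (x q))"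
          by (rule continuous_map_mult[OF 1 2])
        then show ?thesis using False by (simp add: subtopology_subtopology)
      qed
    next
      fix i j :: bool and q assume q: "q \<in> topspace ?Y \<inter> ?T i \<inter> ?T j"
      have "?f b q = s' c q" if "q \<in> ?T b" for b
      proof (cases b)
        case True then show ?thesis using that by (simp add: s'_def)
      next
        case False then show ?thesis using that sD[OF c, of q] by simp
      qed
      moreover have "q \<in> ?T i" "q \<in> ?T j" using q by blast+
      ultimately have "?f i q = s' c q" "?f j q = s' c q" by blast+
      then show "?f i q = ?f j q" by (rule trans[OF _ sym])
    next
      fix q assume "q \<in> topspace ?Y"
      then have q: "q \<in> P \<inter> fst c \<inter> ?K'" unfolding Ytop .
      show "\<exists>j. j \<in> UNIV \<and> q \<in> ?T j \<and> s' c q = ?f j q"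
      proof (cases "q \<in> K")
        case True then show ?thesis using q by (intro exI[of _ True]) (simp add: s'_def)
      next
        case False then show ?thesis using q sD[OF c, of q] by (intro exI[of _ False]) auto
      qed
    qed simp
  qed
  have zD: "g (x q) = 0" "q \<in> P" "q \<in> fst e" if q: "q \<in> zeros_on ?K' s'" "q \<in> disc e \<sigma>" for q
  proof -
    show qe: "q \<in> P" "q \<in> fst e" using q D(2) by auto
    obtain c where c: "adapted c" "q \<in> fst c" "s' c q = 0" using q(1) by (auto simp: zeros_on_def)
    then show "g (x q) = 0" using sD[OF c(1,2) q(2)] u_nz(1)[OF e c(1) qe c(2)] by simp
  qed
  have zK: "q \<in> zeros_on K s" if "q \<in> zeros_on ?K' s'" "q \<in> K" for q
    using that by (auto simp: zeros_on_def s'_def)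
  have "zeros_on ?K' s' \<subseteq> zeros_on K s \<union> (\<lambda>z. iv e (z, 0)) ` {z. g z = 0}"
  proof
    fix q assume q: "q \<in> zeros_on ?K' s'"
    show "q \<in> zeros_on K s \<union> (\<lambda>z. iv e (z, 0)) ` {z. g z = 0}"
    proof (cases "q \<in> K")
      case True then show ?thesis using zK q by blast
    next
      case False
      then have qd: "q \<in> disc e \<sigma>" using q by (auto simp: zeros_on_def)
      note z = zD[OF q qd]
      have "q = iv e (x q, 0)" using P_coord[OF e z(2,3)] iv_left[OF ec z(3)] by (metis x_def)
      then show ?thesis using z(1) by blast
    qed
  qed
  then have zfin: "finite (zeros_on ?K' s')" using fin g(3) finite_subset by (metis finite_UnI finite_imageI)
  have zinner: "zeros_on ?K' s' \<subseteq> interior_on ?K'"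
  proof
    fix q assume q: "q \<in> zeros_on ?K' s'"
    show "q \<in> interior_on ?K'"
    proof (cases "q \<in> K")
      case True
      then have "q \<in> interior_on K" using zK q zin by blast
      then show ?thesis by (auto simp: interior_on_def)
    next
      case False
      then have qd: "q \<in> disc e \<sigma>" using q by (auto simp: zeros_on_def)
      note z = zD[OF q qd]
      have "cmod (x q) \<le> \<sigma>" using D(3)[OF z(2,3)] qd by (simp add: x_def)
      moreover have "cmod (x q) \<noteq> \<sigma>" using \<sigma>(3) z(1) by blast
      ultimately have lt: "cmod (x q) < \<sigma>" by simp
      let ?W = "{t \<in> fst e. snd e t \<in> ball 0 \<sigma> \<times> UNIV}"
      have "openin X ?W" by (rule chart_preimage_open[OF ec]) (auto intro: open_Times)
      moreover have "q \<in> ?W" using lt z by (simp add: x_def mem_Times_iff)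
      moreover have "P \<inter> ?W \<subseteq> ?K'" using D(3) by (auto simp: mem_Times_iff)
      ultimately show ?thesis by (auto simp: interior_on_def)
    qed
  qed
  have "disc e r \<subseteq> disc e \<sigma>" unfolding disc_def using \<sigma>(1) by (intro image_mono) auto
  moreover have "closedin X ?K'" using K(1) D(1) by blast
  moreover have "?K' \<subseteq> P" using K(2) D(2) by blast
  ultimately show ?thesis using n zfin zinner by (intro exI[of _ ?K'] exI[of _ s']) blast
qed

text \<open>Finitely many discs of half radius cover the curve. They are added one at a time,
  starting from the empty set, where there is nothing to check; the full radius leaves the room that
  \<open>extend_over_disc\<close> needs.\<close>

lemma section_exists: "\<exists>s. normal_section X \<A> P s \<and> finite (section_zeros X \<A> P s)"
proof -
  have "\<exists>e R. adapted e \<and> centered_at e p \<and> R > 0 \<and> cball 0 R \<subseteq> slice e UNIV" if p: "p \<in> P" for p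
  proof -
    obtain e where e: "adapted e" "centered_at e p" using adapted_centered[OF p] by blast
    have pe: "p \<in> fst e" "snd e p = (0, 0)" using e by (auto simp: centered_at_def)
    have "0 \<in> slice e (topspace X)" using in_slice[OF e(1) p pe(1), of "topspace X"] pe(2) p P_top by auto
    then obtain R where "R > 0" "cball 0 R \<subseteq> slice e (topspace X)"
      using slice_open[OF adaptedD(1)[OF e(1)] openin_topspace] open_contains_cball by blast
    then show ?thesis using e by (intro exI[of _ e] exI[of _ R]) (auto simp: slice_def)
  qed
  then obtain e R where eR: "\<And>p. p \<in> P \<Longrightarrow> adapted (e p)" "\<And>p. p \<in> P \<Longrightarrow> centered_at (e p) p"
    "\<And>p. p \<in> P \<Longrightarrow> R p > 0" "\<And>p. p \<in> P \<Longrightarrow> cball 0 (R p) \<subseteq> slice (e p) UNIV" by metis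
  define V where "V = (\<lambda>p. {t \<in> fst (e p). snd (e p) t \<in> ball 0 (R p / 2) \<times> UNIV})"
  have W: "openin X (V p)" "p \<in> V p" if "p \<in> P" for p
  proof -
    show "openin X (V p)" unfolding V_def by (rule chart_preimage_open[OF adaptedD(1)[OF eR(1)[OF that]]]) (auto intro: open_Times)
    show "p \<in> V p" using eR(2,3)[OF that] by (simp add: centered_at_def V_def)
  qed
  have "\<forall>U\<in>V ` P. openin X U" "P \<subseteq> \<Union> (V ` P)" using W by blast+
  then obtain \<G> where G: "finite \<G>" "\<G> \<subseteq> V ` P" "P \<subseteq> \<Union> \<G>"
    using P_compact unfolding compactin_def by metis
  obtain Q where Q: "finite Q" "Q \<subseteq> P" "\<G> = V ` Q"
    using finite_subset_image[OF G(1,2)] by blast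
  have "\<exists>K s. closedin X K \<and> K \<subseteq> P \<and> (\<Union>p\<in>Q. disc (e p) (R p / 2)) \<subseteq> K \<and> section_on K s \<and> finite (zeros_on K s) \<and> zeros_on K s \<subseteq> interior_on K"
    using Q(1,2)
  proof (induction Q)
    case empty
    then show ?case by (intro exI[of _ "{}"] exI[of _ "\<lambda>_ _. 0"]) (auto simp: section_on_def zeros_on_def)
  next
    case (insert p Q)
    then obtain K s where K: "closedin X K" "K \<subseteq> P" "(\<Union>p\<in>Q. disc (e p) (R p / 2)) \<subseteq> K" "section_on K s" "finite (zeros_on K s)"
      "zeros_on K s \<subseteq> interior_on K" by auto
    have p: "p \<in> P" using insert by simp
    have "R p / 2 < R p" using eR(3)[OF p] by simp
    from extend_over_disc[OF K(1,2,4,5,6) eR(1)[OF p] this eR(4)[OF p]] obtain K' s' where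
      "closedin X K'" "K' \<subseteq> P" "K \<union> disc (e p) (R p / 2) \<subseteq> K'" "section_on K' s'" "finite (zeros_on K' s')" "zeros_on K' s' \<subseteq> interior_on K'"
      by blast
    then show ?case using K(3) by (intro exI[of _ K'] exI[of _ s']) auto
  qed
  then obtain K s where K: "K \<subseteq> P" "(\<Union>p\<in>Q. disc (e p) (R p / 2)) \<subseteq> K" "section_on K s" "finite (zeros_on K s)" by blast
  have "P \<subseteq> K"
  proof
    fix q assume q: "q \<in> P"
    then obtain p where p: "p \<in> Q" "q \<in> V p" using G(3) Q(3) by blast
    then have pP: "p \<in> P" using Q by blast
    have "cball 0 (R p / 2) \<subseteq> slice (e p) UNIV"
    proof -
      have "cball 0 (R p / 2) \<subseteq> cball (0::complex) (R p)" using eR(3)[OF pP] by (intro subset_cball) simp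
      then show ?thesis using eR(4)[OF pP] by blast
    qed
    moreover have "q \<in> fst (e p)" using p(2) by (simp add: V_def)
    ultimately have "q \<in> disc (e p) (R p / 2)" using disc_props(3)[OF eR(1)[OF pP] _ q] p(2) by (simp add: mem_Times_iff V_def)
    then show "q \<in> K" using K(2) p(1) by blast
  qed
  then have KP: "K = P" using K(1) by blast
  have "P \<inter> fst c \<inter> P = P \<inter> fst c" "P \<inter> fst c \<inter> fst d \<inter> P = P \<inter> fst c \<inter> fst d" for c d :: "'a chart" by auto
  then have "normal_section X \<A> P s" using K(3) unfolding KP section_on_def normal_section_def u_def J_def by simp
  moreover have "section_zeros X \<A> P s = zeros_on K s" by (simp add: KP section_zeros_def zeros_on_def)
  ultimately show ?thesis using K(4) by auto
qed

lemma zero_index_exists: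
  assumes s: "normal_section X \<A> P s" and fin: "finite (section_zeros X \<A> P s)" and q: "q \<in> P"
  shows "\<exists>k. has_zero_index X \<A> P s q k"
proof -
  obtain c where c: "adapted c" "centered_at c q" using adapted_centered[OF q] by blast
  have qc: "q \<in> fst c" "snd c q = (0, 0)" using c(2) by (auto simp: centered_at_def)
  let ?Z = "section_zeros X \<A> P s"
  let ?W = "topspace X - (?Z - {q})"
  have "closedin X (?Z - {q})"
    using fin P_top haus by (intro closedin_Hausdorff_finite) (auto simp: section_zeros_def)
  then have oW: "openin X ?W" by blast
  have "0 \<in> slice c ?W" using in_slice[OF c(1) q qc(1), of ?W] qc(2) q P_top by auto
  then obtain R where R: "R > 0" "ball 0 R \<subseteq> slice c ?W"
    using openE[OF slice_open[OF adaptedD(1)[OF c(1)] oW]] by blast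
  have sc: "continuous_map (subtopology X (P \<inter> fst c)) euclidean (s c)" using s c(1) unfolding normal_section_def by blast
  have cf: "continuous_on (punctured_ball R) (\<lambda>z. s c (iv c (z, 0)))"
    by (rule slice_cont[OF c(1) _ sc, where W = ?W]) (use R(2) in blast)
  have nz: "s c (iv c (z, 0)) \<noteq> 0" if z: "z \<in> punctured_ball R" for z
  proof
    assume 0: "s c (iv c (z, 0)) = 0"
    have zeros_on: "z \<in> slice c ?W" using R(2) z by blast
    note p = slice_point[OF c(1) zeros_on]
    have "iv c (z, 0) \<in> ?Z" unfolding section_zeros_def using p(1,2) 0 c(1) by blast
    then have "iv c (z, 0) = q" using p(3) by blast
    then show False using p(4) qc(2) z by simp
  qed
  obtain k g where "\<And>r. 0 < r \<Longrightarrow> r < R \<Longrightarrow> winding_number (\<lambda>t. s c (iv c (circlepath 0 r t, 0))) 0 = of_int k"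
    using punctured_log[OF R(1) cf nz] by metis
  then have "\<forall>\<^sub>F r in at_right 0. winding_number (\<lambda>t. s c (iv c (circlepath 0 r t, 0))) 0 = of_int k"
    using R(1) by (auto simp: eventually_at_right intro!: exI[of _ R])
  then show ?thesis unfolding has_zero_index_def using c by blast
qed

text \<open>The description in \<open>self_intersection\<close> has a witness by
  \<open>section_exists\<close>. It is unique because the index formula equates every admissible
  count with the same sum of indices.\<close>

theorem self_intersection_eq:
  "of_int (self_intersection X \<A> P) = (\<Sum>q | q \<in> P \<and> sing q. camacho_sad X \<A> N \<F> P q)"
proof -
  let ?Q = "\<lambda>n. \<exists>s m. normal_section X \<A> P s \<and> finite (section_zeros X \<A> P s) \<and>
        (\<forall>q\<in>section_zeros X \<A> P s. has_zero_index X \<A> P s q (m q)) \<and>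
        n = (\<Sum>q\<in>section_zeros X \<A> P s. m q)"
  have all: "of_int n = (\<Sum>q | q \<in> P \<and> sing q. camacho_sad X \<A> N \<F> P q)" if "?Q n" for n
  proof -
    obtain s m where s: "normal_section X \<A> P s" "finite (section_zeros X \<A> P s)"
        "\<And>q. q \<in> section_zeros X \<A> P s \<Longrightarrow> has_zero_index X \<A> P s q (m q)"
        "n = (\<Sum>q\<in>section_zeros X \<A> P s. m q)" using \<open>?Q n\<close> by blast
    interpret section_data X \<A> P N \<F> s m by unfold_locales (use s in auto)
    show ?thesis using index_sum s(4) by simp
  qed
  obtain s where s: "normal_section X \<A> P s" "finite (section_zeros X \<A> P s)" using section_exists by blast
  have "\<forall>q\<in>P. \<exists>k. has_zero_index X \<A> P s q k" using zero_index_exists[OF s] by blast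
  then obtain m where m: "\<forall>q\<in>P. has_zero_index X \<A> P s q (m q)" by (rule bchoice[THEN exE])
  have "?Q (\<Sum>q\<in>section_zeros X \<A> P s. m q)"
    using s m by (intro exI[of _ s] exI[of _ m]) (auto simp: section_zeros_def)
  then have "?Q (self_intersection X \<A> P)"
    unfolding self_intersection_def
  proof (rule theI)
    fix n assume "?Q n"
    from all[OF this] all[OF \<open>?Q (\<Sum>q\<in>section_zeros X \<A> P s. m q)\<close>]
    show "n = (\<Sum>q\<in>section_zeros X \<A> P s. m q)" by (metis of_int_eq_iff)
  qed
  then show ?thesis by (rule all)
qed

end

section \<open>Trees and negative definiteness\<close>

lemma walk_edge_ends:
  "is_walk G u es v \<Longrightarrow> e \<in> set (map fst es) \<Longrightarrow> ends G e \<subseteq> insert u (set (map snd es))"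
proof (induction es arbitrary: u)
  case (Cons a es)
  obtain f w where a: "a = (f, w)" by (cases a)
  have *: "is_walk G w es v" "ends G f = {u, w}" using Cons.prems a by auto
  show ?case
  proof (cases "e = f")
    case False
    then show ?thesis using Cons.IH[OF *(1)] Cons.prems(2) a by auto
  qed (use a * in auto)
qed simp

lemma walk_start_vertex: "is_walk G u es v \<Longrightarrow> u \<in> vertices G"
  by (cases es) auto

lemma walk_append:
  "is_walk G u es v \<Longrightarrow> is_walk G v fs w \<Longrightarrow> is_walk G u (es @ fs) w"
  by (induction es arbitrary: u) auto

lemma path_distinct_edges:
  "is_walk G u es v \<Longrightarrow> distinct (u # map snd es) \<Longrightarrow> distinct (map fst es)"
proof (induction es arbitrary: u)
  case (Cons a es)
  obtain e w where a: "a = (e, w)" by (cases a)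
  have w: "is_walk G w es v" "ends G e = {u, w}" using Cons.prems a by auto
  have "e \<notin> set (map fst es)"
    using walk_edge_ends[OF w(1), of e] w(2) Cons.prems(2) a by auto
  then show ?case using Cons.IH[OF w(1)] Cons.prems a by auto
qed simp

text \<open>Two different edges from an outside vertex \<open>w\<close> to the ends of a simple path
  would close it to a cycle. The empty path, with \<open>a = b\<close>, is the case of parallel
  edges.\<close>

lemma path_closing_edge_unique:
  assumes "is_tree G" "is_walk G a es b" "distinct (a # map snd es)"
    and "w \<notin> set (a # map snd es)"
    and e: "e \<in> edges G" "ends G e = {w, a}" and f: "f \<in> edges G" "ends G f = {w, b}"
    and "w \<in> vertices G"
  shows "e = f"
proof (rule ccontr)
  assume "e \<noteq> f"
  have bV: "b \<in> vertices G" using assms(2) by (induction es arbitrary: a) auto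
  have w: "is_walk G w ((e, a) # es @ [(f, w)]) w"
    using assms bV walk_append[OF assms(2), of "[(f, w)]" w] by auto
  have ef: "g \<notin> set (map fst es)" if "w \<in> ends G g" for g
    using walk_edge_ends[OF assms(2), of g] assms(4) that by auto
  have "distinct (map fst es)" by (rule path_distinct_edges[OF assms(2,3)])
  then have "is_cycle G w ((e, a) # es @ [(f, w)])"
    unfolding is_cycle_def using w ef[of e] ef[of f] e f \<open>e \<noteq> f\<close> assms(3,4) by auto
  then show False using assms(1) unfolding is_tree_def by blast
qed

section \<open>Propagation of ratios over a tree\<close>

definition loopless :: "('v, 'e) weighted_graph \<Rightarrow> bool" where
  "loopless G \<longleftrightarrow> (\<forall>e\<in>edges G. \<exists>u\<in>vertices G. \<exists>v\<in>vertices G. u \<noteq> v \<and> ends G e = {u, v})"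

lemma tree_ends_inj:
  assumes "is_tree G" "loopless G"
  shows "inj_on (ends G) (edges G)"
proof (rule inj_onI)
  fix e f assume ef: "e \<in> edges G" "f \<in> edges G" "ends G e = ends G f"
  obtain u v where uv: "u \<in> vertices G" "v \<in> vertices G" "u \<noteq> v" "ends G e = {u, v}"
    using assms(2) ef(1) unfolding loopless_def by blast
  show "e = f"
    by (rule path_closing_edge_unique[OF assms(1), of v "[]" v u]) (use uv ef in auto)
qed

lemma crossing_edge:
  assumes "is_walk G u es v" "u \<in> S" "v \<notin> S"
  shows "\<exists>a w e. a \<in> S \<and> w \<notin> S \<and> e \<in> edges G \<and> ends G e = {a, w} \<and> w \<in> vertices G"
  using assms
proof (induction es arbitrary: u)
  case (Cons x es)
  obtain e w where x: "x = (e, w)" by (cases x)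
  have *: "is_walk G w es v" "e \<in> edges G" "ends G e = {u, w}" using Cons.prems x by auto
  show ?case
  proof (cases "w \<in> S")
    case True show ?thesis by (rule Cons.IH[OF *(1) True Cons.prems(3)])
  next
    case False then show ?thesis using * Cons.prems(2) walk_start_vertex[OF *(1)] by blast
  qed
qed simp

text \<open>A connected set of vertices is enlarged one vertex at a time. In a tree the new vertex
  is joined to the set by a single edge, so its value is prescribed once and no compatibility
  arises. The order of enlargement decides which end of an edge plays the role of \<open>u\<close>,
  hence the existential orientation.\<close>

lemma tree_propagation:
  fixes t :: "'v \<Rightarrow> 'v \<Rightarrow> real"
  assumes tree: "is_tree G" and fin: "finite (vertices G)" and ll: "loopless G"
  shows "\<exists>x. (\<exists>v\<in>vertices G. x v \<noteq> 0) \<and>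
    (\<forall>e\<in>edges G. \<exists>u v. u \<noteq> v \<and> ends G e = {u, v} \<and> x v = t u v * x u)"
proof -
  \<comment> \<open>Simple paths inside \<open>S\<close> are part of the invariant: with one of them
    a second edge to a new vertex would give a cycle.\<close>
  define good where "good = (\<lambda>S x. S \<subseteq> vertices G \<and> (\<exists>v\<in>S. x v \<noteq> 0) \<and>
     (\<forall>a\<in>S. \<forall>b\<in>S. \<exists>es. is_walk G a es b \<and> set (map snd es) \<subseteq> S \<and> distinct (a # map snd es)) \<and>
     (\<forall>e\<in>edges G. ends G e \<subseteq> S \<longrightarrow> (\<exists>u v. u \<noteq> v \<and> ends G e = {u, v} \<and> x v = t u v * x u)))"
  have conn: "graph_connected G" using tree by (simp add: is_tree_def)
  have "\<exists>S x. good S x \<and> card S = Suc n" if "Suc n \<le> card (vertices G)" for n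
    using that
  proof (induction n)
    case 0
    obtain r where r: "r \<in> vertices G" using conn by (auto simp: graph_connected_def)
    have "good {r} (\<lambda>_. 1)"
      unfolding good_def
    proof (intro conjI ballI impI)
      fix a b assume "a \<in> {r}" "b \<in> {r}"
      then show "\<exists>es. is_walk G a es b \<and> set (map snd es) \<subseteq> {r} \<and> distinct (a # map snd es)"
        using r by (intro exI[of _ "[]"]) auto
    next
      fix e assume "e \<in> edges G" "ends G e \<subseteq> {r}"
      moreover obtain u v where "u \<noteq> v" "ends G e = {u, v}"
        using ll \<open>e \<in> edges G\<close> unfolding loopless_def by blast
      ultimately have False by auto
      then show "\<exists>u v. u \<noteq> v \<and> ends G e = {u, v} \<and> 1 = t u v * 1" by blast
    qed (use r in auto)
    then show ?case by (intro exI[of _ "{r}"]) auto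
  next
    case (Suc n)
    then obtain S x where g: "good S x" "card S = Suc n" by auto
    have finS: "finite S" and SV: "S \<subseteq> vertices G"
      using g fin finite_subset unfolding good_def by blast+
    have "S \<noteq> {}" "S \<noteq> vertices G" using g(2) Suc.prems by auto
    then obtain u v where uv: "u \<in> S" "v \<in> vertices G" "v \<notin> S" using SV by blast
    obtain es where es: "is_walk G u es v"
      using conn uv SV unfolding graph_connected_def by blast
    obtain a w e where aw: "a \<in> S" "w \<notin> S" "e \<in> edges G" "ends G e = {a, w}" "w \<in> vertices G"
      using crossing_edge[OF es uv(1,3)] by blast
    have paths: "\<And>a b. a \<in> S \<Longrightarrow> b \<in> S \<Longrightarrow>
        \<exists>es. is_walk G a es b \<and> set (map snd es) \<subseteq> S \<and> distinct (a # map snd es)"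
      using g(1) unfolding good_def by blast
    define x' where "x' = x(w := t a w * x a)"
    have "good (insert w S) x'"
      unfolding good_def
    proof (intro conjI ballI impI)
      show "insert w S \<subseteq> vertices G" using aw SV by auto
      show "\<exists>v\<in>insert w S. x' v \<noteq> 0"
      proof -
        obtain v where "v \<in> S" "x v \<noteq> 0" using g(1) unfolding good_def by blast
        then have "x' v \<noteq> 0" using aw by (auto simp: x'_def)
        then show ?thesis using \<open>v \<in> S\<close> by blast
      qed
    next
      fix p q assume pq: "p \<in> insert w S" "q \<in> insert w S"
      show "\<exists>es. is_walk G p es q \<and> set (map snd es) \<subseteq> insert w S \<and> distinct (p # map snd es)"
      proof (cases "p = w")
        case True
        show ?thesis
        proof (cases "q = w")
          case True then show ?thesis using \<open>p = w\<close> aw by (intro exI[of _ "[]"]) auto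
        next
          case False
          then obtain es where "is_walk G a es q" "set (map snd es) \<subseteq> S" "distinct (a # map snd es)"
            using paths[OF aw(1), of q] pq by auto
          then show ?thesis using True aw
            by (intro exI[of _ "(e, a) # es"]) (auto simp: insert_commute)
        qed
      next
        case False
        then have p: "p \<in> S" using pq by auto
        show ?thesis
        proof (cases "q = w")
          case True
          obtain es where es: "is_walk G p es a" "set (map snd es) \<subseteq> S" "distinct (p # map snd es)"
            using paths[OF p aw(1)] by metis
          have "a \<in> vertices G" using aw SV by auto
          then have "is_walk G p (es @ [(e, w)]) w"
            using walk_append[OF es(1), of "[(e, w)]" w] aw by auto
          then show ?thesis using True es aw p
            by (intro exI[of _ "es @ [(e, w)]"]) auto
        next
          case False
          then show ?thesis using paths p pq by (meson insertE subset_insertI2)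
        qed
      qed
    next
      fix f assume f: "f \<in> edges G" "ends G f \<subseteq> insert w S"
      obtain p q where pq: "p \<noteq> q" "ends G f = {p, q}"
        using ll f unfolding loopless_def by blast
      have case_w: "\<exists>u v. u \<noteq> v \<and> ends G f = {u, v} \<and> x' v = t u v * x' u" if bS: "b \<in> S" "ends G f = {w, b}" for b
      proof -
        obtain es where es: "is_walk G a es b" "set (map snd es) \<subseteq> S" "distinct (a # map snd es)"
          using paths[OF aw(1) bS(1)] by metis
        \<comment> \<open>The simple path from \<open>a\<close> to \<open>b\<close> inside
          \<open>S\<close> avoids \<open>w\<close>, so \<open>f\<close> cannot differ from the edge
          through which \<open>w\<close> was added.\<close>
        have "e = f"
          by (rule path_closing_edge_unique[OF tree es(1,3)])
            (use aw es bS f in \<open>auto simp: insert_commute\<close>)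
        then have "ends G f = {a, w}" "a \<noteq> w" "x' w = t a w * x' a" using aw by (auto simp: x'_def)
        then show ?thesis by blast
      qed
      consider "p = w" "q \<in> S" | "q = w" "p \<in> S" | "p \<in> S" "q \<in> S" using f pq by auto
      then show "\<exists>u v. u \<noteq> v \<and> ends G f = {u, v} \<and> x' v = t u v * x' u"
      proof cases
        case 1 then show ?thesis using case_w pq by blast
      next
        case 2 then show ?thesis using case_w[of p] pq by (simp add: insert_commute)
      next
        case 3
        then obtain u v where uv: "u \<noteq> v" "ends G f = {u, v}" "x v = t u v * x u"
          using g(1) f pq unfolding good_def by (metis empty_subsetI insert_subset)
        have "u \<noteq> w" "v \<noteq> w" using 3 pq aw uv by (auto simp: doubleton_eq_iff)
        then have "x' v = t u v * x' u" using uv by (simp add: x'_def)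
        then show ?thesis using uv by blast
      qed
    qed
    moreover have "card (insert w S) = Suc (Suc n)" using g aw finS by auto
    ultimately show ?case by blast
  qed
  moreover have "card (vertices G) \<noteq> 0" using conn fin by (auto simp: graph_connected_def)
  ultimately obtain S x where S: "good S x" "card S = card (vertices G)"
    by (metis not0_implies_Suc order_refl)
  then have "S = vertices G" unfolding good_def using fin by (metis card_subset_eq)
  moreover have sub: "ends G e \<subseteq> vertices G" if "e \<in> edges G" for e
    using ll that unfolding loopless_def by force
  moreover have "\<exists>v\<in>S. x v \<noteq> 0"
    "\<forall>e\<in>edges G. ends G e \<subseteq> S \<longrightarrow> (\<exists>u v. u \<noteq> v \<and> ends G e = {u, v} \<and> x v = t u v * x u)"
    using S(1) unfolding good_def by auto
  ultimately show ?thesis by (intro exI[of _ x]) simp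
qed

text \<open>The weight of a vertex is bounded below by contributions of its edges, so the quadratic
  form at \<open>x\<close> is at least a sum over edges. With \<open>x v = t * x u\<close> the term
  of an edge is \<open>(x u)\<^sup>2\<close> times the expression assumed non-negative.\<close>

lemma tree_not_negative_definite:
  fixes b :: "'v \<Rightarrow> 'e \<Rightarrow> real"
  assumes tree: "is_tree G" and fin: "finite (vertices G)" and ll: "loopless G"
    and wt: "\<And>v. v \<in> vertices G \<Longrightarrow> (\<Sum>e | e \<in> edges G \<and> v \<in> ends G e. b v e) \<le> of_int (weight G v)"
    and t: "\<And>e u v. e \<in> edges G \<Longrightarrow> ends G e = {u, v} \<Longrightarrow> u \<noteq> v \<Longrightarrow> \<exists>t. 0 \<le> b u e + b v e * t\<^sup>2 + 2 * t"
  shows "\<not> negative_definite_on (vertices G) (intersection_matrix G)"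
proof -
  let ?V = "vertices G" and ?E = "edges G"
  have finE: "finite ?E"
  proof (rule finite_imageD)
    show "finite (ends G ` ?E)"
      by (rule finite_subset[of _ "Pow ?V"]) (use ll fin in \<open>force simp: loopless_def\<close>)+
  qed (use tree_ends_inj[OF tree ll] in simp)
  \<comment> \<open>\<open>tree_propagation\<close> wants a ratio depending on the ordered pair of
    vertices only. There is at most one edge with given ends, so one value serves all of
    them.\<close>
  define T where "T = (\<lambda>u v. SOME t. \<forall>e\<in>?E. ends G e = {u, v} \<longrightarrow> 0 \<le> b u e + b v e * t\<^sup>2 + 2 * t)"
  have T: "0 \<le> b u e + b v e * (T u v)\<^sup>2 + 2 * T u v"
    if uv: "e \<in> ?E" "ends G e = {u, v}" "u \<noteq> v" for e u v
  proof -
    obtain t where "0 \<le> b u e + b v e * t\<^sup>2 + 2 * t" using t[OF uv] by blast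
    then have "\<forall>e'\<in>?E. ends G e' = {u, v} \<longrightarrow> 0 \<le> b u e' + b v e' * t\<^sup>2 + 2 * t"
      using tree_ends_inj[OF tree ll] uv unfolding inj_on_def by metis
    then have "\<forall>e\<in>?E. ends G e = {u, v} \<longrightarrow> 0 \<le> b u e + b v e * (T u v)\<^sup>2 + 2 * T u v"
      unfolding T_def by (rule someI)
    then show ?thesis using uv by blast
  qed
  obtain x where x: "\<exists>v\<in>?V. x v \<noteq> 0"
    "\<forall>e\<in>?E. \<exists>u v. u \<noteq> v \<and> ends G e = {u, v} \<and> x v = T u v * x u"
    using tree_propagation[OF tree fin ll, of T] by blast
  \<comment> \<open>The off-diagonal product of the edge \<open>e\<close> seen from its end
    \<open>i\<close>; the index set has the other end as its only element. Adding over both ends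
    gives \<open>2 * x u * x v\<close>.\<close>
  define o' where "o' = (\<lambda>e i. \<Sum>j\<in>ends G e - {i}. x i * x j)"
  have row: "(\<Sum>j\<in>?V - {i}. of_int (intersection_matrix G i j) * x i * x j)
     = (\<Sum>e | e \<in> ?E \<and> i \<in> ends G e. o' e i)" if i: "i \<in> ?V" for i
  proof -
    have "(\<Sum>j\<in>?V - {i}. of_int (intersection_matrix G i j) * x i * x j)
      = (\<Sum>j\<in>?V - {i}. \<Sum>e\<in>?E. if ends G e = {i, j} then x i * x j else 0)"
      by (intro sum.cong refl) (auto simp: intersection_matrix_def sum.If_cases finE Int_def)
    also have "\<dots> = (\<Sum>e\<in>?E. \<Sum>j\<in>?V - {i}. if ends G e = {i, j} then x i * x j else 0)"
      by (rule sum.swap)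
    also have "\<dots> = (\<Sum>e\<in>?E. if i \<in> ends G e then o' e i else 0)"
    proof (intro sum.cong refl)
      fix e assume e: "e \<in> ?E"
      show "(\<Sum>j\<in>?V - {i}. if ends G e = {i, j} then x i * x j else 0) = (if i \<in> ends G e then o' e i else 0)"
      proof (cases "i \<in> ends G e")
        case True
        then obtain k where k: "k \<in> ?V" "k \<noteq> i" "ends G e = {i, k}"
          using ll e unfolding loopless_def by (metis insert_iff insert_commute singletonD)
        have "(\<Sum>j\<in>?V - {i}. if ends G e = {i, j} then x i * x j else 0)
            = (\<Sum>j\<in>?V - {i}. if j = k then x i * x j else 0)"
          using k by (intro sum.cong refl) (auto simp: doubleton_eq_iff)
        also have "\<dots> = x i * x k" using k fin by (simp add: sum.delta)
        also have "\<dots> = o' e i" using k unfolding o'_def by (simp add: insert_Diff_if)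
        finally show ?thesis using True by simp
      next
        case False
        then have "ends G e \<noteq> {i, j}" for j by auto
        then show ?thesis using False by simp
      qed
    qed
    also have "\<dots> = (\<Sum>e | e \<in> ?E \<and> i \<in> ends G e. o' e i)"
      using finE by (simp add: sum.If_cases Int_def)
    finally show ?thesis .
  qed
  have "0 \<le> (\<Sum>e\<in>?E. \<Sum>i\<in>ends G e. b i e * (x i)\<^sup>2 + o' e i)"
  proof (rule sum_nonneg)
    fix e assume e: "e \<in> ?E"
    obtain u v where uv: "u \<noteq> v" "ends G e = {u, v}" "x v = T u v * x u" using x(2) e by blast
    have "(\<Sum>i\<in>ends G e. b i e * (x i)\<^sup>2 + o' e i) = (x u)\<^sup>2 * (b u e + b v e * (T u v)\<^sup>2 + 2 * T u v)"
      using uv by (simp add: o'_def insert_Diff_if power2_eq_square algebra_simps)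
    then show "0 \<le> (\<Sum>i\<in>ends G e. b i e * (x i)\<^sup>2 + o' e i)"
      using T[OF e uv(2,1)] by simp
  qed
  also have "\<dots> = (\<Sum>e\<in>?E. \<Sum>i\<in>?V. if i \<in> ends G e then b i e * (x i)\<^sup>2 + o' e i else 0)"
  proof (rule sum.cong[OF refl])
    fix e assume "e \<in> ?E"
    then have "ends G e \<subseteq> ?V" using ll unfolding loopless_def by auto
    then show "(\<Sum>i\<in>ends G e. b i e * (x i)\<^sup>2 + o' e i)
       = (\<Sum>i\<in>?V. if i \<in> ends G e then b i e * (x i)\<^sup>2 + o' e i else 0)"
      by (intro sum.mono_neutral_cong_left) (use fin in auto)
  qed
  also have "\<dots> = (\<Sum>i\<in>?V. \<Sum>e\<in>?E. if i \<in> ends G e then b i e * (x i)\<^sup>2 + o' e i else 0)"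
    by (rule sum.swap)
  also have "\<dots> = (\<Sum>i\<in>?V. (\<Sum>e | e \<in> ?E \<and> i \<in> ends G e. b i e) * (x i)\<^sup>2
      + (\<Sum>e | e \<in> ?E \<and> i \<in> ends G e. o' e i))"
    using finE by (simp add: sum.If_cases Int_def sum.distrib sum_distrib_right)
  also have "\<dots> \<le> (\<Sum>i\<in>?V. of_int (weight G i) * (x i)\<^sup>2
      + (\<Sum>e | e \<in> ?E \<and> i \<in> ends G e. o' e i))"
    by (intro sum_mono add_right_mono mult_right_mono wt) auto
  also have "\<dots> = (\<Sum>i\<in>?V. \<Sum>j\<in>?V. of_int (intersection_matrix G i j) * x i * x j)"
  proof (intro sum.cong refl)
    fix i assume i: "i \<in> ?V"
    show "of_int (weight G i) * (x i)\<^sup>2 + (\<Sum>e | e \<in> ?E \<and> i \<in> ends G e. o' e i)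
      = (\<Sum>j\<in>?V. of_int (intersection_matrix G i j) * x i * x j)"
      using row[OF i] sum.remove[OF fin i, of "\<lambda>j. of_int (intersection_matrix G i j) * x i * x j"]
      by (simp add: intersection_matrix_def power2_eq_square)
  qed
  finally show ?thesis using x(1) unfolding negative_definite_on_def not_all by (intro exI[of _ x]) (simp add: not_less)
qed

text \<open>If \<open>Re a\<^sub>2 < 0\<close> and \<open>a\<^sub>1 a\<^sub>2 = 1\<close>, the maximum over \<open>t\<close> is \<open>Re a\<^sub>1 - 1 / Re a\<^sub>2\<close>, which is
  non-negative because \<open>Re a\<^sub>1 = Re a\<^sub>2 / \<bar>a\<^sub>2\<bar>\<^sup>2\<close>.\<close>

lemma edge_form_nonneg:
  fixes a1 a2 :: complex
  assumes "a1 * a2 = 1 \<or> a1 = 0 \<or> a2 = 0"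
  shows "\<exists>t::real. 0 \<le> Re a1 + Re a2 * t\<^sup>2 + 2 * t"
proof (cases "Re a2 \<ge> 0")
  case True
  have "0 \<le> Re a2 * \<bar>Re a1\<bar>\<^sup>2" using True by simp
  \<comment> \<open>Here \<open>t = \<bar>Re a1\<bar>\<close> suffices: the linear term alone
    outweighs \<open>Re a1\<close>.\<close>
  then have "0 \<le> Re a1 + Re a2 * \<bar>Re a1\<bar>\<^sup>2 + 2 * \<bar>Re a1\<bar>" by linarith
  then show ?thesis by blast
next
  case False
  then have neg: "Re a2 < 0" by simp
  have "1 / Re a2 \<le> Re a1"
  proof (cases "a1 = 0")
    case False
    then have "a1 * a2 = 1" using assms neg by auto
    then have "a1 = 1 / a2" by (metis eq_divide_imp mult_zero_right zero_neq_one)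
    then have r: "Re a1 = Re a2 / ((Re a2)\<^sup>2 + (Im a2)\<^sup>2)" by (simp add: Re_divide)
    have p: "(Re a2)\<^sup>2 > 0" using neg by simp
    have "1 / Re a2 = Re a2 / (Re a2)\<^sup>2" using neg by (simp add: power2_eq_square)
    also have "\<dots> \<le> Re a2 / ((Re a2)\<^sup>2 + (Im a2)\<^sup>2)"
      using neg p by (intro divide_left_mono_neg) (auto simp: add_pos_nonneg)
    finally show ?thesis using r by simp
  qed (use neg in auto)
  moreover have "Re a2 * (- 1 / Re a2)\<^sup>2 = 1 / Re a2" using neg by (simp add: power2_eq_square)
  \<comment> \<open>The value \<open>- 1 / Re a2\<close> is the vertex of the parabola in
    \<open>t\<close>.\<close>
  ultimately have "0 \<le> Re a1 + Re a2 * (- 1 / Re a2)\<^sup>2 + 2 * (- 1 / Re a2)" by (simp add: field_simps)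
  then show ?thesis by blast
qed

section \<open>Corners\<close>

context surface_atlas
begin

text \<open>A chart at a corner is adapted to the branch \<open>y = 0\<close>; exchanging its
  coordinates makes it adapted to the other branch.\<close>

definition swap_chart :: "'a chart \<Rightarrow> 'a chart" where "swap_chart c = (fst c, prod.swap \<circ> snd c)"

lemma hol2_map_swap: "holomorphic2_map_on prod.swap S"
  by (simp add: holomorphic2_map_on_def hol2_fst hol2_snd)

lemma swap_chart_simps [simp]: "fst (swap_chart c) = fst c" "snd (swap_chart c) q = prod.swap (snd c q)"
  by (simp_all add: swap_chart_def)

lemma swap_homeo: "homeomorphic_map (top_of_set S) (top_of_set (prod.swap ` S)) (prod.swap :: cplane \<Rightarrow> cplane)"
proof -
  have c: "continuous_on T (prod.swap :: cplane \<Rightarrow> cplane)" for T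
    by (rule linear_continuous_on[OF bounded_linear_swap])
  have "homeomorphic_maps (top_of_set S) (top_of_set (prod.swap ` S)) (prod.swap :: cplane \<Rightarrow> cplane) prod.swap"
    unfolding homeomorphic_maps_def using c by (auto simp: continuous_map_in_subtopology)
  then show ?thesis using homeomorphic_map_maps by blast
qed

lemma swap_chart_inv: "coord c \<Longrightarrow> q \<in> fst c \<Longrightarrow> inv_into (fst c) (snd (swap_chart c)) (prod.swap (snd c q)) = q"
proof -
  assume c: "coord c" and q: "q \<in> fst c"
  have "inj_on (snd (swap_chart c)) (fst c)"
    using chart_inj[OF c] by (auto simp: inj_on_def prod_eq_iff)
  then show ?thesis using q by (intro inv_into_f_eq) auto
qed

lemma swap_chart_coord:
  assumes c: "coord c"
  shows "coord (swap_chart c)"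
  unfolding coordinates_def
proof (intro conjI ballI)
  have im: "snd (swap_chart c) ` fst c = prod.swap ` (snd c ` fst c)" by (simp add: swap_chart_def image_comp)
  have "homeomorphic_map (subtopology X (fst c)) (top_of_set (prod.swap ` (snd c ` fst c))) (prod.swap \<circ> snd c)"
    by (rule homeomorphic_map_compose[OF chart_open(3)[OF c] swap_homeo])
  then show "chart_on X (swap_chart c)"
    unfolding chart_on_def using chart_open[OF c] im open_swap[OF chart_open(2)[OF c]] by (simp add: swap_chart_def image_comp)
  fix d assume d: "d \<in> \<A>"
  note dc = atlas_coord[OF d]
  have im2: "snd (swap_chart c) ` (fst c \<inter> fst d) = prod.swap ` img c (fst d)" by (simp add: swap_chart_def image_comp)
  have "holomorphic2_map_on (transition (swap_chart c) d) (prod.swap ` img c (fst d))"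
  proof (rule hol2_map_local)
    fix z assume z: "z \<in> prod.swap ` img c (fst d)"
    let ?V = "prod.swap ` img c (fst d)"
    have "prod.swap ` ?V \<subseteq> img c (fst d)" by (auto simp: image_comp o_def)
    then have "holomorphic2_map_on (\<lambda>w. transition c d (prod.swap w)) ?V"
      by (rule hol2_map_compose[OF transition_hol[OF c dc] hol2_map_swap])
    moreover have "transition (swap_chart c) d w = transition c d (prod.swap w)" if w: "w \<in> ?V" for w
    proof -
      obtain q where q: "q \<in> fst c" "w = prod.swap (snd c q)" using w by blast
      then show ?thesis using swap_chart_inv[OF c q(1)] iv_left[OF c q(1)] by (simp add: transition_def)
    qed
    moreover have "open ?V" by (rule open_swap[OF img_open[OF c chart_open(1)[OF dc]]])
    ultimately show "\<exists>V g. open V \<and> z \<in> V \<and> holomorphic2_map_on g V \<and> (\<forall>w\<in>V. transition (swap_chart c) d w = g w)"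
      using z by blast
  qed
  moreover have "holomorphic2_map_on (\<lambda>w. prod.swap (transition d c w)) (img d (fst c))"
    by (rule hol2_map_compose[OF hol2_map_swap transition_hol[OF dc c], of UNIV]) simp
  moreover have "(\<lambda>w. prod.swap (transition d c w)) = transition d (swap_chart c)"
    by (simp add: transition_def swap_chart_def fun_eq_iff)
  ultimately show "compatible_charts (swap_chart c) d"
    unfolding compatible_charts_def im2 swap_chart_simps(1) by (simp add: Int_commute)
qed

lemma J_swap_chart:
  assumes "coord c" "q \<in> fst c"
  shows "J c (swap_chart c) q v = prod.swap v"
proof -
  have "(prod.swap has_derivative J c (swap_chart c) q) (at (snd c q))"
    by (rule J_local[OF assms(1) swap_chart_coord[OF assms(1)] assms(2) _ chart_open(1)[OF assms(1)] assms(2)])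
      (use assms in simp_all)
  from has_derivative_unique[OF this bounded_linear_imp_has_derivative[OF bounded_linear_swap]]
  show ?thesis by simp
qed

end

context foliated
begin

text \<open>Reducedness speaks only of the chosen generators. At a singular point, vanishing of the
  differential survives a change of chart and multiplication by a holomorphic factor, so a chosen
  generator would have zero linear part, against the non-zero eigenvalue.\<close>

lemma linear_part_nonzero:
  assumes V: "lgen c V" and p: "p \<in> fst c" "V (snd c p) = 0" and red: "reduced_singularities \<F>"
    and D: "(V has_derivative (\<lambda>_. 0)) (at (snd c p))"
  shows False
proof -
  note C = lgenD[OF V]
  obtain c0 V0 where c0: "(c0, V0) \<in> \<F>" "p \<in> fst c0" using N_cover C(2) p(1) by blast
  note f = fieldD[OF c0(1)]
  let ?T = "transition c c0" and ?S = "img c (fst c0)" and ?z = "snd c p"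
  obtain g where g: "holomorphic2_on g ?S" "\<forall>z \<in> ?S. g z \<noteq> 0 \<and>
      frechet_derivative ?T (at z) (V z) = cscale (g z) (V0 (?T z))"
    using C(4)[OF c0(1)] by (auto simp: same_foliation_def)
  have oS: "open ?S" by (rule img_open[OF C(1) chart_open(1)[OF f(1)]])
  have zS: "?z \<in> ?S" using p c0 by blast
  have T: "holomorphic2_map_on ?T ?S" by (rule transition_hol[OF C(1) f(1)])
  then have T12: "holomorphic2_on (\<lambda>z. fst (?T z)) ?S" "holomorphic2_on (\<lambda>z. snd (?T z)) ?S"
    by (auto simp: holomorphic2_map_on_def)
  have gi: "holomorphic2_on (\<lambda>z. inverse (g z)) ?S" by (rule hol2_inverse[OF g(1)]) (use g(2) in blast)
  have V0eq: "V0 (?T z) = (inverse (g z) * (D1 (\<lambda>z. fst (?T z)) z * fst (V z) + D2 (\<lambda>z. fst (?T z)) z * snd (V z)),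
     inverse (g z) * (D1 (\<lambda>z. snd (?T z)) z * fst (V z) + D2 (\<lambda>z. snd (?T z)) z * snd (V z)))" if z: "z \<in> ?S" for z
  proof -
    have "cscale (g z) (V0 (?T z)) = frechet_derivative ?T (at z) (fst (V z), snd (V z))" using bspec[OF g(2) z] by simp
    also have "\<dots> = (D1 (\<lambda>z. fst (?T z)) z * fst (V z) + D2 (\<lambda>z. fst (?T z)) z * snd (V z),
        D1 (\<lambda>z. snd (?T z)) z * fst (V z) + D2 (\<lambda>z. snd (?T z)) z * snd (V z))"
      by (rule hol2_map_derivative(2)[OF T z])
    finally show ?thesis using bspec[OF g(2) z] by (auto simp: cscale_def prod_eq_iff field_simps)
  qed
  have V12: "((\<lambda>z. fst (V z)) has_derivative (\<lambda>_. 0)) (at ?z)" "((\<lambda>z. snd (V z)) has_derivative (\<lambda>_. 0)) (at ?z)"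
    using has_derivative_fst[OF D] has_derivative_snd[OF D] by simp_all
  have prod0: "((\<lambda>z. a z * b z) has_derivative (\<lambda>_. 0)) (at ?z)"
    if "holomorphic2_on a ?S" "(b has_derivative (\<lambda>_. 0)) (at ?z)" "b ?z = 0" for a b :: "cplane \<Rightarrow> complex"
    using has_derivative_mult[OF hol2_has_derivative[OF that(1) zS] that(2)] that(3) by simp
  have sum0: "((\<lambda>z. a z * fst (V z) + b z * snd (V z)) has_derivative (\<lambda>_. 0)) (at ?z)"
    if "holomorphic2_on a ?S" "holomorphic2_on b ?S" for a b
    using has_derivative_add[OF prod0[OF that(1) V12(1)] prod0[OF that(2) V12(2)]] p(2) by simp
  note H12 = prod0[OF gi sum0[OF D1_hol2[OF oS T12(1)] D2_hol2[OF oS T12(1)]]]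
    prod0[OF gi sum0[OF D1_hol2[OF oS T12(2)] D2_hol2[OF oS T12(2)]]]
  have "((\<lambda>z. (inverse (g z) * (D1 (\<lambda>z. fst (?T z)) z * fst (V z) + D2 (\<lambda>z. fst (?T z)) z * snd (V z)),
     inverse (g z) * (D1 (\<lambda>z. snd (?T z)) z * fst (V z) + D2 (\<lambda>z. snd (?T z)) z * snd (V z)))) has_derivative (\<lambda>_. (0, 0))) (at ?z)"
    by (intro has_derivative_Pair H12) (use p(2) in simp_all)
  then have H: "((\<lambda>z. V0 (?T z)) has_derivative (\<lambda>_. (0, 0))) (at ?z)"
    by (rule has_derivative_transform_within_open[OF _ oS zS]) (simp add: V0eq)
  let ?R = "transition c0 c" and ?y = "snd c0 p"
  have Rz: "?R ?y = ?z" by (rule transition_at[OF f(1) c0(2)])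
  have dR: "(?R has_derivative J c0 c p) (at ?y)" by (rule J_deriv[OF f(1) C(1) c0(2) p(1)])
  have "((\<lambda>w. V0 (?T (?R w))) has_derivative (\<lambda>_. (0, 0))) (at ?y)"
    using has_derivative_compose[OF dR, of "\<lambda>z. V0 (?T z)"] H Rz by simp
  then have "(V0 has_derivative (\<lambda>_. (0, 0))) (at ?y)"
  proof (rule has_derivative_transform_within_open[OF _ img_open[OF f(1) chart_open(1)[OF C(1)]]])
    show "?y \<in> img c0 (fst c)" using p c0 by blast
    fix w assume "w \<in> img c0 (fst c)"
    then obtain q where q: "q \<in> fst c0" "q \<in> fst c" "w = snd c0 q" by blast
    show "V0 (?T (?R w)) = V0 w"
      using transition_at[OF f(1) q(1), of c] transition_at[OF C(1) q(2), of c0] q(3) by simp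
  qed
  then have fd: "frechet_derivative V0 (at ?y) = (\<lambda>_. (0, 0))" using frechet_derivative_at by metis
  have "sing p" using sing_iff[OF V p(1)] p(2) by simp
  then have "V0 ?y = 0" using sing_iff[OF f(4) c0(2)] by simp
  then have "reduced_linear_part (\<lambda>_. (0, 0))"
    using red c0 fd unfolding reduced_singularities_def by fastforce
  then obtain m1 m2 :: complex where m: "m1 \<noteq> 0" "eigenvalue_pair (\<lambda>_. (0, 0)) m1 m2"
    unfolding reduced_linear_part_def by blast
  \<comment> \<open>Evaluating the characteristic polynomial of 0 at the eigenvalue
    \<open>m1\<close> gives \<open>m1 * m1 = 0\<close>.\<close>
  have "det (mat m1 - (vector [vector [0, 0], vector [0, 0]] :: complex^2^2)) = (m1 - m1) * (m1 - m2)"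
    using m(2) unfolding eigenvalue_pair_def by (simp only: fst_conv snd_conv)
  then have "m1 * m1 = 0" by (simp add: det_2 mat_def)
  then show False using m(1) by simp
qed

end

text \<open>With the branches as coordinate axes both components of the generator are divisible by
  their own variable, so its linear part is diagonal with entries \<open>\<nu>\<close> and
  \<open>\<mu>\<close>, not both 0. If both are non-zero, the indices are
  \<open>\<nu> / \<mu>\<close> and \<open>\<mu> / \<nu>\<close>. If one vanishes, the index having
  it as numerator is 0; nothing is claimed about the other one.\<close>

lemma corner_indices:
  assumes I: "compact_foliated X \<A> P1 N \<F>" and K: "compact_foliated X \<A> P2 N \<F>"
    and red: "reduced_singularities \<F>"
    and c: "coordinates X \<A> c" "centered_at c p" "\<forall>q\<in>fst c. q \<in> P1 \<longleftrightarrow> fst (snd c q) = 0"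
      "\<forall>q\<in>fst c. q \<in> P2 \<longleftrightarrow> snd (snd c q) = 0"
  shows "singular_point \<F> p"
    "camacho_sad X \<A> N \<F> P1 p * camacho_sad X \<A> N \<F> P2 p = 1 \<or> camacho_sad X \<A> N \<F> P1 p = 0
       \<or> camacho_sad X \<A> N \<F> P2 p = 0"
proof -
  interpret I: compact_foliated X \<A> P1 N \<F> by (rule I)
  interpret K: compact_foliated X \<A> P2 N \<F> by (rule K)
  have pc: "p \<in> fst c" "snd c p = (0, 0)" using c(2) by (auto simp: centered_at_def)
  have p12: "p \<in> P1" "p \<in> P2" using c(3,4) pc by auto
  have aK: "K.adapted c" using c(1,4) by (simp add: adapted_chart_def)
  have aI: "I.adapted (I.swap_chart c)" using I.swap_chart_coord[OF c(1)] c(3) by (simp add: adapted_chart_def)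
  obtain W A B where W: "openin X W" "p \<in> W" "K.normal_form (I.restrict_chart c W) A B" using K.normal_form_exists[OF aK p12(2) pc(1)] by blast
  obtain W' A' B' where W': "openin X W'" "p \<in> W'" "I.normal_form (I.restrict_chart (I.swap_chart c) W') A' B'"
    using I.normal_form_exists[OF aI p12(1)] pc(1) by auto
  obtain W0 where W0: "openin X W0" "p \<in> W0" "\<forall>q\<in>W0. singular_point \<F> q \<longrightarrow> q = p"
    using K.sing_isolated K.PN p12(2) by blast
  \<comment> \<open>After this common restriction the charts \<open>d\<close> and \<open>e\<close>
    have the same domain and differ exactly by the exchange of coordinates.\<close>
  let ?W = "W \<inter> W' \<inter> W0"
  have oW: "openin X ?W" using W W' W0 by blast
  define d where "d = I.restrict_chart c ?W"
  define e where "e = I.restrict_chart (I.swap_chart c) ?W"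
  have dd: "K.normal_form d A B"
  proof -
    have "I.restrict_chart (I.restrict_chart c W) ?W = d" by (auto simp: d_def I.restrict_chart_def)
    then show ?thesis using K.normal_form_restrict[OF W(3) oW] by simp
  qed
  have ee: "I.normal_form e A' B'"
  proof -
    have "I.restrict_chart (I.restrict_chart (I.swap_chart c) W') ?W = e" by (auto simp: e_def I.restrict_chart_def)
    then show ?thesis using I.normal_form_restrict[OF W'(3) oW] by simp
  qed
  have de: "fst e = fst d" "\<And>q. snd e q = prod.swap (snd d q)" "snd d = snd c" "fst d = fst c \<inter> ?W" by (simp_all add: d_def e_def)
  have pd: "p \<in> fst d" "snd d p = (0, 0)" "p \<in> fst e" "snd e p = (0, 0)" using pc W W' W0 by (auto simp: de)
  note Dd = K.normal_formD[OF dd] and De = I.normal_formD[OF ee]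
  have J: "I.J d e q v = prod.swap v" if q: "q \<in> fst d" for q v
  proof -
    have qc: "q \<in> fst c" "q \<in> ?W" using q de(4) by auto
    have "I.J d e q = I.J c e q" unfolding d_def
      by (rule I.J_restrict_chart(1)[OF c(1) De(2) qc(1) _ oW qc(2)]) (use q de in simp)
    also have "I.J c e q = I.J c (I.swap_chart c) q" unfolding e_def
      by (rule I.J_restrict_chart(2)[OF I.swap_chart_coord[OF c(1)] c(1) _ qc(1) oW qc(2)]) (use qc in simp)
    finally show ?thesis using I.J_swap_chart[OF c(1) qc(1)] by simp
  qed
  let ?S = "snd d ` fst d"
  have oS: "open ?S" by (rule I.chart_open(2)[OF Dd(2)])
  have rel: "\<exists>g. g \<noteq> 0 \<and> y * B (x, y) = g * A' (y, x) \<and> A (x, y) = g * (x * B' (y, x))" if xy: "(x, y) \<in> ?S" for x y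
  proof -
    obtain q where q: "q \<in> fst d" "snd d q = (x, y)" using xy by force
    have "K.agree d (\<lambda>(x, y). (A (x, y), y * B (x, y))) e (\<lambda>(x, y). (A' (x, y), y * B' (x, y))) q"
      by (rule K.lgen_agree[OF Dd(5) De(5) q(1)]) (use q de in simp)
    then show ?thesis using J[OF q(1)] q de(2)[of q] by (auto simp: K.agree_def cscale_def)
  qed
  have S0: "(0, 0) \<in> ?S" using pd by force
  have A0: "A (0, y) = 0" if "(0, y) \<in> ?S" for y using rel[OF that] by auto
  have sing_p: "singular_point \<F> p" using K.sing_iff[OF Dd(5) pd(1)] pd(2) A0[OF S0] by (simp add: zero_prod_def)
  then show "singular_point \<F> p" .
  \<comment> \<open>\<open>hol2_divide_y\<close> divides by the second coordinate, so it is applied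
    to \<open>A\<close> with variables exchanged; this explains the order of arguments in
    \<open>A (x, y) = x * At (y, x)\<close>.\<close>
  define At where "At = (\<lambda>(x, y). if y = 0 then D2 (\<lambda>z. A (prod.swap z)) (x, y) else A (prod.swap (x, y)) / y)"
  have swA: "holomorphic2_on (\<lambda>z. A (prod.swap z)) (prod.swap ` ?S)" by (rule hol2_swap(1)[OF Dd(3)])
  have oS': "open (prod.swap ` ?S)" by (rule open_swap[OF oS])
  have swA0: "\<forall>x. (x, 0) \<in> prod.swap ` ?S \<longrightarrow> A (prod.swap (x, 0)) = 0" 
  proof (intro allI impI)
    fix x assume "(x, 0) \<in> prod.swap ` ?S"
    then obtain z where z: "z \<in> ?S" "(x, 0) = prod.swap z" by blast
    then have "z = (0, x)" by (cases z) simp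
    then show "A (prod.swap (x, 0)) = 0" using A0[of x] z(1) by simp
  qed
  note At = hol2_divide_y[OF oS' swA swA0, folded At_def]
  have AtS: "A (x, y) = x * At (y, x)" if "(x, y) \<in> ?S" for x y
  proof -
    have "(y, x) \<in> prod.swap ` ?S" using that by force
    from At(2)[OF this] show ?thesis by simp
  qed
  define \<nu> where "\<nu> = At (0, 0)"
  define \<mu> where "\<mu> = B (0, 0)"
  obtain r where r: "r > 0" "cball 0 r \<times> cball 0 r \<subseteq> ?S" using polydisc[OF oS S0] .
  have rS: "(x, y) \<in> ?S" "(y, x) \<in> prod.swap ` ?S" if "x \<in> ball 0 r" "y \<in> ball 0 r" for x y
  proof -
    show "(x, y) \<in> ?S" using r(2) that by auto
    then show "(y, x) \<in> prod.swap ` ?S" by force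
  qed
  have eS: "(y, x) \<in> snd e ` fst e" if xy: "(x, y) \<in> ?S" for x y
  proof -
    obtain q where "q \<in> fst d" "snd d q = (x, y)" using xy by force
    then have "q \<in> fst e" "snd e q = (y, x)" using de by auto
    then show ?thesis by force
  qed
  \<comment> \<open>The factor \<open>g\<close> is eliminated and \<open>x\<close> cancelled for
    non-zero \<open>x\<close>; the relation on the axis \<open>x = 0\<close> is the limit.\<close>
  have rel2: "B' (y, 0) * (y * B (0, y)) = A' (y, 0) * At (y, 0)" if y: "y \<in> ball 0 r" for y
  proof -
    define L where "L = (\<lambda>x. B' (y, x) * (y * B (x, y)) - A' (y, x) * At (y, x))"
    have "L x = 0" if x: "x \<in> ball 0 r" "x \<noteq> 0" for x
    proof -
      obtain g where g: "y * B (x, y) = g * A' (y, x)" "A (x, y) = g * (x * B' (y, x))"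
        using rel[OF rS(1)[OF x(1) y]] by blast
      have "x * (g * B' (y, x)) = x * At (y, x)" using g(2) AtS[OF rS(1)[OF x(1) y]] by (metis mult.left_commute)
      then have "g * B' (y, x) = At (y, x)" using mult_left_cancel[OF x(2)] by blast
      then show ?thesis unfolding L_def g(1) by (simp add: algebra_simps)
    qed
    then have ev: "\<forall>\<^sub>F x in at 0. L x = 0"
      unfolding eventually_at_topological using r(1) by (intro exI[of _ "ball 0 r"]) auto
    have c1: "isCont (\<lambda>x. F (y, x)) 0" if F: "holomorphic2_on F S'" "(y, 0) \<in> S'" for F S'
      using hol2_partial2[OF F] DERIV_isCont by blast
    have c2: "isCont (\<lambda>x. B (x, y)) 0"
      using hol2_partial1[OF Dd(4) rS(1)[OF _ y], of 0] r(1) DERIV_isCont by simp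
    have "isCont L 0" unfolding L_def
      using c1[OF De(4) eS[OF rS(1)[OF _ y]]] c1[OF De(3) eS[OF rS(1)[OF _ y]]]
        c1[OF At(1) rS(2)[OF _ y]] c2 r(1) by (intro continuous_intros) auto
    then have "(L \<longlongrightarrow> L 0) (at 0)" by (simp add: isCont_def)
    from tendsto_unique[OF _ this tendsto_eventually[OF ev]] have "L 0 = 0" by simp
    then show ?thesis by (simp add: L_def)
  qed
  have csK: "camacho_sad X \<A> N \<F> P2 p = residue (\<lambda>x. B (x, 0) / A (x, 0)) 0"
    by (rule K.camacho_sad_eq[OF dd _ p12(2)]) (use pd in \<open>simp add: centered_at_def\<close>)
  have csI: "camacho_sad X \<A> N \<F> P1 p = residue (\<lambda>x. B' (x, 0) / A' (x, 0)) 0"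
    by (rule I.camacho_sad_eq[OF ee _ p12(1)]) (use pd in \<open>simp add: centered_at_def\<close>)
  have hl: "(\<lambda>x. F (x, 0)) holomorphic_on ball 0 r" if "holomorphic2_on F S'" "\<And>x. x \<in> ball 0 r \<Longrightarrow> (x, 0) \<in> S'" for F S'
    unfolding holomorphic_on_open[OF open_ball] using hol2_partial1[OF that(1) that(2)] by blast
  \<comment> \<open>The residue at a simple pole with \<open>x\<close> split off from the
    denominator; since \<open>b\<close> does not vanish near 0, the formula for \<open>h\<close> is
    needed only where \<open>b x\<close> is non-zero.\<close>
  have quot: "residue h 0 = a 0 / b 0"
    if ab: "a holomorphic_on ball 0 r" "b holomorphic_on ball 0 r" "b 0 \<noteq> 0"
      "\<And>x. x \<in> ball 0 r \<Longrightarrow> x \<noteq> 0 \<Longrightarrow> b x \<noteq> 0 \<Longrightarrow> h x = a x / (x * b x)" for a b h :: "complex \<Rightarrow> complex"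
  proof -
    have "continuous_on (ball 0 r) b" using ab(2) holomorphic_on_imp_continuous_on by blast
    then have "open (ball 0 r \<inter> b -` (- {0}))" by (intro continuous_open_preimage) auto
    moreover have "0 \<in> ball 0 r \<inter> b -` (- {0})" using ab(3) r(1) by simp
    ultimately obtain r' where r': "r' > 0" "ball 0 r' \<subseteq> ball 0 r \<inter> b -` (- {0})" by (rule openE)
    have "(\<lambda>x. a x / b x) holomorphic_on ball 0 r'"
      by (intro holomorphic_on_divide holomorphic_on_subset[OF ab(1)] holomorphic_on_subset[OF ab(2)]) (use r' in auto)
    then have "residue (\<lambda>x. (a x / b x) / (x - 0)) 0 = a 0 / b 0"
      by (intro residue_simple[of "ball 0 r'"]) (use r' in auto)
    moreover have "residue h 0 = residue (\<lambda>x. (a x / b x) / (x - 0)) 0"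
    proof (rule residue_cong)
      have "h x = (a x / b x) / (x - 0)" if "x \<in> ball 0 r'" "x \<noteq> 0" for x
      proof -
        have "x \<in> ball 0 r" "b x \<noteq> 0" using r'(2) that(1) by blast+
        from ab(4)[OF this(1) that(2) this(2)] show ?thesis by (simp add: mult.commute)
      qed
      then show "\<forall>\<^sub>F x in at 0. h x = (a x / b x) / (x - 0)"
        unfolding eventually_at_topological using r'(1) by (intro exI[of _ "ball 0 r'"]) auto
    qed simp
    ultimately show ?thesis by simp
  qed
  have rz: "x \<in> ball 0 r \<Longrightarrow> (x, 0) \<in> ?S" "x \<in> ball 0 r \<Longrightarrow> (0, x) \<in> ?S" "x \<in> ball 0 r \<Longrightarrow> (x, 0) \<in> prod.swap ` ?S" for x
    using rS[of x 0] rS[of 0 x] r(1) by auto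
  have hB0: "(\<lambda>y. B (0, y)) holomorphic_on ball 0 r"
    unfolding holomorphic_on_open[OF open_ball] using hol2_partial2[OF Dd(4) rz(2)] by blast
  have hAt0: "(\<lambda>x. At (0, x)) holomorphic_on ball 0 r"
    unfolding holomorphic_on_open[OF open_ball] using hol2_partial2[OF At(1), of 0] rS(2)[of _ 0] r(1) by (metis centre_in_ball)
  have resI: "camacho_sad X \<A> N \<F> P1 p = \<nu> / \<mu>" if "\<mu> \<noteq> 0"
    unfolding csI \<nu>_def \<mu>_def
  proof (rule quot[where a = "\<lambda>y. At (y, 0)" and b = "\<lambda>y. B (0, y)"])
    show "(\<lambda>y. At (y, 0)) holomorphic_on ball 0 r" by (rule hl[OF At(1) rz(3)])
    show "(\<lambda>y. B (0, y)) holomorphic_on ball 0 r" by (rule hB0)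
    show "B (0, 0) \<noteq> 0" using that by (simp add: \<mu>_def)
    fix y assume y: "y \<in> ball 0 r" "y \<noteq> 0" "B (0, y) \<noteq> 0"
    have "A' (y, 0) \<noteq> 0" using rel[OF rz(2)[OF y(1)]] y by auto
    then show "B' (y, 0) / A' (y, 0) = At (y, 0) / (y * B (0, y))"
      using rel2[OF y(1)] y by (simp add: field_simps)
  qed
  have resK: "camacho_sad X \<A> N \<F> P2 p = \<mu> / \<nu>" if "\<nu> \<noteq> 0"
    unfolding csK \<nu>_def \<mu>_def
  proof (rule quot[where a = "\<lambda>x. B (x, 0)" and b = "\<lambda>x. At (0, x)"])
    show "(\<lambda>x. B (x, 0)) holomorphic_on ball 0 r" by (rule hl[OF Dd(4) rz(1)])
    show "(\<lambda>x. At (0, x)) holomorphic_on ball 0 r" by (rule hAt0)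
    show "At (0, 0) \<noteq> 0" using that by (simp add: \<nu>_def)
    show "B (x, 0) / A (x, 0) = B (x, 0) / (x * At (0, x))" if "x \<in> ball 0 r" for x
      using AtS[OF rz(1)[OF that]] by simp
  qed
  have "\<nu> \<noteq> 0 \<or> \<mu> \<noteq> 0"
  proof (rule ccontr)
    assume "\<not> (\<nu> \<noteq> 0 \<or> \<mu> \<noteq> 0)"
    then have 0: "At (0, 0) = 0" "B (0, 0) = 0" by (auto simp: \<nu>_def \<mu>_def)
    have dA: "(A has_derivative (\<lambda>_. 0)) (at (0, 0))"
    proof (rule has_derivative_transform_within_open[OF _ oS S0])
      have "((\<lambda>z. At (prod.swap z)) has_derivative (\<lambda>(h, k). D1 (\<lambda>z. At (prod.swap z)) (0, 0) * h + D2 (\<lambda>z. At (prod.swap z)) (0, 0) * k)) (at (0, 0))"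
        by (rule hol2_has_derivative[OF hol2_swap(1)[OF At(1)]]) (use S0 in \<open>force simp: image_comp o_def\<close>)
      from has_derivative_mult[OF bounded_linear_imp_has_derivative[OF bounded_linear_fst] this]
      show "((\<lambda>z. fst z * At (prod.swap z)) has_derivative (\<lambda>_. 0)) (at (0, 0))" using 0 by simp
      fix z assume z: "z \<in> ?S"
      obtain a b where ab: "z = (a, b)" by (cases z)
      show "fst z * At (prod.swap z) = A z" using AtS[of a b] z unfolding ab by simp
    qed
    have "((\<lambda>z. snd z * B z) has_derivative (\<lambda>_. 0)) (at (0, 0))"
      using has_derivative_mult[OF bounded_linear_imp_has_derivative[OF bounded_linear_snd] hol2_has_derivative[OF Dd(4) S0]] 0 by simp
    from has_derivative_Pair[OF dA this]
    have "((\<lambda>(x, y). (A (x, y), y * B (x, y))) has_derivative (\<lambda>_. 0)) (at (snd d p))"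
      using pd(2) by (simp add: case_prod_unfold zero_prod_def)
    from K.linear_part_nonzero[OF Dd(5) pd(1) _ red this] show False
      using pd(2) A0[OF S0] by (simp add: zero_prod_def)
  qed
  then show "camacho_sad X \<A> N \<F> P1 p * camacho_sad X \<A> N \<F> P2 p = 1 \<or> camacho_sad X \<A> N \<F> P1 p = 0
       \<or> camacho_sad X \<A> N \<F> P2 p = 0"
    using resI resK by (cases "\<nu> = 0"; cases "\<mu> = 0") auto
qed

theorem theorem4:
  fixes X :: "'a topology" and \<A> :: "'a chart set"
    and J :: "'j set" and P :: "'j \<Rightarrow> 'a set"
    and N :: "'a set" and \<F> :: "'a local_field set"
  assumes "complex_surface X \<A>"
    and "finite J"
    and "\<And>j. j \<in> J \<Longrightarrow> compact_regular_curve X \<A> (P j)"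
    and "normal_crossings X \<A> J P"
    and "holomorphic_foliation X \<A> N \<F>"
    and "(\<Union>j\<in>J. P j) \<subseteq> N"
    and "reduced_singularities \<F>"
    and "\<And>j. j \<in> J \<Longrightarrow> invariant_curve X \<A> \<F> (P j)"
    and "is_tree (dual_graph X \<A> J P)"
    and "negative_definite_on J (intersection_matrix (dual_graph X \<A> J P))"
  shows "\<exists>j\<^sub>0\<in>J. \<exists>q\<in>P j\<^sub>0. singular_point \<F> q \<and> q \<notin> corners J P \<and>
           Re (camacho_sad X \<A> N \<F> (P j\<^sub>0) q) < 0"
proof (rule ccontr)
  assume neg: "\<not> ?thesis"
  let ?G = "dual_graph X \<A> J P"
  define CS where "CS = (\<lambda>j q. camacho_sad X \<A> N \<F> (P j) q)"
  have cf: "compact_foliated X \<A> (P j) N \<F>" if j: "j \<in> J" for j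
  proof unfold_locales
    show "complex_surface X \<A>" "holomorphic_foliation X \<A> N \<F>" by (rule assms)+
    show "compact_regular_curve X \<A> (P j)" "invariant_curve X \<A> \<F> (P j)" using assms j by auto
    then show "P j \<subseteq> topspace X" by (simp add: compact_regular_curve_def compactin_subset_topspace)
    show "P j \<subseteq> N" using assms(6) j by blast
  qed
  have corner: "singular_point \<F> p" "CS i p * CS j p = 1 \<or> CS i p = 0 \<or> CS j p = 0"
    if t: "i \<in> J" "j \<in> J" "i \<noteq> j" "p \<in> P i" "p \<in> P j" for i j p
  proof -
    have "p \<in> P i \<inter> P j" using that by blast
    then obtain c where c: "coordinates X \<A> c" "centered_at c p" "\<forall>q\<in>fst c. q \<in> P i \<longleftrightarrow> fst (snd c q) = 0"
      "\<forall>q\<in>fst c. q \<in> P j \<longleftrightarrow> snd (snd c q) = 0"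
      using assms(4) t(1-3) unfolding normal_crossings_def by metis
    note h = corner_indices[OF cf[OF t(1)] cf[OF t(2)] assms(7) c]
    show "singular_point \<F> p" "CS i p * CS j p = 1 \<or> CS i p = 0 \<or> CS j p = 0" using h by (simp_all add: CS_def)
  qed
  \<comment> \<open>No three curves meet in a point, so a corner on a curve determines the other
    curve through it.\<close>
  have triple: "k = i \<or> k = j" if t: "i \<in> J" "j \<in> J" "i \<noteq> j" "p \<in> P i" "p \<in> P j" "k \<in> J" "p \<in> P k" for i j k p
  proof -
    have "p \<in> P i \<inter> P j" using that by blast
    then have "\<forall>k\<in>J - {i, j}. p \<notin> P k" using assms(4) t(1-3) unfolding normal_crossings_def by metis
    then show ?thesis using t(6,7) by blast
  qed
  have V: "vertices ?G = J" and E: "edges ?G = {({i, j}, p) | i j p. i \<in> J \<and> j \<in> J \<and> i \<noteq> j \<and> p \<in> P i \<inter> P j}"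
    and en: "ends ?G = fst" and w: "weight ?G = (\<lambda>j. self_intersection X \<A> (P j))"
    by (simp_all add: dual_graph_def)
  have ll: "loopless ?G" unfolding loopless_def V E en by fastforce
  have "\<not> negative_definite_on (vertices ?G) (intersection_matrix ?G)"
  \<comment> \<open>Each edge contributes to either end the real part of the index at its corner
    along that curve.\<close>
  proof (rule tree_not_negative_definite[OF assms(9) _ ll, where b = "\<lambda>v e. Re (CS v (snd e))"])
    show "finite (vertices ?G)" using assms(2) V by simp
  next
    fix v assume "v \<in> vertices ?G"
    then have v: "v \<in> J" by (simp add: V)
    interpret compact_foliated X \<A> "P v" N \<F> by (rule cf[OF v])
    let ?Ev = "{e. e \<in> edges ?G \<and> v \<in> ends ?G e}"
    let ?S = "{q \<in> P v. singular_point \<F> q}"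
    have Ev: "\<exists>k. k \<in> J \<and> k \<noteq> v \<and> snd e \<in> P v \<and> snd e \<in> P k \<and> e = ({v, k}, snd e)" if e: "e \<in> ?Ev" for e
    proof -
      obtain i j p where ij: "e = ({i, j}, p)" "i \<in> J" "j \<in> J" "i \<noteq> j" "p \<in> P i \<inter> P j" using e by (auto simp: E)
      have "v \<in> {i, j}" using e ij(1) by (simp add: en)
      then show ?thesis using ij by (auto simp: insert_commute)
    qed
    \<comment> \<open>Edges at \<open>v\<close> correspond bijectively to the corners on
      \<open>P v\<close>, so a sum over edges becomes a sum over corners.\<close>
    have inj: "inj_on snd ?Ev"
    proof (rule inj_onI)
      fix e e' assume e: "e \<in> ?Ev" "e' \<in> ?Ev" "snd e = snd e'"
      obtain k where k: "k \<in> J" "k \<noteq> v" "snd e \<in> P v" "snd e \<in> P k" "e = ({v, k}, snd e)" using Ev[OF e(1)] by blast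
      obtain k' where k': "k' \<in> J" "k' \<noteq> v" "snd e' \<in> P k'" "e' = ({v, k'}, snd e')" using Ev[OF e(2)] by blast
      have "k' = k" using triple[OF v k(1) _ k(3,4) k'(1)] k(2) k' e(3) by auto
      then show "e = e'" using k(5) k'(4) e(3) by simp
    qed
    have img: "snd ` ?Ev = {q \<in> ?S. q \<in> corners J P}"
    proof (intro equalityI subsetI)
      fix q assume "q \<in> snd ` ?Ev"
      then obtain k where k: "k \<in> J" "k \<noteq> v" "q \<in> P v" "q \<in> P k" using Ev by blast
      then show "q \<in> {q \<in> ?S. q \<in> corners J P}" using corner(1)[OF v k(1) _ k(3,4)] v by (auto simp: corners_def)
    next
      fix q assume q: "q \<in> {q \<in> ?S. q \<in> corners J P}"
      then obtain i j where ij: "i \<in> J" "j \<in> J" "i \<noteq> j" "q \<in> P i" "q \<in> P j" "q \<in> P v" by (auto simp: corners_def)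
      then have "v = i \<or> v = j" using triple v by blast
      then obtain k where k: "k \<in> J" "k \<noteq> v" "q \<in> P k" using ij by blast
      have "({v, k}, q) \<in> ?Ev" using k v ij(6) unfolding E en by auto
      then show "q \<in> snd ` ?Ev" by force
    qed
    have "(\<Sum>e\<in>?Ev. Re (CS v (snd e))) = (\<Sum>q\<in>snd ` ?Ev. Re (CS v q))"
      by (simp add: sum.reindex[OF inj])
    \<comment> \<open>Passing from the corners to all singular points adds terms that are
      non-negative by the assumption made for contradiction; the full sum is the weight.\<close>
    also have "\<dots> \<le> (\<Sum>q\<in>?S. Re (CS v q))"
      unfolding img
    proof (rule sum_mono2[OF finite_sing])
      show "0 \<le> Re (CS v q)" if "q \<in> ?S - {q \<in> ?S. q \<in> corners J P}" for q
        using neg v that by (force simp: CS_def)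
    qed blast
    also have "\<dots> = Re (of_int (self_intersection X \<A> (P v)))"
      unfolding self_intersection_eq by (simp add: CS_def)
    finally show "(\<Sum>e\<in>?Ev. Re (CS v (snd e))) \<le> of_int (weight ?G v)" by (simp add: w)
  next
    fix e u v assume e: "e \<in> edges ?G" "ends ?G e = {u, v}" "u \<noteq> v"
    obtain i j p where ij: "e = ({i, j}, p)" "i \<in> J" "j \<in> J" "i \<noteq> j" "p \<in> P i \<inter> P j" using e(1) unfolding E by blast
    have "{i, j} = {u, v}" using e(2) ij(1) by (simp add: en)
    then have "u \<in> J" "v \<in> J" "p \<in> P u" "p \<in> P v" using ij by (auto simp: doubleton_eq_iff)
    from edge_form_nonneg[OF corner(2)[OF this(1,2) e(3) this(3,4)]]
    show "\<exists>t. 0 \<le> Re (CS u (snd e)) + Re (CS v (snd e)) * t\<^sup>2 + 2 * t" by (simp add: ij(1))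
  qed
  then show False using assms(10) V by simp
qed

end
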